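(* Let $F>0$ be smooth and $P$-periodic on $\mathbb R$, and set $I_F=\int_0^PF^{-1}\,dt$. 1. For every $\kappa\in\mathbb R$, the data $F$ and $T=\kappa/F^2$ determine a fixed positive periodic source metric $g_{F,\kappa}=dt^2+\ell_1^2g_1+\ell_2^2g_2$, where $(\ell_1,\ell_2)$ is the unique pair of positive functions with $\ell_1^{k_1}\ell_2^{k_2}=F$ and $d_2/\ell_2^2-d_1/\ell_1^2=\kappa/F^2$. Its harmonic profiles (the curves $\gamma$ for which $G_\gamma$ is harmonic for $g_{F,\kappa}$) are the time changes $\gamma=\Gamma\circ\tau$, $d\tau=dt/F$, of the trajectories $\Gamma$ of the autonomous Neumann system $\nabla^{\mathbb S^3}_\tau\dot\Gamma=\kappa\,\mathrm{grad}_{\mathbb S^3}U(\Gamma)$, $U(z_1,z_2)=|z_2|^2/2$, on $\mathbb S^3$. 2. For coprime nonzero integers $r_1,r_2$ with $|r_1|\ne|r_2|$, choose $$\kappa=\frac{4\pi^2(r_1^2-r_2^2)}{I_F^2}.$$ The resulting single metric $g_{F,\kappa}$ on $(\mathbb R/P\mathbb Z)\times M_1\times M_2$ carries a one-parameter family of pairwise noncongruent closed ($P$-periodic) harmonic profiles lying on distinct Hopf tori. Their oriented graphs in $(\mathbb R/P\mathbb Z)\times\mathbb S^3$ are pairwise disjoint closed $\mathcal K$-geodesics of equal length. 3. Let $p,q\ge2$ be even and take as inputs the real identity maps $f_1=\mathrm{id}_{\mathbb S^p}$, $f_2=\mathrm{id}_{\mathbb S^q}$ (so $k_1=d_1=p$,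 $k_2=d_2=q$). For every $\kappa\in\mathbb R$, the fixed metric $g_{F,\kappa}$ supports, for all $m\ge1$, harmonic maps $$(\mathbb R/P\mathbb Z)\times\mathbb S^p\times\mathbb S^q\longrightarrow\mathbb S^{p+q+1}$$ of degree $4m$, of the form $(t,x,y)\mapsto(z_1(t)x,z_2(t)y)$ with real $P$-periodic profile $(z_1,z_2)$ in the great circle $\mathbb S^3\cap\mathbb R^2$. The closed graph geodesics $t\mapsto(t,z_1(t),z_2(t))$ of $\mathcal K$ in $(\mathbb R/P\mathbb Z)\times\mathbb S^3$ associated with these maps are not iterates of shorter closed geodesics, and their $\mathcal K$-lengths are unbounded (as $m$ varies).
   Context: Setting. For $i=1,2$, $(M_i,g_i)$ is a Riemannian manifold of dimension $k_i>0$, and $f_i:(M_i,g_i)\to\mathbb S^{2n_i+1}\subset\mathbb C^{n_i+1}$ (unit round sphere) is an eigenmap: $\Delta f_i=-d_if_i$ with $d_i=|df_i|^2>0$ constant. A map $f$ into a unit sphere is harmonic iff $\Delta f=-|df|^2f$. For a smooth curve (profile) $\gamma=(z_1,z_2)$ in $\mathbb S^3\subset\mathbb C^2$ and positive source warps $\ell_1,\ell_2$ set $$G_\gamma(t,x,y)=(z_1(t)f_1(x),z_2(t)f_2(y))\in\mathbb S^{2n_1+2n_2+3},$$ with source metric $dt^2+\ell_1^2g_1+\ell_2^2g_2$. For real inputs in $\mathbb R^{p+1}$, $\mathbb R^{q+1}$ and a real profile the map takes values in $\mathbb S^{p+q+1}\subset\mathbb R^{p+1}\oplus\mathbb R^{q+1}$.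 For $F>0$, $T\in\mathbb R$ there is a unique positive pair $(\ell_1,\ell_2)$ with $\ell_1^{k_1}\ell_2^{k_2}=F$, $d_2/\ell_2^2-d_1/\ell_1^2=T$, depending smoothly on $(F,T)$. Put $\lambda_i=d_i/\ell_i^2$ and $V(t,z)=\tfrac12(\lambda_1|z_1|^2+\lambda_2|z_2|^2)$. The conic Finsler metric $\mathcal K$ on $(\mathbb R/P\mathbb Z)\times\mathbb S^3$, with cone $\xi>0$, is $\mathcal K(t,z;\xi,v)=\frac{F(t)}{2\xi}(|v|^2+2V(t,z)\xi^2)$; its geodesics are the curves with velocity in the cone that are critical for the length $\int\mathcal K$ under compactly supported variations. An iterate of a closed geodesic is its $n$-fold traversal, $n\ge2$. A Hopf torus is $\{|z_1|=a,|z_2|=b\}\subset\mathbb S^3$ with $0<a<1$, $a^2+b^2=1$. Congruence of profile curves means equivalence under isometries of the round $\mathbb S^3$ and reparametrization. Degree is taken with the product orientation given by increasing $t$ and the standard orientations of $\mathbb S^p$, $\mathbb S^q$, and the standard orientation of $\mathbb S^{p+q+1}\subset\mathbb R^{p+1}\oplus\mathbb R^{q+1}$. *)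

theory Defs
  imports "HOL-Analysis.Analysis" "HOL-Combinatorics.Permutations"
begin

section \<open>Smooth maps between Euclidean spaces\<close>

text \<open>Only used on open sets \<open>S\<close>, where the unrestricted derivative is the right one.\<close>

primrec Ck_on :: "nat \<Rightarrow> 'a::euclidean_space set \<Rightarrow> ('a \<Rightarrow> 'b::real_normed_vector) \<Rightarrow> bool" where
  "Ck_on 0 S f = continuous_on S f"
| "Ck_on (Suc k) S f =
     ((\<forall>x\<in>S. f differentiable (at x)) \<and>
      (\<forall>b\<in>Basis. Ck_on k S (\<lambda>x. frechet_derivative f (at x) b)))"

definition smooth_on :: "'a::euclidean_space set \<Rightarrow> ('a \<Rightarrow> 'b::real_normed_vector) \<Rightarrow> bool" where
  "smooth_on S f \<longleftrightarrow> (\<forall>k. Ck_on k S f)"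

definition pd :: "'a::euclidean_space \<Rightarrow> ('a \<Rightarrow> 'b::real_normed_vector) \<Rightarrow> 'a \<Rightarrow> 'b" where
  "pd e h u = frechet_derivative h (at u) e"


section \<open>Riemannian manifolds\<close>

text \<open>
  A Riemannian chart is a coordinate domain, a coordinate map into the model space, and the
  coordinate expression of the metric: \<open>cmet c u v w\<close> is the inner product of the tangent vectors
  with coordinates \<open>v\<close>, \<open>w\<close> at the point with coordinates \<open>u\<close>.  The dimension of the manifold is
  the dimension of the model space \<open>'e\<close>, hence positive.
\<close>

record ('a, 'e) rchart =
  cdom :: "'a set"
  cmap :: "'a \<Rightarrow> 'e"
  cmet :: "'e \<Rightarrow> 'e \<Rightarrow> 'e \<Rightarrow> real"

definition cran :: "('a, 'e) rchart \<Rightarrow> 'e set" where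
  "cran c = cmap c ` cdom c"

definition cinv :: "('a, 'e) rchart \<Rightarrow> 'e \<Rightarrow> 'a" where
  "cinv c = inv_into (cdom c) (cmap c)"

definition inner_form :: "('e::euclidean_space \<Rightarrow> 'e \<Rightarrow> real) \<Rightarrow> bool" where
  "inner_form b \<longleftrightarrow> bilinear b \<and> (\<forall>v w. b v w = b w v) \<and> (\<forall>v. v \<noteq> 0 \<longrightarrow> b v v > 0)"

definition second_countable_space :: "'a topology \<Rightarrow> bool" where
  "second_countable_space X \<longleftrightarrow>
     (\<exists>\<B>. countable \<B> \<and> (\<forall>V\<in>\<B>. openin X V) \<and>
        (\<forall>U x. openin X U \<and> x \<in> U \<longrightarrow> (\<exists>V\<in>\<B>. x \<in> V \<and> V \<subseteq> U)))"

definition compatible_charts :: "('a, 'e::euclidean_space) rchart \<Rightarrow> ('a, 'e) rchart \<Rightarrow> bool" where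
  "compatible_charts c c' \<longleftrightarrow>
     (let S = cmap c ` (cdom c \<inter> cdom c'); T = cmap c' \<circ> cinv c
      in smooth_on S T \<and>
         (\<forall>u\<in>S. \<forall>v w. cmet c u v w = cmet c' (T u) (pd v T u) (pd w T u)))"

definition riemannian_manifold ::
    "'a topology \<Rightarrow> ('a, 'e::euclidean_space) rchart set \<Rightarrow> bool" where
  "riemannian_manifold X A \<longleftrightarrow>
     topspace X \<noteq> {} \<and> Hausdorff_space X \<and> second_countable_space X \<and>
     (\<Union>c\<in>A. cdom c) = topspace X \<and>
     (\<forall>c\<in>A. openin X (cdom c) \<and> open (cran c) \<and>
        homeomorphic_map (subtopology X (cdom c)) (top_of_set (cran c)) (cmap c) \<and>
        (\<forall>v w. smooth_on (cran c) (\<lambda>u. cmet c u v w)) \<and>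
        (\<forall>u\<in>cran c. inner_form (cmet c u))) \<and>
     (\<forall>c\<in>A. \<forall>c'\<in>A. compatible_charts c c')"

text \<open>
  Components of the inverse metric.  Only the values on \<open>Basis\<close> are used, and these are uniquely
  determined when \<open>b\<close> is nondegenerate.
\<close>

definition inv_form :: "('e::euclidean_space \<Rightarrow> 'e \<Rightarrow> real) \<Rightarrow> 'e \<Rightarrow> 'e \<Rightarrow> real" where
  "inv_form b = (SOME h. \<forall>i\<in>Basis. \<forall>k\<in>Basis.
      (\<Sum>j\<in>Basis. b i j * h j k) = (if i = k then 1 else 0))"

definition christoffel ::
    "('a, 'e::euclidean_space) rchart \<Rightarrow> 'e \<Rightarrow> 'e \<Rightarrow> 'e \<Rightarrow> 'e \<Rightarrow> real" where
  "christoffel c u i j k =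
     (\<Sum>l\<in>Basis. inv_form (cmet c u) k l *
        (pd i (\<lambda>x. cmet c x j l) u + pd j (\<lambda>x. cmet c x i l) u - pd l (\<lambda>x. cmet c x i j) u)) / 2"

text \<open>
  Laplace-Beltrami operator as trace of the Hessian (so it is nonpositive, as in \<open>\<Delta>f = - d f\<close>),
  acting componentwise on vector-valued maps, and \<open>|dh|\<^sup>2\<close>; both in the coordinates of a chart.
\<close>

definition laplacian ::
    "('a, 'e::euclidean_space) rchart \<Rightarrow> ('e \<Rightarrow> 'v::real_inner) \<Rightarrow> 'e \<Rightarrow> 'v" where
  "laplacian c h u =
     (\<Sum>i\<in>Basis. \<Sum>j\<in>Basis. inv_form (cmet c u) i j *\<^sub>R
        (pd i (pd j h) u - (\<Sum>k\<in>Basis. christoffel c u i j k *\<^sub>R pd k h u)))"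

definition diff_norm_sq ::
    "('a, 'e::euclidean_space) rchart \<Rightarrow> ('e \<Rightarrow> 'v::real_inner) \<Rightarrow> 'e \<Rightarrow> real" where
  "diff_norm_sq c h u =
     (\<Sum>i\<in>Basis. \<Sum>j\<in>Basis. inv_form (cmet c u) i j * (pd i h u \<bullet> pd j h u))"

definition smooth_map ::
    "('a, 'e::euclidean_space) rchart set \<Rightarrow> ('a \<Rightarrow> 'v::real_normed_vector) \<Rightarrow> bool" where
  "smooth_map A f \<longleftrightarrow> (\<forall>c\<in>A. smooth_on (cran c) (f \<circ> cinv c))"

text \<open>Harmonicity of a map into the unit sphere: \<open>\<Delta>f = -|df|\<^sup>2 f\<close>.\<close>

definition harmonic_into_sphere ::
    "('a, 'e::euclidean_space) rchart set \<Rightarrow> ('a \<Rightarrow> 'v::real_inner) \<Rightarrow> bool" where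
  "harmonic_into_sphere A f \<longleftrightarrow> smooth_map A f \<and>
     (\<forall>c\<in>A. \<forall>u\<in>cran c. f (cinv c u) \<in> sphere 0 1 \<and>
        laplacian c (f \<circ> cinv c) u = - diff_norm_sq c (f \<circ> cinv c) u *\<^sub>R f (cinv c u))"

definition eigenmap ::
    "('a, 'e::euclidean_space) rchart set \<Rightarrow> ('a \<Rightarrow> 'v::real_inner) \<Rightarrow> real \<Rightarrow> bool" where
  "eigenmap A f d \<longleftrightarrow> d > 0 \<and> smooth_map A f \<and>
     (\<forall>c\<in>A. \<forall>u\<in>cran c. f (cinv c u) \<in> sphere 0 1 \<and>
        laplacian c (f \<circ> cinv c) u = - d *\<^sub>R f (cinv c u) \<and>
        diff_norm_sq c (f \<circ> cinv c) u = d)"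


section \<open>The line, the circle, round spheres\<close>

text \<open>
  Points of the circle of length \<open>P\<close> are the cosets \<open>t + P\<int>\<close>.  Its charts are the branches of the
  multivalued coordinate \<open>t\<close>, so a \<open>P\<close>-periodic function on the line is read in each of them as
  the same function of \<open>t\<close>.
\<close>

definition circ :: "real \<Rightarrow> real \<Rightarrow> real set" where
  "circ P t = {t + of_int k * P | k. True}"

definition circle_topology :: "real \<Rightarrow> real set topology" where
  "circle_topology P = topology (\<lambda>U. U \<subseteq> range (circ P) \<and> open (circ P -` U))"

lemma openin_circle_topology:
  "openin (circle_topology P) U \<longleftrightarrow> U \<subseteq> range (circ P) \<and> open (circ P -` U)"
proof -
  have "istopology (\<lambda>U. U \<subseteq> range (circ P) \<and> open (circ P -` U))"
    unfolding istopology_def by (auto simp: vimage_Union)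
  then show ?thesis
    by (simp add: circle_topology_def topology_inverse')
qed

definition circle_atlas :: "real \<Rightarrow> (real set, real) rchart set" where
  "circle_atlas P = {\<lparr> cdom = circ P ` {a<..<a + P},
                       cmap = inv_into {a<..<a + P} (circ P),
                       cmet = (\<lambda>t v w. v * w) \<rparr> | a. True}"

definition line_atlas :: "real set \<Rightarrow> (real, real) rchart set" where
  "line_atlas J = {\<lparr> cdom = J, cmap = id, cmet = (\<lambda>t v w. v * w) \<rparr>}"

text \<open>
  The unit sphere of \<open>'v\<close> with the induced metric.  All charts into \<open>'e\<close> whose inverse is a smooth
  immersion are admitted; there are such charts when \<open>DIM('v) = DIM('e) + 1\<close>.
\<close>

definition sphere_atlas :: "('v::euclidean_space, 'e::euclidean_space) rchart set" where
  "sphere_atlas = {c. openin (top_of_set (sphere 0 1)) (cdom c) \<and> open (cran c) \<and>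
     homeomorphic_map (top_of_set (cdom c)) (top_of_set (cran c)) (cmap c) \<and>
     smooth_on (cran c) (cinv c) \<and>
     (\<forall>u\<in>cran c. inj (\<lambda>v. pd v (cinv c) u)) \<and>
     cmet c = (\<lambda>u v w. pd v (cinv c) u \<bullet> pd w (cinv c) u)}"


section \<open>Warped products\<close>

text \<open>
  The metric \<open>dt\<^sup>2 + l\<^sub>1\<^sup>2 g\<^sub>1 + l\<^sub>2\<^sup>2 g\<^sub>2\<close> over the line or the circle.  The warps are functions on the
  line, evaluated at the base coordinate \<open>t\<close>; over the circle they have to be periodic.
\<close>

definition warped_chart ::
    "(real \<Rightarrow> real) \<Rightarrow> (real \<Rightarrow> real) \<Rightarrow> ('s, real) rchart \<Rightarrow> ('a, 'e) rchart \<Rightarrow> ('b, 'f) rchart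
      \<Rightarrow> ('s \<times> 'a \<times> 'b, real \<times> 'e \<times> 'f) rchart" where
  "warped_chart l1 l2 b c1 c2 =
     \<lparr> cdom = cdom b \<times> cdom c1 \<times> cdom c2,
       cmap = (\<lambda>(s, x, y). (cmap b s, cmap c1 x, cmap c2 y)),
       cmet = (\<lambda>(t, x, y) (r, v1, v2) (s, w1, w2).
          cmet b t r s + (l1 t)\<^sup>2 * cmet c1 x v1 w1 + (l2 t)\<^sup>2 * cmet c2 y v2 w2) \<rparr>"

definition warped_atlas ::
    "(real \<Rightarrow> real) \<Rightarrow> (real \<Rightarrow> real) \<Rightarrow> ('s, real) rchart set \<Rightarrow> ('a, 'e) rchart set
      \<Rightarrow> ('b, 'f) rchart set \<Rightarrow> ('s \<times> 'a \<times> 'b, real \<times> 'e \<times> 'f) rchart set" where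
  "warped_atlas l1 l2 B A1 A2 =
     {warped_chart l1 l2 b c1 c2 | b c1 c2. b \<in> B \<and> c1 \<in> A1 \<and> c2 \<in> A2}"

definition warp_pair ::
    "(real \<Rightarrow> real) \<Rightarrow> real \<Rightarrow> nat \<Rightarrow> nat \<Rightarrow> real \<Rightarrow> real \<Rightarrow> (real \<Rightarrow> real) \<Rightarrow> (real \<Rightarrow> real) \<Rightarrow> bool"
    where
  "warp_pair F \<kappa> k1 k2 d1 d2 l1 l2 \<longleftrightarrow>
     (\<forall>t. l1 t > 0 \<and> l2 t > 0 \<and> l1 t ^ k1 * l2 t ^ k2 = F t \<and>
          d2 / (l2 t)\<^sup>2 - d1 / (l1 t)\<^sup>2 = \<kappa> / (F t)\<^sup>2)"

definition periodic :: "real \<Rightarrow> (real \<Rightarrow> 'a) \<Rightarrow> bool" where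
  "periodic P h \<longleftrightarrow> (\<forall>t. h (t + P) = h t)"


section \<open>Profiles\<close>

abbreviation S3 :: "(complex \<times> complex) set" where
  "S3 \<equiv> sphere 0 1"

definition profile_on :: "real set \<Rightarrow> (real \<Rightarrow> complex \<times> complex) \<Rightarrow> bool" where
  "profile_on J \<gamma> \<longleftrightarrow> smooth_on J \<gamma> \<and> (\<forall>t\<in>J. \<gamma> t \<in> S3)"

text \<open>\<open>G\<^sub>\<gamma>(t, x, y) = (z\<^sub>1(t) f\<^sub>1(x), z\<^sub>2(t) f\<^sub>2(y))\<close>, for complex and for real inputs.\<close>

definition join_map ::
    "(real \<Rightarrow> complex \<times> complex) \<Rightarrow> ('a \<Rightarrow> complex^'n1) \<Rightarrow> ('b \<Rightarrow> complex^'n2)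
      \<Rightarrow> real \<times> 'a \<times> 'b \<Rightarrow> (complex^'n1) \<times> (complex^'n2)" where
  "join_map \<gamma> f1 f2 = (\<lambda>(t, x, y). (fst (\<gamma> t) *s f1 x, snd (\<gamma> t) *s f2 y))"

definition real_join_map ::
    "(real \<Rightarrow> real) \<Rightarrow> (real \<Rightarrow> real) \<Rightarrow> ('a \<Rightarrow> 'v::real_vector) \<Rightarrow> ('b \<Rightarrow> 'w::real_vector)
      \<Rightarrow> real \<times> 'a \<times> 'b \<Rightarrow> 'v \<times> 'w" where
  "real_join_map z1 z2 f1 f2 = (\<lambda>(t, x, y). (z1 t *\<^sub>R f1 x, z2 t *\<^sub>R f2 y))"

text \<open>
  The map on the circle induced by a map on the line that is periodic in \<open>t\<close>; the representative
  chosen in the coset is then irrelevant.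
\<close>

definition on_circle :: "(real \<times> 'a \<times> 'b \<Rightarrow> 'v) \<Rightarrow> real set \<times> 'a \<times> 'b \<Rightarrow> 'v" where
  "on_circle G = (\<lambda>(c, x, y). G (SOME t. t \<in> c, x, y))"

definition tangent_proj :: "'v::real_inner \<Rightarrow> 'v \<Rightarrow> 'v" where
  "tangent_proj z v = v - (v \<bullet> z) *\<^sub>R z"

text \<open>Levi-Civita covariant derivative of the velocity of a curve in the unit sphere.\<close>

definition sphere_acceleration :: "(real \<Rightarrow> 'v::real_inner) \<Rightarrow> real \<Rightarrow> 'v" where
  "sphere_acceleration \<Gamma> s =
     tangent_proj (\<Gamma> s) (vector_derivative (\<lambda>r. vector_derivative \<Gamma> (at r)) (at s))"

definition sphere_gradient :: "('v::real_inner \<Rightarrow> real) \<Rightarrow> 'v \<Rightarrow> 'v" where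
  "sphere_gradient U z =
     (THE w. w \<bullet> z = 0 \<and> (\<forall>v. v \<bullet> z = 0 \<longrightarrow> w \<bullet> v = frechet_derivative U (at z) v))"

definition neumann_trajectory :: "real \<Rightarrow> real set \<Rightarrow> (real \<Rightarrow> complex \<times> complex) \<Rightarrow> bool" where
  "neumann_trajectory \<kappa> I \<Gamma> \<longleftrightarrow> profile_on I \<Gamma> \<and>
     (\<forall>s\<in>I. sphere_acceleration \<Gamma> s =
        \<kappa> *\<^sub>R sphere_gradient (\<lambda>z :: complex \<times> complex. (norm (snd z))\<^sup>2 / 2) (\<Gamma> s))"

definition hopf_torus :: "real \<Rightarrow> (complex \<times> complex) set" where
  "hopf_torus a = {z. norm (fst z) = a \<and> norm (snd z) = sqrt (1 - a\<^sup>2)}"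

text \<open>Isometries of the round sphere, i.e. for the geodesic distance \<open>arccos (x \<bullet> y)\<close>.\<close>

definition S3_isometry :: "(complex \<times> complex \<Rightarrow> complex \<times> complex) \<Rightarrow> bool" where
  "S3_isometry A \<longleftrightarrow> A ` S3 = S3 \<and> (\<forall>x\<in>S3. \<forall>y\<in>S3. arccos (A x \<bullet> A y) = arccos (x \<bullet> y))"

definition congruent_curves ::
    "(real \<Rightarrow> complex \<times> complex) \<Rightarrow> (real \<Rightarrow> complex \<times> complex) \<Rightarrow> bool" where
  "congruent_curves \<gamma> \<delta> \<longleftrightarrow>
     (\<exists>A \<phi>. S3_isometry A \<and> bij \<phi> \<and> smooth_on UNIV \<phi> \<and> (\<forall>t. deriv \<phi> t \<noteq> 0) \<and>
        (\<forall>t. \<delta> (\<phi> t) = A (\<gamma> t)))"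


section \<open>The conic Finsler metric and its geodesics\<close>

definition potential ::
    "real \<Rightarrow> real \<Rightarrow> (real \<Rightarrow> real) \<Rightarrow> (real \<Rightarrow> real) \<Rightarrow> real \<Rightarrow> complex \<times> complex \<Rightarrow> real" where
  "potential d1 d2 l1 l2 t z =
     (d1 / (l1 t)\<^sup>2 * (norm (fst z))\<^sup>2 + d2 / (l2 t)\<^sup>2 * (norm (snd z))\<^sup>2) / 2"

definition finsler ::
    "(real \<Rightarrow> real) \<Rightarrow> (real \<Rightarrow> complex \<times> complex \<Rightarrow> real)
      \<Rightarrow> real \<Rightarrow> complex \<times> complex \<Rightarrow> real \<Rightarrow> complex \<times> complex \<Rightarrow> real" where
  "finsler F V t z \<xi> v = F t / (2 * \<xi>) * ((norm v)\<^sup>2 + 2 * V t z * \<xi>\<^sup>2)"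

text \<open>
  Curves in circle \<open>\<times>\<close> sphere are given by their lifts to \<open>\<real> \<times> S3\<close>; \<open>K\<close> is a metric that is
  periodic in its first argument.
\<close>

definition curve_length ::
    "(real \<Rightarrow> complex \<times> complex \<Rightarrow> real \<Rightarrow> complex \<times> complex \<Rightarrow> real)
      \<Rightarrow> (real \<Rightarrow> real \<times> complex \<times> complex) \<Rightarrow> real \<Rightarrow> real \<Rightarrow> real" where
  "curve_length K c \<alpha> \<beta> = integral {\<alpha>..\<beta>} (\<lambda>s.
     K (fst (c s)) (snd (c s))
       (fst (vector_derivative c (at s))) (snd (vector_derivative c (at s))))"

definition cone_curve :: "real set \<Rightarrow> (real \<Rightarrow> real \<times> complex \<times> complex) \<Rightarrow> bool" where
  "cone_curve J c \<longleftrightarrow> smooth_on J c \<and>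
     (\<forall>s\<in>J. snd (c s) \<in> S3 \<and> fst (vector_derivative c (at s)) > 0)"

definition cone_variation ::
    "real set \<Rightarrow> (real \<Rightarrow> real \<times> complex \<times> complex) \<Rightarrow> real \<Rightarrow> real \<Rightarrow> real
      \<Rightarrow> (real \<times> real \<Rightarrow> real \<times> complex \<times> complex) \<Rightarrow> bool" where
  "cone_variation J c \<epsilon> \<alpha> \<beta> h \<longleftrightarrow>
     smooth_on ({-\<epsilon><..<\<epsilon>} \<times> J) h \<and>
     (\<forall>\<sigma>\<in>{-\<epsilon><..<\<epsilon>}. cone_curve J (\<lambda>s. h (\<sigma>, s))) \<and>
     (\<forall>s\<in>J. h (0, s) = c s) \<and>
     (\<forall>\<sigma>\<in>{-\<epsilon><..<\<epsilon>}. \<forall>s\<in>J - {\<alpha>..\<beta>}. h (\<sigma>, s) = c s)"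

definition conic_geodesic ::
    "(real \<Rightarrow> complex \<times> complex \<Rightarrow> real \<Rightarrow> complex \<times> complex \<Rightarrow> real)
      \<Rightarrow> real set \<Rightarrow> (real \<Rightarrow> real \<times> complex \<times> complex) \<Rightarrow> bool" where
  "conic_geodesic K J c \<longleftrightarrow> cone_curve J c \<and>
     (\<forall>\<epsilon> \<alpha> \<beta> h. \<epsilon> > 0 \<and> \<alpha> \<le> \<beta> \<and> {\<alpha>..\<beta>} \<subseteq> J \<and> cone_variation J c \<epsilon> \<alpha> \<beta> h \<longrightarrow>
        ((\<lambda>\<sigma>. curve_length K (\<lambda>s. h (\<sigma>, s)) \<alpha> \<beta>) has_real_derivative 0) (at 0))"

definition to_circle :: "real \<Rightarrow> real \<times> 'b \<Rightarrow> real set \<times> 'b" where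
  "to_circle P p = (circ P (fst p), snd p)"

definition closed_geodesic ::
    "(real \<Rightarrow> complex \<times> complex \<Rightarrow> real \<Rightarrow> complex \<times> complex \<Rightarrow> real)
      \<Rightarrow> real \<Rightarrow> (real \<Rightarrow> real \<times> complex \<times> complex) \<Rightarrow> real \<Rightarrow> bool" where
  "closed_geodesic K P c Q \<longleftrightarrow> Q > 0 \<and> conic_geodesic K UNIV c \<and>
     (\<forall>s. to_circle P (c (s + Q)) = to_circle P (c s))"

text \<open>
  The closed curve \<open>c\<close> of period \<open>Q\<close> is, up to oriented reparametrization, an \<open>n\<close>-fold traversal
  of a closed geodesic \<open>e\<close>, with \<open>n \<ge> 2\<close>.
\<close>

definition is_iterate ::
    "(real \<Rightarrow> complex \<times> complex \<Rightarrow> real \<Rightarrow> complex \<times> complex \<Rightarrow> real)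
      \<Rightarrow> real \<Rightarrow> (real \<Rightarrow> real \<times> complex \<times> complex) \<Rightarrow> real \<Rightarrow> bool" where
  "is_iterate K P c Q \<longleftrightarrow>
     (\<exists>n \<ge> (2::nat). \<exists>e R \<phi>. closed_geodesic K P e R \<and>
        smooth_on UNIV \<phi> \<and> (\<forall>s. deriv \<phi> s > 0) \<and> (\<forall>s. \<phi> (s + Q) = \<phi> s + real n * R) \<and>
        (\<forall>s. to_circle P (c s) = to_circle P (e (\<phi> s))))"

definition graph_curve :: "(real \<Rightarrow> 'b) \<Rightarrow> real \<Rightarrow> real \<times> 'b" where
  "graph_curve \<gamma> t = (t, \<gamma> t)"

definition circle_graph :: "real \<Rightarrow> (real \<Rightarrow> 'b) \<Rightarrow> (real set \<times> 'b) set" where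
  "circle_graph P \<gamma> = range (\<lambda>t. to_circle P (graph_curve \<gamma> t))"


section \<open>Degree\<close>

text \<open>
  \<open>frame_det B vs\<close> is the determinant of the vectors \<open>vs\<close> in the ordered orthonormal basis \<open>B\<close>
  (Leibniz formula).  \<open>real^'a\<close> is oriented by the order of its coordinates, a direct sum by
  concatenation, and the unit sphere by the outward normal first.
\<close>

definition frame_det :: "'v::real_inner list \<Rightarrow> 'v list \<Rightarrow> real" where
  "frame_det B vs = (\<Sum>\<sigma> | \<sigma> permutes {..<length B}.
     of_int (sign \<sigma>) * (\<Prod>i<length B. (vs ! i) \<bullet> (B ! \<sigma> i)))"

type_synonym 'a rvec = "(real, 'a) vec"

definition std_frame :: "('a::{finite,linorder}) rvec list" where
  "std_frame = map (\<lambda>i. axis i 1) (sorted_list_of_set UNIV)"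

definition sum_frame ::
    "(('a::{finite,linorder}) rvec \<times> ('b::{finite,linorder}) rvec) list" where
  "sum_frame = map (\<lambda>v. (v, 0)) std_frame @ map (\<lambda>w. (0, w)) std_frame"

definition positive_frame :: "('a::{finite,linorder}) rvec \<Rightarrow> 'a rvec list \<Rightarrow> bool" where
  "positive_frame x es \<longleftrightarrow>
     Suc (length es) = CARD('a) \<and> (\<forall>e\<in>set es. e \<bullet> x = 0) \<and> frame_det std_frame (x # es) > 0"

text \<open>
  Sign of the Jacobian of a map from circle \<open>\<times>\<close> sphere \<open>\<times>\<close> sphere to a sphere, in positively
  oriented frames of the source and the target; it is \<open>0\<close> exactly at the critical points.  On
  tangent vectors \<open>D\<close> is the differential of the map; elsewhere it is not unique.
\<close>

definition orientation_sign ::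
    "real \<Rightarrow> (real set \<times> ('a::{finite,linorder}) rvec \<times> ('b::{finite,linorder}) rvec
        \<Rightarrow> 'a rvec \<times> 'b rvec)
      \<Rightarrow> real set \<times> 'a rvec \<times> 'b rvec \<Rightarrow> real" where
  "orientation_sign P \<Phi> = (\<lambda>(c, x, y). THE s. \<exists>t D es hs.
     circ P t = c \<and>
     ((\<lambda>(t, x, y). \<Phi> (circ P t, x, y)) has_derivative D)
        (at (t, x, y) within UNIV \<times> sphere 0 1 \<times> sphere 0 1) \<and>
     positive_frame x es \<and> positive_frame y hs \<and>
     s = sgn (frame_det sum_frame (\<Phi> (c, x, y) #
           map D ((1, 0, 0) # map (\<lambda>e. (0, e, 0)) es @ map (\<lambda>h. (0, 0, h)) hs))))"

definition fibre ::
    "real \<Rightarrow> (real set \<times> ('a::finite) rvec \<times> ('b::finite) rvec \<Rightarrow> 'a rvec \<times> 'b rvec)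
      \<Rightarrow> 'a rvec \<times> 'b rvec \<Rightarrow> (real set \<times> 'a rvec \<times> 'b rvec) set" where
  "fibre P \<Phi> w = {p \<in> range (circ P) \<times> sphere 0 1 \<times> sphere 0 1. \<Phi> p = w}"

definition regular_value ::
    "real \<Rightarrow> (real set \<times> ('a::{finite,linorder}) rvec \<times> ('b::{finite,linorder}) rvec
        \<Rightarrow> 'a rvec \<times> 'b rvec)
      \<Rightarrow> 'a rvec \<times> 'b rvec \<Rightarrow> bool" where
  "regular_value P \<Phi> w \<longleftrightarrow> w \<in> sphere 0 1 \<and> (\<forall>p\<in>fibre P \<Phi> w. orientation_sign P \<Phi> p \<noteq> 0)"

definition has_degree ::
    "real \<Rightarrow> (real set \<times> ('a::{finite,linorder}) rvec \<times> ('b::{finite,linorder}) rvec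
        \<Rightarrow> 'a rvec \<times> 'b rvec)
      \<Rightarrow> int \<Rightarrow> bool" where
  "has_degree P \<Phi> n \<longleftrightarrow> (\<exists>w. regular_value P \<Phi> w) \<and>
     (\<forall>w. regular_value P \<Phi> w \<longrightarrow>
        finite (fibre P \<Phi> w) \<and> (\<Sum>p\<in>fibre P \<Phi> w. orientation_sign P \<Phi> p) = of_int n)"

end

theory Submission
  imports Defs "Jordan_Normal_Form.Determinant"
begin

text \<open>
  On a warped product the Laplacian of the join of two eigenmaps splits, so \<open>G\<^sub>\<gamma>\<close> is harmonic iff
  \<open>\<gamma>'' + (F'/F) \<gamma>' = (\<lambda>\<^sub>1 z\<^sub>1, \<lambda>\<^sub>2 z\<^sub>2) + e \<gamma>\<close> for some function \<open>e\<close>. This is also the Euler-Lagrange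
  equation of the length of graphs. In the clock \<open>d\<tau> = dt / F\<close> the friction term disappears, and
  \<open>\<lambda>\<^sub>2 - \<lambda>\<^sub>1 = \<kappa> / F\<^sup>2\<close> turns the equation into the Neumann system. On every Hopf torus the rotation with
  the frequencies \<open>\<omega>\<^sub>i = 2 \<pi> r\<^sub>i / I\<^sub>F\<close> solves it, because \<open>\<kappa> = \<omega>\<^sub>1\<^sup>2 - \<omega>\<^sub>2\<^sup>2\<close>. On the real great circle it is a
  pendulum equation, whose rotating solutions take every positive value as the time of one turn; hence
  some solution makes exactly \<open>m\<close> turns in the time \<open>I\<^sub>F\<close>. Its angle increases and \<open>p\<close>, \<open>q\<close> are even, so
  all preimages of a regular value count positively, and there are \<open>4m\<close> of them.
\<close>

text \<open>The source occurs in several versions: over an interval or the circle, with complex or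
  real inputs, with abstract factors or round spheres. One computation serves them all, because it
  asks only for what they share: a base coordinate with metric dt^2, factor charts with smooth
  positive definite metrics, and a product of scalars and vectors with |z v| = |z| |v|. The friction
  is F'/F because the fibre dimensions are the exponents in the volume condition.

  Three facts decide the claims on lengths and iterates. On a Hopf torus, in the clock \<tau>, the
  squared speed a^2 \<omega>1^2 + (1 - a^2) \<omega>2^2 and the potential difference (1 - a^2)
  \<kappa> add up to \<omega>1^2 for every a. On the great circle (F u' - 1)^2 \<ge> 0 bounds the
  length below by 2 \<pi> m - I_F / 2. A graph winds once round the base, an n-fold traversal a
  multiple of n times.

  A differential within a product of spheres is not unique as a linear map of the ambient space, and
  an isometry of \<open>S3\<close> comes without a derivative. Both are therefore examined along
  curves only.\<close>

no_notation Matrix.scalar_prod (infix "\<bullet>" 70)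
hide_const (open) Determinant.det Matrix.mat Matrix.vec Matrix.orthogonal

section \<open>Calculus of smooth maps\<close>

lemma pd_eqI: "(f has_derivative f') (at u) \<Longrightarrow> pd b f u = f' b"
  unfolding pd_def by (metis frechet_derivative_at)

lemma has_derivative_pd:
  "f differentiable (at u) \<Longrightarrow> (f has_derivative (\<lambda>v. pd v f u)) (at u)"
  unfolding pd_def by (simp add: frechet_derivative_works)

lemma linear_pd: "f differentiable (at u) \<Longrightarrow> linear (\<lambda>v. pd v f u)"
  using has_derivative_linear[OF has_derivative_pd] .

lemma Ck_on_Suc':
  "Ck_on (Suc k) S f \<longleftrightarrow> (\<forall>x\<in>S. f differentiable (at x)) \<and> (\<forall>b\<in>Basis. Ck_on k S (pd b f))"
  by (simp add: pd_def[abs_def])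

declare Ck_on.simps(2)[simp del]

lemma Ck_on_imp_continuous: "Ck_on k S f \<Longrightarrow> continuous_on S f"
  by (cases k) (auto simp: Ck_on_Suc'
      intro!: continuous_at_imp_continuous_on differentiable_imp_continuous_within)

lemma Ck_on_SucD: "Ck_on (Suc k) S f \<Longrightarrow> Ck_on k S f"
proof (induction k arbitrary: f)
  case 0 then show ?case using Ck_on_imp_continuous by auto
next
  case (Suc k) then show ?case by (subst Ck_on_Suc') (auto simp: Ck_on_Suc'[of "Suc k"])
qed

lemma Ck_on_subset: "Ck_on k S f \<Longrightarrow> T \<subseteq> S \<Longrightarrow> Ck_on k T f"
  by (induction k arbitrary: f) (auto simp: Ck_on_Suc' intro: continuous_on_subset)

text \<open>The derivatives in \<open>Ck_on\<close> are unrestricted, so agreement on an open set is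
  enough to exchange two functions. In this way formulas that hold only over a chart range may be
  differentiated repeatedly.\<close>

lemma has_derivative_cong_open:
  assumes "open S" "x \<in> S" "\<And>y. y \<in> S \<Longrightarrow> f y = g y"
  shows "(f has_derivative D) (at x) \<longleftrightarrow> (g has_derivative D) (at x)"
  by (metis assms has_derivative_transform_within_open)

lemma pd_cong_open:
  assumes "open S" "x \<in> S" "\<And>y. y \<in> S \<Longrightarrow> f y = g y"
  shows "pd b f x = pd b g x"
  unfolding pd_def frechet_derivative_def using has_derivative_cong_open[OF assms] by simp

lemma differentiable_cong_open:
  assumes "open S" "x \<in> S" "\<And>y. y \<in> S \<Longrightarrow> f y = g y"
  shows "f differentiable (at x) \<longleftrightarrow> g differentiable (at x)"
  unfolding differentiable_def using has_derivative_cong_open[OF assms] by simp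

lemma Ck_on_cong:
  assumes "open S" "\<And>x. x \<in> S \<Longrightarrow> f x = g x"
  shows "Ck_on k S f \<longleftrightarrow> Ck_on k S g"
  using assms(2)
proof (induction k arbitrary: f g)
  case 0 then show ?case by (auto cong: continuous_on_cong)
next
  case (Suc k)
  have "Ck_on k S (pd b f) \<longleftrightarrow> Ck_on k S (pd b g)" for b
    by (rule Suc.IH) (rule pd_cong_open[OF \<open>open S\<close> _ Suc.prems])
  moreover have "f differentiable (at x) \<longleftrightarrow> g differentiable (at x)" if "x \<in> S" for x
    using differentiable_cong_open[OF \<open>open S\<close> that Suc.prems] .
  ultimately show ?case by (simp add: Ck_on_Suc')
qed

text \<open>Smoothness is local. This serves maps that have a simple formula only near each point,
  such as the transition maps of the circle.\<close>

lemma Ck_on_open_Union: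
  assumes "\<And>x. x \<in> S \<Longrightarrow> \<exists>U. open U \<and> x \<in> U \<and> Ck_on k U f"
  shows "Ck_on k S f"
  using assms
proof (induction k arbitrary: f)
  case 0
  have "isCont f x" if x: "x \<in> S" for x
  proof -
    obtain U where U: "open U" "x \<in> U" "Ck_on 0 U f" using 0[OF x] by blast
    then show ?thesis using continuous_on_eq_continuous_at by auto
  qed
  then show ?case by (auto intro!: continuous_at_imp_continuous_on)
next
  case (Suc k)
  have "Ck_on k S (pd b f)" if "b \<in> Basis" for b
  proof (rule Suc.IH)
    fix x assume "x \<in> S"
    from Suc.prems[OF this] obtain U where "open U" "x \<in> U" "Ck_on (Suc k) U f" by blast
    with that show "\<exists>U. open U \<and> x \<in> U \<and> Ck_on k U (pd b f)" by (auto simp: Ck_on_Suc')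
  qed
  moreover have "f differentiable (at x)" if "x \<in> S" for x
    using Suc.prems[OF that] by (auto simp: Ck_on_Suc')
  ultimately show ?case by (simp add: Ck_on_Suc')
qed

lemma Ck_on_const: "Ck_on k S (\<lambda>x::'a::euclidean_space. c)"
proof (induction k arbitrary: c)
  case (Suc k)
  have "pd b (\<lambda>x. c) = (\<lambda>x. 0)" for b :: 'a by (rule ext, rule pd_eqI) auto
  then show ?case using Suc unfolding Ck_on_Suc' by simp
qed auto

lemma Ck_on_bounded_linear:
  assumes "bounded_linear L" "open S" shows "Ck_on k S f \<Longrightarrow> Ck_on k S (\<lambda>x. L (f x))"
proof (induction k arbitrary: f)
  case 0 then show ?case
    using bounded_linear.continuous_on[OF assms(1)] by auto
next
  case (Suc k)
  have d: "((\<lambda>x. L (f x)) has_derivative (\<lambda>v. L (pd v f x))) (at x)" if "x \<in> S" for x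
    by (rule bounded_linear.has_derivative[OF assms(1) has_derivative_pd])
      (use Suc.prems that Ck_on_Suc' in blast)
  note eq = pd_eqI[OF this]
  have "Ck_on k S (pd b (\<lambda>x. L (f x)))" if "b \<in> Basis" for b
    using Suc.IH[of "pd b f"] Suc.prems that
    by (subst Ck_on_cong[OF assms(2), of _ "\<lambda>x. L (pd b f x)"]) (auto simp: Ck_on_Suc' eq)
  then show ?case using d by (auto simp: Ck_on_Suc' differentiable_def)
qed

lemma Ck_on_add:
  assumes "open S" shows "Ck_on k S f \<Longrightarrow> Ck_on k S g \<Longrightarrow> Ck_on k S (\<lambda>x. f x + g x)"
proof (induction k arbitrary: f g)
  case 0 then show ?case by (auto intro: continuous_on_add)
next
  case (Suc k)
  have d: "((\<lambda>x. f x + g x) has_derivative (\<lambda>v. pd v f x + pd v g x)) (at x)" if "x \<in> S" for x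
    by (intro has_derivative_add has_derivative_pd) (use Suc.prems that Ck_on_Suc' in blast)+
  note eq = pd_eqI[OF this]
  have "Ck_on k S (pd b (\<lambda>x. f x + g x))" if "b \<in> Basis" for b
    using Suc.IH[of "pd b f" "pd b g"] Suc.prems that
    by (subst Ck_on_cong[OF assms, of _ "\<lambda>x. pd b f x + pd b g x"]) (auto simp: Ck_on_Suc' eq)
  then show ?case using d by (auto simp: Ck_on_Suc' differentiable_def)
qed

text \<open>One product rule for real and complex scalars, inner products and products of numbers.
  The rule pairs a derivative of one factor with the other factor itself, so the induction uses each
  factor at two orders of regularity.\<close>

lemma Ck_on_bounded_bilinear:
  assumes "bounded_bilinear B" "open S"
  shows "Ck_on k S f \<Longrightarrow> Ck_on k S g \<Longrightarrow> Ck_on k S (\<lambda>x. B (f x) (g x))"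
proof (induction k arbitrary: f g)
  case 0 then show ?case using bounded_bilinear.continuous_on[OF assms(1)] by auto
next
  case (Suc k)
  have d: "((\<lambda>x. B (f x) (g x)) has_derivative (\<lambda>v. B (f x) (pd v g x) + B (pd v f x) (g x))) (at x)"
    if "x \<in> S" for x
    by (intro bounded_bilinear.FDERIV[OF assms(1)] has_derivative_pd)
      (use Suc.prems that Ck_on_Suc' in blast)+
  note eq = pd_eqI[OF this]
  have "Ck_on k S (pd b (\<lambda>x. B (f x) (g x)))" if "b \<in> Basis" for b
    using Suc.IH[of "pd b f" g] Suc.IH[of f "pd b g"] Suc.prems that
      Ck_on_SucD[OF Suc.prems(1)] Ck_on_SucD[OF Suc.prems(2)]
    by (subst Ck_on_cong[OF assms(2), of _ "\<lambda>x. B (f x) (pd b g x) + B (pd b f x) (g x)"])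
       (auto simp: Ck_on_Suc' eq intro!: Ck_on_add assms)
  then show ?case using d by (auto simp: Ck_on_Suc' differentiable_def)
qed

lemma Ck_on_sum:
  assumes "open S" "\<And>i. i \<in> I \<Longrightarrow> Ck_on k S (f i)"
  shows "Ck_on k S (\<lambda>x. \<Sum>i\<in>I. f i x)"
  using assms(2)
  by (induction I rule: infinite_finite_induct)
     (auto intro!: Ck_on_const Ck_on_add assms(1))

lemma Ck_on_compose:
  fixes f :: "'a::euclidean_space \<Rightarrow> 'b::euclidean_space" and g :: "'b \<Rightarrow> 'c::real_normed_vector"
  assumes "open S" "f ` S \<subseteq> T"
  shows "Ck_on k T g \<Longrightarrow> Ck_on k S f \<Longrightarrow> Ck_on k S (\<lambda>x. g (f x))"
proof (induction k arbitrary: g)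
  case 0 then show ?case using assms by (auto intro: continuous_on_compose2)
next
  case (Suc k)
  have d: "((\<lambda>x. g (f x)) has_derivative (\<lambda>v. pd (pd v f x) g (f x))) (at x)" if "x \<in> S" for x
    by (rule has_derivative_compose[OF has_derivative_pd has_derivative_pd])
      (use Suc.prems that assms Ck_on_Suc' in blast)+
  have lin: "linear (\<lambda>v. pd v g (f x))" if "x \<in> S" for x
    by (rule linear_pd) (use Suc.prems that assms Ck_on_Suc' in blast)
  \<comment> \<open>Only derivatives of \<open>g\<close> in basis directions are known to be
    \<open>Ck_on\<close>, so the direction \<open>pd b f x\<close> is expanded in the basis.\<close>
  have "pd (pd b f x) g (f x) = (\<Sum>c\<in>Basis. (pd b f x \<bullet> c) *\<^sub>R pd c g (f x))"
    if "x \<in> S" for x b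
    using linear_sum[OF lin[OF that], of "\<lambda>c. (pd b f x \<bullet> c) *\<^sub>R c" Basis]
      linear_scale[OF lin[OF that]]
    by (simp add: euclidean_representation)
  then have eq: "pd b (\<lambda>x. g (f x)) x = (\<Sum>c\<in>Basis. (pd b f x \<bullet> c) *\<^sub>R pd c g (f x))"
    if "x \<in> S" for x b
    using pd_eqI[OF d[OF that], of b] that by simp
  have "Ck_on k S (pd b (\<lambda>x. g (f x)))" if "b \<in> Basis" for b
    using Suc.IH Suc.prems that Ck_on_SucD[OF Suc.prems(2)]
    by (subst Ck_on_cong[OF assms(1), OF eq])
       (auto simp: Ck_on_Suc' intro!: Ck_on_sum assms(1) Ck_on_bounded_bilinear[OF bounded_bilinear_scaleR]
         Ck_on_bounded_linear[OF bounded_linear_inner_left])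
  then show ?case using d by (auto simp: Ck_on_Suc' differentiable_def)
qed

lemma smooth_onD:
  assumes "smooth_on S f"
  shows "\<And>x. x \<in> S \<Longrightarrow> f differentiable (at x)" "\<And>b. b \<in> Basis \<Longrightarrow> smooth_on S (pd b f)"
proof -
  have "Ck_on (Suc k) S f" for k using assms by (simp add: smooth_on_def)
  note * = this[unfolded Ck_on_Suc']
  show "\<And>x. x \<in> S \<Longrightarrow> f differentiable (at x)" using *[of 0] by simp
  show "\<And>b. b \<in> Basis \<Longrightarrow> smooth_on S (pd b f)" using * by (simp add: smooth_on_def)
qed

lemma smooth_on_imp_continuous_on: "smooth_on S f \<Longrightarrow> continuous_on S f"
  unfolding smooth_on_def using Ck_on.simps(1) by blast

lemma smooth_on_has_derivative:
  "smooth_on S f \<Longrightarrow> x \<in> S \<Longrightarrow> (f has_derivative (\<lambda>v. pd v f x)) (at x)"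
  using smooth_onD(1) has_derivative_pd by blast

lemma smooth_on_subset: "smooth_on S f \<Longrightarrow> T \<subseteq> S \<Longrightarrow> smooth_on T f"
  unfolding smooth_on_def using Ck_on_subset by blast

lemma smooth_on_cong:
  "open S \<Longrightarrow> (\<And>x. x \<in> S \<Longrightarrow> f x = g x) \<Longrightarrow> smooth_on S f \<longleftrightarrow> smooth_on S g"
  unfolding smooth_on_def using Ck_on_cong by blast

lemma smooth_on_open_Union:
  assumes "\<And>x. x \<in> S \<Longrightarrow> \<exists>U. open U \<and> x \<in> U \<and> smooth_on U f"
  shows "smooth_on S f"
  unfolding smooth_on_def
proof (intro allI Ck_on_open_Union)
  fix k x assume "x \<in> S"
  from assms[OF this] show "\<exists>U. open U \<and> x \<in> U \<and> Ck_on k U f"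
    by (auto simp: smooth_on_def)
qed

lemma smooth_on_const [simp]: "smooth_on S (\<lambda>x. c)"
  unfolding smooth_on_def using Ck_on_const by blast

lemma smooth_on_bounded_linear:
  "bounded_linear L \<Longrightarrow> open S \<Longrightarrow> smooth_on S f \<Longrightarrow> smooth_on S (\<lambda>x. L (f x))"
  unfolding smooth_on_def using Ck_on_bounded_linear by blast

lemma smooth_on_add:
  "open S \<Longrightarrow> smooth_on S f \<Longrightarrow> smooth_on S g \<Longrightarrow> smooth_on S (\<lambda>x. f x + g x)"
  unfolding smooth_on_def using Ck_on_add by blast

lemma smooth_on_minus: "open S \<Longrightarrow> smooth_on S f \<Longrightarrow> smooth_on S (\<lambda>x. - f x)"
  using smooth_on_bounded_linear[OF bounded_linear_minus[OF bounded_linear_ident]] .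

lemma smooth_on_diff:
  "open S \<Longrightarrow> smooth_on S f \<Longrightarrow> smooth_on S g \<Longrightarrow> smooth_on S (\<lambda>x. f x - g x)"
  using smooth_on_add[of S f "\<lambda>x. - g x"] smooth_on_minus[of S g] by simp

lemma smooth_on_bounded_bilinear:
  "bounded_bilinear B \<Longrightarrow> open S \<Longrightarrow> smooth_on S f \<Longrightarrow> smooth_on S g
    \<Longrightarrow> smooth_on S (\<lambda>x. B (f x) (g x))"
  unfolding smooth_on_def using Ck_on_bounded_bilinear[of B S _ f g] by blast

lemmas smooth_on_scaleR = smooth_on_bounded_bilinear[OF bounded_bilinear_scaleR]
  and smooth_on_mult = smooth_on_bounded_bilinear[OF bounded_bilinear_mult]
  and smooth_on_inner = smooth_on_bounded_bilinear[OF bounded_bilinear_inner]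

lemma smooth_on_sum:
  "open S \<Longrightarrow> (\<And>i. i \<in> I \<Longrightarrow> smooth_on S (f i)) \<Longrightarrow> smooth_on S (\<lambda>x. \<Sum>i\<in>I. f i x)"
  unfolding smooth_on_def by (auto intro!: Ck_on_sum)

lemma smooth_on_power:
  "open S \<Longrightarrow> smooth_on S f \<Longrightarrow> smooth_on S (\<lambda>x. (f x :: 'a::real_normed_algebra_1) ^ n)"
proof (induction n)
  case (Suc n) then show ?case using smooth_on_mult[of S f "\<lambda>x. f x ^ n"] by simp
qed simp

lemma smooth_on_compose:
  fixes f :: "'a::euclidean_space \<Rightarrow> 'b::euclidean_space" and g :: "'b \<Rightarrow> 'c::real_normed_vector"
  shows "smooth_on T g \<Longrightarrow> smooth_on S f \<Longrightarrow> open S \<Longrightarrow> f ` S \<subseteq> T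
    \<Longrightarrow> smooth_on S (\<lambda>x. g (f x))"
  unfolding smooth_on_def using Ck_on_compose[of S f T _ g] by blast

lemma smooth_on_ident [simp]: "smooth_on S (\<lambda>x. x)"
proof -
  have "pd b (\<lambda>x. x) = (\<lambda>x. b)" for b :: 'a by (rule ext, rule pd_eqI) auto
  then have "Ck_on k S (\<lambda>x. x)" for k
    by (cases k) (auto simp: Ck_on_Suc' intro: Ck_on_const)
  then show ?thesis unfolding smooth_on_def by blast
qed

lemmas smooth_on_fst = smooth_on_bounded_linear[OF bounded_linear_fst]
  and smooth_on_snd = smooth_on_bounded_linear[OF bounded_linear_snd]

lemma smooth_on_Pair:
  assumes "open S" "smooth_on S f" "smooth_on S g" shows "smooth_on S (\<lambda>x. (f x, g x))"
proof -
  have "bounded_linear (\<lambda>y. (y, 0))" "bounded_linear (\<lambda>y. (0, y))"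
    by (intro bounded_linear_Pair bounded_linear_ident bounded_linear_zero)+
  from smooth_on_add[OF assms(1) smooth_on_bounded_linear[OF this(1) assms(1,2)]
    smooth_on_bounded_linear[OF this(2) assms(1,3)]]
  show ?thesis by simp
qed

lemma smooth_on_if_derivative:
  fixes f :: "real \<Rightarrow> 'a::real_normed_vector"
  assumes "open S" "\<And>x. x \<in> S \<Longrightarrow> (f has_vector_derivative f' x) (at x)" "smooth_on S f'"
  shows "smooth_on S f"
proof -
  have "pd 1 f x = f' x" if "x \<in> S" for x
    using pd_eqI[OF assms(2)[OF that, unfolded has_vector_derivative_def], of 1] by simp
  then have "smooth_on S (pd 1 f)"
    using assms(3) smooth_on_cong[OF assms(1), of "pd 1 f" f'] by simp
  moreover have "f differentiable (at x)" if "x \<in> S" for x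
    using assms(2)[OF that] by (auto simp: has_vector_derivative_def differentiable_def)
  ultimately have "Ck_on k S f" for k
    using Ck_on_SucD[of k S f] by (auto simp: Ck_on_Suc' smooth_on_def)
  then show ?thesis by (simp add: smooth_on_def)
qed

text \<open>Bootstrapping: the right-hand side of the equation gains the regularity of the solution.\<close>

lemma smooth_on_ode:
  fixes f :: "real \<Rightarrow> 'a::euclidean_space"
  assumes S: "open S" and d: "\<And>x. x \<in> S \<Longrightarrow> (f has_vector_derivative H (f x)) (at x)"
    and H: "smooth_on T H" "f ` S \<subseteq> T"
  shows "smooth_on S f"
proof -
  have diff: "f differentiable (at x)" if "x \<in> S" for x
    using d[OF that] by (auto simp: has_vector_derivative_def differentiable_def)
  have eq: "pd 1 f x = H (f x)" if "x \<in> S" for x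
    using pd_eqI[OF d[OF that, unfolded has_vector_derivative_def], of 1] by simp
  have "Ck_on k S f" for k
  proof (induction k)
    case 0 show ?case using diff
      by (auto intro!: continuous_at_imp_continuous_on differentiable_imp_continuous_within)
  next
    case (Suc k)
    have C: "Ck_on k S (\<lambda>x. H (f x))"
      using Ck_on_compose[OF S H(2) _ Suc] H(1) by (auto simp: smooth_on_def)
    have "Ck_on k S (pd 1 f) \<longleftrightarrow> Ck_on k S (\<lambda>x. H (f x))"
      by (rule Ck_on_cong[OF S eq])
    with C have "Ck_on k S (pd 1 f)" by blast
    then show ?case using diff by (auto simp: Ck_on_Suc')
  qed
  then show ?thesis by (simp add: smooth_on_def)
qed

lemma smooth_on_vector_derivative:
  fixes f :: "real \<Rightarrow> 'a::real_normed_vector"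
  assumes "open S" "smooth_on S f"
  shows "\<And>x. x \<in> S \<Longrightarrow> (f has_vector_derivative vector_derivative f (at x)) (at x)"
    and "smooth_on S (\<lambda>x. vector_derivative f (at x))"
    and "\<And>x. x \<in> S \<Longrightarrow> vector_derivative f (at x) = pd 1 f x"
proof -
  show *: "(f has_vector_derivative vector_derivative f (at x)) (at x)" if "x \<in> S" for x
    using smooth_onD(1)[OF assms(2) that] vector_derivative_works by blast
  show **: "vector_derivative f (at x) = pd 1 f x" if "x \<in> S" for x
    using pd_eqI[OF *[OF that, unfolded has_vector_derivative_def], of 1] by simp
  have "smooth_on S (\<lambda>x. vector_derivative f (at x)) \<longleftrightarrow> smooth_on S (pd 1 f)"
    by (rule smooth_on_cong[OF assms(1) **])
  then show "smooth_on S (\<lambda>x. vector_derivative f (at x))"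
    using smooth_onD(2)[OF assms(2), of 1] by simp
qed

section \<open>Smoothness of elementary functions\<close>

text \<open>Inversion solves y' = - y^2, so the bootstrapping lemma applies away from 0. The
  smoothness of \<open>exp\<close>, \<open>sqrt\<close> and \<open>cis\<close> comes from their own
  differential equations in the same way.\<close>

lemma smooth_on_inverse:
  assumes "open S" "smooth_on S f" "\<And>x. x \<in> S \<Longrightarrow> f x \<noteq> (0::real)"
  shows "smooth_on S (\<lambda>x. inverse (f x))"
proof -
  have "smooth_on (- {0}) (inverse :: real \<Rightarrow> real)"
  proof (rule smooth_on_ode)
    show "(inverse has_vector_derivative (\<lambda>y. - (y * y)) (inverse x)) (at x)"
      if "x \<in> - {0}" for x :: real
      using DERIV_inverse[of x UNIV] that
      by (simp add: has_real_derivative_iff_has_vector_derivative power2_eq_square)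
    show "smooth_on UNIV (\<lambda>y::real. - (y * y))"
      by (intro smooth_on_minus smooth_on_mult smooth_on_ident open_UNIV)
  qed auto
  from smooth_on_compose[OF this assms(2,1)] assms(3) show ?thesis by force
qed

lemma smooth_on_divide:
  assumes "open S" "smooth_on S f" "smooth_on S g" "\<And>x. x \<in> S \<Longrightarrow> g x \<noteq> (0::real)"
  shows "smooth_on S (\<lambda>x. f x / g x)"
  unfolding divide_inverse by (intro smooth_on_mult smooth_on_inverse assms)

lemma smooth_on_exp:
  assumes "open S" "smooth_on S f" shows "smooth_on S (\<lambda>x. exp (f x :: real))"
proof -
  have "smooth_on UNIV (exp :: real \<Rightarrow> real)"
    by (rule smooth_on_ode[where H="\<lambda>x. x" and T=UNIV])
       (auto simp: has_real_derivative_iff_has_vector_derivative[symmetric])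
  from smooth_on_compose[OF this assms(2,1)] show ?thesis by auto
qed

lemma smooth_on_ln:
  assumes "open S" "smooth_on S f" "\<And>x. x \<in> S \<Longrightarrow> f x > (0::real)"
  shows "smooth_on S (\<lambda>x. ln (f x))"
proof -
  have "smooth_on {0<..} (ln :: real \<Rightarrow> real)"
  proof (rule smooth_on_if_derivative)
    show "(ln has_vector_derivative inverse x) (at x)" if "x \<in> {0<..}" for x :: real
      using DERIV_ln[of x] that by (simp add: has_real_derivative_iff_has_vector_derivative)
    show "smooth_on {0<..} (inverse :: real \<Rightarrow> real)"
      using smooth_on_inverse[OF _ smooth_on_ident, of "{0<..} :: real set"] by simp
  qed simp
  from smooth_on_compose[OF this assms(2,1)] assms(3) show ?thesis by auto
qed

lemma smooth_on_sqrt: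
  assumes "open S" "smooth_on S f" "\<And>x. x \<in> S \<Longrightarrow> f x > (0::real)"
  shows "smooth_on S (\<lambda>x. sqrt (f x))"
proof -
  have "smooth_on {0<..} sqrt"
  proof (rule smooth_on_ode)
    show "(sqrt has_vector_derivative inverse (2 * sqrt x)) (at x)" if "x \<in> {0<..}" for x
      using DERIV_real_sqrt[of x] that
      by (simp add: has_real_derivative_iff_has_vector_derivative field_simps)
    show "smooth_on {0<..} (\<lambda>y::real. inverse (2 * y))"
      by (intro smooth_on_inverse smooth_on_mult) auto
  qed auto
  from smooth_on_compose[OF this assms(2,1)] assms(3) show ?thesis by auto
qed

lemma smooth_on_cis:
  assumes "open S" "smooth_on S f" shows "smooth_on S (\<lambda>x. cis (f x))"
proof -
  have "smooth_on UNIV cis"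
  proof (rule smooth_on_ode[where H="\<lambda>z. \<i> * z" and T=UNIV])
    show "(cis has_vector_derivative \<i> * cis x) (at x)" for x
      using has_derivative_cis[of "\<lambda>x. x" "\<lambda>x. x" x UNIV]
      by (simp add: has_vector_derivative_def)
  qed (auto intro: smooth_on_mult)
  from smooth_on_compose[OF this assms(2,1)] show ?thesis by auto
qed

lemma smooth_on_cos: "open S \<Longrightarrow> smooth_on S f \<Longrightarrow> smooth_on S (\<lambda>x. cos (f x :: real))"
  and smooth_on_sin: "open S \<Longrightarrow> smooth_on S f \<Longrightarrow> smooth_on S (\<lambda>x. sin (f x :: real))"
  using smooth_on_bounded_linear[OF bounded_linear_Re, of S "\<lambda>x. cis (f x)"]
    smooth_on_bounded_linear[OF bounded_linear_Im, of S "\<lambda>x. cis (f x)"]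
    smooth_on_cis[of S f] by simp_all

lemmas smooth_intros = smooth_on_const smooth_on_ident smooth_on_add smooth_on_diff smooth_on_minus
  smooth_on_scaleR smooth_on_mult smooth_on_inner smooth_on_sum smooth_on_power smooth_on_fst
  smooth_on_snd smooth_on_Pair smooth_on_inverse smooth_on_divide smooth_on_exp smooth_on_cos
  smooth_on_sin smooth_on_cis

section \<open>Inverse functions in one variable\<close>

text \<open>On a connected set of reals a positive derivative gives strict monotonicity; invariance
  of domain then makes the image open.\<close>

lemma has_real_derivative_inv_into:
  fixes f :: "real \<Rightarrow> real"
  assumes S: "open S" "connected S" and d: "\<And>x. x \<in> S \<Longrightarrow> (f has_real_derivative f' x) (at x)"
    and pos: "\<And>x. x \<in> S \<Longrightarrow> f' x > 0"
  shows "inj_on f S" "open (f ` S)"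
    and "\<And>x. x \<in> S \<Longrightarrow> (inv_into S f has_real_derivative inverse (f' x)) (at (f x))"
proof -
  have less: "f x < f y" if "x \<in> S" "y \<in> S" "x < y" for x y
  proof (rule DERIV_pos_imp_increasing[OF \<open>x < y\<close>])
    fix z assume "x \<le> z" "z \<le> y"
    then have "z \<in> S" using that S(2) by (meson connected_contains_Icc atLeastAtMost_iff subsetD)
    then show "\<exists>y. (f has_real_derivative y) (at z) \<and> y > 0" using d pos by blast
  qed
  then show inj: "inj_on f S" by (metis inj_onI less_irrefl linorder_cases)
  have cont: "continuous_on S f"
    using d by (meson DERIV_isCont continuous_at_imp_continuous_on)
  show op: "open (f ` S)"
    by (rule invariance_of_domain[OF cont S(1) inj])
  show "(inv_into S f has_real_derivative inverse (f' x)) (at (f x))" if x: "x \<in> S" for x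
  proof -
    have "(inv_into S f has_derivative (\<lambda>h. h / f' x)) (at (f x))"
    proof (rule has_derivative_inverse_strong_x[OF S(1), where f=f and f'="\<lambda>h. f' x * h"])
      show "(f has_derivative (\<lambda>h. f' x * h)) (at (inv_into S f (f x)))"
        using d[OF x] x inj by (simp add: has_field_derivative_def)
      show "(*) (f' x) \<circ> (\<lambda>h. h / f' x) = id" using pos[OF x] by auto
    qed (use cont x inj in auto)
    then show ?thesis
      by (simp add: has_field_derivative_def divide_inverse mult.commute[of _ "inverse (f' x)"])
  qed
qed

text \<open>Bootstrapping again, now with \<open>g' = 1 / f'(g)\<close>.\<close>

lemma smooth_on_inv_into:
  fixes f :: "real \<Rightarrow> real"
  assumes S: "open S" "connected S" and d: "\<And>x. x \<in> S \<Longrightarrow> (f has_real_derivative f' x) (at x)"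
    and pos: "\<And>x. x \<in> S \<Longrightarrow> f' x > 0" and sm: "smooth_on S f'"
  shows "smooth_on (f ` S) (inv_into S f)"
proof (rule smooth_on_ode[where H="\<lambda>y. inverse (f' y)" and T=S])
  note inv = has_real_derivative_inv_into[OF S d pos]
  show "open (f ` S)" by (rule inv(2))
  show "(inv_into S f has_vector_derivative inverse (f' (inv_into S f x))) (at x)"
    if "x \<in> f ` S" for x
    using that inv(1,3) by (auto simp: has_real_derivative_iff_has_vector_derivative[symmetric])
  show "smooth_on S (\<lambda>y. inverse (f' y))"
    by (rule smooth_on_inverse[OF S(1) sm]) (use pos in force)
  show "inv_into S f ` f ` S \<subseteq> S" using inv(1) by auto
qed

section \<open>Symmetry of second derivatives\<close>

lemma has_vector_derivative_line:
  assumes "g differentiable (at (u + r *\<^sub>R i))"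
  shows "((\<lambda>r. g (u + r *\<^sub>R i)) has_vector_derivative pd i g (u + r *\<^sub>R i)) (at r)"
proof -
  have "((\<lambda>r. u + r *\<^sub>R i) has_derivative (\<lambda>h. h *\<^sub>R i)) (at r)"
    by (auto intro!: derivative_eq_intros)
  from has_derivative_compose[OF this has_derivative_pd[OF assms]] linear_scale[OF linear_pd[OF assms]]
  show ?thesis by (simp add: has_vector_derivative_def)
qed

text \<open>The mixed second difference is symmetric in \<open>i\<close> and \<open>j\<close>. The
  mean value theorem, applied along \<open>i\<close> and then along \<open>j\<close>, expresses it
  by one mixed derivative; the opposite order expresses it by the other. All points involved lie
  within 2 s of \<open>u\<close>, hence the bound on \<open>s\<close>.\<close>

lemma second_difference_MVT:
  fixes g :: "'a::euclidean_space \<Rightarrow> real"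
  assumes g: "smooth_on (ball u r) g" and i: "i \<in> Basis" and j: "j \<in> Basis"
    and s: "0 < s" "2 * s < r"
  shows "\<exists>\<xi> \<eta>. 0 < \<xi> \<and> \<xi> < s \<and> 0 < \<eta> \<and> \<eta> < s \<and>
    g (u + s *\<^sub>R i + s *\<^sub>R j) - g (u + s *\<^sub>R i) - (g (u + s *\<^sub>R j) - g u)
      = s\<^sup>2 * pd j (pd i g) (u + \<xi> *\<^sub>R i + \<eta> *\<^sub>R j)"
proof -
  have in_ball: "u + x *\<^sub>R i + y *\<^sub>R j \<in> ball u r" if "0 \<le> x" "x \<le> s" "0 \<le> y" "y \<le> s" for x y
  proof -
    have "norm (x *\<^sub>R i + y *\<^sub>R j) \<le> norm (x *\<^sub>R i) + norm (y *\<^sub>R j)" by (rule norm_triangle_ineq)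
    also have "\<dots> \<le> 2 * s" using that i j by simp
    finally have "norm (x *\<^sub>R i + y *\<^sub>R j) < r" using s by simp
    moreover have "dist u (u + x *\<^sub>R i + y *\<^sub>R j) = norm (x *\<^sub>R i + y *\<^sub>R j)"
      unfolding dist_norm using norm_minus_cancel[of "x *\<^sub>R i + y *\<^sub>R j"]
      by (simp add: algebra_simps)
    ultimately show ?thesis by simp
  qed
  \<comment> \<open>The difference along \<open>j\<close>, regarded as a function of the step along
    \<open>i\<close>.\<close>
  define \<phi> where "\<phi> x = g (u + s *\<^sub>R j + x *\<^sub>R i) - g (u + x *\<^sub>R i)" for x
  have "\<exists>\<xi>>0. \<xi> < s \<and> \<phi> s - \<phi> 0 = (s - 0) * (pd i g (u + s *\<^sub>R j + \<xi> *\<^sub>R i) - pd i g (u + \<xi> *\<^sub>R i))"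
  proof (rule MVT2[OF s(1)])
    fix x assume x: "0 \<le> x" "x \<le> s"
    have a: "u + s *\<^sub>R j + x *\<^sub>R i \<in> ball u r" "u + x *\<^sub>R i \<in> ball u r"
      using in_ball[of x s] in_ball[of x 0] x s by (simp_all add: algebra_simps)
    show "(\<phi> has_real_derivative pd i g (u + s *\<^sub>R j + x *\<^sub>R i) - pd i g (u + x *\<^sub>R i)) (at x)"
      unfolding \<phi>_def has_real_derivative_iff_has_vector_derivative
      using a by (intro has_vector_derivative_diff has_vector_derivative_line smooth_onD(1)[OF g])
  qed
  then obtain \<xi> where \<xi>: "0 < \<xi>" "\<xi> < s"
    "\<phi> s - \<phi> 0 = s * (pd i g (u + s *\<^sub>R j + \<xi> *\<^sub>R i) - pd i g (u + \<xi> *\<^sub>R i))" by auto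
  define \<psi> where "\<psi> y = pd i g (u + \<xi> *\<^sub>R i + y *\<^sub>R j)" for y
  have "\<exists>\<eta>>0. \<eta> < s \<and> \<psi> s - \<psi> 0 = (s - 0) * pd j (pd i g) (u + \<xi> *\<^sub>R i + \<eta> *\<^sub>R j)"
  proof (rule MVT2[OF s(1)])
    fix y assume y: "0 \<le> y" "y \<le> s"
    show "(\<psi> has_real_derivative pd j (pd i g) (u + \<xi> *\<^sub>R i + y *\<^sub>R j)) (at y)"
      unfolding \<psi>_def has_real_derivative_iff_has_vector_derivative
      using in_ball[of \<xi> y] \<xi> y
      by (intro has_vector_derivative_line smooth_onD(1)[OF smooth_onD(2)[OF g i]]) auto
  qed
  then obtain \<eta> where \<eta>: "0 < \<eta>" "\<eta> < s"
    "\<psi> s - \<psi> 0 = s * pd j (pd i g) (u + \<xi> *\<^sub>R i + \<eta> *\<^sub>R j)" by auto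
  have "\<phi> s - \<phi> 0 = s * (\<psi> s - \<psi> 0)" using \<xi>(3) by (simp add: \<psi>_def algebra_simps)
  then have "\<phi> s - \<phi> 0 = s\<^sup>2 * pd j (pd i g) (u + \<xi> *\<^sub>R i + \<eta> *\<^sub>R j)"
    using \<eta>(3) by (simp add: power2_eq_square)
  moreover have "\<phi> s - \<phi> 0
     = g (u + s *\<^sub>R i + s *\<^sub>R j) - g (u + s *\<^sub>R i) - (g (u + s *\<^sub>R j) - g u)"
    by (simp add: \<phi>_def algebra_simps)
  ultimately show ?thesis using \<xi> \<eta> by auto
qed

text \<open>Arbitrarily close to \<open>u\<close> there are points at which the two mixed
  derivatives take the same value, so continuity makes them agree at \<open>u\<close>.\<close>

lemma pd_commute_real:
  fixes g :: "'a::euclidean_space \<Rightarrow> real"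
  assumes S: "open S" "u \<in> S" and g: "smooth_on S g" and i: "i \<in> Basis" and j: "j \<in> Basis"
  shows "pd i (pd j g) u = pd j (pd i g) u"
proof -
  have c: "isCont (pd i (pd j g)) u" "isCont (pd j (pd i g)) u"
    using S smooth_on_imp_continuous_on[OF smooth_onD(2)[OF smooth_onD(2)[OF g]]] i j
    by (simp_all add: continuous_on_eq_continuous_at)
  have "dist (pd i (pd j g) u) (pd j (pd i g) u) \<le> e" if e: "e > 0" for e
  proof -
    obtain r0 where r0: "r0 > 0" "ball u r0 \<subseteq> S" using S openE by blast
    have "e / 2 > 0" using e by simp
    then obtain r1 where r1: "r1 > 0"
      "\<And>x. dist x u < r1 \<Longrightarrow> dist (pd i (pd j g) x) (pd i (pd j g) u) < e / 2"
      using c(1) unfolding continuous_at_eps_delta by blast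
    from \<open>e / 2 > 0\<close> obtain r2 where r2: "r2 > 0"
      "\<And>x. dist x u < r2 \<Longrightarrow> dist (pd j (pd i g) x) (pd j (pd i g) u) < e / 2"
      using c(2) unfolding continuous_at_eps_delta by blast
    define r where "r = min r0 (min r1 r2)"
    \<comment> \<open>The evaluation points lie within 2 s of \<open>u\<close>, hence in the ball
      where both continuity estimates hold.\<close>
    define s where "s = r / 4"
    have r: "r > 0" "r \<le> r0" "r \<le> r1" "r \<le> r2" using r0 r1 r2 by (auto simp: r_def)
    then have s: "0 < s" "2 * s < r" by (auto simp: s_def)
    have sm: "smooth_on (ball u r) g"
      using g r0(2) r(2) by (meson smooth_on_subset subset_ball order_trans)
    from second_difference_MVT[OF sm i j s] obtain x1 y1 where 1: "0 < x1" "x1 < s" "0 < y1" "y1 < s"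
      "g (u + s *\<^sub>R i + s *\<^sub>R j) - g (u + s *\<^sub>R i) - (g (u + s *\<^sub>R j) - g u)
      = s\<^sup>2 * pd j (pd i g) (u + x1 *\<^sub>R i + y1 *\<^sub>R j)" by blast
    from second_difference_MVT[OF sm j i s] obtain x2 y2 where 2: "0 < x2" "x2 < s" "0 < y2" "y2 < s"
      "g (u + s *\<^sub>R j + s *\<^sub>R i) - g (u + s *\<^sub>R j) - (g (u + s *\<^sub>R i) - g u)
      = s\<^sup>2 * pd i (pd j g) (u + x2 *\<^sub>R j + y2 *\<^sub>R i)" by blast
    have eq: "pd j (pd i g) (u + x1 *\<^sub>R i + y1 *\<^sub>R j) = pd i (pd j g) (u + x2 *\<^sub>R j + y2 *\<^sub>R i)"
    proof -
      have "u + s *\<^sub>R j + s *\<^sub>R i = u + s *\<^sub>R i + s *\<^sub>R j" by (simp add: algebra_simps)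
      then have "s\<^sup>2 * pd j (pd i g) (u + x1 *\<^sub>R i + y1 *\<^sub>R j)
          = s\<^sup>2 * pd i (pd j g) (u + x2 *\<^sub>R j + y2 *\<^sub>R i)" using 1(5) 2(5)
        by (metis (no_types, lifting) add_diff_eq diff_diff_eq diff_add_eq add.commute)
      then show ?thesis using s(1) by simp
    qed
    have d: "dist (u + x *\<^sub>R a + y *\<^sub>R b) u < r"
      if "0 < x" "x < s" "0 < y" "y < s" "a \<in> Basis" "b \<in> Basis" for x y and a b :: 'a
    proof -
      have "norm (x *\<^sub>R a + y *\<^sub>R b) \<le> norm (x *\<^sub>R a) + norm (y *\<^sub>R b)" by (rule norm_triangle_ineq)
      also have "\<dots> < r" using that s by simp
      finally show ?thesis by (simp add: dist_norm algebra_simps)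
    qed
    have "dist (pd j (pd i g) (u + x1 *\<^sub>R i + y1 *\<^sub>R j)) (pd j (pd i g) u) < e / 2"
      using r2(2) d[OF 1(1-4) i j] r by auto
    moreover have "dist (pd i (pd j g) (u + x2 *\<^sub>R j + y2 *\<^sub>R i)) (pd i (pd j g) u) < e / 2"
      using r1(2) d[OF 2(1-4) j i] r by auto
    ultimately show ?thesis unfolding eq dist_real_def by argo
  qed
  then show ?thesis by (metis dist_le_zero_iff dense_ge)
qed

lemma pd_bounded_linear:
  assumes "bounded_linear L" "f differentiable (at u)"
  shows "pd b (\<lambda>x. L (f x)) u = L (pd b f u)"
  using pd_eqI[OF bounded_linear.has_derivative[OF assms(1) has_derivative_pd[OF assms(2)]]] .

lemma pd_commute:
  fixes f :: "'a::euclidean_space \<Rightarrow> 'b::euclidean_space"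
  assumes S: "open S" "u \<in> S" and f: "smooth_on S f" and i: "i \<in> Basis" and j: "j \<in> Basis"
  shows "pd i (pd j f) u = pd j (pd i f) u"
proof (rule euclidean_eqI)
  fix b :: 'b assume "b \<in> Basis"
  note L = bounded_linear_inner_left[of b]
  have 1: "pd k (\<lambda>x. f x \<bullet> b) x = pd k f x \<bullet> b" if "x \<in> S" for x k
    by (rule pd_bounded_linear[OF L smooth_onD(1)[OF f that]])
  have 2: "pd l (pd k (\<lambda>x. f x \<bullet> b)) u = pd l (pd k f) u \<bullet> b" if "k \<in> Basis" for k l
    using pd_cong_open[OF S, of "pd k (\<lambda>x. f x \<bullet> b)" "\<lambda>x. pd k f x \<bullet> b" l] 1
      pd_bounded_linear[OF L smooth_onD(1)[OF smooth_onD(2)[OF f that] S(2)]] by simp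
  have "smooth_on S (\<lambda>x. f x \<bullet> b)" by (rule smooth_on_bounded_linear[OF L S(1) f])
  from pd_commute_real[OF S this i j] 2[OF i, of j] 2[OF j, of i]
  show "pd i (pd j f) u \<bullet> b = pd j (pd i f) u \<bullet> b" by simp
qed

section \<open>Inverse metrics\<close>

lemma inner_form_linear:
  assumes "inner_form b" shows "linear (b v)" "linear (\<lambda>v. b v w)"
  using assms by (auto simp: inner_form_def bilinear_def)

lemma inner_form_expand_left:
  assumes "inner_form b" shows "b v w = (\<Sum>i\<in>Basis. (v \<bullet> i) * b i w)"
proof -
  note lin = inner_form_linear(2)[OF assms, of w]
  have "b v w = b (\<Sum>i\<in>Basis. (v \<bullet> i) *\<^sub>R i) w" by (simp add: euclidean_representation)
  also have "\<dots> = (\<Sum>i\<in>Basis. (v \<bullet> i) * b i w)"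
    unfolding linear_sum[OF lin] linear_scale[OF lin] by simp
  finally show ?thesis .
qed

lemma inner_form_expand_right:
  assumes "inner_form b" shows "b v w = (\<Sum>i\<in>Basis. b v i * (w \<bullet> i))"
  using inner_form_expand_left[OF assms, of w v] assms
  by (simp add: inner_form_def mult.commute)

lemma inner_form_nondegenerate:
  assumes "inner_form b" "\<And>i. i \<in> Basis \<Longrightarrow> b i v = 0" shows "v = 0"
proof (rule ccontr)
  assume "v \<noteq> 0"
  then have "b v v > 0" using assms(1) by (simp add: inner_form_def)
  then show False using inner_form_expand_left[OF assms(1), of v v] assms(2) by simp
qed

text \<open>\<open>inv_form\<close> is a choice, so an inverse has to be exhibited. Lowering an
  index is linear and, by definiteness, injective, hence surjective; the preimages of the basis
  vectors are the columns of the inverse.\<close>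

lemma inv_form_right:
  assumes "inner_form b" "i \<in> Basis" "k \<in> Basis"
  shows "(\<Sum>j\<in>Basis. b i j * inv_form b j k) = (if i = k then 1 else 0)"
proof -
  define A where "A v = (\<Sum>i\<in>Basis. b i v *\<^sub>R i)" for v
  have A: "A v \<bullet> i = b i v" if "i \<in> Basis" for v i
    unfolding A_def using that by (simp add: inner_sum_left_Basis)
  have "linear A"
    unfolding A_def
    by (intro linear_compose_sum ballI bounded_linear.linear bounded_linear_scaleR_const)
      (use inner_form_linear(1)[OF assms(1)] in \<open>auto simp: linear_conv_bounded_linear\<close>)
  moreover have "inj A"
    unfolding linear_injective_0[OF \<open>linear A\<close>]
    using inner_form_nondegenerate[OF assms(1)] A by (metis inner_zero_left)
  ultimately have "surj A" by (intro linear_injective_imp_surjective) auto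
  then obtain g where g: "\<And>y. A (g y) = y" by (metis surjD)
  have "(\<Sum>j\<in>Basis. b i j * (g k \<bullet> j)) = (if i = k then 1 else 0)"
    if "i \<in> Basis" "k \<in> Basis" for i k
    unfolding inner_form_expand_right[OF assms(1), of i "g k", symmetric]
    using A[OF that(1), of "g k"] that by (auto simp: g inner_Basis split: if_splits)
  then have "\<exists>h. \<forall>i\<in>Basis. \<forall>k\<in>Basis. (\<Sum>j\<in>Basis. b i j * h j k) = (if i = k then 1 else 0)"
    by (intro exI[of _ "\<lambda>j k. g k \<bullet> j"]) simp
  from someI_ex[OF this] show ?thesis using assms(2,3) unfolding inv_form_def by blast
qed

text \<open>The difference of two candidate columns pairs to zero with every basis vector, so
  definiteness makes it vanish. The inverse of a warped metric can therefore be guessed and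
  checked.\<close>

lemma inv_form_unique:
  assumes b: "inner_form b" and jk: "j \<in> Basis" "k \<in> Basis"
    and h: "\<And>i k. i \<in> Basis \<Longrightarrow> k \<in> Basis \<Longrightarrow>
      (\<Sum>j\<in>Basis. b i j * h j k) = (if i = k then 1 else 0)"
  shows "inv_form b j k = h j k"
proof -
  define v where "v = (\<Sum>j\<in>Basis. (inv_form b j k - h j k) *\<^sub>R j)"
  have v: "v \<bullet> j = inv_form b j k - h j k" if "j \<in> Basis" for j
    unfolding v_def using that by (simp add: inner_sum_left_Basis)
  have "b i v = 0" if "i \<in> Basis" for i
  proof -
    have "b i v = (\<Sum>j\<in>Basis. b i j * inv_form b j k) - (\<Sum>j\<in>Basis. b i j * h j k)"
      unfolding inner_form_expand_right[OF b, of i v] sum_subtractf[symmetric]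
      by (intro sum.cong) (auto simp: v algebra_simps)
    then show ?thesis using inv_form_right[OF b that jk(2)] h[OF that jk(2)] by simp
  qed
  then have "v = 0" by (rule inner_form_nondegenerate[OF b])
  then show ?thesis using v[OF jk(1)] by simp
qed

lemma inv_form_sym:
  assumes b: "inner_form b" and kl: "k \<in> Basis" "l \<in> Basis"
  shows "inv_form b k l = inv_form b l k"
proof -
  \<comment> \<open>\<open>w k\<close> is the vector dual to \<open>k\<close>. The inverse metric is
    the Gram matrix of these vectors, which makes its symmetry evident.\<close>
  define w where "w k = (\<Sum>j\<in>Basis. inv_form b j k *\<^sub>R j)" for k
  have w: "w k \<bullet> j = inv_form b j k" if "j \<in> Basis" for j k
    unfolding w_def using that by (simp add: inner_sum_left_Basis)
  have bw: "b i (w k) = (if i = k then 1 else 0)" if "i \<in> Basis" "k \<in> Basis" for i k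
    unfolding inner_form_expand_right[OF b, of i "w k"]
    using inv_form_right[OF b that] by (simp add: w)
  have "b (w l) (w k) = inv_form b k l" if "k \<in> Basis" "l \<in> Basis" for k l
    unfolding inner_form_expand_left[OF b, of "w l" "w k"]
    using that by (simp add: w bw if_distrib cong: if_cong)
  then show ?thesis using kl b by (metis inner_form_def)
qed

lemma inv_form_left:
  assumes "inner_form b" "i \<in> Basis" "k \<in> Basis"
  shows "(\<Sum>j\<in>Basis. inv_form b i j * b j k) = (if i = k then 1 else 0)"
proof -
  have "(\<Sum>j\<in>Basis. inv_form b i j * b j k) = (\<Sum>j\<in>Basis. b k j * inv_form b j i)"
    using assms by (intro sum.cong) (auto simp: inv_form_sym[OF assms(1)] inner_form_def)
  then show ?thesis using inv_form_right[OF assms(1,3,2)] by auto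
qed

text \<open>This trace is where the fibre dimensions enter the first-order term of the warped
  Laplacian.\<close>

lemma inv_form_trace:
  fixes b :: "'e::euclidean_space \<Rightarrow> 'e \<Rightarrow> real"
  assumes "inner_form b"
  shows "(\<Sum>i\<in>Basis. \<Sum>j\<in>Basis. inv_form b i j * b i j) = DIM('e)"
proof -
  have "(\<Sum>j\<in>Basis. inv_form b i j * b i j) = 1" if "i \<in> Basis" for i
    using inv_form_left[OF assms that that] assms by (simp add: inner_form_def)
  then show ?thesis by simp
qed

section \<open>The Laplacian of a warped product\<close>

lemma sum_Basis_Pair:
  "(\<Sum>p\<in>(Basis :: ('e::euclidean_space \<times> 'f::euclidean_space) set). \<phi> p)
    = (\<Sum>i\<in>Basis. \<phi> (i, 0)) + (\<Sum>j\<in>Basis. \<phi> (0, j))"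
proof -
  have "inj_on (\<lambda>u. (u::'e, 0::'f)) Basis" "inj_on (\<lambda>u. (0::'e, u::'f)) Basis"
    by (auto intro!: inj_onI)
  then show ?thesis
    unfolding Basis_prod_def
    by (subst sum.union_disjoint) (auto simp: sum.reindex nonzero_Basis)
qed

lemma sum_swap3:
  "(\<Sum>i\<in>A. \<Sum>j\<in>B. \<Sum>k\<in>C. f i j k) = (\<Sum>k\<in>C. \<Sum>i\<in>A. \<Sum>j\<in>B. f i j k)"
proof -
  have "(\<Sum>i\<in>A. \<Sum>j\<in>B. \<Sum>k\<in>C. f i j k) = (\<Sum>i\<in>A. \<Sum>k\<in>C. \<Sum>j\<in>B. f i j k)"
    by (intro sum.cong refl sum.swap)
  also have "\<dots> = (\<Sum>k\<in>C. \<Sum>i\<in>A. \<Sum>j\<in>B. f i j k)" by (rule sum.swap)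
  finally show ?thesis .
qed

lemma sum_Basis_triple:
  "(\<Sum>p\<in>(Basis :: (real \<times> 'e::euclidean_space \<times> 'f::euclidean_space) set). \<phi> p) =
     \<phi> (1, 0, 0) + (\<Sum>i\<in>Basis. \<phi> (0, i, 0)) + (\<Sum>j\<in>Basis. \<phi> (0, 0, j))"
  by (simp add: sum_Basis_Pair zero_prod_def add.assoc)

lemma Basis_triple_cases:
  assumes "p \<in> (Basis :: (real \<times> 'e::euclidean_space \<times> 'f::euclidean_space) set)"
  obtains "p = (1, 0, 0)" | i where "i \<in> Basis" "p = (0, i, 0)" | j where "j \<in> Basis" "p = (0, 0, j)"
  using assms by (auto simp: Basis_prod_def zero_prod_def)

lemma Basis_triple [simp, intro]:
  "(1, 0, 0) \<in> (Basis :: (real \<times> 'e::euclidean_space \<times> 'f::euclidean_space) set)"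
  "i \<in> Basis \<Longrightarrow> (0, i, 0) \<in> (Basis :: (real \<times> 'e \<times> 'f) set)"
  "j \<in> Basis \<Longrightarrow> (0, 0, j) \<in> (Basis :: (real \<times> 'e \<times> 'f) set)"
  by (auto simp: Basis_prod_def zero_prod_def)

text \<open>The warped metric at one point, with the squared warps frozen to the numbers
  \<open>a\<close> and \<open>c\<close>, so that its inverse is a matter of linear algebra.\<close>

definition warped_form ::
    "real \<Rightarrow> ('e::euclidean_space \<Rightarrow> 'e \<Rightarrow> real) \<Rightarrow> real \<Rightarrow> ('f::euclidean_space \<Rightarrow> 'f \<Rightarrow> real)
      \<Rightarrow> real \<times> 'e \<times> 'f \<Rightarrow> real \<times> 'e \<times> 'f \<Rightarrow> real" where
  "warped_form a b1 c b2 = (\<lambda>(r, v1, v2) (s, w1, w2). r * s + a * b1 v1 w1 + c * b2 v2 w2)"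

lemma sum_inner_Basis:
  fixes f :: "'a::euclidean_space \<Rightarrow> real"
  assumes "j \<in> Basis" shows "(\<Sum>k\<in>Basis. (j \<bullet> k) * f k) = f j"
proof -
  have "(\<Sum>k\<in>Basis. (j \<bullet> k) * f k) = (\<Sum>k\<in>Basis. if k = j then f k else 0)"
    by (intro sum.cong) (auto simp: inner_Basis assms)
  then show ?thesis using assms by simp
qed

lemma inner_form_zero:
  assumes "inner_form b" shows "b 0 w = 0" "b v 0 = 0"
  using linear_0[OF inner_form_linear(2)[OF assms, of w]]
    linear_0[OF inner_form_linear(1)[OF assms, of v]] by simp_all

lemma inner_form_warped:
  assumes "inner_form b1" "inner_form b2" "a > 0" "c > 0"
  shows "inner_form (warped_form a b1 c b2)"
proof -
  have "linear (\<lambda>q. warped_form a b1 c b2 p q)" for p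
  proof (rule linearI)
    note lin = inner_form_linear(1)[OF assms(1), of "fst (snd p)"]
      inner_form_linear(1)[OF assms(2), of "snd (snd p)"]
    show "warped_form a b1 c b2 p (q + r) = warped_form a b1 c b2 p q + warped_form a b1 c b2 p r"
      for q r
      using linear_add[OF lin(1), of "fst (snd q)" "fst (snd r)"]
        linear_add[OF lin(2), of "snd (snd q)" "snd (snd r)"]
      by (simp add: warped_form_def case_prod_beta distrib_left)
    show "warped_form a b1 c b2 p (s *\<^sub>R q) = s *\<^sub>R warped_form a b1 c b2 p q" for s q
      using linear_scale[OF lin(1), of s "fst (snd q)"] linear_scale[OF lin(2), of s "snd (snd q)"]
      by (simp add: warped_form_def case_prod_beta distrib_left mult.left_commute)
  qed
  moreover have sym: "warped_form a b1 c b2 p q = warped_form a b1 c b2 q p" for p q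
    using assms(1,2) by (simp add: warped_form_def case_prod_beta inner_form_def)
  ultimately have "bilinear (warped_form a b1 c b2)"
    unfolding bilinear_def by simp
  moreover have "warped_form a b1 c b2 v v > 0" if "v \<noteq> 0" for v
  proof -
    obtain r x y where v: "v = (r, x, y)" by (cases v)
    have nn: "b1 x x \<ge> 0" "b2 y y \<ge> 0"
      using assms(1,2) inner_form_zero(1)[OF assms(1), of 0] inner_form_zero(1)[OF assms(2), of 0]
      by (cases "x = 0"; cases "y = 0"; simp add: inner_form_def less_imp_le)+
    have "r \<noteq> 0 \<or> x \<noteq> 0 \<or> y \<noteq> 0" using that v by (auto simp: zero_prod_def)
    then have "r * r > 0 \<or> a * b1 x x > 0 \<or> c * b2 y y > 0"
      using assms by (auto simp: inner_form_def zero_less_mult_iff)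
    moreover have "r * r \<ge> 0" "a * b1 x x \<ge> 0" "c * b2 y y \<ge> 0" using nn assms by auto
    ultimately have "r * r + a * b1 x x + c * b2 y y > 0" by linarith
    then show ?thesis by (simp add: v warped_form_def)
  qed
  ultimately show ?thesis using sym by (simp add: inner_form_def)
qed

lemma inv_form_warped:
  assumes b1: "inner_form b1" and b2: "inner_form b2" and pos: "a > 0" "c > 0"
  defines "G \<equiv> inv_form (warped_form a b1 c b2)"
  shows "G (1,0,0) (1,0,0) = 1"
    "i \<in> Basis \<Longrightarrow> G (1,0,0) (0,i,0) = 0" "i \<in> Basis \<Longrightarrow> G (0,i,0) (1,0,0) = 0"
    "j \<in> Basis \<Longrightarrow> G (1,0,0) (0,0,j) = 0" "j \<in> Basis \<Longrightarrow> G (0,0,j) (1,0,0) = 0"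
    "i \<in> Basis \<Longrightarrow> j \<in> Basis \<Longrightarrow> G (0,i,0) (0,0,j) = 0"
    "i \<in> Basis \<Longrightarrow> j \<in> Basis \<Longrightarrow> G (0,0,j) (0,i,0) = 0"
    "i \<in> Basis \<Longrightarrow> k \<in> Basis \<Longrightarrow> G (0,i,0) (0,k,0) = inv_form b1 i k / a"
    "j \<in> Basis \<Longrightarrow> l \<in> Basis \<Longrightarrow> G (0,0,j) (0,0,l) = inv_form b2 j l / c"
proof -
  \<comment> \<open>\<open>inv_form\<close> is determined on basis vectors only, whereas basis
    vectors of a product have zero components. The bilinear extensions \<open>E1\<close>,
    \<open>E2\<close> vanish on those, so a single formula \<open>H\<close> covers all
    blocks.\<close>
  define E1 where "E1 v w = (\<Sum>i\<in>Basis. (v \<bullet> i) * (\<Sum>j\<in>Basis. (w \<bullet> j) * inv_form b1 i j))" for v w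
  define E2 where "E2 v w = (\<Sum>i\<in>Basis. (v \<bullet> i) * (\<Sum>j\<in>Basis. (w \<bullet> j) * inv_form b2 i j))" for v w
  have E1: "E1 i j = inv_form b1 i j" if "i \<in> Basis" "j \<in> Basis" for i j
    unfolding E1_def sum_inner_Basis[OF that(1)] sum_inner_Basis[OF that(2)] ..
  have E2: "E2 i j = inv_form b2 i j" if "i \<in> Basis" "j \<in> Basis" for i j
    unfolding E2_def sum_inner_Basis[OF that(1)] sum_inner_Basis[OF that(2)] ..
  have E0: "E1 0 w = 0" "E1 v 0 = 0" "E2 0 w' = 0" "E2 v' 0 = 0" for v w v' w'
    by (simp_all add: E1_def E2_def)
  define a' where "a' = inverse a"
  define c' where "c' = inverse c"
  have a': "a * a' = 1" "c * c' = 1" using pos by (auto simp: a'_def c'_def)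
  define H where "H p q = fst p * fst q + a' * E1 (fst (snd p)) (fst (snd q))
     + c' * E2 (snd (snd p)) (snd (snd q))" for p q :: "real \<times> 'a \<times> 'b"
  have S1: "(\<Sum>j\<in>Basis. a * b1 i j * (a' * E1 j k)) = (if i = k then 1 else 0)"
    if "i \<in> Basis" "k \<in> Basis" for i k
  proof -
    have "(\<Sum>j\<in>Basis. a * b1 i j * (a' * E1 j k)) = (\<Sum>j\<in>Basis. b1 i j * inv_form b1 j k)"
    proof (rule sum.cong[OF refl])
      fix j :: 'a assume "j \<in> Basis"
      have "a * b1 i j * (a' * E1 j k) = (a * a') * (b1 i j * E1 j k)" by (simp only: mult_ac)
      then show "a * b1 i j * (a' * E1 j k) = b1 i j * inv_form b1 j k"
        using a' E1[OF \<open>j \<in> Basis\<close> that(2)] by simp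
    qed
    then show ?thesis using inv_form_right[OF b1 that] by simp
  qed
  have S2: "(\<Sum>j\<in>Basis. c * b2 i j * (c' * E2 j k)) = (if i = k then 1 else 0)"
    if "i \<in> Basis" "k \<in> Basis" for i k
  proof -
    have "(\<Sum>j\<in>Basis. c * b2 i j * (c' * E2 j k)) = (\<Sum>j\<in>Basis. b2 i j * inv_form b2 j k)"
    proof (rule sum.cong[OF refl])
      fix j :: 'b assume "j \<in> Basis"
      have "c * b2 i j * (c' * E2 j k) = (c * c') * (b2 i j * E2 j k)" by (simp only: mult_ac)
      then show "c * b2 i j * (c' * E2 j k) = b2 i j * inv_form b2 j k"
        using a' E2[OF \<open>j \<in> Basis\<close> that(2)] by simp
    qed
    then show ?thesis using inv_form_right[OF b2 that] by simp
  qed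
  have "G p q = H p q" if "p \<in> Basis" "q \<in> Basis" for p q
    unfolding G_def
  proof (rule inv_form_unique[OF inner_form_warped[OF assms(1-4)] that])
    fix p q :: "real \<times> 'a \<times> 'b" assume pq: "p \<in> Basis" "q \<in> Basis"
    have z: "b1 0 w = 0" "b1 v 0 = 0" "b2 0 w' = 0" "b2 v' 0 = 0" for v w v' w'
      using inner_form_zero[OF b1] inner_form_zero[OF b2] by auto
    have W: "warped_form a b1 c b2 (r, v, w) (s, v', w') = r * s + a * b1 v v' + c * b2 w w'"
      and H: "H (r, v, w) (s, v', w') = r * s + a' * E1 v v' + c' * E2 w w'" for r v w s v' w'
      by (simp_all add: warped_form_def H_def)
    show "(\<Sum>r\<in>Basis. warped_form a b1 c b2 p r * H r q) = (if p = q then 1 else 0)"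
      unfolding sum_Basis_triple
      by (rule Basis_triple_cases[OF pq(1)]; rule Basis_triple_cases[OF pq(2)])
        (simp_all add: W H E0 z S1 S2 nonzero_Basis)
  qed
  then show "G (1,0,0) (1,0,0) = 1"
    "i \<in> Basis \<Longrightarrow> G (1,0,0) (0,i,0) = 0" "i \<in> Basis \<Longrightarrow> G (0,i,0) (1,0,0) = 0"
    "j \<in> Basis \<Longrightarrow> G (1,0,0) (0,0,j) = 0" "j \<in> Basis \<Longrightarrow> G (0,0,j) (1,0,0) = 0"
    "i \<in> Basis \<Longrightarrow> j \<in> Basis \<Longrightarrow> G (0,i,0) (0,0,j) = 0"
    "i \<in> Basis \<Longrightarrow> j \<in> Basis \<Longrightarrow> G (0,0,j) (0,i,0) = 0"
    "i \<in> Basis \<Longrightarrow> k \<in> Basis \<Longrightarrow> G (0,i,0) (0,k,0) = inv_form b1 i k / a"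
    "j \<in> Basis \<Longrightarrow> l \<in> Basis \<Longrightarrow> G (0,0,j) (0,0,l) = inv_form b2 j l / c"
    by (simp_all add: H_def E0 E1 E2 a'_def c'_def divide_inverse_commute)
qed

text \<open>What the computations use of a chart; the charts of a Riemannian manifold and those of
  \<open>sphere_atlas\<close> both have it.\<close>

definition regular_chart :: "('a, 'e::euclidean_space) rchart \<Rightarrow> bool" where
  "regular_chart c \<longleftrightarrow> inj_on (cmap c) (cdom c) \<and> open (cran c) \<and>
     (\<forall>v w. smooth_on (cran c) (\<lambda>u. cmet c u v w)) \<and> (\<forall>u\<in>cran c. inner_form (cmet c u))"

text \<open>The common features of the charts of the line and of the circle, so that both bases are
  treated at once.\<close>

definition flat_chart :: "('s, real) rchart \<Rightarrow> bool" where
  "flat_chart b \<longleftrightarrow> inj_on (cmap b) (cdom b) \<and> open (cran b) \<and> cmet b = (\<lambda>t v w. v * w)"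

lemma cran_warped: "cran (warped_chart l1 l2 b c1 c2) = cran b \<times> cran c1 \<times> cran c2"
  by (force simp: cran_def warped_chart_def image_iff)

lemma cinv_warped:
  assumes "inj_on (cmap b) (cdom b)" "inj_on (cmap c1) (cdom c1)" "inj_on (cmap c2) (cdom c2)"
    and "t \<in> cran b" "x \<in> cran c1" "y \<in> cran c2"
  shows "cinv (warped_chart l1 l2 b c1 c2) (t, x, y) = (cinv b t, cinv c1 x, cinv c2 y)"
  unfolding cinv_def
proof (rule inv_into_f_eq)
  show "inj_on (cmap (warped_chart l1 l2 b c1 c2)) (cdom (warped_chart l1 l2 b c1 c2))"
    using assms(1-3) by (auto simp: inj_on_def warped_chart_def)
qed (use assms(4-6) in \<open>auto simp: warped_chart_def cran_def inv_into_into f_inv_into_f\<close>)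

lemma cmet_warped:
  assumes "flat_chart b"
  shows "cmet (warped_chart l1 l2 b c1 c2) (t, x, y)
    = warped_form ((l1 t)\<^sup>2) (cmet c1 x) ((l2 t)\<^sup>2) (cmet c2 y)"
  using assms by (auto simp: warped_chart_def warped_form_def fun_eq_iff flat_chart_def)

lemma pd_zero: "f differentiable (at u) \<Longrightarrow> pd 0 f u = 0"
  using linear_0[OF linear_pd] .

lemma pd_cmet_warped:
  fixes c1 :: "('a, 'e::euclidean_space) rchart" and c2 :: "('b, 'f::euclidean_space) rchart"
  assumes b: "flat_chart b" and c1: "regular_chart c1" and c2: "regular_chart c2"
    and l: "(l1 has_real_derivative l1') (at t)" "(l2 has_real_derivative l2') (at t)"
    and u: "x \<in> cran c1" "y \<in> cran c2"
  shows "pd (p0, p1, p2) (\<lambda>z. cmet (warped_chart l1 l2 b c1 c2) z (q0, q1, q2) (r0, r1, r2)) (t, x, y)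
    = p0 * (2 * l1 t * l1' * cmet c1 x q1 r1 + 2 * l2 t * l2' * cmet c2 y q2 r2)
      + (l1 t)\<^sup>2 * pd p1 (\<lambda>x. cmet c1 x q1 r1) x + (l2 t)\<^sup>2 * pd p2 (\<lambda>y. cmet c2 y q2 r2) y"
proof -
  let ?A = "\<lambda>x. cmet c1 x q1 r1" and ?B = "\<lambda>y. cmet c2 y q2 r2"
  have A: "(?A has_derivative (\<lambda>v. pd v ?A x)) (at x)"
    using c1 u(1) smooth_on_has_derivative unfolding regular_chart_def by blast
  have B: "(?B has_derivative (\<lambda>v. pd v ?B y)) (at y)"
    using c2 u(2) smooth_on_has_derivative unfolding regular_chart_def by blast
  have f1: "((\<lambda>z::real \<times> 'e \<times> 'f. fst (snd z)) has_derivative (\<lambda>z. fst (snd z))) (at z)"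
    and f2: "((\<lambda>z::real \<times> 'e \<times> 'f. snd (snd z)) has_derivative (\<lambda>z. snd (snd z))) (at z)"
    and f0: "((\<lambda>z::real \<times> 'e \<times> 'f. fst z) has_derivative (\<lambda>z. fst z)) (at z)" for z
    by (auto intro!: derivative_eq_intros)
  have A': "((\<lambda>z. ?A (fst (snd z))) has_derivative (\<lambda>v. pd (fst (snd v)) ?A x)) (at (t, x, y))"
    using has_derivative_compose[OF f1, of ?A "\<lambda>v. pd v ?A x" "(t, x, y)"] A by simp
  have B': "((\<lambda>z. ?B (snd (snd z))) has_derivative (\<lambda>v. pd (snd (snd v)) ?B y)) (at (t, x, y))"
    using has_derivative_compose[OF f2, of ?B "\<lambda>v. pd v ?B y" "(t, x, y)"] B by simp
  have L1: "((\<lambda>z. l1 (fst z)) has_derivative (\<lambda>v. l1' * fst v)) (at (t, x, y))"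
    using has_derivative_compose[OF f0, of l1 "\<lambda>h. l1' * h" "(t, x, y)"] l(1)
    by (simp add: has_field_derivative_def)
  have L2: "((\<lambda>z. l2 (fst z)) has_derivative (\<lambda>v. l2' * fst v)) (at (t, x, y))"
    using has_derivative_compose[OF f0, of l2 "\<lambda>h. l2' * h" "(t, x, y)"] l(2)
    by (simp add: has_field_derivative_def)
  have eq: "(\<lambda>z. cmet (warped_chart l1 l2 b c1 c2) z (q0, q1, q2) (r0, r1, r2))
    = (\<lambda>z. q0 * r0 + (l1 (fst z))\<^sup>2 * ?A (fst (snd z)) + (l2 (fst z))\<^sup>2 * ?B (snd (snd z)))"
    using cmet_warped[OF b, of l1 l2 c1 c2] by (auto simp: warped_form_def fun_eq_iff)
  have "((\<lambda>z. q0 * r0 + (l1 (fst z))\<^sup>2 * ?A (fst (snd z)) + (l2 (fst z))\<^sup>2 * ?B (snd (snd z)))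
    has_derivative (\<lambda>v. fst v * (2 * l1 t * l1' * ?A x + 2 * l2 t * l2' * ?B y)
      + (l1 t)\<^sup>2 * pd (fst (snd v)) ?A x + (l2 t)\<^sup>2 * pd (snd (snd v)) ?B y)) (at (t, x, y))"
    by (auto intro!: derivative_eq_intros L1 L2 A' B' simp: algebra_simps power2_eq_square)
  from pd_eqI[OF this, of "(p0, p1, p2)"] show ?thesis unfolding eq by simp
qed

section \<open>Christoffel symbols and Laplacian of a warped product\<close>

text \<open>The Christoffel symbols of the first kind, before the index is raised.\<close>

definition christoffel_low :: "('a, 'e::euclidean_space) rchart \<Rightarrow> 'e \<Rightarrow> 'e \<Rightarrow> 'e \<Rightarrow> 'e \<Rightarrow> real" where
  "christoffel_low c u i j l =
     (pd i (\<lambda>x. cmet c x j l) u + pd j (\<lambda>x. cmet c x i l) u - pd l (\<lambda>x. cmet c x i j) u) / 2"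

definition christoffel_trace :: "('a, 'e::euclidean_space) rchart \<Rightarrow> 'e \<Rightarrow> 'e \<Rightarrow> real" where
  "christoffel_trace c u l =
     (\<Sum>i\<in>Basis. \<Sum>j\<in>Basis. inv_form (cmet c u) i j * christoffel_low c u i j l)"

text \<open>The symbols are traced before the index is raised. In a warped product the traced
  covector splits into a base part and the covectors of the two factors, although single symbols mix
  base and fibre directions.\<close>

lemma laplacian_eq:
  "laplacian c h u =
     (\<Sum>i\<in>Basis. \<Sum>j\<in>Basis. inv_form (cmet c u) i j *\<^sub>R pd i (pd j h) u)
     - (\<Sum>k\<in>Basis. (\<Sum>l\<in>Basis. inv_form (cmet c u) k l * christoffel_trace c u l) *\<^sub>R pd k h u)"
proof -
  let ?g = "inv_form (cmet c u)" and ?G = "christoffel_low c u"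
  have chr: "christoffel c u i j k = (\<Sum>l\<in>Basis. ?g k l * ?G i j l)" for i j k
    by (simp add: christoffel_def christoffel_low_def sum_divide_distrib)
  have tr: "(\<Sum>i\<in>Basis. \<Sum>j\<in>Basis. ?g i j * christoffel c u i j k)
    = (\<Sum>l\<in>Basis. ?g k l * christoffel_trace c u l)" for k
  proof -
    have "(\<Sum>i\<in>Basis. \<Sum>j\<in>Basis. ?g i j * christoffel c u i j k)
      = (\<Sum>i\<in>Basis. \<Sum>j\<in>Basis. \<Sum>l\<in>Basis. ?g k l * (?g i j * ?G i j l))"
      by (simp add: chr sum_distrib_left mult.left_commute)
    also have "\<dots> = (\<Sum>l\<in>Basis. \<Sum>i\<in>Basis. \<Sum>j\<in>Basis. ?g k l * (?g i j * ?G i j l))"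
      by (rule sum_swap3)
    finally show ?thesis by (simp add: christoffel_trace_def sum_distrib_left)
  qed
  have "(\<Sum>i\<in>Basis. \<Sum>j\<in>Basis. ?g i j *\<^sub>R (\<Sum>k\<in>Basis. christoffel c u i j k *\<^sub>R pd k h u))
    = (\<Sum>i\<in>Basis. \<Sum>j\<in>Basis. \<Sum>k\<in>Basis. (?g i j * christoffel c u i j k) *\<^sub>R pd k h u)"
    by (simp add: scaleR_sum_right)
  also have "\<dots> = (\<Sum>k\<in>Basis. \<Sum>i\<in>Basis. \<Sum>j\<in>Basis. (?g i j * christoffel c u i j k) *\<^sub>R pd k h u)"
    by (rule sum_swap3)
  also have "\<dots> = (\<Sum>k\<in>Basis. (\<Sum>l\<in>Basis. ?g k l * christoffel_trace c u l) *\<^sub>R pd k h u)"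
    by (simp only: scaleR_sum_left[symmetric] tr)
  finally show ?thesis
    by (simp add: laplacian_def scaleR_diff_right sum_subtractf)
qed

context
  fixes b :: "('s, real) rchart" and c1 :: "('a, 'e::euclidean_space) rchart"
    and c2 :: "('b, 'f::euclidean_space) rchart" and l1 l2 :: "real \<Rightarrow> real" and l1' l2' t :: real
    and x :: 'e and y :: 'f
  assumes b: "flat_chart b" and c1: "regular_chart c1" and c2: "regular_chart c2"
    and l: "(l1 has_real_derivative l1') (at t)" "(l2 has_real_derivative l2') (at t)"
      "l1 t > 0" "l2 t > 0"
    and u: "x \<in> cran c1" "y \<in> cran c2"
begin

lemma form1: "inner_form (cmet c1 x)" and form2: "inner_form (cmet c2 y)"
  using c1 c2 u by (auto simp: regular_chart_def)

lemma cmet_zero1: "cmet c1 x 0 w = 0" "cmet c1 x v 0 = 0"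
  and cmet_zero2: "cmet c2 y 0 w' = 0" "cmet c2 y v' 0 = 0"
  using inner_form_zero[OF form1] inner_form_zero[OF form2] by auto

lemma pd_cmet_zero:
  "pd i (\<lambda>x. cmet c1 x 0 w) x = 0" "pd i (\<lambda>x. cmet c1 x v 0) x = 0"
  "pd j (\<lambda>y. cmet c2 y 0 w') y = 0" "pd j (\<lambda>y. cmet c2 y v' 0) y = 0"
proof -
  have o: "open (cran c1)" "open (cran c2)" using c1 c2 by (auto simp: regular_chart_def)
  have z: "pd i (\<lambda>x. 0) z = (0::real)" for i z :: "'z::euclidean_space"
    by (rule pd_eqI[THEN trans]) auto
  have 1: "cmet c1 z 0 w = 0" "cmet c1 z v 0 = 0" if "z \<in> cran c1" for z
    using that c1 inner_form_zero[of "cmet c1 z"] by (auto simp: regular_chart_def)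
  have 2: "cmet c2 z 0 w' = 0" "cmet c2 z v' 0 = 0" if "z \<in> cran c2" for z
    using that c2 inner_form_zero[of "cmet c2 z"] by (auto simp: regular_chart_def)
  show "pd i (\<lambda>x. cmet c1 x 0 w) x = 0" "pd i (\<lambda>x. cmet c1 x v 0) x = 0"
    using pd_cong_open[OF o(1) u(1), of "\<lambda>x. cmet c1 x 0 w" "\<lambda>x. 0" i]
      pd_cong_open[OF o(1) u(1), of "\<lambda>x. cmet c1 x v 0" "\<lambda>x. 0" i] 1 z by simp_all
  show "pd j (\<lambda>y. cmet c2 y 0 w') y = 0" "pd j (\<lambda>y. cmet c2 y v' 0) y = 0"
    using pd_cong_open[OF o(2) u(2), of "\<lambda>y. cmet c2 y 0 w'" "\<lambda>x. 0" j]
      pd_cong_open[OF o(2) u(2), of "\<lambda>y. cmet c2 y v' 0" "\<lambda>x. 0" j] 2 z by simp_all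
qed

lemma pd_zero_cmet: "pd 0 (\<lambda>x. cmet c1 x v w) x = 0" "pd 0 (\<lambda>y. cmet c2 y v' w') y = 0"
  using c1 c2 u smooth_onD(1) unfolding regular_chart_def by (blast intro: pd_zero)+

lemma warp_pos: "(l1 t)\<^sup>2 > 0" "(l2 t)\<^sup>2 > 0"
  using l by simp_all

lemma inv_form_cmet: "inv_form (cmet (warped_chart l1 l2 b c1 c2) (t, x, y))
    = inv_form (warped_form ((l1 t)\<^sup>2) (cmet c1 x) ((l2 t)\<^sup>2) (cmet c2 y))"
  by (simp add: cmet_warped[OF b])

lemmas inv_form_C = inv_form_warped[OF form1 form2 warp_pos, folded inv_form_cmet]

text \<open>In the base direction only the term with minus half the \<open>t\<close>-derivative of
  the metric survives, and its trace over a fibre is minus the fibre dimension times l'/l. In a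
  fibre direction the square of the warp cancels against the inverse metric.\<close>

lemma christoffel_trace_warped:
  "christoffel_trace (warped_chart l1 l2 b c1 c2) (t, x, y) (1, 0, 0) = - (DIM('e) * l1' / l1 t + DIM('f) * l2' / l2 t)"
  "k \<in> Basis \<Longrightarrow> christoffel_trace (warped_chart l1 l2 b c1 c2) (t, x, y) (0, k, 0) = christoffel_trace c1 x k"
  "k' \<in> Basis \<Longrightarrow> christoffel_trace (warped_chart l1 l2 b c1 c2) (t, x, y) (0, 0, k') = christoffel_trace c2 y k'"
proof -
  have nz: "l1 t \<noteq> 0" "l2 t \<noteq> 0" using l by auto
  note S = christoffel_trace_def sum_Basis_triple inv_form_C christoffel_low_def
    pd_cmet_warped[OF b c1 c2 l(1,2) u] pd_cmet_zero pd_zero_cmet cmet_zero1 cmet_zero2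
  have 1: "(\<Sum>i\<in>Basis. \<Sum>j\<in>Basis. - (inv_form (cmet c1 x) i j * (l1 t * (l1' * cmet c1 x i j)) / (l1 t)\<^sup>2))
    = - (DIM('e) * l1' / l1 t)"
  proof -
    have "- (inv_form (cmet c1 x) i j * (l1 t * (l1' * cmet c1 x i j)) / (l1 t)\<^sup>2)
      = - (l1' / l1 t) * (inv_form (cmet c1 x) i j * cmet c1 x i j)" for i j
      using nz by (simp add: power2_eq_square)
    then have "(\<Sum>i\<in>Basis. \<Sum>j\<in>Basis. - (inv_form (cmet c1 x) i j * (l1 t * (l1' * cmet c1 x i j)) / (l1 t)\<^sup>2))
      = - (l1' / l1 t) * (\<Sum>i\<in>Basis. \<Sum>j\<in>Basis. inv_form (cmet c1 x) i j * cmet c1 x i j)"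
      by (simp only: sum_distrib_left)
    then show ?thesis using inv_form_trace[OF form1] by simp
  qed
  have 2: "(\<Sum>i\<in>Basis. \<Sum>j\<in>Basis. - (inv_form (cmet c2 y) i j * (l2 t * (l2' * cmet c2 y i j)) / (l2 t)\<^sup>2))
    = - (DIM('f) * l2' / l2 t)"
  proof -
    have "- (inv_form (cmet c2 y) i j * (l2 t * (l2' * cmet c2 y i j)) / (l2 t)\<^sup>2)
      = - (l2' / l2 t) * (inv_form (cmet c2 y) i j * cmet c2 y i j)" for i j
      using nz by (simp add: power2_eq_square)
    then have "(\<Sum>i\<in>Basis. \<Sum>j\<in>Basis. - (inv_form (cmet c2 y) i j * (l2 t * (l2' * cmet c2 y i j)) / (l2 t)\<^sup>2))
      = - (l2' / l2 t) * (\<Sum>i\<in>Basis. \<Sum>j\<in>Basis. inv_form (cmet c2 y) i j * cmet c2 y i j)"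
      by (simp only: sum_distrib_left)
    then show ?thesis using inv_form_trace[OF form2] by simp
  qed
  show "christoffel_trace (warped_chart l1 l2 b c1 c2) (t, x, y) (1, 0, 0) = - (DIM('e) * l1' / l1 t + DIM('f) * l2' / l2 t)"
    using 1 2 by (simp add: S)
  show "christoffel_trace (warped_chart l1 l2 b c1 c2) (t, x, y) (0, k, 0) = christoffel_trace c1 x k" if "k \<in> Basis"
    using that nz
    by (simp add: S sum_divide_distrib[symmetric] distrib_left[symmetric] right_diff_distrib[symmetric])
  show "christoffel_trace (warped_chart l1 l2 b c1 c2) (t, x, y) (0, 0, k') = christoffel_trace c2 y k'" if "k' \<in> Basis"
    using that nz
    by (simp add: S sum_divide_distrib[symmetric] distrib_left[symmetric] right_diff_distrib[symmetric])
qed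

lemma laplacian_warped:
  fixes h :: "real \<times> 'e \<times> 'f \<Rightarrow> 'v::real_inner"
  shows "laplacian (warped_chart l1 l2 b c1 c2) h (t, x, y) =
    pd (1,0,0) (pd (1,0,0) h) (t, x, y)
    + (DIM('e) * l1' / l1 t + DIM('f) * l2' / l2 t) *\<^sub>R pd (1,0,0) h (t, x, y)
    + (1 / (l1 t)\<^sup>2) *\<^sub>R
      ((\<Sum>i\<in>Basis. \<Sum>j\<in>Basis. inv_form (cmet c1 x) i j *\<^sub>R pd (0,i,0) (pd (0,j,0) h) (t, x, y))
       - (\<Sum>k\<in>Basis. (\<Sum>l\<in>Basis. inv_form (cmet c1 x) k l * christoffel_trace c1 x l) *\<^sub>R pd (0,k,0) h (t, x, y)))
    + (1 / (l2 t)\<^sup>2) *\<^sub>R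
      ((\<Sum>i\<in>Basis. \<Sum>j\<in>Basis. inv_form (cmet c2 y) i j *\<^sub>R pd (0,0,i) (pd (0,0,j) h) (t, x, y))
       - (\<Sum>k\<in>Basis. (\<Sum>l\<in>Basis. inv_form (cmet c2 y) k l * christoffel_trace c2 y l) *\<^sub>R pd (0,0,k) h (t, x, y)))"
  unfolding laplacian_eq[of "warped_chart l1 l2 b c1 c2"] sum_Basis_triple
  by (simp add: inv_form_C christoffel_trace_warped scaleR_diff_right scaleR_sum_right sum_divide_distrib
    scaleR_diff_left scaleR_add_left)

lemma diff_norm_sq_warped:
  fixes h :: "real \<times> 'e \<times> 'f \<Rightarrow> 'v::real_inner"
  shows "diff_norm_sq (warped_chart l1 l2 b c1 c2) h (t, x, y) = (norm (pd (1,0,0) h (t, x, y)))\<^sup>2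
    + (\<Sum>i\<in>Basis. \<Sum>j\<in>Basis. inv_form (cmet c1 x) i j
        * (pd (0,i,0) h (t, x, y) \<bullet> pd (0,j,0) h (t, x, y))) / (l1 t)\<^sup>2
    + (\<Sum>i\<in>Basis. \<Sum>j\<in>Basis. inv_form (cmet c2 y) i j
        * (pd (0,0,i) h (t, x, y) \<bullet> pd (0,0,j) h (t, x, y))) / (l2 t)\<^sup>2"
  unfolding diff_norm_sq_def sum_Basis_triple
  by (simp add: inv_form_C sum_divide_distrib power2_norm_eq_inner)

end

section \<open>Joins of eigenmaps\<close>

text \<open>The common frame for complex scalars acting on \<open>\<complex>\<^sup>n\<close> and real scalars acting on \<open>\<real>\<^sup>n\<close>.\<close>

definition norm_mult_bilinear :: "('z::euclidean_space \<Rightarrow> 'v::euclidean_space \<Rightarrow> 'v) \<Rightarrow> bool" where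
  "norm_mult_bilinear B \<longleftrightarrow> bounded_bilinear B \<and> (\<forall>z v. norm (B z v) = norm z * norm v)"

lemma norm_mult_bilinear_scaleR: "norm_mult_bilinear (scaleR :: real \<Rightarrow> 'v::euclidean_space \<Rightarrow> 'v)"
  by (simp add: norm_mult_bilinear_def bounded_bilinear_scaleR)

lemma norm_vector_scalar_mult: "norm (z *s v) = norm z * norm (v :: complex^'n)"
  by (simp add: norm_vec_def norm_mult L2_set_right_distrib)

lemma norm_mult_bilinear_vector_scalar_mult:
  "norm_mult_bilinear ((*s) :: complex \<Rightarrow> complex^'n \<Rightarrow> complex^'n)"
proof -
  have "bounded_bilinear ((*s) :: complex \<Rightarrow> complex^'n \<Rightarrow> complex^'n)"
  proof (rule bounded_bilinear.intro)
    show "\<exists>K. \<forall>a b. norm (a *s b) \<le> norm a * norm (b :: complex^'n) * K"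
      by (auto simp: norm_vector_scalar_mult intro!: exI[of _ 1])
    show "(r *\<^sub>R z) *s v = r *\<^sub>R (z *s v)" "z *s (r *\<^sub>R v) = r *\<^sub>R (z *s v)"
      for r z and v :: "complex^'n"
      unfolding Finite_Cartesian_Product.vec_eq_iff by simp_all
  qed (simp_all add: Finite_Cartesian_Product.vec_eq_iff distrib_left distrib_right)
  then show ?thesis by (simp add: norm_mult_bilinear_def norm_vector_scalar_mult)
qed

lemma inner_from_norm: "(v::'a::real_inner) \<bullet> w = ((norm (v + w))\<^sup>2 - (norm v)\<^sup>2 - (norm w)\<^sup>2) / 2"
  by (simp add: power2_norm_eq_inner inner_add_left inner_add_right inner_commute)

text \<open>Polarisation of |B z v| = |z| |v| in one argument at a time.\<close>

lemma norm_mult_bilinear_inner: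
  assumes "norm_mult_bilinear B"
  shows "B z v \<bullet> B z w = (norm z)\<^sup>2 * (v \<bullet> w)" "B z v \<bullet> B z' v = (z \<bullet> z') * (norm v)\<^sup>2"
proof -
  interpret bounded_bilinear B using assms by (simp add: norm_mult_bilinear_def)
  have n: "norm (B z v) = norm z * norm v" for z v using assms by (simp add: norm_mult_bilinear_def)
  show "B z v \<bullet> B z w = (norm z)\<^sup>2 * (v \<bullet> w)"
    unfolding inner_from_norm[of "B z v"] add_right[symmetric] n inner_from_norm[of v w]
    by (simp add: power_mult_distrib algebra_simps)
  show "B z v \<bullet> B z' v = (z \<bullet> z') * (norm v)\<^sup>2"
    unfolding inner_from_norm[of "B z v"] add_left[symmetric] n inner_from_norm[of z z']
    by (simp add: power_mult_distrib algebra_simps)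
qed

text \<open>With this the unit vectors \<open>f1 x\<close> and \<open>f2 y\<close> are removed from
  the harmonic map equation, which leaves an equation for the profile alone.\<close>

lemma norm_mult_bilinear_cancel:
  assumes "norm_mult_bilinear B" "norm v = 1"
  shows "B z v = B z' v \<longleftrightarrow> z = z'"
proof -
  interpret bounded_bilinear B using assms by (simp add: norm_mult_bilinear_def)
  have "norm (B (z - z') v) = norm (z - z')" using assms by (simp add: norm_mult_bilinear_def)
  then show ?thesis unfolding diff_left by (metis eq_iff_diff_eq_0 norm_eq_zero)
qed

text \<open>The scalars and the inputs are arbitrary functions here, so the partial derivatives of a
  join are joins again and the second derivatives follow from the formulas for the first.\<close>

definition scalar_join ::
    "('z \<Rightarrow> 'v \<Rightarrow> 'v) \<Rightarrow> ('z \<Rightarrow> 'w \<Rightarrow> 'w) \<Rightarrow> (real \<Rightarrow> 'z) \<Rightarrow> (real \<Rightarrow> 'z) \<Rightarrow> ('a \<Rightarrow> 'v) \<Rightarrow> ('b \<Rightarrow> 'w)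
      \<Rightarrow> real \<times> 'a \<times> 'b \<Rightarrow> 'v \<times> 'w" where
  "scalar_join B1 B2 z1 z2 f1 f2 = (\<lambda>(t, x, y). (B1 (z1 t) (f1 x), B2 (z2 t) (f2 y)))"

lemma scalar_join_apply: "scalar_join B1 B2 z1 z2 f1 f2 (t, x, y) = (B1 (z1 t) (f1 x), B2 (z2 t) (f2 y))"
  by (simp add: scalar_join_def)

lemma pd_join:
  fixes \<phi>1 :: "'e::euclidean_space \<Rightarrow> 'v::euclidean_space" and \<phi>2 :: "'f::euclidean_space \<Rightarrow> 'w::euclidean_space"
    and z1 z2 :: "real \<Rightarrow> 'z::euclidean_space"
  assumes B1: "norm_mult_bilinear B1" and B2: "norm_mult_bilinear B2"
    and z: "(z1 has_vector_derivative z1') (at t)" "(z2 has_vector_derivative z2') (at t)"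
    and \<phi>: "\<phi>1 differentiable (at x)" "\<phi>2 differentiable (at y)"
  shows "pd (r, v, w) (scalar_join B1 B2 z1 z2 \<phi>1 \<phi>2) (t, x, y)
    = (r *\<^sub>R B1 z1' (\<phi>1 x) + B1 (z1 t) (pd v \<phi>1 x), r *\<^sub>R B2 z2' (\<phi>2 y) + B2 (z2 t) (pd w \<phi>2 y))"
proof -
  interpret B1: bounded_bilinear B1 using B1 by (simp add: norm_mult_bilinear_def)
  interpret B2: bounded_bilinear B2 using B2 by (simp add: norm_mult_bilinear_def)
  have f1: "((\<lambda>z::real \<times> 'e \<times> 'f. fst (snd z)) has_derivative (\<lambda>z. fst (snd z))) (at z)"
    and f2: "((\<lambda>z::real \<times> 'e \<times> 'f. snd (snd z)) has_derivative (\<lambda>z. snd (snd z))) (at z)"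
    and f0: "((\<lambda>z::real \<times> 'e \<times> 'f. fst z) has_derivative (\<lambda>z. fst z)) (at z)" for z
    by (auto intro!: derivative_eq_intros)
  have p1: "((\<lambda>z. \<phi>1 (fst (snd z))) has_derivative (\<lambda>v. pd (fst (snd v)) \<phi>1 x)) (at (t, x, y))"
    using has_derivative_compose[OF f1, of \<phi>1 "\<lambda>v. pd v \<phi>1 x" "(t, x, y)"] has_derivative_pd[OF \<phi>(1)]
    by simp
  have p2: "((\<lambda>z. \<phi>2 (snd (snd z))) has_derivative (\<lambda>v. pd (snd (snd v)) \<phi>2 y)) (at (t, x, y))"
    using has_derivative_compose[OF f2, of \<phi>2 "\<lambda>v. pd v \<phi>2 y" "(t, x, y)"] has_derivative_pd[OF \<phi>(2)]
    by simp
  have q1: "((\<lambda>z. z1 (fst z)) has_derivative (\<lambda>v. fst v *\<^sub>R z1')) (at (t, x, y))"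
    using has_derivative_compose[OF f0, of z1 "\<lambda>h. h *\<^sub>R z1'" "(t, x, y)"] z(1)
    by (simp add: has_vector_derivative_def)
  have q2: "((\<lambda>z. z2 (fst z)) has_derivative (\<lambda>v. fst v *\<^sub>R z2')) (at (t, x, y))"
    using has_derivative_compose[OF f0, of z2 "\<lambda>h. h *\<^sub>R z2'" "(t, x, y)"] z(2)
    by (simp add: has_vector_derivative_def)
  have "((\<lambda>z. (B1 (z1 (fst z)) (\<phi>1 (fst (snd z))), B2 (z2 (fst z)) (\<phi>2 (snd (snd z)))))
    has_derivative (\<lambda>v. (B1 (z1 t) (pd (fst (snd v)) \<phi>1 x) + B1 (fst v *\<^sub>R z1') (\<phi>1 x),
      B2 (z2 t) (pd (snd (snd v)) \<phi>2 y) + B2 (fst v *\<^sub>R z2') (\<phi>2 y)))) (at (t, x, y))"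
    using has_derivative_Pair[OF B1.FDERIV[OF q1 p1] B2.FDERIV[OF q2 p2]] by simp
  from pd_eqI[OF this, of "(r, v, w)"] show ?thesis
    by (simp add: scalar_join_def case_prod_unfold B1.scaleR_left B2.scaleR_left add.commute)
qed

context
  fixes B1 :: "'z::euclidean_space \<Rightarrow> 'v::euclidean_space \<Rightarrow> 'v" and B2 :: "'z \<Rightarrow> 'w::euclidean_space \<Rightarrow> 'w"
    and \<phi>1 :: "'e::euclidean_space \<Rightarrow> 'v" and \<phi>2 :: "'f::euclidean_space \<Rightarrow> 'w"
    and z1 z2 :: "real \<Rightarrow> 'z" and J U1 U2
  assumes B: "norm_mult_bilinear B1" "norm_mult_bilinear B2"
    and o: "open J" "open U1" "open U2"
    and sz: "smooth_on J z1" "smooth_on J z2"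
    and s\<phi>: "smooth_on U1 \<phi>1" "smooth_on U2 \<phi>2"
begin

lemma pd_join_simps:
  assumes "t \<in> J" "x \<in> U1" "y \<in> U2"
  shows "pd (1,0,0) (scalar_join B1 B2 z1 z2 \<phi>1 \<phi>2) (t,x,y)
      = scalar_join B1 B2 (pd 1 z1) (pd 1 z2) \<phi>1 \<phi>2 (t,x,y)"
    and "pd (0,i,0) (scalar_join B1 B2 z1 z2 \<phi>1 \<phi>2) (t,x,y) = scalar_join B1 B2 z1 (\<lambda>_. 0) (pd i \<phi>1) \<phi>2 (t,x,y)"
    and "pd (0,0,j) (scalar_join B1 B2 z1 z2 \<phi>1 \<phi>2) (t,x,y) = scalar_join B1 B2 (\<lambda>_. 0) z2 \<phi>1 (pd j \<phi>2) (t,x,y)"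
proof -
  interpret B1: bounded_bilinear B1 using B by (simp add: norm_mult_bilinear_def)
  interpret B2: bounded_bilinear B2 using B by (simp add: norm_mult_bilinear_def)
  have z: "(z1 has_vector_derivative pd 1 z1 t) (at t)" "(z2 has_vector_derivative pd 1 z2 t) (at t)"
    using smooth_on_vector_derivative(1,3)[OF o(1) sz(1) assms(1)]
      smooth_on_vector_derivative(1,3)[OF o(1) sz(2) assms(1)] by auto
  note d = smooth_onD(1)[OF s\<phi>(1) assms(2)] smooth_onD(1)[OF s\<phi>(2) assms(3)]
  note P = pd_join[OF B z d]
  show "pd (1,0,0) (scalar_join B1 B2 z1 z2 \<phi>1 \<phi>2) (t,x,y)
      = scalar_join B1 B2 (pd 1 z1) (pd 1 z2) \<phi>1 \<phi>2 (t,x,y)"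
    "pd (0,i,0) (scalar_join B1 B2 z1 z2 \<phi>1 \<phi>2) (t,x,y) = scalar_join B1 B2 z1 (\<lambda>_. 0) (pd i \<phi>1) \<phi>2 (t,x,y)"
    "pd (0,0,j) (scalar_join B1 B2 z1 z2 \<phi>1 \<phi>2) (t,x,y) = scalar_join B1 B2 (\<lambda>_. 0) z2 \<phi>1 (pd j \<phi>2) (t,x,y)"
    by (simp_all add: P pd_zero[OF d(1)] pd_zero[OF d(2)] B1.zero_right B2.zero_right
        B1.zero_left B2.zero_left scalar_join_apply)
qed

lemma smooth_on_join: "smooth_on (J \<times> U1 \<times> U2) (scalar_join B1 B2 z1 z2 \<phi>1 \<phi>2)"
proof -
  have O: "open (J \<times> U1 \<times> U2)" using o by (simp add: open_Times)
  have bb: "bounded_bilinear B1" "bounded_bilinear B2" using B by (auto simp: norm_mult_bilinear_def)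
  have p: "smooth_on (J \<times> U1 \<times> U2) (\<lambda>z. fst z)" "smooth_on (J \<times> U1 \<times> U2) (\<lambda>z. fst (snd z))"
    "smooth_on (J \<times> U1 \<times> U2) (\<lambda>z. snd (snd z))"
    by (intro smooth_on_fst smooth_on_snd O smooth_on_ident)+
  have "smooth_on (J \<times> U1 \<times> U2) (\<lambda>z. (B1 (z1 (fst z)) (\<phi>1 (fst (snd z))), B2 (z2 (fst z)) (\<phi>2 (snd (snd z)))))"
    by (intro smooth_on_Pair O smooth_on_bounded_bilinear[OF bb(1)] smooth_on_bounded_bilinear[OF bb(2)]
       smooth_on_compose[OF sz(1) p(1) O] smooth_on_compose[OF sz(2) p(1) O]
       smooth_on_compose[OF s\<phi>(1) p(2) O] smooth_on_compose[OF s\<phi>(2) p(3) O]) auto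
  then show ?thesis by (simp add: scalar_join_def case_prod_unfold)
qed

end

lemma laplacian_join:
  fixes B1 :: "'z::euclidean_space \<Rightarrow> 'v::euclidean_space \<Rightarrow> 'v" and B2 :: "'z \<Rightarrow> 'w::euclidean_space \<Rightarrow> 'w"
    and \<phi>1 :: "'e::euclidean_space \<Rightarrow> 'v" and \<phi>2 :: "'f::euclidean_space \<Rightarrow> 'w"
    and c1 :: "('a, 'e) rchart" and c2 :: "('b, 'f) rchart" and z1 z2 :: "real \<Rightarrow> 'z"
    and l1' l2' :: real
  assumes B: "norm_mult_bilinear B1" "norm_mult_bilinear B2"
    and b: "flat_chart b" and c: "regular_chart c1" "regular_chart c2"
    and l: "(l1 has_real_derivative l1') (at t)" "(l2 has_real_derivative l2') (at t)"
      "l1 t > 0" "l2 t > 0"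
    and sz: "open J" "smooth_on J z1" "smooth_on J z2"
    and s\<phi>: "smooth_on (cran c1) \<phi>1" "smooth_on (cran c2) \<phi>2"
    and u: "t \<in> J" "x \<in> cran c1" "y \<in> cran c2"
  defines "\<mu> \<equiv> DIM('e) * l1' / l1 t + DIM('f) * l2' / l2 t"
  shows "laplacian (warped_chart l1 l2 b c1 c2) (scalar_join B1 B2 z1 z2 \<phi>1 \<phi>2) (t, x, y) =
      (B1 (pd 1 (pd 1 z1) t + \<mu> *\<^sub>R pd 1 z1 t) (\<phi>1 x) + (1 / (l1 t)\<^sup>2) *\<^sub>R B1 (z1 t) (laplacian c1 \<phi>1 x),
       B2 (pd 1 (pd 1 z2) t + \<mu> *\<^sub>R pd 1 z2 t) (\<phi>2 y) + (1 / (l2 t)\<^sup>2) *\<^sub>R B2 (z2 t) (laplacian c2 \<phi>2 y))"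
    and "diff_norm_sq (warped_chart l1 l2 b c1 c2) (scalar_join B1 B2 z1 z2 \<phi>1 \<phi>2) (t, x, y) =
      (norm (pd 1 z1 t))\<^sup>2 * (norm (\<phi>1 x))\<^sup>2 + (norm (pd 1 z2 t))\<^sup>2 * (norm (\<phi>2 y))\<^sup>2
      + (norm (z1 t))\<^sup>2 * diff_norm_sq c1 \<phi>1 x / (l1 t)\<^sup>2 + (norm (z2 t))\<^sup>2 * diff_norm_sq c2 \<phi>2 y / (l2 t)\<^sup>2"
proof -
  interpret B1: bounded_bilinear B1 using B by (simp add: norm_mult_bilinear_def)
  interpret B2: bounded_bilinear B2 using B by (simp add: norm_mult_bilinear_def)
  have o: "open (cran c1)" "open (cran c2)" using c by (auto simp: regular_chart_def)
  let ?S = "J \<times> cran c1 \<times> cran c2" and ?h = "scalar_join B1 B2 z1 z2 \<phi>1 \<phi>2"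
  have S: "open ?S" "(t, x, y) \<in> ?S" using o sz u by (auto intro: open_Times)
  note sz' = smooth_onD(2)[OF sz(2), of 1, simplified] smooth_onD(2)[OF sz(3), of 1, simplified]
  note D = pd_join_simps[OF B sz(1) o sz(2,3) s\<phi>]
  have tt: "pd (1,0,0) (pd (1,0,0) ?h) (t, x, y) = scalar_join B1 B2 (pd 1 (pd 1 z1)) (pd 1 (pd 1 z2)) \<phi>1 \<phi>2 (t, x, y)"
    using pd_cong_open[OF S, of "pd (1,0,0) ?h" "scalar_join B1 B2 (pd 1 z1) (pd 1 z2) \<phi>1 \<phi>2" "(1,0,0)"]
      D(1) pd_join_simps(1)[OF B sz(1) o sz' s\<phi> u] by auto
  have xx: "pd (0,i,0) (pd (0,j,0) ?h) (t, x, y) = scalar_join B1 B2 z1 (\<lambda>_. 0) (pd i (pd j \<phi>1)) \<phi>2 (t, x, y)"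
    if "i \<in> Basis" "j \<in> Basis" for i j
    using pd_cong_open[OF S, of "pd (0,j,0) ?h" "scalar_join B1 B2 z1 (\<lambda>_. 0) (pd j \<phi>1) \<phi>2" "(0,i,0)"]
      D(2) pd_join_simps(2)[OF B sz(1) o sz(2) smooth_on_const smooth_onD(2)[OF s\<phi>(1) that(2)] s\<phi>(2) u]
    by auto
  have yy: "pd (0,0,i) (pd (0,0,j) ?h) (t, x, y) = scalar_join B1 B2 (\<lambda>_. 0) z2 \<phi>1 (pd i (pd j \<phi>2)) (t, x, y)"
    if "i \<in> Basis" "j \<in> Basis" for i j
    using pd_cong_open[OF S, of "pd (0,0,j) ?h" "scalar_join B1 B2 (\<lambda>_. 0) z2 \<phi>1 (pd j \<phi>2)" "(0,0,i)"]
      D(3) pd_join_simps(3)[OF B sz(1) o smooth_on_const sz(3) s\<phi>(1) smooth_onD(2)[OF s\<phi>(2) that(2)] u]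
    by auto
  note D' = D[OF u]
  \<comment> \<open>In fibre directions all derivatives of the join are images, under one of two
    fixed linear maps, of derivatives of an input, so the Laplacian of the factor can be pulled
    through.\<close>
  define L1 where "L1 v = (B1 (z1 t) v, 0::'w)" for v
  define L2 where "L2 v = (0::'v, B2 (z2 t) v)" for v
  have L1: "linear L1" and L2: "linear L2"
    by (auto intro!: linearI simp: L1_def L2_def B1.add_right B2.add_right B1.scaleR_right B2.scaleR_right)
  have J1: "scalar_join B1 B2 z1 (\<lambda>_. 0) \<psi> \<phi>2 (t, x, y) = L1 (\<psi> x)" for \<psi>
    by (simp add: scalar_join_def L1_def B2.zero_left)
  have J2: "scalar_join B1 B2 (\<lambda>_. 0) z2 \<phi>1 \<psi> (t, x, y) = L2 (\<psi> y)" for \<psi>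
    by (simp add: scalar_join_def L2_def B1.zero_left)
  have 1: "(\<Sum>i\<in>Basis. \<Sum>j\<in>Basis. inv_form (cmet c1 x) i j *\<^sub>R pd (0,i,0) (pd (0,j,0) ?h) (t, x, y))
     - (\<Sum>k\<in>Basis. (\<Sum>l\<in>Basis. inv_form (cmet c1 x) k l * christoffel_trace c1 x l) *\<^sub>R pd (0,k,0) ?h (t, x, y))
     = L1 (laplacian c1 \<phi>1 x)"
    unfolding laplacian_eq[of c1] linear_diff[OF L1] linear_sum[OF L1] linear_scale[OF L1] D' J1
    by (simp add: xx J1)
  have 2: "(\<Sum>i\<in>Basis. \<Sum>j\<in>Basis. inv_form (cmet c2 y) i j *\<^sub>R pd (0,0,i) (pd (0,0,j) ?h) (t, x, y))
     - (\<Sum>k\<in>Basis. (\<Sum>l\<in>Basis. inv_form (cmet c2 y) k l * christoffel_trace c2 y l) *\<^sub>R pd (0,0,k) ?h (t, x, y))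
     = L2 (laplacian c2 \<phi>2 y)"
    unfolding laplacian_eq[of c2] linear_diff[OF L2] linear_sum[OF L2] linear_scale[OF L2] D' J2
    by (simp add: yy J2)
  show "laplacian (warped_chart l1 l2 b c1 c2) ?h (t, x, y) =
      (B1 (pd 1 (pd 1 z1) t + \<mu> *\<^sub>R pd 1 z1 t) (\<phi>1 x) + (1 / (l1 t)\<^sup>2) *\<^sub>R B1 (z1 t) (laplacian c1 \<phi>1 x),
       B2 (pd 1 (pd 1 z2) t + \<mu> *\<^sub>R pd 1 z2 t) (\<phi>2 y) + (1 / (l2 t)\<^sup>2) *\<^sub>R B2 (z2 t) (laplacian c2 \<phi>2 y))"
    unfolding laplacian_warped[OF b c l u(2,3)] 1 2 tt D'(1) \<mu>_def[symmetric]
    by (simp add: scalar_join_def L1_def L2_def B1.add_left B2.add_left B1.scaleR_left B2.scaleR_left)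
  have n1: "L1 v \<bullet> L1 w = (norm (z1 t))\<^sup>2 * (v \<bullet> w)" for v w
    by (simp add: L1_def norm_mult_bilinear_inner[OF B(1)])
  have n2: "L2 v \<bullet> L2 w = (norm (z2 t))\<^sup>2 * (v \<bullet> w)" for v w
    by (simp add: L2_def norm_mult_bilinear_inner[OF B(2)])
  have nt: "(norm (scalar_join B1 B2 (pd 1 z1) (pd 1 z2) \<phi>1 \<phi>2 (t, x, y)))\<^sup>2
    = (norm (pd 1 z1 t))\<^sup>2 * (norm (\<phi>1 x))\<^sup>2 + (norm (pd 1 z2 t))\<^sup>2 * (norm (\<phi>2 y))\<^sup>2"
    using B by (simp add: scalar_join_def norm_Pair norm_mult_bilinear_def power_mult_distrib)
  show "diff_norm_sq (warped_chart l1 l2 b c1 c2) ?h (t, x, y) =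
      (norm (pd 1 z1 t))\<^sup>2 * (norm (\<phi>1 x))\<^sup>2 + (norm (pd 1 z2 t))\<^sup>2 * (norm (\<phi>2 y))\<^sup>2
      + (norm (z1 t))\<^sup>2 * diff_norm_sq c1 \<phi>1 x / (l1 t)\<^sup>2 + (norm (z2 t))\<^sup>2 * diff_norm_sq c2 \<phi>2 y / (l2 t)\<^sup>2"
    unfolding diff_norm_sq_warped[OF b c l u(2,3)] D' J1 J2 n1 n2 nt diff_norm_sq_def[of c1] diff_norm_sq_def[of c2]
    by (simp add: sum_distrib_left mult.left_commute)
qed

section \<open>The profile equation\<close>

text \<open>\<open>\<mu>\<close> is the mean curvature term \<open>F'/F\<close>, and \<open>a\<close>, \<open>c\<close> are \<open>\<lambda>\<^sub>1\<close>, \<open>\<lambda>\<^sub>2\<close>.\<close>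

definition profile_eq :: "real \<Rightarrow> real \<Rightarrow> real \<Rightarrow> (real \<Rightarrow> 'z::real_inner \<times> 'z) \<Rightarrow> real \<Rightarrow> bool" where
  "profile_eq \<mu> a c \<gamma> t \<longleftrightarrow>
     (\<exists>e. pd 1 (pd 1 \<gamma>) t + \<mu> *\<^sub>R pd 1 \<gamma> t = (a *\<^sub>R fst (\<gamma> t), c *\<^sub>R snd (\<gamma> t)) + e *\<^sub>R \<gamma> t)"

text \<open>The relation |\<gamma>|^2 = 1, differentiated once and twice.\<close>

lemma sphere_curve_derivatives:
  fixes \<gamma> :: "real \<Rightarrow> 'v::euclidean_space"
  assumes J: "open J" "t \<in> J" and \<gamma>: "smooth_on J \<gamma>" "\<And>t. t \<in> J \<Longrightarrow> norm (\<gamma> t) = 1"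
  shows "pd 1 \<gamma> t \<bullet> \<gamma> t = 0" "pd 1 (pd 1 \<gamma>) t \<bullet> \<gamma> t = - (norm (pd 1 \<gamma> t))\<^sup>2"
proof -
  have d1: "(\<gamma> has_derivative (\<lambda>v. pd v \<gamma> t)) (at t)" if "t \<in> J" for t
    by (rule smooth_on_has_derivative[OF \<gamma>(1) that])
  have d2: "(pd 1 \<gamma> has_derivative (\<lambda>v. pd v (pd 1 \<gamma>) t)) (at t)" if "t \<in> J" for t
    by (rule smooth_on_has_derivative[OF smooth_onD(2)[OF \<gamma>(1)] that]) simp
  have z: "pd 1 (\<lambda>t. 0) t = (0::real)" and k: "pd 1 (\<lambda>t. 1) t = (0::real)" for t :: real
    by (rule pd_eqI[THEN trans], auto)+
  have 1: "pd 1 \<gamma> t \<bullet> \<gamma> t = 0" if t: "t \<in> J" for t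
  proof -
    have "pd 1 (\<lambda>t. \<gamma> t \<bullet> \<gamma> t) t = \<gamma> t \<bullet> pd 1 \<gamma> t + pd 1 \<gamma> t \<bullet> \<gamma> t"
      by (rule pd_eqI[OF has_derivative_inner[OF d1[OF t] d1[OF t]]])
    moreover have "pd 1 (\<lambda>t. \<gamma> t \<bullet> \<gamma> t) t = pd 1 (\<lambda>t. 1) t"
      by (rule pd_cong_open[OF J(1) t]) (simp add: \<gamma>(2) dot_square_norm)
    ultimately show ?thesis by (simp add: k inner_commute)
  qed
  then show "pd 1 \<gamma> t \<bullet> \<gamma> t = 0" using J by blast
  have "pd 1 (\<lambda>t. pd 1 \<gamma> t \<bullet> \<gamma> t) t = pd 1 \<gamma> t \<bullet> pd 1 \<gamma> t + pd 1 (pd 1 \<gamma>) t \<bullet> \<gamma> t"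
    by (rule pd_eqI[OF has_derivative_inner[OF d2[OF J(2)] d1[OF J(2)]]])
  moreover have "pd 1 (\<lambda>t. pd 1 \<gamma> t \<bullet> \<gamma> t) t = pd 1 (\<lambda>t. 0) t"
    by (rule pd_cong_open[OF J]) (simp add: 1)
  ultimately show "pd 1 (pd 1 \<gamma>) t \<bullet> \<gamma> t = - (norm (pd 1 \<gamma> t))\<^sup>2"
    by (simp add: z power2_norm_eq_inner)
qed

text \<open>Pairing with \<gamma> determines the multiplier, and its value is minus the energy
  density of the join. So the equation with an unspecified multiplier is already the harmonic map
  equation.\<close>

lemma profile_eq_multiplier:
  fixes \<gamma> :: "real \<Rightarrow> 'z::euclidean_space \<times> 'z"
  assumes J: "open J" "t \<in> J" and \<gamma>: "smooth_on J \<gamma>" "\<And>t. t \<in> J \<Longrightarrow> norm (\<gamma> t) = 1"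
  shows "profile_eq \<mu> a c \<gamma> t \<longleftrightarrow>
    pd 1 (pd 1 \<gamma>) t + \<mu> *\<^sub>R pd 1 \<gamma> t = (a *\<^sub>R fst (\<gamma> t), c *\<^sub>R snd (\<gamma> t))
      + - ((norm (pd 1 \<gamma> t))\<^sup>2 + a * (norm (fst (\<gamma> t)))\<^sup>2 + c * (norm (snd (\<gamma> t)))\<^sup>2) *\<^sub>R \<gamma> t"
    (is "_ \<longleftrightarrow> ?eq")
proof
  assume "profile_eq \<mu> a c \<gamma> t"
  then obtain e where e:
    "pd 1 (pd 1 \<gamma>) t + \<mu> *\<^sub>R pd 1 \<gamma> t = (a *\<^sub>R fst (\<gamma> t), c *\<^sub>R snd (\<gamma> t)) + e *\<^sub>R \<gamma> t"
    unfolding profile_eq_def by blast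
  note D = sphere_curve_derivatives[OF assms]
  have "(pd 1 (pd 1 \<gamma>) t + \<mu> *\<^sub>R pd 1 \<gamma> t) \<bullet> \<gamma> t = - (norm (pd 1 \<gamma> t))\<^sup>2"
    using D by (simp add: inner_add_left)
  moreover have "((a *\<^sub>R fst (\<gamma> t), c *\<^sub>R snd (\<gamma> t)) + e *\<^sub>R \<gamma> t) \<bullet> \<gamma> t
    = a * (norm (fst (\<gamma> t)))\<^sup>2 + c * (norm (snd (\<gamma> t)))\<^sup>2 + e"
  proof -
    have "\<gamma> t \<bullet> \<gamma> t = 1" using \<gamma>(2)[OF J(2)] by (simp add: dot_square_norm)
    then show ?thesis by (simp add: inner_add_left) (simp add: inner_prod_def power2_norm_eq_inner)
  qed
  ultimately have "e = - ((norm (pd 1 \<gamma> t))\<^sup>2 + a * (norm (fst (\<gamma> t)))\<^sup>2 + c * (norm (snd (\<gamma> t)))\<^sup>2)"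
    unfolding e by simp
  then show ?eq using e by simp
next
  assume ?eq then show "profile_eq \<mu> a c \<gamma> t" unfolding profile_eq_def by blast
qed

lemma pd1_bounded_linear:
  assumes "bounded_linear L" "open J" "smooth_on J f" "t \<in> J"
  shows "pd 1 (\<lambda>t. L (f t)) t = L (pd 1 f t)" "pd 1 (pd 1 (\<lambda>t. L (f t))) t = L (pd 1 (pd 1 f) (t::real))"
proof -
  have 1: "pd 1 (\<lambda>t. L (f t)) t = L (pd 1 f t)" if "t \<in> J" for t
    by (rule pd_bounded_linear[OF assms(1) smooth_onD(1)[OF assms(3) that]])
  then show "pd 1 (\<lambda>t. L (f t)) t = L (pd 1 f t)" using assms(4) .
  have s: "smooth_on J (pd 1 f)" using smooth_onD(2)[OF assms(3)] by simp
  show "pd 1 (pd 1 (\<lambda>t. L (f t))) t = L (pd 1 (pd 1 f) t)"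
    using pd_cong_open[OF assms(2,4), of "pd 1 (\<lambda>t. L (f t))" "\<lambda>t. L (pd 1 f t)" 1] 1
      pd_bounded_linear[OF assms(1) smooth_onD(1)[OF s assms(4)], of 1] by simp
qed

lemma eigenmap_regular:
  assumes "eigenmap A f d" "c \<in> A"
  shows "smooth_on (cran c) (\<lambda>u. f (cinv c u))"
    and "u \<in> cran c \<Longrightarrow> norm (f (cinv c u)) = 1"
    and "u \<in> cran c \<Longrightarrow> laplacian c (\<lambda>u. f (cinv c u)) u = - d *\<^sub>R f (cinv c u)"
    and "u \<in> cran c \<Longrightarrow> diff_norm_sq c (\<lambda>u. f (cinv c u)) u = d"
  using assms by (auto simp: eigenmap_def smooth_map_def o_def)

lemma laplacian_cong_open:
  assumes "open S" "u \<in> S" "\<And>x. x \<in> S \<Longrightarrow> f x = g x"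
  shows "laplacian c f u = laplacian c g u" "diff_norm_sq c f u = diff_norm_sq c g u"
proof -
  have 1: "pd i f x = pd i g x" if "x \<in> S" for x i using pd_cong_open[OF assms(1) that assms(3)] .
  then have 2: "pd i (pd j f) u = pd i (pd j g) u" for i j
    using pd_cong_open[OF assms(1,2), of "pd j f" "pd j g"] by blast
  show "laplacian c f u = laplacian c g u" "diff_norm_sq c f u = diff_norm_sq c g u"
    unfolding laplacian_def diff_norm_sq_def using 1[OF assms(2)] 2 by simp_all
qed

text \<open>The two conditions are equivalent in each product chart, because the Laplacian of an
  eigenmap is a multiple of the map and the energy density of the join depends on \<open>t\<close>
  only. For the way back from the map to the profile, each factor has to supply a point at which the
  equation can be read.\<close>

lemma
  fixes B1 :: "'z::euclidean_space \<Rightarrow> 'v::euclidean_space \<Rightarrow> 'v" and B2 :: "'z \<Rightarrow> 'w::euclidean_space \<Rightarrow> 'w"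
    and A1 :: "('a, 'e::euclidean_space) rchart set" and A2 :: "('b, 'f::euclidean_space) rchart set"
    and f1 :: "'a \<Rightarrow> 'v" and f2 :: "'b \<Rightarrow> 'w" and \<gamma> :: "real \<Rightarrow> 'z \<times> 'z"
    and Bs :: "('s, real) rchart set" and l1' l2' :: "real \<Rightarrow> real"
  assumes B: "norm_mult_bilinear B1" "norm_mult_bilinear B2"
    and Bs: "\<And>b. b \<in> Bs \<Longrightarrow> flat_chart b" "(\<Union>b\<in>Bs. cran b) = J"
    and A: "\<And>c. c \<in> A1 \<Longrightarrow> regular_chart c" "\<And>c. c \<in> A2 \<Longrightarrow> regular_chart c"
    and f: "eigenmap A1 f1 d1" "eigenmap A2 f2 d2"
    and l: "\<And>t. (l1 has_real_derivative l1' t) (at t)" "\<And>t. (l2 has_real_derivative l2' t) (at t)"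
      "\<And>t. l1 t > 0" "\<And>t. l2 t > 0"
    and \<gamma>: "open J" "smooth_on J \<gamma>" "\<And>t. t \<in> J \<Longrightarrow> norm (\<gamma> t) = 1"
    and G: "\<And>b t x y. b \<in> Bs \<Longrightarrow> t \<in> cran b \<Longrightarrow>
      G (cinv b t, x, y) = (B1 (fst (\<gamma> t)) (f1 x), B2 (snd (\<gamma> t)) (f2 y))"
  defines "H \<equiv> harmonic_into_sphere (warped_atlas l1 l2 Bs A1 A2) G"
    and "E \<equiv> (\<forall>t\<in>J. profile_eq (DIM('e) * l1' t / l1 t + DIM('f) * l2' t / l2 t)
      (d1 / (l1 t)\<^sup>2) (d2 / (l2 t)\<^sup>2) \<gamma> t)"
  shows harmonic_joinI: "E \<Longrightarrow> H"
    and harmonic_joinD: "(\<Union>c\<in>A1. cran c) \<noteq> {} \<Longrightarrow> (\<Union>c\<in>A2. cran c) \<noteq> {} \<Longrightarrow> H \<Longrightarrow> E"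
proof -
  let ?\<mu> = "\<lambda>t. DIM('e) * l1' t / l1 t + DIM('f) * l2' t / l2 t"
  let ?P = "\<lambda>t. profile_eq (?\<mu> t) (d1 / (l1 t)\<^sup>2) (d2 / (l2 t)\<^sup>2) \<gamma> t"
  let ?z1 = "\<lambda>t. fst (\<gamma> t)" and ?z2 = "\<lambda>t. snd (\<gamma> t)"
  have sz: "smooth_on J ?z1" "smooth_on J ?z2"
    by (rule smooth_on_fst[OF \<gamma>(1,2)], rule smooth_on_snd[OF \<gamma>(1,2)])
  have "smooth_on (cran (warped_chart l1 l2 b c1 c2)) (G \<circ> cinv (warped_chart l1 l2 b c1 c2)) \<and>
    (\<forall>u\<in>cran (warped_chart l1 l2 b c1 c2). G (cinv (warped_chart l1 l2 b c1 c2) u) \<in> sphere 0 1 \<and>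
      (laplacian (warped_chart l1 l2 b c1 c2) (G \<circ> cinv (warped_chart l1 l2 b c1 c2)) u =
        - diff_norm_sq (warped_chart l1 l2 b c1 c2) (G \<circ> cinv (warped_chart l1 l2 b c1 c2)) u
          *\<^sub>R G (cinv (warped_chart l1 l2 b c1 c2) u) \<longleftrightarrow> ?P (fst u)))"
    if bcc: "b \<in> Bs" "c1 \<in> A1" "c2 \<in> A2" for b c1 c2
  proof -
    let ?C = "warped_chart l1 l2 b c1 c2"
    let ?p1 = "\<lambda>x. f1 (cinv c1 x)" and ?p2 = "\<lambda>y. f2 (cinv c2 y)"
    let ?h = "scalar_join B1 B2 ?z1 ?z2 ?p1 ?p2"
    note fl = Bs(1)[OF bcc(1)] and r = A(1)[OF bcc(2)] A(2)[OF bcc(3)]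
    have o: "open (cran b)" "open (cran c1)" "open (cran c2)"
      using fl r by (auto simp: flat_chart_def regular_chart_def)
    have inj: "inj_on (cmap b) (cdom b)" "inj_on (cmap c1) (cdom c1)" "inj_on (cmap c2) (cdom c2)"
      using fl r by (auto simp: flat_chart_def regular_chart_def)
    have bJ: "cran b \<subseteq> J" using Bs(2) bcc(1) by blast
    have Gh: "G (cinv ?C u) = ?h u" if "u \<in> cran ?C" for u
    proof -
      obtain t x y where u: "u = (t, x, y)" by (cases u)
      then have "t \<in> cran b" "x \<in> cran c1" "y \<in> cran c2" using that by (auto simp: cran_warped)
      then show ?thesis unfolding u cinv_warped[OF inj \<open>t \<in> cran b\<close> \<open>x \<in> cran c1\<close> \<open>y \<in> cran c2\<close>]
        by (simp add: G[OF bcc(1)] scalar_join_apply)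
    qed
    have O: "open (cran ?C)" using o by (simp add: cran_warped open_Times)
    note e1 = eigenmap_regular[OF f(1) bcc(2)] and e2 = eigenmap_regular[OF f(2) bcc(3)]
    have "smooth_on (cran ?C) ?h"
      unfolding cran_warped
      using smooth_on_join[OF B o smooth_on_subset[OF sz(1) bJ] smooth_on_subset[OF sz(2) bJ] e1(1) e2(1)] .
    then have 1: "smooth_on (cran ?C) (G \<circ> cinv ?C)"
      using smooth_on_cong[OF O, of ?h "G \<circ> cinv ?C"] Gh by simp
    have "G (cinv ?C u) \<in> sphere 0 1 \<and> (laplacian ?C (G \<circ> cinv ?C) u =
        - diff_norm_sq ?C (G \<circ> cinv ?C) u *\<^sub>R G (cinv ?C u) \<longleftrightarrow> ?P (fst u))" if u: "u \<in> cran ?C" for u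
    proof -
      obtain t x y where u_eq: "u = (t, x, y)" by (cases u)
      then have txy: "t \<in> cran b" "x \<in> cran c1" "y \<in> cran c2" using u by (auto simp: cran_warped)
      have t: "t \<in> J" using txy bJ by blast
      have lap: "laplacian ?C (G \<circ> cinv ?C) u = laplacian ?C ?h u"
        "diff_norm_sq ?C (G \<circ> cinv ?C) u = diff_norm_sq ?C ?h u"
        using laplacian_cong_open[OF O u, of "G \<circ> cinv ?C" ?h ?C] Gh by auto
      note L = laplacian_join[OF B fl r l(1)[of t] l(2)[of t] l(3)[of t] l(4)[of t] \<gamma>(1) sz e1(1) e2(1) t txy(2,3)]
      let ?E = "(norm (pd 1 \<gamma> t))\<^sup>2 + d1 / (l1 t)\<^sup>2 * (norm (fst (\<gamma> t)))\<^sup>2 + d2 / (l2 t)\<^sup>2 * (norm (snd (\<gamma> t)))\<^sup>2"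
      have d: "pd 1 ?z1 t = fst (pd 1 \<gamma> t)" "pd 1 ?z2 t = snd (pd 1 \<gamma> t)"
        "pd 1 (pd 1 ?z1) t = fst (pd 1 (pd 1 \<gamma>) t)" "pd 1 (pd 1 ?z2) t = snd (pd 1 (pd 1 \<gamma>) t)"
        using pd1_bounded_linear[OF bounded_linear_fst \<gamma>(1,2) t]
          pd1_bounded_linear[OF bounded_linear_snd \<gamma>(1,2) t] by simp_all
      have n\<gamma>: "(norm (fst (\<gamma> t)))\<^sup>2 + (norm (snd (\<gamma> t)))\<^sup>2 = 1"
        using \<gamma>(3)[OF t] by (simp add: norm_prod_def)
      \<comment> \<open>Up to sign this is the multiplier of
        \<open>profile_eq_multiplier\<close>.\<close>
      have dn: "diff_norm_sq ?C ?h (t, x, y) = ?E"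
        unfolding L(2) by (simp add: e1(2,4) e2(2,4) txy d norm_prod_def[of "pd 1 \<gamma> t"] mult.commute)
      interpret B1: bounded_bilinear B1 using B by (simp add: norm_mult_bilinear_def)
      interpret B2: bounded_bilinear B2 using B by (simp add: norm_mult_bilinear_def)
      let ?w1 = "fst (pd 1 (pd 1 \<gamma>) t) + ?\<mu> t *\<^sub>R fst (pd 1 \<gamma> t) - (d1 / (l1 t)\<^sup>2) *\<^sub>R fst (\<gamma> t)"
      let ?w2 = "snd (pd 1 (pd 1 \<gamma>) t) + ?\<mu> t *\<^sub>R snd (pd 1 \<gamma> t) - (d2 / (l2 t)\<^sup>2) *\<^sub>R snd (\<gamma> t)"
      have lp: "laplacian ?C ?h (t, x, y) = (B1 ?w1 (?p1 x), B2 ?w2 (?p2 y))"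
        unfolding L(1) d e1(3)[OF txy(2)] e2(3)[OF txy(3)]
        by (simp add: B1.diff_left B2.diff_left B1.add_left B2.add_left B1.scaleR_left B2.scaleR_left
            B1.minus_right B2.minus_right B1.scaleR_right B2.scaleR_right)
      have "laplacian ?C ?h (t, x, y) = - diff_norm_sq ?C ?h (t, x, y) *\<^sub>R ?h (t, x, y) \<longleftrightarrow>
        B1 ?w1 (?p1 x) = B1 (- ?E *\<^sub>R fst (\<gamma> t)) (?p1 x) \<and> B2 ?w2 (?p2 y) = B2 (- ?E *\<^sub>R snd (\<gamma> t)) (?p2 y)"
        unfolding dn lp scalar_join_apply by (simp only: scaleR_Pair prod.inject B1.scaleR_left B2.scaleR_left)
      also have "\<dots> \<longleftrightarrow> ?w1 = - ?E *\<^sub>R fst (\<gamma> t) \<and> ?w2 = - ?E *\<^sub>R snd (\<gamma> t)"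
        using norm_mult_bilinear_cancel[OF B(1)] norm_mult_bilinear_cancel[OF B(2)] e1(2)[OF txy(2)] e2(2)[OF txy(3)]
        by simp
      also have "\<dots> \<longleftrightarrow> ?P t"
      proof -
        have gen: "p + q - r = s \<longleftrightarrow> p + q = r + s" for p q r s :: 'z by (auto simp: algebra_simps)
        show ?thesis
          by (simp only: profile_eq_multiplier[OF \<gamma>(1) t \<gamma>(2,3)] prod_eq_iff gen fst_add snd_add fst_scaleR snd_scaleR fst_conv snd_conv)
      qed
      finally have e: "laplacian ?C ?h (t, x, y) = - diff_norm_sq ?C ?h (t, x, y) *\<^sub>R ?h (t, x, y) \<longleftrightarrow> ?P t" .
      have eq: "laplacian ?C (G \<circ> cinv ?C) u = - diff_norm_sq ?C (G \<circ> cinv ?C) u *\<^sub>R G (cinv ?C u) \<longleftrightarrow> ?P (fst u)"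
        unfolding lap Gh[OF u] using e by (simp only: u_eq fst_conv)
      have "norm (?h u) = 1"
        using B n\<gamma> by (simp add: u_eq scalar_join_apply norm_prod_def norm_mult_bilinear_def e1(2) e2(2) txy)
      then show ?thesis using eq Gh[OF u] by simp
    qed
    then show ?thesis using 1 by blast
  qed note main = this
  show E if ne: "(\<Union>c\<in>A1. cran c) \<noteq> {}" "(\<Union>c\<in>A2. cran c) \<noteq> {}" and hH: H
  proof -
    show E unfolding E_def
    proof
      fix t assume "t \<in> J"
      then obtain b where b: "b \<in> Bs" "t \<in> cran b" using Bs(2) by blast
      obtain c1 x c2 y where c: "c1 \<in> A1" "x \<in> cran c1" "c2 \<in> A2" "y \<in> cran c2" using ne by blast
      have "warped_chart l1 l2 b c1 c2 \<in> warped_atlas l1 l2 Bs A1 A2"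
        using b c by (auto simp: warped_atlas_def)
      moreover have "(t, x, y) \<in> cran (warped_chart l1 l2 b c1 c2)" using b c by (simp add: cran_warped)
      ultimately show "?P t" using hH main[OF b(1) c(1,3)] unfolding H_def harmonic_into_sphere_def by fastforce
    qed
  qed
  show H if E: E
  proof -
    have *: "smooth_on (cran C) (G \<circ> cinv C) \<and> (\<forall>u\<in>cran C. G (cinv C u) \<in> sphere 0 1 \<and>
        laplacian C (G \<circ> cinv C) u = - diff_norm_sq C (G \<circ> cinv C) u *\<^sub>R G (cinv C u))"
      if CW: "C \<in> warped_atlas l1 l2 Bs A1 A2" for C
    proof -
      obtain b c1 c2 where C: "C = warped_chart l1 l2 b c1 c2" "b \<in> Bs" "c1 \<in> A1" "c2 \<in> A2"
        using CW by (auto simp: warped_atlas_def)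
      have "fst u \<in> J" if "u \<in> cran C" for u
        using that C(2) Bs(2) unfolding C(1) cran_warped by auto
      then show ?thesis using main[OF C(2-4)] E unfolding E_def C(1) by blast
    qed
    then show H
      unfolding H_def harmonic_into_sphere_def smooth_map_def by blast
  qed
qed

section \<open>Neumann trajectories\<close>

text \<open>The tangential part of the ambient gradient has the property that defines
  \<open>sphere_gradient\<close>. Uniqueness follows by testing with the difference of two
  candidates, which is itself tangent.\<close>

lemma sphere_gradient_snd:
  fixes z :: "complex \<times> complex"
  assumes "norm z = 1"
  shows "sphere_gradient (\<lambda>z :: complex \<times> complex. (norm (snd z))\<^sup>2 / 2) z = tangent_proj z (0, snd z)"
proof -
  have "((\<lambda>z::complex \<times> complex. (snd z \<bullet> snd z) / 2) has_derivative (\<lambda>v. (0, snd z) \<bullet> v)) (at z)"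
    by (auto intro!: derivative_eq_intros simp: inner_prod_def inner_commute field_simps)
  then have D: "frechet_derivative (\<lambda>z :: complex \<times> complex. (norm (snd z))\<^sup>2 / 2) (at z) = (\<lambda>v. (0, snd z) \<bullet> v)"
    unfolding power2_norm_eq_inner by (metis frechet_derivative_at)
  have zz: "z \<bullet> z = 1" using assms by (simp add: dot_square_norm)
  let ?w = "tangent_proj z (0, snd z)"
  have w: "?w \<bullet> z = 0" by (simp add: tangent_proj_def inner_diff_left zz)
  have wv: "?w \<bullet> v = (0, snd z) \<bullet> v" if "v \<bullet> z = 0" for v
    using that by (simp add: tangent_proj_def inner_diff_left inner_commute[of z v])
  show ?thesis
    unfolding sphere_gradient_def D
  proof (rule the_equality)
    fix w' assume w': "w' \<bullet> z = 0 \<and> (\<forall>v. v \<bullet> z = 0 \<longrightarrow> w' \<bullet> v = (0, snd z) \<bullet> v)"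
    have z: "(w' - ?w) \<bullet> z = 0" using w w' by (simp add: inner_diff_left)
    have "w' \<bullet> (w' - ?w) = (0, snd z) \<bullet> (w' - ?w)" using w' z by blast
    then have "(w' - ?w) \<bullet> (w' - ?w) = 0"
      using wv[OF z] by (simp only: inner_diff_left)
    then show "w' = ?w" by simp
  qed (use w wv in auto)
qed

text \<open>Translates equations between tangential parts into equations with a multiplier, the form
  in which \<open>profile_eq\<close> is stated.\<close>

lemma tangent_proj_eq_iff:
  assumes "norm z = 1" shows "tangent_proj z v = tangent_proj z w \<longleftrightarrow> (\<exists>e. v = w + e *\<^sub>R z)"
proof
  assume "tangent_proj z v = tangent_proj z w"
  then have "v = w + (v \<bullet> z - w \<bullet> z) *\<^sub>R z"
    by (simp add: tangent_proj_def algebra_simps)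
  then show "\<exists>e. v = w + e *\<^sub>R z" by blast
next
  assume "\<exists>e. v = w + e *\<^sub>R z"
  then obtain e where "v = w + e *\<^sub>R z" ..
  moreover have "z \<bullet> z = 1" using assms by (simp add: dot_square_norm)
  ultimately show "tangent_proj z v = tangent_proj z w"
    by (simp add: tangent_proj_def inner_add_left algebra_simps)
qed

lemma neumann_trajectory_iff:
  assumes "open I"
  shows "neumann_trajectory \<kappa> I \<Gamma> \<longleftrightarrow> profile_on I \<Gamma> \<and> (\<forall>s\<in>I. profile_eq 0 0 \<kappa> \<Gamma> s)"
proof -
  have "sphere_acceleration \<Gamma> s =
        \<kappa> *\<^sub>R sphere_gradient (\<lambda>z :: complex \<times> complex. (norm (snd z))\<^sup>2 / 2) (\<Gamma> s) \<longleftrightarrow> profile_eq 0 0 \<kappa> \<Gamma> s"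
    if P: "profile_on I \<Gamma>" and s: "s \<in> I" for s
  proof -
    have sm: "smooth_on I \<Gamma>" and n: "norm (\<Gamma> s) = 1" using P s by (auto simp: profile_on_def)
    note V = smooth_on_vector_derivative[OF assms sm]
    have "vector_derivative (\<lambda>r. vector_derivative \<Gamma> (at r)) (at s) = pd 1 (\<lambda>r. vector_derivative \<Gamma> (at r)) s"
      by (rule smooth_on_vector_derivative(3)[OF assms V(2) s])
    also have "\<dots> = pd 1 (pd 1 \<Gamma>) s" by (rule pd_cong_open[OF assms s V(3)])
    finally have a: "sphere_acceleration \<Gamma> s = tangent_proj (\<Gamma> s) (pd 1 (pd 1 \<Gamma>) s)"
      by (simp add: sphere_acceleration_def)
    have "\<kappa> *\<^sub>R tangent_proj (\<Gamma> s) (0, snd (\<Gamma> s)) = tangent_proj (\<Gamma> s) (0, \<kappa> *\<^sub>R snd (\<Gamma> s))"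
      by (simp add: tangent_proj_def scaleR_diff_right inner_prod_def)
    then show ?thesis
      unfolding a sphere_gradient_snd[OF n] using tangent_proj_eq_iff[OF n]
      by (simp add: profile_eq_def)
  qed
  then show ?thesis unfolding neumann_trajectory_def by blast
qed

text \<open>In the clock every derivative acquires a factor 1/F, and the derivative of this factor
  cancels the friction. The part \<open>a\<close> common to both coefficients acts as a multiple of
  the identity and goes into the multiplier, so only the difference \<open>c - a\<close>
  remains.\<close>

lemma profile_eq_time_change:
  fixes \<Gamma> :: "real \<Rightarrow> 'z::euclidean_space \<times> 'z" and F :: "real \<Rightarrow> real" and F' :: real
  assumes J: "open J" "t \<in> J" and I: "open I" "\<tau> ` J \<subseteq> I"
    and \<tau>: "\<And>t. t \<in> J \<Longrightarrow> (\<tau> has_real_derivative 1 / F t) (at t)"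
    and F: "(F has_real_derivative F') (at t)" "F t > 0"
    and \<Gamma>: "smooth_on I \<Gamma>" and \<gamma>: "\<And>t. t \<in> J \<Longrightarrow> \<gamma> t = \<Gamma> (\<tau> t)"
    and ac: "c - a = \<kappa> / (F t)\<^sup>2"
  shows "profile_eq (F' / F t) a c \<gamma> t \<longleftrightarrow> profile_eq 0 0 \<kappa> \<Gamma> (\<tau> t)"
proof -
  have s\<Gamma>: "smooth_on I (pd 1 \<Gamma>)" using smooth_onD(2)[OF \<Gamma>] by simp
  have ch: "((\<lambda>t. \<Delta> (\<tau> t)) has_vector_derivative (1 / F t) *\<^sub>R pd 1 \<Delta> (\<tau> t)) (at t)"
    if "t \<in> J" "smooth_on I \<Delta>" for t and \<Delta> :: "real \<Rightarrow> 'z \<times> 'z"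
  proof -
    have "\<tau> t \<in> I" using I that by blast
    then have "(\<Delta> has_vector_derivative pd 1 \<Delta> (\<tau> t)) (at (\<tau> t))"
      using smooth_on_vector_derivative(1,3)[OF I(1) that(2)] by force
    from vector_diff_chain_at[of \<tau> "1 / F t" t, OF _ this] \<tau>[OF that(1)] show ?thesis
      by (simp add: has_real_derivative_iff_has_vector_derivative o_def)
  qed
  have vd_pd: "pd 1 f t = D" if "(f has_vector_derivative D) (at t)" for f :: "real \<Rightarrow> 'z \<times> 'z" and D t
    using pd_eqI[OF that[unfolded has_vector_derivative_def], of 1] by simp
  have 1: "pd 1 \<gamma> t = (1 / F t) *\<^sub>R pd 1 \<Gamma> (\<tau> t)" if "t \<in> J" for t
    using vd_pd[OF ch[OF that \<Gamma>]] pd_cong_open[OF J(1) that \<gamma>] by simp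
  have Fi: "((\<lambda>t. 1 / F t) has_real_derivative - F' / (F t)\<^sup>2) (at t)"
    using F by (auto intro!: derivative_eq_intros simp: power2_eq_square field_simps)
  have "((\<lambda>t. (1 / F t) *\<^sub>R pd 1 \<Gamma> (\<tau> t)) has_vector_derivative
      ((1 / F t) *\<^sub>R ((1 / F t) *\<^sub>R pd 1 (pd 1 \<Gamma>) (\<tau> t)) + (- F' / (F t)\<^sup>2) *\<^sub>R pd 1 \<Gamma> (\<tau> t))) (at t)"
    by (rule has_vector_derivative_scaleR[OF Fi ch[OF J(2) s\<Gamma>]])
  from vd_pd[OF this] have 2: "pd 1 (pd 1 \<gamma>) t
    = (1 / (F t)\<^sup>2) *\<^sub>R pd 1 (pd 1 \<Gamma>) (\<tau> t) - (F' / (F t)\<^sup>2) *\<^sub>R pd 1 \<Gamma> (\<tau> t)"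
    using pd_cong_open[OF J(1,2), of "pd 1 \<gamma>" "\<lambda>t. (1 / F t) *\<^sub>R pd 1 \<Gamma> (\<tau> t)" 1] 1
    by (simp add: power2_eq_square)
  let ?f = "(F t)\<^sup>2"
  have f0: "?f \<noteq> 0" using F(2) by simp
  have 3: "pd 1 (pd 1 \<gamma>) t + (F' / F t) *\<^sub>R pd 1 \<gamma> t = (1 / ?f) *\<^sub>R pd 1 (pd 1 \<Gamma>) (\<tau> t)"
    unfolding 1[OF J(2)] 2 by (simp add: power2_eq_square)
  have z: "(a *\<^sub>R fst (\<gamma> t), c *\<^sub>R snd (\<gamma> t))
     = a *\<^sub>R \<Gamma> (\<tau> t) + (1 / ?f) *\<^sub>R (0, \<kappa> *\<^sub>R snd (\<Gamma> (\<tau> t)))"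
  proof -
    have "c = a + \<kappa> / ?f" using ac by simp
    then show ?thesis by (simp add: \<gamma>[OF J(2)] prod_eq_iff scaleR_add_left)
  qed
  have "profile_eq (F' / F t) a c \<gamma> t \<longleftrightarrow> (\<exists>e. (1 / ?f) *\<^sub>R pd 1 (pd 1 \<Gamma>) (\<tau> t)
      = (1 / ?f) *\<^sub>R (0, \<kappa> *\<^sub>R snd (\<Gamma> (\<tau> t))) + (a + e) *\<^sub>R \<Gamma> (\<tau> t))"
    unfolding profile_eq_def 3 z unfolding \<gamma>[OF J(2)]
    by (simp only: scaleR_add_left add_ac)
  also have "\<dots> \<longleftrightarrow> (\<exists>e. pd 1 (pd 1 \<Gamma>) (\<tau> t) = (0, \<kappa> *\<^sub>R snd (\<Gamma> (\<tau> t))) + e *\<^sub>R \<Gamma> (\<tau> t))"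
  proof
    assume "\<exists>e. (1 / ?f) *\<^sub>R pd 1 (pd 1 \<Gamma>) (\<tau> t)
      = (1 / ?f) *\<^sub>R (0, \<kappa> *\<^sub>R snd (\<Gamma> (\<tau> t))) + (a + e) *\<^sub>R \<Gamma> (\<tau> t)"
    then obtain e where "(1 / ?f) *\<^sub>R pd 1 (pd 1 \<Gamma>) (\<tau> t)
      = (1 / ?f) *\<^sub>R (0, \<kappa> *\<^sub>R snd (\<Gamma> (\<tau> t))) + (a + e) *\<^sub>R \<Gamma> (\<tau> t)" ..
    from arg_cong[OF this, of "\<lambda>v. ?f *\<^sub>R v"] f0
    have "pd 1 (pd 1 \<Gamma>) (\<tau> t) = (0, \<kappa> *\<^sub>R snd (\<Gamma> (\<tau> t))) + (?f * (a + e)) *\<^sub>R \<Gamma> (\<tau> t)"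
      by (simp add: scaleR_add_right)
    then show "\<exists>e. pd 1 (pd 1 \<Gamma>) (\<tau> t) = (0, \<kappa> *\<^sub>R snd (\<Gamma> (\<tau> t))) + e *\<^sub>R \<Gamma> (\<tau> t)" by blast
  next
    assume "\<exists>e. pd 1 (pd 1 \<Gamma>) (\<tau> t) = (0, \<kappa> *\<^sub>R snd (\<Gamma> (\<tau> t))) + e *\<^sub>R \<Gamma> (\<tau> t)"
    then obtain e where e: "pd 1 (pd 1 \<Gamma>) (\<tau> t) = (0, \<kappa> *\<^sub>R snd (\<Gamma> (\<tau> t))) + e *\<^sub>R \<Gamma> (\<tau> t)" ..
    show "\<exists>e. (1 / ?f) *\<^sub>R pd 1 (pd 1 \<Gamma>) (\<tau> t)
      = (1 / ?f) *\<^sub>R (0, \<kappa> *\<^sub>R snd (\<Gamma> (\<tau> t))) + (a + e) *\<^sub>R \<Gamma> (\<tau> t)"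
      \<comment> \<open>The witness undoes the scaling by F^2 and the shift of the multiplier by
        \<open>a\<close>.\<close>
      unfolding e by (intro exI[of _ "e / ?f - a"]) (simp add: scaleR_add_right)
  qed
  finally show ?thesis by (simp add: profile_eq_def)
qed

section \<open>Charts of the circle and of round spheres\<close>

lemma circ_eq_iff: "circ P s = circ P t \<longleftrightarrow> (\<exists>k::int. s = t + of_int k * P)"
proof
  assume "circ P s = circ P t"
  moreover have "s \<in> circ P s" by (auto simp: circ_def intro: exI[of _ 0])
  ultimately show "\<exists>k::int. s = t + of_int k * P" by (auto simp: circ_def)
next
  assume "\<exists>k::int. s = t + of_int k * P"
  then obtain k :: int where k: "s = t + of_int k * P" ..
  have "\<exists>j'. s + of_int j * P = t + of_int j' * P" for j :: int
    by (rule exI[of _ "k + j"]) (simp add: k algebra_simps)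
  moreover have "\<exists>j'. t + of_int j * P = s + of_int j' * P" for j :: int
    by (rule exI[of _ "j - k"]) (simp add: k algebra_simps)
  ultimately show "circ P s = circ P t" by (fastforce simp: circ_def)
qed

lemma circ_add_int: "circ P (t + of_int k * P) = circ P t"
  by (auto simp: circ_eq_iff)

lemma circ_add_period: "circ P (t + P) = circ P t"
  using circ_add_int[of P t 1] by simp

lemma circ_SOME: "\<exists>k::int. (SOME s. s \<in> circ P t) = t + of_int k * P"
proof -
  have "t \<in> circ P t" by (auto simp: circ_def intro: exI[of _ 0])
  from someI[of "\<lambda>s. s \<in> circ P t", OF this] show ?thesis unfolding circ_def by blast
qed

lemma periodic_int:
  assumes "periodic P h" shows "h (t + of_int k * P) = h t"
proof (induction k rule: int_induct[where k=0])
  case (step1 i)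
  have "t + of_int (i + 1) * P = (t + of_int i * P) + P" by (simp add: algebra_simps)
  then show ?case using step1 assms unfolding periodic_def by metis
next
  case (step2 i)
  have "t + of_int i * P = (t + of_int (i - 1) * P) + P" by (simp add: algebra_simps)
  then show ?case using step2 assms unfolding periodic_def by metis
qed simp

lemma circ_inj_on:
  assumes "P > 0" shows "inj_on (circ P) {a<..<a + P}"
proof (rule inj_onI)
  fix s t assume st: "s \<in> {a<..<a + P}" "t \<in> {a<..<a + P}" "circ P s = circ P t"
  then obtain k :: int where k: "s = t + of_int k * P" by (auto simp: circ_eq_iff)
  have "s - t = of_int k * P" using k by simp
  moreover have "\<bar>s - t\<bar> < P" using st by auto
  ultimately have "\<bar>of_int k * P\<bar> < P" by simp
  then have "\<bar>of_int k\<bar> * P < 1 * P" using assms by (simp add: abs_mult)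
  then have "\<bar>real_of_int k\<bar> < 1" by (simp only: mult_less_cancel_right_pos[OF assms])
  then have "k = 0" by linarith
  then show "s = t" using k by simp
qed

lemma line_atlas_flat:
  assumes "open J" "b \<in> line_atlas J"
  shows "flat_chart b" "cran b = J" "t \<in> J \<Longrightarrow> cinv b t = t"
  using assms by (auto simp: line_atlas_def flat_chart_def cran_def cinv_def)

lemma circle_atlas_flat:
  assumes "P > 0" "b \<in> circle_atlas P"
  shows "flat_chart b" "\<exists>a. cran b = {a<..<a + P}" "t \<in> cran b \<Longrightarrow> cinv b t = circ P t"
proof -
  obtain a where b: "b = \<lparr> cdom = circ P ` {a<..<a + P}, cmap = inv_into {a<..<a + P} (circ P),
    cmet = (\<lambda>t v w. v * w) \<rparr>" using assms(2) by (auto simp: circle_atlas_def)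
  let ?I = "{a<..<a + P}"
  note inj = circ_inj_on[OF assms(1), of a]
  have cran: "cran b = ?I" by (simp add: b cran_def inv_into_image_cancel[OF inj])
  then show "\<exists>a. cran b = {a<..<a + P}" by blast
  show "flat_chart b" using cran by (simp add: flat_chart_def b inj_on_inv_into)
  show "cinv b t = circ P t" if "t \<in> cran b"
    unfolding cinv_def
  proof (rule inv_into_f_eq)
    show "inj_on (cmap b) (cdom b)" by (simp add: b inj_on_inv_into)
  qed (use that inj in \<open>simp_all add: cran, simp_all add: b\<close>)
qed

lemma circle_atlas_cran:
  assumes "P > 0" shows "(\<Union>b\<in>circle_atlas P. cran b) = UNIV"
proof -
  have "t \<in> (\<Union>b\<in>circle_atlas P. cran b)" for t
  proof -
    let ?a = "t - P / 2"
    let ?b = "\<lparr> cdom = circ P ` {?a<..<?a + P}, cmap = inv_into {?a<..<?a + P} (circ P),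
      cmet = (\<lambda>t v w. v * w) \<rparr>"
    have "?b \<in> circle_atlas P" unfolding circle_atlas_def by blast
    moreover have "cran ?b = {?a<..<?a + P}"
      by (simp only: cran_def rchart.simps inv_into_image_cancel[OF circ_inj_on[OF assms] subset_refl])
    moreover have "t \<in> {?a<..<?a + P}" using assms by simp
    ultimately show ?thesis by blast
  qed
  then show ?thesis by blast
qed

text \<open>\<open>on_circle\<close> picks some representative of the coset; it differs from
  \<open>t\<close> by a multiple of the period, which a periodic map does not see.\<close>

lemma on_circle_eq:
  assumes "\<And>t x y. G (t + P, x, y) = G (t, x, y)"
  shows "on_circle G (circ P t, x, y) = G (t, x, y)"
proof -
  have "periodic P (\<lambda>t. G (t, x, y))" using assms by (simp add: periodic_def)
  from periodic_int[OF this, of t] circ_SOME[of P t] show ?thesis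
    by (auto simp: on_circle_def)
qed

lemma riemannian_manifold_regular:
  assumes "riemannian_manifold X A" "c \<in> A" shows "regular_chart c"
proof -
  have h: "homeomorphic_map (subtopology X (cdom c)) (top_of_set (cran c)) (cmap c)"
    and o: "openin X (cdom c)" using assms by (auto simp: riemannian_manifold_def)
  have "topspace (subtopology X (cdom c)) = cdom c" using openin_subset[OF o] by auto
  then have "inj_on (cmap c) (cdom c)" using homeomorphic_imp_injective_map[OF h] by simp
  then show ?thesis using assms by (auto simp: riemannian_manifold_def regular_chart_def)
qed

lemma riemannian_manifold_nonempty:
  assumes "riemannian_manifold X A" shows "(\<Union>c\<in>A. cran c) \<noteq> {}"
proof -
  have "topspace X \<noteq> {}" "(\<Union>c\<in>A. cdom c) = topspace X"
    using assms unfolding riemannian_manifold_def by blast+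
  then show ?thesis unfolding cran_def by blast
qed

lemma smooth_on_pd:
  assumes "open S" "smooth_on S f" shows "smooth_on S (pd v f)"
proof -
  have "pd v f u = (\<Sum>b\<in>Basis. (v \<bullet> b) *\<^sub>R pd b f u)" if "u \<in> S" for u
  proof -
    note lin = linear_pd[OF smooth_onD(1)[OF assms(2) that]]
    have "pd v f u = pd (\<Sum>b\<in>Basis. (v \<bullet> b) *\<^sub>R b) f u" by (simp add: euclidean_representation)
    then show ?thesis unfolding linear_sum[OF lin] linear_scale[OF lin] .
  qed
  moreover have "smooth_on S (\<lambda>u. \<Sum>b\<in>Basis. (v \<bullet> b) *\<^sub>R pd b f u)"
    by (intro smooth_on_sum smooth_on_scaleR assms smooth_on_const smooth_onD(2)[OF assms(2)])
  ultimately show ?thesis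
    using smooth_on_cong[OF assms(1), of "pd v f" "\<lambda>u. \<Sum>b\<in>Basis. (v \<bullet> b) *\<^sub>R pd b f u"] by simp
qed

lemma sphere_atlas_chart:
  fixes c :: "('v::euclidean_space, 'e::euclidean_space) rchart"
  assumes "c \<in> sphere_atlas"
  shows "regular_chart c" "smooth_on (cran c) (cinv c)" "u \<in> cran c \<Longrightarrow> norm (cinv c u) = 1"
proof -
  note A = assms[unfolded sphere_atlas_def mem_Collect_eq]
  then have o: "open (cran c)" and sm: "smooth_on (cran c) (cinv c)"
    and met: "cmet c = (\<lambda>u v w. pd v (cinv c) u \<bullet> pd w (cinv c) u)" by auto
  show "smooth_on (cran c) (cinv c)" by (rule sm)
  have h: "homeomorphic_map (top_of_set (cdom c)) (top_of_set (cran c)) (cmap c)" using A by blast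
  have inj: "inj_on (cmap c) (cdom c)" using homeomorphic_imp_injective_map[OF h] by simp
  have "smooth_on (cran c) (\<lambda>u. cmet c u v w)" for v w
    unfolding met by (intro smooth_on_inner o smooth_on_pd sm)
  moreover have "inner_form (cmet c u)" if u: "u \<in> cran c" for u
  proof -
    note lin = linear_pd[OF smooth_onD(1)[OF sm u]]
    have "pd v (cinv c) u \<noteq> 0" if "v \<noteq> 0" for v
    proof
      assume "pd v (cinv c) u = 0"
      then have "pd v (cinv c) u = pd 0 (cinv c) u" using linear_0[OF lin] by simp
      moreover have "inj (\<lambda>v. pd v (cinv c) u)" using A u by blast
      ultimately show False using \<open>v \<noteq> 0\<close> by (auto dest: injD)
    qed
    moreover have "bilinear (cmet c u)"
      unfolding met bilinear_def
      by (auto intro!: linearI simp: linear_add[OF lin] linear_scale[OF lin] inner_add_left inner_add_right)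
    ultimately show ?thesis by (simp add: inner_form_def met inner_commute)
  qed
  ultimately show "regular_chart c" using inj o by (simp add: regular_chart_def)
  show "norm (cinv c u) = 1" if "u \<in> cran c"
  proof -
    have "cinv c u \<in> cdom c" using that by (simp add: cinv_def cran_def inv_into_into)
    moreover have "cdom c \<subseteq> sphere 0 1" using openin_subset[OF conjunct1[OF A]] by simp
    ultimately show ?thesis by auto
  qed
qed

text \<open>The Hessian of the inclusion of the sphere is normal, with normal part \<open>-g\<close>.\<close>

lemma eigenmap_sphere_inclusion:
  assumes dim: "DIM('v::euclidean_space) = Suc DIM('e::euclidean_space)"
  shows "eigenmap (sphere_atlas :: ('v, 'e) rchart set) (\<lambda>x. x) (real DIM('e))"
proof -
  have "laplacian c (cinv c) u = - real DIM('e) *\<^sub>R cinv c u \<and> diff_norm_sq c (cinv c) u = DIM('e)"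
    if c: "c \<in> sphere_atlas" and u: "u \<in> cran c" for c :: "('v, 'e) rchart" and u
  proof -
    let ?i = "cinv c"
    note C = sphere_atlas_chart[OF c]
    have met: "cmet c = (\<lambda>u v w. pd v ?i u \<bullet> pd w ?i u)" and inj: "inj (\<lambda>v. pd v ?i u)"
      using c u by (auto simp: sphere_atlas_def)
    have o: "open (cran c)" and g: "inner_form (cmet c u)" using C(1) u by (auto simp: regular_chart_def)
    let ?g = "inv_form (cmet c u)"
    have d1: "(?i has_derivative (\<lambda>v. pd v ?i u)) (at u)" if "u \<in> cran c" for u
      by (rule smooth_on_has_derivative[OF C(2) that])
    have d2: "(pd i ?i has_derivative (\<lambda>v. pd v (pd i ?i) u)) (at u)" if "u \<in> cran c" for u i
      by (rule smooth_on_has_derivative[OF smooth_on_pd[OF o C(2)] that])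
    have ii: "?i u \<bullet> ?i u = 1" if "u \<in> cran c" for u using C(3)[OF that] by (simp add: dot_square_norm)
    have z: "pd i (\<lambda>u. r) u = (0::real)" for i u r by (rule pd_eqI[THEN trans]) auto
    have tan: "pd i ?i u \<bullet> ?i u = 0" if u: "u \<in> cran c" for u i
    proof -
      have "pd i (\<lambda>u. ?i u \<bullet> ?i u) u = ?i u \<bullet> pd i ?i u + pd i ?i u \<bullet> ?i u"
        by (rule pd_eqI[OF has_derivative_inner[OF d1[OF u] d1[OF u]]])
      moreover have "pd i (\<lambda>u. ?i u \<bullet> ?i u) u = pd i (\<lambda>u. 1) u" by (rule pd_cong_open[OF o u ii])
      ultimately show ?thesis by (simp add: z inner_commute)
    qed
    have nor: "pd i (pd j ?i) u \<bullet> ?i u = - cmet c u i j" for i j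
    proof -
      have "pd i (\<lambda>u. pd j ?i u \<bullet> ?i u) u = pd j ?i u \<bullet> pd i ?i u + pd i (pd j ?i) u \<bullet> ?i u"
        by (rule pd_eqI[OF has_derivative_inner[OF d2[OF u] d1[OF u]]])
      moreover have "pd i (\<lambda>u. pd j ?i u \<bullet> ?i u) u = pd i (\<lambda>u. 0) u" by (rule pd_cong_open[OF o u tan])
      ultimately show ?thesis by (simp add: z met inner_commute)
    qed
    have dg: "pd m (\<lambda>x. cmet c x i j) u = pd i ?i u \<bullet> pd m (pd j ?i) u + pd m (pd i ?i) u \<bullet> pd j ?i u" for m i j
      unfolding met by (rule pd_eqI[OF has_derivative_inner[OF d2[OF u] d2[OF u]]])
    \<comment> \<open>By the symmetry of second derivatives four of the six terms cancel in pairs,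
      and the other two are equal.\<close>
    have low: "christoffel_low c u i j l = pd i (pd j ?i) u \<bullet> pd l ?i u"
      if "i \<in> Basis" "j \<in> Basis" "l \<in> Basis" for i j l
      using pd_commute[OF o u C(2) that(1,2)] pd_commute[OF o u C(2) that(1,3)] pd_commute[OF o u C(2) that(2,3)]
      by (simp add: christoffel_low_def dg inner_commute)
    define H where "H = (\<Sum>i\<in>Basis. \<Sum>j\<in>Basis. ?g i j *\<^sub>R pd i (pd j ?i) u)"
    have tr: "christoffel_trace c u l = H \<bullet> pd l ?i u" if "l \<in> Basis" for l
      using that by (simp add: christoffel_trace_def low H_def inner_sum_left)
    have Hn: "H \<bullet> ?i u = - DIM('e)"
      using inv_form_trace[OF g] by (simp add: H_def inner_sum_left nor sum_negf)
    let ?L = "laplacian c ?i u"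
    have L: "?L = H - (\<Sum>k\<in>Basis. (\<Sum>l\<in>Basis. ?g k l * (H \<bullet> pd l ?i u)) *\<^sub>R pd k ?i u)"
      unfolding laplacian_eq H_def[symmetric] by (simp add: tr)
    have Ln: "?L \<bullet> ?i u = - DIM('e)"
      unfolding L by (simp add: inner_diff_left inner_sum_left tan[OF u] Hn)
    \<comment> \<open>The Christoffel term removes exactly the tangential part of
      \<open>H\<close>.\<close>
    have Lt: "?L \<bullet> pd m ?i u = 0" if "m \<in> Basis" for m
    proof -
      have "(\<Sum>k\<in>Basis. (\<Sum>l\<in>Basis. ?g k l * (H \<bullet> pd l ?i u)) * cmet c u k m)
        = (\<Sum>k\<in>Basis. \<Sum>l\<in>Basis. (H \<bullet> pd l ?i u) * (?g k l * cmet c u k m))"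
        by (simp add: sum_distrib_left mult_ac)
      also have "\<dots> = (\<Sum>l\<in>Basis. \<Sum>k\<in>Basis. (H \<bullet> pd l ?i u) * (?g k l * cmet c u k m))"
        by (rule sum.swap)
      also have "\<dots> = (\<Sum>l\<in>Basis. (H \<bullet> pd l ?i u) * (if l = m then 1 else 0))"
      proof (rule sum.cong[OF refl])
        fix l :: 'e assume l: "l \<in> Basis"
        have "(\<Sum>k\<in>Basis. ?g k l * cmet c u k m) = (\<Sum>k\<in>Basis. ?g l k * cmet c u k m)"
          by (rule sum.cong) (auto simp: inv_form_sym[OF g _ l])
        then show "(\<Sum>k\<in>Basis. (H \<bullet> pd l ?i u) * (?g k l * cmet c u k m)) = (H \<bullet> pd l ?i u) * (if l = m then 1 else 0)"
          using inv_form_left[OF g l that] by (simp add: sum_distrib_left[symmetric])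
      qed
      also have "\<dots> = H \<bullet> pd m ?i u" using that by (simp add: if_distrib cong: if_cong)
      finally show ?thesis
        unfolding L by (simp add: inner_diff_left inner_sum_left met)
    qed
    note lin = linear_pd[OF smooth_onD(1)[OF C(2) u]]
    \<comment> \<open>To be shown to vanish: it is orthogonal to the position vector and to every
      tangent vector.\<close>
    define W where "W = ?L + real DIM('e) *\<^sub>R ?i u"
    have Wn: "W \<bullet> ?i u = 0" by (simp add: W_def inner_add_left Ln ii[OF u])
    have Wt: "W \<bullet> pd v ?i u = 0" for v
    proof -
      have "pd v ?i u = pd (\<Sum>b\<in>Basis. (v \<bullet> b) *\<^sub>R b) ?i u" by (simp add: euclidean_representation)
      also have "\<dots> = (\<Sum>b\<in>Basis. (v \<bullet> b) *\<^sub>R pd b ?i u)" unfolding linear_sum[OF lin] linear_scale[OF lin] ..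
      finally show ?thesis
        using tan[OF u] by (simp add: inner_sum_right W_def inner_add_left Lt inner_commute[of "?i u"])
    qed
    \<comment> \<open>Position vector and tangent space together span the ambient space:
      \<open>f\<close> is injective between spaces of equal dimension, hence onto, and
      \<open>W\<close> is orthogonal to its range.\<close>
    define f where "f = (\<lambda>p::real \<times> 'e. fst p *\<^sub>R ?i u + pd (snd p) ?i u)"
    have lf: "linear f"
      by (rule linearI) (simp_all add: f_def linear_add[OF lin] linear_scale[OF lin] algebra_simps)
    have "inj f"
      unfolding linear_injective_0[OF lf]
    proof safe
      fix r v assume "f (r, v) = 0"
      then have f0: "r *\<^sub>R ?i u + pd v ?i u = 0" by (simp add: f_def)
      from arg_cong[OF this, of "\<lambda>w. w \<bullet> ?i u"] have r: "r = 0"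
        by (simp add: inner_add_left ii[OF u] tan[OF u])
      then have "pd v ?i u = pd 0 ?i u" using f0 linear_0[OF lin] by simp
      then have "v = 0" using inj by (auto dest: injD)
      then show "(r, v) = 0" using r by (simp add: zero_prod_def)
    qed
    then have "surj f"
      using linear_injective_imp_surjective[OF lf] dim by simp
    then obtain p where "W = f p" by (metis surjD)
    then have "W \<bullet> W = W \<bullet> f p" by simp
    then have "W = 0" by (simp add: f_def inner_add_right Wn Wt)
    then have "?L = - real DIM('e) *\<^sub>R ?i u" by (simp add: W_def add_eq_0_iff)
    moreover have "diff_norm_sq c ?i u = DIM('e)"
      using inv_form_trace[OF g] by (simp add: diff_norm_sq_def met)
    ultimately show ?thesis by blast
  qed
  moreover have "smooth_map (sphere_atlas :: ('v, 'e) rchart set) (\<lambda>x. x)"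
    using sphere_atlas_chart(2) by (auto simp: smooth_map_def o_def)
  moreover have "norm (cinv c u) = 1" if "c \<in> sphere_atlas" "u \<in> cran c" for c :: "('v, 'e) rchart" and u
    using sphere_atlas_chart(3)[OF that] .
  ultimately show ?thesis by (simp add: eigenmap_def o_def)
qed

section \<open>Warped products are Riemannian manifolds\<close>

lemma riemannian_manifoldD:
  assumes "riemannian_manifold X A"
  shows "topspace X \<noteq> {}" "Hausdorff_space X" "second_countable_space X" "(\<Union>c\<in>A. cdom c) = topspace X"
    "c \<in> A \<Longrightarrow> openin X (cdom c)" "c \<in> A \<Longrightarrow> open (cran c)"
    "c \<in> A \<Longrightarrow> homeomorphic_map (subtopology X (cdom c)) (top_of_set (cran c)) (cmap c)"
    "c \<in> A \<Longrightarrow> c' \<in> A \<Longrightarrow> compatible_charts c c'"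
  using assms[unfolded riemannian_manifold_def] by (elim conjE, simp)+

lemma second_countable_spaceI:
  assumes "countable B" "\<And>V. V \<in> B \<Longrightarrow> openin X V"
    "\<And>U x. openin X U \<Longrightarrow> x \<in> U \<Longrightarrow> \<exists>V\<in>B. x \<in> V \<and> V \<subseteq> U"
  shows "second_countable_space X"
  unfolding second_countable_space_def using assms by (intro exI[of _ B] conjI ballI allI impI) auto

lemma second_countable_space_prod:
  assumes "second_countable_space X" "second_countable_space Y"
  shows "second_countable_space (prod_topology X Y)"
proof -
  obtain A where A': "countable A" "\<forall>V\<in>A. openin X V"
    "\<forall>U x. openin X U \<and> x \<in> U \<longrightarrow> (\<exists>V\<in>A. x \<in> V \<and> V \<subseteq> U)"
    using assms(1) unfolding second_countable_space_def by (elim exE conjE)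
  note A = A'(1) A'(2)[rule_format] A'(3)[rule_format, OF conjI]
  obtain B where B': "countable B" "\<forall>V\<in>B. openin Y V"
    "\<forall>U x. openin Y U \<and> x \<in> U \<longrightarrow> (\<exists>V\<in>B. x \<in> V \<and> V \<subseteq> U)"
    using assms(2) unfolding second_countable_space_def by (elim exE conjE)
  note B = B'(1) B'(2)[rule_format] B'(3)[rule_format, OF conjI]
  let ?C = "(\<lambda>(U, V). U \<times> V) ` (A \<times> B)"
  have "countable ?C" using A(1) B(1) by auto
  moreover have "openin (prod_topology X Y) W" if "W \<in> ?C" for W
    using that A(2) B(2) by (auto simp: openin_prod_Times_iff)
  moreover have "\<exists>V\<in>?C. z \<in> V \<and> V \<subseteq> W" if W: "openin (prod_topology X Y) W" "z \<in> W" for W z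
  proof -
    obtain x y where z: "z = (x, y)" by (cases z)
    obtain U V where UV: "openin X U" "openin Y V" "x \<in> U" "y \<in> V" "U \<times> V \<subseteq> W"
      using openin_prod_topology_alt[THEN iffD1, OF W(1)] W(2) unfolding z by meson
    obtain U' where U': "U' \<in> A" "x \<in> U'" "U' \<subseteq> U" using A(3)[OF UV(1,3)] by blast
    obtain V' where V': "V' \<in> B" "y \<in> V'" "V' \<subseteq> V" using B(3)[OF UV(2,4)] by blast
    have "U' \<times> V' \<in> ?C" using U'(1) V'(1) by (intro image_eqI[of _ _ "(U', V')"]) auto
    moreover have "z \<in> U' \<times> V'" "U' \<times> V' \<subseteq> W" using U' V' UV(5) z by auto
    ultimately show ?thesis by blast
  qed
  ultimately show ?thesis by (rule second_countable_spaceI)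
qed

lemma top_of_set_Times:
  "top_of_set (S \<times> T) = prod_topology (top_of_set S) (top_of_set T)"
  by (metis subtopology_Times prod_topology_euclidean)

lemma homeomorphic_map_prod:
  assumes "homeomorphic_map X X' f" "homeomorphic_map Y Y' g"
  shows "homeomorphic_map (prod_topology X Y) (prod_topology X' Y') (\<lambda>(x, y). (f x, g y))"
proof -
  obtain f' g' where "homeomorphic_maps X X' f f'" "homeomorphic_maps Y Y' g g'"
    using assms by (auto simp: homeomorphic_map_maps)
  then have "homeomorphic_maps (prod_topology X Y) (prod_topology X' Y')
      (\<lambda>(x,y). (f x, g y)) (\<lambda>(x,y). (f' x, g' y))"
    by (simp add: homeomorphic_maps_prod)
  then show ?thesis by (auto simp: homeomorphic_map_maps)
qed

lemma open_chart_overlap: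
  assumes "openin X (cdom c)" "openin X (cdom c')" "open (cran c)"
    and h: "homeomorphic_map (subtopology X (cdom c)) (top_of_set (cran c)) (cmap c)"
  shows "open (cmap c ` (cdom c \<inter> cdom c'))"
proof -
  have "openin (subtopology X (cdom c)) (cdom c \<inter> cdom c')"
    unfolding openin_subtopology using assms(2) by (intro exI[of _ "cdom c'"]) (simp add: Int_commute)
  then have "openin (top_of_set (cran c)) (cmap c ` (cdom c \<inter> cdom c'))"
    using homeomorphic_imp_open_map[OF h] by (simp add: open_map_def)
  then show ?thesis using assms(3) by (simp add: openin_open_eq)
qed

lemma pd_product_map:
  assumes "T0 differentiable (at t)" "T1 differentiable (at x)" "T2 differentiable (at y)"
  shows "((\<lambda>(t, x, y). (T0 t, T1 x, T2 y)) has_derivative (\<lambda>(r, v, w). (pd r T0 t, pd v T1 x, pd w T2 y)))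
    (at (t, x, y))"
proof -
  note D = has_derivative_pd[OF assms(1)] has_derivative_pd[OF assms(2)] has_derivative_pd[OF assms(3)]
  have f0: "(fst has_derivative fst) (at z)" and f1: "((\<lambda>z. fst (snd z)) has_derivative (\<lambda>z. fst (snd z))) (at z)"
    and f2: "((\<lambda>z. snd (snd z)) has_derivative (\<lambda>z. snd (snd z))) (at z)" for z :: "'a \<times> 'c \<times> 'e"
    by (auto intro!: derivative_eq_intros)
  have "((\<lambda>z. (T0 (fst z), T1 (fst (snd z)), T2 (snd (snd z)))) has_derivative
    (\<lambda>z. (pd (fst z) T0 t, pd (fst (snd z)) T1 x, pd (snd (snd z)) T2 y))) (at (t, x, y))"
    using has_derivative_compose[OF f0, of T0 "\<lambda>v. pd v T0 t" "(t, x, y)"]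
      has_derivative_compose[OF f1, of T1 "\<lambda>v. pd v T1 x" "(t, x, y)"]
      has_derivative_compose[OF f2, of T2 "\<lambda>v. pd v T2 y" "(t, x, y)"] D
    by (intro has_derivative_Pair) simp_all
  then show ?thesis by (simp add: case_prod_unfold)
qed

lemma image_Times3:
  "(\<lambda>(s, z). (f s, (\<lambda>(x, y). (g x, h y)) z)) ` (A \<times> B \<times> C) = f ` A \<times> g ` B \<times> h ` C"
  (is "?f ` _ = _")
proof (rule equalityI)
  show "f ` A \<times> g ` B \<times> h ` C \<subseteq> ?f ` (A \<times> B \<times> C)"
  proof
    fix w assume "w \<in> f ` A \<times> g ` B \<times> h ` C"
    then obtain a b c where "a \<in> A" "b \<in> B" "c \<in> C" "w = (f a, g b, h c)" by auto
    then show "w \<in> ?f ` (A \<times> B \<times> C)" by (intro image_eqI[of _ _ "(a, b, c)"]) auto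
  qed
qed auto

lemma warped_atlas_image:
  "warped_atlas l1 l2 B A1 A2 = (\<lambda>(b, c1, c2). warped_chart l1 l2 b c1 c2) ` (B \<times> A1 \<times> A2)"
  by (force simp: warped_atlas_def image_iff)

text \<open>The warps are functions of the base coordinate, not of the base point. The last
  hypothesis says that they do not depend on the chart in which this coordinate is read, and it
  makes the product metrics agree on overlaps.\<close>

lemma riemannian_manifold_warped:
  fixes A1 :: "('a, 'e::euclidean_space) rchart set" and A2 :: "('b, 'f::euclidean_space) rchart set"
  assumes M0: "riemannian_manifold X0 B" and M1: "riemannian_manifold X1 A1" and M2: "riemannian_manifold X2 A2"
    and flat: "\<And>b. b \<in> B \<Longrightarrow> flat_chart b"
    and l: "smooth_on UNIV l1" "smooth_on UNIV l2" "\<And>t. l1 t > 0" "\<And>t. l2 t > 0"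
    and inv: "\<And>b b' t. b \<in> B \<Longrightarrow> b' \<in> B \<Longrightarrow> t \<in> cmap b ` (cdom b \<inter> cdom b') \<Longrightarrow>
      l1 (cmap b' (cinv b t)) = l1 t \<and> l2 (cmap b' (cinv b t)) = l2 t"
  shows "riemannian_manifold (prod_topology X0 (prod_topology X1 X2)) (warped_atlas l1 l2 B A1 A2)"
  unfolding riemannian_manifold_def
proof (intro conjI ballI)
  let ?X = "prod_topology X0 (prod_topology X1 X2)" and ?A = "warped_atlas l1 l2 B A1 A2"
  note M0' = riemannian_manifoldD[OF M0] and M1' = riemannian_manifoldD[OF M1]
    and M2' = riemannian_manifoldD[OF M2]
  note cov = M0'(4) M1'(4) M2'(4)
  show "topspace ?X \<noteq> {}" using M0'(1) M1'(1) M2'(1) by simp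
  show "Hausdorff_space ?X" using M0'(2) M1'(2) M2'(2) by (simp add: Hausdorff_space_prod_topology)
  show "second_countable_space ?X" using M0'(3) M1'(3) M2'(3) by (simp add: second_countable_space_prod)
  have dom: "cdom (warped_chart l1 l2 b c1 c2) = cdom b \<times> cdom c1 \<times> cdom c2" for b :: "('c, real) rchart" and c1 :: "('a, 'e) rchart" and c2 :: "('b, 'f) rchart"
    by (simp add: warped_chart_def)
  show "(\<Union>c\<in>?A. cdom c) = topspace ?X"
  proof -
    have "(\<Union>c\<in>?A. cdom c) = (\<Union>c\<in>B. cdom c) \<times> (\<Union>c\<in>A1. cdom c) \<times> (\<Union>c\<in>A2. cdom c)"
      by (auto simp: warped_atlas_image dom)
    then show ?thesis by (simp add: cov)
  qed
  have rep: "\<exists>b c1 c2. C = warped_chart l1 l2 b c1 c2 \<and> b \<in> B \<and> c1 \<in> A1 \<and> c2 \<in> A2" if "C \<in> ?A" for C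
    using that by (auto simp: warped_atlas_def)
  fix C assume C: "C \<in> ?A"
  then obtain b c1 c2 where bcc: "C = warped_chart l1 l2 b c1 c2" "b \<in> B" "c1 \<in> A1" "c2 \<in> A2" using rep by blast
  have H: "openin X0 (cdom b)" "openin X1 (cdom c1)" "openin X2 (cdom c2)"
    "open (cran b)" "open (cran c1)" "open (cran c2)"
    "homeomorphic_map (subtopology X0 (cdom b)) (top_of_set (cran b)) (cmap b)"
    "homeomorphic_map (subtopology X1 (cdom c1)) (top_of_set (cran c1)) (cmap c1)"
    "homeomorphic_map (subtopology X2 (cdom c2)) (top_of_set (cran c2)) (cmap c2)"
    using M0'(5-7)[OF bcc(2)] M1'(5-7)[OF bcc(3)] M2'(5-7)[OF bcc(4)] by simp_all
  note fl = flat[OF bcc(2)]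
  note r = riemannian_manifold_regular[OF M1 bcc(3)] riemannian_manifold_regular[OF M2 bcc(4)]
  show "openin ?X (cdom C)" using H by (simp add: bcc(1) dom openin_prod_Times_iff)
  show O: "open (cran C)" using H by (simp add: bcc(1) cran_warped open_Times)
  have cm: "cmap C = (\<lambda>(s, z). (cmap b s, (\<lambda>(x, y). (cmap c1 x, cmap c2 y)) z))"
    by (auto simp: bcc(1) warped_chart_def)
  show "homeomorphic_map (subtopology ?X (cdom C)) (top_of_set (cran C)) (cmap C)"
    unfolding cm unfolding bcc(1) dom cran_warped subtopology_Times top_of_set_Times
    by (intro homeomorphic_map_prod H)
  have "smooth_on (cran C) (\<lambda>u. cmet C u v w)" for v w :: "real \<times> 'e \<times> 'f"
  proof -
    obtain v0 v1 v2 w0 w1 w2 where vw: "v = (v0, v1, v2)" "w = (w0, w1, w2)" by (cases v, cases w) auto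
    have p: "smooth_on (cran C) (\<lambda>z. fst z)" "smooth_on (cran C) (\<lambda>z. fst (snd z))"
      "smooth_on (cran C) (\<lambda>z. snd (snd z))"
      by (intro smooth_on_fst smooth_on_snd O smooth_on_ident)+
    have s: "smooth_on (cran c1) (\<lambda>x. cmet c1 x v1 w1)" "smooth_on (cran c2) (\<lambda>x. cmet c2 x v2 w2)"
      using r by (auto simp: regular_chart_def)
    have eq: "(\<lambda>u. cmet C u v w) = (\<lambda>z. v0 * w0 + (l1 (fst z))\<^sup>2 * cmet c1 (fst (snd z)) v1 w1
      + (l2 (fst z))\<^sup>2 * cmet c2 (snd (snd z)) v2 w2)"
      using cmet_warped[OF fl, of l1 l2 c1 c2] by (auto simp: fun_eq_iff warped_form_def vw bcc(1))
    show "smooth_on (cran C) (\<lambda>u. cmet C u v w)"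
      unfolding eq
      by (intro smooth_on_add smooth_on_mult smooth_on_power smooth_on_const O
         smooth_on_compose[OF l(1) p(1) O] smooth_on_compose[OF l(2) p(1) O]
         smooth_on_compose[OF s(1) p(2) O] smooth_on_compose[OF s(2) p(3) O])
        (auto simp: bcc(1) cran_warped)
  qed
  then show "\<forall>v w. smooth_on (cran C) (\<lambda>u. cmet C u v w)" by blast
  show "inner_form (cmet C u)" if "u \<in> cran C" for u
  proof -
    obtain t x y where u: "u = (t, x, y)" by (cases u)
    then have "x \<in> cran c1" "y \<in> cran c2" using that by (auto simp: bcc(1) cran_warped)
    then show ?thesis
      unfolding u bcc(1) cmet_warped[OF fl] using r l(3,4)[of t]
      by (intro inner_form_warped) (auto simp: regular_chart_def)
  qed
  fix C' assume C': "C' \<in> ?A"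
  then obtain b' c1' c2' where bcc': "C' = warped_chart l1 l2 b' c1' c2'" "b' \<in> B" "c1' \<in> A1" "c2' \<in> A2"
    using rep by blast
  have H': "openin X0 (cdom b')" "openin X1 (cdom c1')" "openin X2 (cdom c2')"
    using M0'(5)[OF bcc'(2)] M1'(5)[OF bcc'(3)] M2'(5)[OF bcc'(4)] by simp_all
  define S0 where "S0 = cmap b ` (cdom b \<inter> cdom b')"
  define S1 where "S1 = cmap c1 ` (cdom c1 \<inter> cdom c1')"
  define S2 where "S2 = cmap c2 ` (cdom c2 \<inter> cdom c2')"
  define T0 where "T0 = cmap b' \<circ> cinv b"
  define T1 where "T1 = cmap c1' \<circ> cinv c1"
  define T2 where "T2 = cmap c2' \<circ> cinv c2"
  have oS: "open S0" "open S1" "open S2"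
    unfolding S0_def S1_def S2_def
    by (rule open_chart_overlap[OF H(1) H'(1) H(4) H(7)], rule open_chart_overlap[OF H(2) H'(2) H(5) H(8)],
      rule open_chart_overlap[OF H(3) H'(3) H(6) H(9)])
  have sub: "S0 \<subseteq> cran b" "S1 \<subseteq> cran c1" "S2 \<subseteq> cran c2"
    by (auto simp: S0_def S1_def S2_def cran_def)
  have com: "compatible_charts b b'" "compatible_charts c1 c1'" "compatible_charts c2 c2'"
    using M0'(8)[OF bcc(2) bcc'(2)] M1'(8)[OF bcc(3) bcc'(3)] M2'(8)[OF bcc(4) bcc'(4)] by simp_all
  have sT: "smooth_on S0 T0" "smooth_on S1 T1" "smooth_on S2 T2"
    using com unfolding compatible_charts_def Let_def S0_def S1_def S2_def T0_def T1_def T2_def by simp_all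
  have met: "u \<in> S0 \<Longrightarrow> cmet b u r s = cmet b' (T0 u) (pd r T0 u) (pd s T0 u)"
    "x \<in> S1 \<Longrightarrow> cmet c1 x v1 w1 = cmet c1' (T1 x) (pd v1 T1 x) (pd w1 T1 x)"
    "y \<in> S2 \<Longrightarrow> cmet c2 y v2 w2 = cmet c2' (T2 y) (pd v2 T2 y) (pd w2 T2 y)" for u r s x v1 w1 y v2 w2
    using com unfolding compatible_charts_def Let_def S0_def S1_def S2_def T0_def T1_def T2_def
    by (auto simp del: o_apply)
  let ?S = "S0 \<times> S1 \<times> S2" and ?T = "\<lambda>(t, x, y). (T0 t, T1 x, T2 y)"
  have oSS: "open ?S" using oS by (simp add: open_Times)
  have S: "cmap C ` (cdom C \<inter> cdom C') = ?S"
    unfolding cm unfolding bcc(1) bcc'(1) dom S0_def S1_def S2_def Times_Int_Times by (rule image_Times3)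
  have T: "(cmap C' \<circ> cinv C) u = ?T u" if "u \<in> ?S" for u
  proof -
    obtain t x y where u: "u = (t, x, y)" by (cases u)
    then have "t \<in> cran b" "x \<in> cran c1" "y \<in> cran c2" using that sub by auto
    moreover have "inj_on (cmap b) (cdom b)" "inj_on (cmap c1) (cdom c1)" "inj_on (cmap c2) (cdom c2)"
      using fl r by (auto simp: flat_chart_def regular_chart_def)
    ultimately show ?thesis
      unfolding u bcc(1) bcc'(1) by (simp add: cinv_warped T0_def T1_def T2_def) (simp add: warped_chart_def)
  qed
  have d: "(?T has_derivative (\<lambda>(r, v, w). (pd r T0 t, pd v T1 x, pd w T2 y))) (at (t, x, y))"
    if "t \<in> S0" "x \<in> S1" "y \<in> S2" for t x y
    using that sT by (intro pd_product_map smooth_onD(1))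
  show "compatible_charts C C'"
    unfolding compatible_charts_def Let_def S
  proof (intro conjI ballI allI)
    have p: "smooth_on ?S (\<lambda>z. fst z)" "smooth_on ?S (\<lambda>z. fst (snd z))" "smooth_on ?S (\<lambda>z. snd (snd z))"
      by (intro smooth_on_fst smooth_on_snd oSS smooth_on_ident)+
    have "smooth_on ?S (\<lambda>z. (T0 (fst z), T1 (fst (snd z)), T2 (snd (snd z))))"
      by (intro smooth_on_Pair oSS smooth_on_compose[OF sT(1) p(1) oSS]
         smooth_on_compose[OF sT(2) p(2) oSS] smooth_on_compose[OF sT(3) p(3) oSS]) auto
    then have "smooth_on ?S ?T" by (simp add: case_prod_unfold)
    then show "smooth_on ?S (cmap C' \<circ> cinv C)" using smooth_on_cong[OF oSS, of ?T "cmap C' \<circ> cinv C"] T by simp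
    fix u v w :: "real \<times> 'e \<times> 'f" assume u: "u \<in> ?S"
    obtain t x y where u': "u = (t, x, y)" by (cases u)
    obtain v0 v1 v2 w0 w1 w2 where vw: "v = (v0, v1, v2)" "w = (w0, w1, w2)" by (cases v, cases w) auto
    have txy: "t \<in> S0" "x \<in> S1" "y \<in> S2" using u u' by auto
    have P: "pd z (cmap C' \<circ> cinv C) u = (\<lambda>(r, v, w). (pd r T0 t, pd v T1 x, pd w T2 y)) z" for z
      using pd_cong_open[OF oSS u, of "cmap C' \<circ> cinv C" ?T z] T pd_eqI[OF d[OF txy], of z] by (simp add: u')
    have l': "l1 (T0 t) = l1 t" "l2 (T0 t) = l2 t"
      using inv[OF bcc(2) bcc'(2), of t] txy(1) by (auto simp: S0_def T0_def)
    have flb: "cmet b = (\<lambda>t v w. v * w)" "cmet b' = (\<lambda>t v w. v * w)"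
      using fl flat[OF bcc'(2)] by (auto simp: flat_chart_def)
    \<comment> \<open>Compatibility of two flat charts: the base transition preserves dt^2.\<close>
    have "v0 * w0 = pd v0 T0 t * pd w0 T0 t" using met(1)[OF txy(1), of v0 w0] by (simp add: flb)
    then have "cmet C (t, x, y) v w = cmet C' (T0 t, T1 x, T2 y) (pd v0 T0 t, pd v1 T1 x, pd v2 T2 y)
      (pd w0 T0 t, pd w1 T1 x, pd w2 T2 y)"
      unfolding bcc(1) bcc'(1) cmet_warped[OF fl] cmet_warped[OF flat[OF bcc'(2)]] vw
      by (simp add: warped_form_def met(2)[OF txy(2), of v1 w1] met(3)[OF txy(3), of v2 w2] l')
    then show "cmet C u v w = cmet C' ((cmap C' \<circ> cinv C) u) (pd v (cmap C' \<circ> cinv C) u) (pd w (cmap C' \<circ> cinv C) u)"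
      unfolding P T[OF u] by (simp add: u' vw)
  qed
qed

lemma second_countable_euclidean:
  "second_countable_space (euclidean :: 'a::second_countable_topology topology)"
proof -
  obtain B :: "'a set set" where B: "countable B" "topological_basis B" using ex_countable_basis by blast
  show ?thesis
  proof (rule second_countable_spaceI[OF B(1)])
    show "openin euclidean V" if "V \<in> B" for V using topological_basis_open[OF B(2) that] by simp
    fix U and x :: 'a assume "openin euclidean U" "x \<in> U"
    then obtain V where "V \<in> B" "x \<in> V" "V \<subseteq> U" using topological_basisE[OF B(2), of U x] by auto
    then show "\<exists>V\<in>B. x \<in> V \<and> V \<subseteq> U" by blast
  qed
qed

lemma riemannian_manifold_line: "riemannian_manifold euclideanreal (line_atlas UNIV)"
proof -
  have i: "inv_into UNIV id = (id :: real \<Rightarrow> real)" by (simp add: fun_eq_iff inv_id)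
  have p: "pd v id u = v" for v u :: real by (rule pd_eqI[THEN trans, OF has_derivative_id]) simp
  have s: "smooth_on UNIV (id :: real \<Rightarrow> real)" using smooth_on_ident by (simp add: id_def)
  have "inner_form (\<lambda>v w :: real. v * w)"
    by (auto simp: inner_form_def bilinear_def mult.commute intro!: linearI simp: algebra_simps)
      (metis not_real_square_gt_zero)
  then show ?thesis
    unfolding riemannian_manifold_def line_atlas_def compatible_charts_def Let_def cran_def cinv_def
    by (simp add: second_countable_euclidean i p s Hausdorff_space_euclidean)
qed

section \<open>The circle as a quotient of the line\<close>

lemma topspace_circle: "topspace (circle_topology P) = range (circ P)"
proof (rule equalityI)
  show "topspace (circle_topology P) \<subseteq> range (circ P)"
    using openin_topspace[of "circle_topology P", unfolded openin_circle_topology] by simp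
  have "openin (circle_topology P) (range (circ P))" by (simp add: openin_circle_topology vimage_def)
  then show "range (circ P) \<subseteq> topspace (circle_topology P)" by (rule openin_subset)
qed

lemma openin_circ_image:
  assumes "open U" shows "openin (circle_topology P) (circ P ` U)"
proof -
  have "circ P -` circ P ` U = (\<Union>k::int. (\<lambda>t. t + of_int k * P) ` U)"
  proof (rule equalityI; rule subsetI)
    fix t assume "t \<in> circ P -` circ P ` U"
    then obtain s where s: "s \<in> U" "circ P t = circ P s" by auto
    then obtain k :: int where "t = s + of_int k * P" using circ_eq_iff[of P t s] by auto
    then show "t \<in> (\<Union>k::int. (\<lambda>t. t + of_int k * P) ` U)" using s(1) by blast
  next
    fix t assume "t \<in> (\<Union>k::int. (\<lambda>t. t + of_int k * P) ` U)"
    then obtain s and k :: int where "s \<in> U" "t = s + of_int k * P" by blast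
    then show "t \<in> circ P -` circ P ` U" by (simp add: circ_add_int)
  qed
  moreover have "open ((\<lambda>t. t + of_int k * P) ` U)" for k :: int
    using open_translation[OF assms, of "of_int k * P"] by (simp add: add.commute)
  then have "open (\<Union>k::int. (\<lambda>t. t + of_int k * P) ` U)" by (intro open_UN ballI)
  ultimately have "open (circ P -` circ P ` U)" by simp
  then show ?thesis by (auto simp: openin_circle_topology)
qed

text \<open>The map \<open>cis (2 * pi * t / P)\<close> descends to a continuous injection of the
  circle into the complex plane, and separation is inherited along it.\<close>

lemma Hausdorff_circle:
  assumes "P > 0" shows "Hausdorff_space (circle_topology P)"
proof -
  define E where "E c = cis (2 * pi * (SOME t. t \<in> c) / P)" for c
  have E: "E (circ P t) = cis (2 * pi * t / P)" for t
  proof -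
    obtain k :: int where k: "(SOME s. s \<in> circ P t) = t + of_int k * P" using circ_SOME by blast
    have "2 * pi * (t + of_int k * P) / P = 2 * pi * t / P + 2 * pi * of_int k"
      using assms by (simp add: field_simps)
    then show ?thesis by (simp add: E_def k cis_mult[symmetric])
  qed
  have "continuous_map (circle_topology P) euclidean E"
    unfolding continuous_map_def topspace_circle
  proof (intro conjI allI impI)
    fix U :: "complex set" assume "openin euclidean U"
    moreover have "circ P -` {x \<in> range (circ P). E x \<in> U} = (\<lambda>t. cis (2 * pi * t / P)) -` U"
      by (auto simp: E)
    moreover have "continuous_on UNIV (\<lambda>t. cis (2 * pi * t / P))" by (intro continuous_intros) (use assms in auto)
    ultimately show "openin (circle_topology P) {x \<in> range (circ P). E x \<in> U}"
      by (auto simp: openin_circle_topology continuous_on_open_vimage)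
  qed auto
  moreover have "inj_on E (topspace (circle_topology P))"
  proof (rule inj_onI)
    fix x y assume "x \<in> topspace (circle_topology P)" "y \<in> topspace (circle_topology P)" and e: "E x = E y"
    then obtain s t where st: "x = circ P s" "y = circ P t" by (auto simp: topspace_circle)
    with e have "cis (2 * pi * s / P) = cis (2 * pi * t / P)" by (simp add: E)
    then have "sin (2 * pi * s / P) = sin (2 * pi * t / P) \<and> cos (2 * pi * s / P) = cos (2 * pi * t / P)"
      by (simp add: complex_eq_iff)
    then obtain k :: int where "2 * pi * s / P = 2 * pi * t / P + 2 * pi * of_int k"
      unfolding sin_cos_eq_iff by blast
    then have "2 * pi * s = 2 * pi * (t + of_int k * P)" using assms by (simp add: field_simps)
    then show "x = y" using st by (auto simp: circ_eq_iff)
  qed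
  ultimately show ?thesis using Hausdorff_space_injective_preimage Hausdorff_space_euclidean by blast
qed

lemma second_countable_circle: "second_countable_space (circle_topology P)"
proof -
  obtain B :: "real set set" where B: "countable B" "topological_basis B" using ex_countable_basis by blast
  have "\<exists>V\<in>(image (circ P)) ` B. x \<in> V \<and> V \<subseteq> U" if U: "openin (circle_topology P) U" "x \<in> U" for U x
  proof -
    have "open (circ P -` U)" "U \<subseteq> range (circ P)" using U by (auto simp: openin_circle_topology)
    moreover from this U obtain t where t: "x = circ P t" by blast
    ultimately obtain V where V: "V \<in> B" "t \<in> V" "V \<subseteq> circ P -` U"
      using topological_basisE[OF B(2), of "circ P -` U" t] U by auto
    show ?thesis using V t by (intro bexI[of _ "circ P ` V"]) auto
  qed
  note nb = this
  show ?thesis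
  proof (rule second_countable_spaceI)
    show "countable ((image (circ P)) ` B)" using B(1) by simp
    show "openin (circle_topology P) V" if "V \<in> (image (circ P)) ` B" for V
      using that openin_circ_image topological_basis_open[OF B(2)] by auto
  qed (rule nb)
qed

lemma homeomorphic_map_circle_chart:
  assumes "P > 0"
  defines "I \<equiv> \<lambda>a. {a<..<a + P}"
  shows "homeomorphic_map (subtopology (circle_topology P) (circ P ` I a)) (top_of_set (I a)) (inv_into (I a) (circ P))"
proof -
  have inj: "inj_on (circ P) (I a)" unfolding I_def by (rule circ_inj_on[OF assms(1)])
  let ?Y = "subtopology (circle_topology P) (circ P ` I a)"
  have ts: "topspace ?Y = circ P ` I a" by (auto simp: topspace_circle)
  have oI: "open (I a)" by (simp add: I_def)
  have "continuous_map ?Y (top_of_set (I a)) (inv_into (I a) (circ P))"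
    unfolding continuous_map_def ts
  proof (intro conjI allI impI)
    show "inv_into (I a) (circ P) \<in> circ P ` I a \<rightarrow> topspace (top_of_set (I a))"
      by (auto simp: inj)
    fix W assume "openin (top_of_set (I a)) W"
    then have W: "open W" "W \<subseteq> I a" using oI by (auto simp: openin_open_eq)
    then have "{x \<in> circ P ` I a. inv_into (I a) (circ P) x \<in> W} = circ P ` W"
      using inj by (auto simp: inv_into_f_f subset_iff image_iff)
    moreover have "openin ?Y (circ P ` W)"
      using openin_circ_image[OF W(1), of P] W(2)
      by (metis image_mono inf.absorb1 openin_subtopology)
    ultimately show "openin ?Y {x \<in> circ P ` I a. inv_into (I a) (circ P) x \<in> W}" by simp
  qed
  moreover have "continuous_map (top_of_set (I a)) ?Y (circ P)"
    unfolding continuous_map_in_subtopology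
  proof
    have "continuous_map euclideanreal (circle_topology P) (circ P)"
      unfolding continuous_map_def topspace_circle by (auto simp: openin_circle_topology vimage_def)
    then show "continuous_map (top_of_set (I a)) (circle_topology P) (circ P)"
      by (rule continuous_map_from_subtopology)
  qed auto
  ultimately have "homeomorphic_maps ?Y (top_of_set (I a)) (inv_into (I a) (circ P)) (circ P)"
    unfolding homeomorphic_maps_def ts by (auto simp: inj f_inv_into_f)
  then show ?thesis by (auto simp: homeomorphic_map_maps)
qed

text \<open>Two arcs of length \<open>P\<close> may overlap in two pieces on which the coordinates
  differ by different multiples of \<open>P\<close>. The shift is therefore constant only locally,
  and the derivatives of the transition need the second claim.\<close>

lemma circle_transition:
  assumes P: "P > 0" and b: "b \<in> circle_atlas P" "b' \<in> circle_atlas P"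
    and t: "t \<in> cmap b ` (cdom b \<inter> cdom b')"
  shows "\<exists>k::int. (cmap b' \<circ> cinv b) t = t + of_int k * P"
    and "\<exists>k::int. \<exists>U. open U \<and> t \<in> U \<and> (\<forall>s\<in>U. (cmap b' \<circ> cinv b) s = s + of_int k * P)"
proof -
  obtain a where b_eq: "b = \<lparr> cdom = circ P ` {a<..<a + P}, cmap = inv_into {a<..<a + P} (circ P),
    cmet = (\<lambda>t v w. v * w) \<rparr>" using b(1) by (auto simp: circle_atlas_def)
  obtain a' where b'_eq: "b' = \<lparr> cdom = circ P ` {a'<..<a' + P}, cmap = inv_into {a'<..<a' + P} (circ P),
    cmet = (\<lambda>t v w. v * w) \<rparr>" using b(2) by (auto simp: circle_atlas_def)
  let ?I = "{a<..<a + P}" and ?I' = "{a'<..<a' + P}"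
  note inj = circ_inj_on[OF P]
  have cran: "cran b = ?I" by (simp add: b_eq cran_def inv_into_image_cancel[OF inj])
  obtain x where x: "t = cmap b x" "x \<in> cdom b" "x \<in> cdom b'" using t by blast
  then have tI: "t \<in> ?I" "circ P t = x" by (auto simp: b_eq inv_into_into f_inv_into_f inj)
  obtain s where s: "s \<in> ?I'" "x = circ P s" using x(3) by (auto simp: b'_eq)
  then obtain k :: int where k: "s = t + of_int k * P" using tI(2) circ_eq_iff[of P s t] by auto
  have loc: "(cmap b' \<circ> cinv b) r = r + of_int k * P" if "r \<in> ?I" "r + of_int k * P \<in> ?I'" for r
  proof -
    have "cinv b r = circ P (r + of_int k * P)"
      using circle_atlas_flat(3)[OF P b(1), of r] that(1) cran circ_add_int by simp
    then show ?thesis using inv_into_f_f[OF inj that(2)] by (simp add: b'_eq)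
  qed
  show "\<exists>k::int. (cmap b' \<circ> cinv b) t = t + of_int k * P" using loc[OF tI(1)] s(1) k by blast
  have "open (?I \<inter> (\<lambda>r. r + of_int k * P) -` ?I')"
    by (intro open_Int open_greaterThanLessThan open_vimage continuous_intros)
  moreover have "t \<in> ?I \<inter> (\<lambda>r. r + of_int k * P) -` ?I'" using tI s k by simp
  ultimately show "\<exists>k::int. \<exists>U. open U \<and> t \<in> U \<and> (\<forall>s\<in>U. (cmap b' \<circ> cinv b) s = s + of_int k * P)"
    using loc by blast
qed

lemma riemannian_manifold_circle:
  assumes P: "P > 0"
  shows "riemannian_manifold (circle_topology P) (circle_atlas P)"
  unfolding riemannian_manifold_def
proof (intro conjI ballI)
  show "topspace (circle_topology P) \<noteq> {}" by (simp add: topspace_circle)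
  show "Hausdorff_space (circle_topology P)" by (rule Hausdorff_circle[OF P])
  show "second_countable_space (circle_topology P)" by (rule second_countable_circle)
  show "(\<Union>c\<in>circle_atlas P. cdom c) = topspace (circle_topology P)"
  proof
    show "topspace (circle_topology P) \<subseteq> (\<Union>c\<in>circle_atlas P. cdom c)"
    proof
      fix x assume "x \<in> topspace (circle_topology P)"
      then obtain t where t: "x = circ P t" by (auto simp: topspace_circle)
      let ?I = "{t - P / 2<..<t - P / 2 + P}"
      have "t \<in> ?I" using P by simp
      then have "x \<in> cdom \<lparr> cdom = circ P ` ?I, cmap = inv_into ?I (circ P), cmet = (\<lambda>t v w. v * w) \<rparr>"
        by (simp add: t)
      then show "x \<in> (\<Union>c\<in>circle_atlas P. cdom c)" unfolding circle_atlas_def by blast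
    qed
  qed (auto simp: circle_atlas_def topspace_circle)
  fix b assume b: "b \<in> circle_atlas P"
  obtain a where b_eq: "b = \<lparr> cdom = circ P ` {a<..<a + P}, cmap = inv_into {a<..<a + P} (circ P),
    cmet = (\<lambda>t v w. v * w) \<rparr>" using b by (auto simp: circle_atlas_def)
  have cran: "cran b = {a<..<a + P}" by (simp add: b_eq cran_def inv_into_image_cancel[OF circ_inj_on[OF P]])
  show od: "openin (circle_topology P) (cdom b)" by (simp add: b_eq openin_circ_image)
  show oc: "open (cran b)" by (simp add: cran)
  show h: "homeomorphic_map (subtopology (circle_topology P) (cdom b)) (top_of_set (cran b)) (cmap b)"
    using homeomorphic_map_circle_chart[OF P, of a] by (simp add: cran) (simp add: b_eq)
  show "\<forall>v w. smooth_on (cran b) (\<lambda>u. cmet b u v w)" by (simp add: b_eq)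
  show "inner_form (cmet b u)" for u
    by (auto simp: b_eq inner_form_def bilinear_def mult.commute intro!: linearI simp: algebra_simps)
      (metis not_real_square_gt_zero)
  fix b' assume b': "b' \<in> circle_atlas P"
  have o': "openin (circle_topology P) (cdom b')" using b' by (auto simp: circle_atlas_def openin_circ_image)
  let ?S = "cmap b ` (cdom b \<inter> cdom b')" and ?T = "cmap b' \<circ> cinv b"
  have loc: "\<exists>U. open U \<and> t \<in> U \<and> smooth_on U ?T \<and> (\<forall>v. pd v ?T t = v)" if t: "t \<in> ?S" for t
  proof -
    obtain k :: int and U where U: "open U" "t \<in> U" "\<And>s. s \<in> U \<Longrightarrow> ?T s = s + of_int k * P"
      using circle_transition(2)[OF P b b' t] by blast
    have "smooth_on U (\<lambda>s. s + of_int k * P)" using U(1) by (intro smooth_on_add) auto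
    then have "smooth_on U ?T" using smooth_on_cong[OF U(1), of ?T "\<lambda>s. s + of_int k * P"] U(3) by simp
    moreover have "pd v ?T t = v" for v
    proof -
      have "((\<lambda>s. s + of_int k * P) has_derivative (\<lambda>v. v)) (at t)" by (auto intro!: derivative_eq_intros)
      from pd_eqI[OF this] pd_cong_open[OF U(1,2), of ?T "\<lambda>s. s + of_int k * P" v] U(3) show ?thesis by simp
    qed
    ultimately show ?thesis using U by blast
  qed
  have "smooth_on ?S ?T"
  proof (rule smooth_on_open_Union)
    fix t assume "t \<in> ?S"
    from loc[OF this] show "\<exists>U. open U \<and> t \<in> U \<and> smooth_on U ?T" by (elim exE conjE) (intro exI conjI)
  qed
  moreover have "cmet b u v w = cmet b' (?T u) (pd v ?T u) (pd w ?T u)" if "u \<in> ?S" for u v w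
  proof -
    have "pd v ?T u = v" for v using loc[OF that] by blast
    moreover have "cmet b' = (\<lambda>t v w. v * w)" using b' by (auto simp: circle_atlas_def)
    ultimately show ?thesis by (simp add: b_eq)
  qed
  ultimately show "compatible_charts b b'" by (simp add: compatible_charts_def Let_def)
qed

section \<open>The warping functions\<close>

text \<open>
  With \<open>l\<^sub>1 = exp (ln f / (k\<^sub>1 + k\<^sub>2) + k\<^sub>2 w)\<close>, \<open>l\<^sub>2 = exp (ln f / (k\<^sub>1 + k\<^sub>2) - k\<^sub>1 w)\<close> the volume
  condition holds identically, and the other condition prescribes the value at \<open>w\<close> of the following
  strictly increasing function.
\<close>

definition warp_shear :: "nat \<Rightarrow> nat \<Rightarrow> real \<Rightarrow> real \<Rightarrow> real \<Rightarrow> real" where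
  "warp_shear k1 k2 d1 d2 w = d2 * exp (2 * real k1 * w) - d1 * exp (- (2 * real k2 * w))"

context
  fixes k1 k2 :: nat and d1 d2 :: real
  assumes k: "k1 > 0" "k2 > 0" and d: "d1 > 0" "d2 > 0"
begin

lemma warp_shear_deriv:
  "(warp_shear k1 k2 d1 d2 has_real_derivative
     d2 * exp (2 * real k1 * w) * (2 * real k1) + d1 * exp (- (2 * real k2 * w)) * (2 * real k2)) (at (w::real))"
  unfolding warp_shear_def[abs_def] by (auto intro!: derivative_eq_intros)

lemma warp_shear_deriv_pos: "d2 * exp (2 * real k1 * (w::real)) * (2 * real k1) + d1 * exp (- (2 * real k2 * w)) * (2 * real k2) > 0"
  using k d by (intro add_pos_pos mult_pos_pos) auto

lemma warp_shear_surj: "range (warp_shear k1 k2 d1 d2) = UNIV"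
proof -
  have "\<exists>w. warp_shear k1 k2 d1 d2 w = y" for y
  proof -
    \<comment> \<open>Both bounds come from \<open>exp x \<ge> 1 + x\<close>: the growing
      exponential term then outweighs |y| and the other term, which is at most its
      coefficient.\<close>
    define w1 where "w1 = (\<bar>y\<bar> + d1) / (2 * real k1 * d2)"
    define w0 where "w0 = - ((\<bar>y\<bar> + d2) / (2 * real k2 * d1))"
    have w: "w1 \<ge> 0" "w0 \<le> 0" using k d by (auto simp: w1_def w0_def)
    have "d2 * exp (2 * real k1 * w1) \<ge> d2 * (1 + 2 * real k1 * w1)"
      using d by (intro mult_left_mono exp_ge_add_one_self) auto
    moreover have "d2 * (1 + 2 * real k1 * w1) = d2 + \<bar>y\<bar> + d1" using k d by (simp add: w1_def field_simps)
    moreover have "d1 * exp (- (2 * real k2 * w1)) \<le> d1 * 1"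
      using w d by (intro mult_left_mono) auto
    ultimately have hi: "y \<le> warp_shear k1 k2 d1 d2 w1"
      unfolding warp_shear_def using d by linarith
    have "d1 * exp (- (2 * real k2 * w0)) \<ge> d1 * (1 + - (2 * real k2 * w0))"
      using d by (intro mult_left_mono exp_ge_add_one_self) auto
    moreover have "d1 * (1 + - (2 * real k2 * w0)) = d1 + \<bar>y\<bar> + d2" using k d by (simp add: w0_def field_simps)
    moreover have "d2 * exp (2 * real k1 * w0) \<le> d2 * 1"
      using w d by (intro mult_left_mono) (auto simp: mult_nonneg_nonpos)
    ultimately have lo: "warp_shear k1 k2 d1 d2 w0 \<le> y"
      unfolding warp_shear_def using d by linarith
    have "continuous_on {w0..w1} (warp_shear k1 k2 d1 d2)"
      using warp_shear_deriv by (meson DERIV_isCont continuous_at_imp_continuous_on)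
    from IVT'[OF lo hi _ this] w show ?thesis by auto
  qed
  then show ?thesis by (metis surjI surj_def)
qed

lemma warp_shear_inv:
  "smooth_on UNIV (inv_into UNIV (warp_shear k1 k2 d1 d2))"
  "warp_shear k1 k2 d1 d2 w = y \<longleftrightarrow> w = inv_into UNIV (warp_shear k1 k2 d1 d2) y"
proof -
  have "smooth_on UNIV (\<lambda>w. d2 * exp (2 * real k1 * w) * (2 * real k1) + d1 * exp (- (2 * real k2 * w)) * (2 * real k2))"
    by (intro smooth_intros open_UNIV)
  from smooth_on_inv_into[OF open_UNIV connected_UNIV warp_shear_deriv warp_shear_deriv_pos this]
  show "smooth_on UNIV (inv_into UNIV (warp_shear k1 k2 d1 d2))" by (simp add: warp_shear_surj)
  have "inj (warp_shear k1 k2 d1 d2)"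
    using has_real_derivative_inv_into(1)[OF open_UNIV connected_UNIV warp_shear_deriv warp_shear_deriv_pos] .
  then show "warp_shear k1 k2 d1 d2 w = y \<longleftrightarrow> w = inv_into UNIV (warp_shear k1 k2 d1 d2) y"
    by (metis inv_f_f surj_f_inv_f[OF warp_shear_surj])
qed

lemma warp_equations_iff:
  fixes f T x y :: real
  assumes f: "f > 0"
  defines "W \<equiv>  inv_into UNIV (warp_shear k1 k2 d1 d2) (T * exp (2 * (ln f / (real k1 + real k2))))"
  shows "x > 0 \<and> y > 0 \<and> x ^ k1 * y ^ k2 = f \<and> d2 / y\<^sup>2 - d1 / x\<^sup>2 = T \<longleftrightarrow>
    x = exp (ln f / (real k1 + real k2) + real k2 * W) \<and> y = exp (ln f / (real k1 + real k2) - real k1 * W)"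
proof -
  \<comment> \<open>\<open>exp s\<close> is the common value of two equal warps of volume
    \<open>f\<close>. The factor \<open>exp (- (2 * s))\<close> comes out of both quotients, which
    leaves an equation for \<open>warp_shear\<close> alone.\<close>
  define s where "s = ln f / (real k1 + real k2)"
  have ks: "real k1 * s + real k2 * s = ln f"
  proof -
    have "(real k1 + real k2) * s = ln f" using k by (simp add: s_def)
    then show ?thesis by (simp add: distrib_right)
  qed
  have fs: "f = exp (real k1 * s + real k2 * s)" using f by (simp add: ks)
  have eqs: "exp (s + real k2 * w) ^ k1 * exp (s - real k1 * w) ^ k2 = f"
    "d2 / (exp (s - real k1 * w))\<^sup>2 - d1 / (exp (s + real k2 * w))\<^sup>2 = exp (- (2 * s)) * warp_shear k1 k2 d1 d2 w" for w
  proof -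
    have "exp (s + real k2 * w) ^ k1 * exp (s - real k1 * w) ^ k2 = exp (real k1 * (s + real k2 * w) + real k2 * (s - real k1 * w))"
      by (simp add: exp_add exp_of_nat_mult)
    also have "real k1 * (s + real k2 * w) + real k2 * (s - real k1 * w) = real k1 * s + real k2 * s" by (simp add: algebra_simps)
    finally show "exp (s + real k2 * w) ^ k1 * exp (s - real k1 * w) ^ k2 = f" using fs by simp
    have sq: "c / (exp z)\<^sup>2 = c * exp (- (2 * z))" for c z :: real
      by (simp add: exp_double[symmetric] exp_minus divide_inverse mult.commute)
    have "- (2 * (s - real k1 * w)) = - (2 * s) + 2 * real k1 * w" "- (2 * (s + real k2 * w)) = - (2 * s) + - (2 * real k2 * w)"
      by (simp_all add: algebra_simps)
    then show "d2 / (exp (s - real k1 * w))\<^sup>2 - d1 / (exp (s + real k2 * w))\<^sup>2 = exp (- (2 * s)) * warp_shear k1 k2 d1 d2 w"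
      unfolding sq warp_shear_def by (simp only: exp_add) (simp add: algebra_simps)
  qed
  have sh: "exp (- (2 * s)) * warp_shear k1 k2 d1 d2 w = T \<longleftrightarrow> w = W" for w
  proof -
    have "exp (- (2 * s)) * warp_shear k1 k2 d1 d2 w = T \<longleftrightarrow> warp_shear k1 k2 d1 d2 w = T * exp (2 * s)"
      by (simp add: exp_minus field_simps)
    then show ?thesis using warp_shear_inv(2) by (simp add: W_def s_def)
  qed
  show ?thesis
    unfolding s_def[symmetric]
  proof
    assume L: "x > 0 \<and> y > 0 \<and> x ^ k1 * y ^ k2 = f \<and> d2 / y\<^sup>2 - d1 / x\<^sup>2 = T"
    then have "ln f = ln (x ^ k1 * y ^ k2)" by simp
    also have "\<dots> = real k1 * ln x + real k2 * ln y"
    proof -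
      have "x > 0" "y > 0" using L by auto
      then show ?thesis by (simp add: ln_mult ln_realpow)
    qed
    finally have u: "real k1 * ln x + real k2 * ln y = real k1 * s + real k2 * s" by (simp add: ks)
    \<comment> \<open>The volume condition is linear in the logarithms, and \<open>w\<close> is the
      coordinate on its line of solutions.\<close>
    define w where "w = (ln x - s) / real k2"
    have "ln x = s + real k2 * w" using k by (simp add: w_def)
    moreover have "ln y = s - real k1 * w"
    proof -
      have "real k2 * ln y = real k2 * (s - real k1 * w)" using u \<open>ln x = s + real k2 * w\<close> by (simp add: algebra_simps)
      then show ?thesis using k by simp
    qed
    ultimately have xy: "x = exp (s + real k2 * w)" "y = exp (s - real k1 * w)" using L by (metis exp_ln)+
    then have "w = W" using L eqs(2)[of w] sh by simp
    then show "x = exp (s + real k2 * W) \<and> y = exp (s - real k1 * W)" using xy by simp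
  next
    assume "x = exp (s + real k2 * W) \<and> y = exp (s - real k1 * W)"
    then show "x > 0 \<and> y > 0 \<and> x ^ k1 * y ^ k2 = f \<and> d2 / y\<^sup>2 - d1 / x\<^sup>2 = T"
      using eqs[of W] sh[of W] by simp
  qed
qed

text \<open>The solution is an explicit smooth expression in F, which yields existence, uniqueness,
  smoothness and periodicity together.\<close>

lemma warp_pair_unique_smooth:
  assumes F: "smooth_on UNIV F" "\<forall>t. F t > 0"
  shows "\<exists>!l. warp_pair F \<kappa> k1 k2 d1 d2 (fst l) (snd l)"
    and "warp_pair F \<kappa> k1 k2 d1 d2 l1 l2 \<Longrightarrow> smooth_on UNIV l1 \<and> smooth_on UNIV l2"
    and "warp_pair F \<kappa> k1 k2 d1 d2 l1 l2 \<Longrightarrow> periodic P F \<Longrightarrow> periodic P l1 \<and> periodic P l2"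
proof -
  define W where "W t = inv_into UNIV (warp_shear k1 k2 d1 d2) (\<kappa> / (F t)\<^sup>2 * exp (2 * (ln (F t) / (real k1 + real k2))))" for t
  define m1 where "m1 t = exp (ln (F t) / (real k1 + real k2) + real k2 * W t)" for t
  define m2 where "m2 t = exp (ln (F t) / (real k1 + real k2) - real k1 * W t)" for t
  have iff: "warp_pair F \<kappa> k1 k2 d1 d2 l1 l2 \<longleftrightarrow> l1 = m1 \<and> l2 = m2" for l1 l2
    unfolding warp_pair_def fun_eq_iff m1_def m2_def W_def using warp_equations_iff[OF F(2)[rule_format]] by auto
  then show "\<exists>!l. warp_pair F \<kappa> k1 k2 d1 d2 (fst l) (snd l)"
    by (intro ex1I[of _ "(m1, m2)"]) auto
  have Fp: "F t > 0" and F0: "(F t)\<^sup>2 \<noteq> 0" for t using F(2)[rule_format, of t] by auto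
  have kk: "real k1 + real k2 \<noteq> 0" using k by simp
  have sF: "smooth_on UNIV (\<lambda>t. ln (F t))" by (rule smooth_on_ln[OF open_UNIV F(1) Fp])
  have "smooth_on UNIV (\<lambda>t. \<kappa> / (F t)\<^sup>2 * exp (2 * (ln (F t) / (real k1 + real k2))))"
    by (intro smooth_on_mult smooth_on_exp smooth_on_divide smooth_on_const smooth_on_power sF F open_UNIV)
      (use F0 kk in auto)
  then have "smooth_on UNIV W"
    unfolding W_def by (intro smooth_on_compose[OF warp_shear_inv(1)]) auto
  then have "smooth_on UNIV m1" "smooth_on UNIV m2"
    unfolding m1_def m2_def
    by (intro smooth_on_mult smooth_on_exp smooth_on_divide smooth_on_const smooth_on_add smooth_on_diff sF open_UNIV;
        use kk in auto)+
  then show "warp_pair F \<kappa> k1 k2 d1 d2 l1 l2 \<Longrightarrow> smooth_on UNIV l1 \<and> smooth_on UNIV l2"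
    using iff by simp
  show "warp_pair F \<kappa> k1 k2 d1 d2 l1 l2 \<Longrightarrow> periodic P F \<Longrightarrow> periodic P l1 \<and> periodic P l2"
    using iff by (simp add: periodic_def m1_def m2_def W_def)
qed

end

lemma warp_pair_pos:
  assumes "warp_pair F \<kappa> k1 k2 d1 d2 l1 l2" shows "l1 t > 0" "l2 t > 0"
  using assms by (auto simp: warp_pair_def)

lemma smooth_on_real_derivative:
  assumes "smooth_on UNIV (f :: real \<Rightarrow> real)" shows "(f has_real_derivative pd 1 f t) (at t)"
  using smooth_on_vector_derivative(1,3)[OF open_UNIV assms, of t]
  by (simp add: has_real_derivative_iff_has_vector_derivative)

text \<open>The logarithmic derivative of the volume condition. Its left side is the first-order
  coefficient of the warped Laplacian, so the individual warps drop out of the friction and only F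
  remains.\<close>

lemma warp_pair_log_derivative:
  assumes w: "warp_pair F \<kappa> k1 k2 d1 d2 l1 l2"
    and sm: "smooth_on UNIV F" "smooth_on UNIV l1" "smooth_on UNIV l2"
  shows "real k1 * pd 1 l1 t / l1 t + real k2 * pd 1 l2 t / l2 t = pd 1 F t / F t"
proof -
  have pos: "l1 t > 0" "l2 t > 0" and eq: "l1 t ^ k1 * l2 t ^ k2 = F t" for t using w by (auto simp: warp_pair_def)
  then have Fp: "F t > 0" for t by (metis mult_pos_pos zero_less_power)
  have ln: "ln (F t) = real k1 * ln (l1 t) + real k2 * ln (l2 t)" for t
    using pos[of t] by (simp add: eq[symmetric] ln_mult ln_realpow)
  have "((\<lambda>t. real k1 * ln (l1 t) + real k2 * ln (l2 t)) has_real_derivative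
      real k1 * (pd 1 l1 t / l1 t) + real k2 * (pd 1 l2 t / l2 t)) (at t)"
    using pos[of t] smooth_on_real_derivative[OF sm(2), of t] smooth_on_real_derivative[OF sm(3), of t]
    by (auto intro!: derivative_eq_intros simp: field_simps)
  moreover have "((\<lambda>t. ln (F t)) has_real_derivative pd 1 F t / F t) (at t)"
    using Fp[of t] smooth_on_real_derivative[OF sm(1), of t] by (auto intro!: derivative_eq_intros)
  ultimately show ?thesis unfolding ln using DERIV_unique by fastforce
qed

lemma profile_eq_iff_neumann:
  assumes F: "smooth_on UNIV F" "\<forall>t. F t > 0"
    and J: "open J" "connected J" and \<tau>: "\<And>t. t \<in> J \<Longrightarrow> (\<tau> has_real_derivative 1 / F t) (at t)"
    and \<gamma>: "profile_on J \<gamma>"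
    and ac: "\<And>t. c t - a t = \<kappa> / (F t)\<^sup>2"
  shows "(\<forall>t\<in>J. profile_eq (pd 1 F t / F t) (a t) (c t) \<gamma> t) \<longleftrightarrow>
    (\<exists>\<Gamma>. neumann_trajectory \<kappa> (\<tau> ` J) \<Gamma> \<and> (\<forall>t\<in>J. \<gamma> t = \<Gamma> (\<tau> t)))"
proof -
  have Fp: "F t > 0" for t using F(2) by blast
  have F0: "F t \<noteq> 0" for t using Fp[of t] by simp
  have sF: "smooth_on J (\<lambda>t. 1 / F t)"
    using F0 by (intro smooth_on_divide J smooth_on_const smooth_on_subset[OF F(1)]) simp_all
  have p: "1 / F t > 0" for t using Fp by simp
  note inv = has_real_derivative_inv_into[OF J \<tau> p]
  have NT: "neumann_trajectory \<kappa> (\<tau> ` J) \<Gamma> \<longleftrightarrow>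
      smooth_on (\<tau> ` J) \<Gamma> \<and> (\<forall>s\<in>\<tau> ` J. \<Gamma> s \<in> S3) \<and> (\<forall>s\<in>\<tau> ` J. profile_eq 0 0 \<kappa> \<Gamma> s)" for \<Gamma>
    by (simp only: neumann_trajectory_iff[OF inv(2)] profile_on_def conj_assoc)
  have tc: "profile_eq (pd 1 F t / F t) (a t) (c t) \<gamma> t \<longleftrightarrow> profile_eq 0 0 \<kappa> \<Gamma> (\<tau> t)"
    if "t \<in> J" "smooth_on (\<tau> ` J) \<Gamma>" "\<And>t. t \<in> J \<Longrightarrow> \<gamma> t = \<Gamma> (\<tau> t)" for \<Gamma> t
    by (rule profile_eq_time_change[OF J(1) that(1) inv(2) subset_refl \<tau> smooth_on_real_derivative[OF F(1)] Fp
       that(2,3) ac])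
  show ?thesis
  proof
    assume E: "\<forall>t\<in>J. profile_eq (pd 1 F t / F t) (a t) (c t) \<gamma> t"
    \<comment> \<open>The only candidate: \<tau> has positive derivative on \<open>J\<close>, so it
      is a diffeomorphism onto its image.\<close>
    define \<Gamma> where "\<Gamma> s = \<gamma> (inv_into J \<tau> s)" for s
    have \<gamma>\<Gamma>: "\<gamma> t = \<Gamma> (\<tau> t)" if "t \<in> J" for t using inv(1) that by (simp add: \<Gamma>_def)
    have "smooth_on J \<gamma>" "\<And>t. t \<in> J \<Longrightarrow> \<gamma> t \<in> S3" using \<gamma> by (auto simp: profile_on_def)
    moreover have "inv_into J \<tau> ` \<tau> ` J \<subseteq> J" by (simp add: inv_into_image_cancel[OF inv(1)])
    ultimately have "smooth_on (\<tau> ` J) \<Gamma>"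
      unfolding \<Gamma>_def using smooth_on_compose[OF _ smooth_on_inv_into[OF J \<tau> p sF] inv(2)] by simp
    moreover have "\<Gamma> s \<in> S3" if "s \<in> \<tau> ` J" for s
      using that \<open>\<And>t. t \<in> J \<Longrightarrow> \<gamma> t \<in> S3\<close> \<gamma>\<Gamma> by auto
    ultimately have "neumann_trajectory \<kappa> (\<tau> ` J) \<Gamma>"
      unfolding NT
    proof (intro conjI ballI)
      fix s assume "smooth_on (\<tau> ` J) \<Gamma>" "s \<in> \<tau> ` J"
      then obtain t where "t \<in> J" "s = \<tau> t" by blast
      then show "profile_eq 0 0 \<kappa> \<Gamma> s" using tc[OF \<open>t \<in> J\<close> \<open>smooth_on (\<tau> ` J) \<Gamma>\<close> \<gamma>\<Gamma>] E by blast
    qed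
    then show "\<exists>\<Gamma>. neumann_trajectory \<kappa> (\<tau> ` J) \<Gamma> \<and> (\<forall>t\<in>J. \<gamma> t = \<Gamma> (\<tau> t))"
      using \<gamma>\<Gamma> by (intro exI[of _ \<Gamma>]) simp
  next
    assume "\<exists>\<Gamma>. neumann_trajectory \<kappa> (\<tau> ` J) \<Gamma> \<and> (\<forall>t\<in>J. \<gamma> t = \<Gamma> (\<tau> t))"
    then obtain \<Gamma> where \<Gamma>: "neumann_trajectory \<kappa> (\<tau> ` J) \<Gamma>" "\<And>t. t \<in> J \<Longrightarrow> \<gamma> t = \<Gamma> (\<tau> t)" by auto
    note N = \<Gamma>(1)[unfolded NT]
    note s = N[THEN conjunct1] and e = N[THEN conjunct2, THEN conjunct2]
    show "\<forall>t\<in>J. profile_eq (pd 1 F t / F t) (a t) (c t) \<gamma> t"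
    proof
      fix t assume t: "t \<in> J"
      show "profile_eq (pd 1 F t / F t) (a t) (c t) \<gamma> t"
        using tc[OF t s \<Gamma>(2)] e t by blast
    qed
  qed
qed

section \<open>Harmonic joins over the line and the circle\<close>

context
  fixes A1 :: "('a, 'e::euclidean_space) rchart set" and A2 :: "('b, 'f::euclidean_space) rchart set"
    and F l1 l2 :: "real \<Rightarrow> real" and \<kappa> d1 d2 P :: real
  assumes F: "smooth_on UNIV F" "\<forall>t. F t > 0"
    and A: "\<And>c. c \<in> A1 \<Longrightarrow> regular_chart c" "\<And>c. c \<in> A2 \<Longrightarrow> regular_chart c"
    and d: "d1 > 0" "d2 > 0"
    and w: "warp_pair F \<kappa> DIM('e) DIM('f) d1 d2 l1 l2"
begin

lemma warp_smooth: "smooth_on UNIV l1" "smooth_on UNIV l2"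
  using warp_pair_unique_smooth(2)[OF DIM_positive DIM_positive d F w] by auto

lemma warp_mu: "DIM('e) * pd 1 l1 t / l1 t + DIM('f) * pd 1 l2 t / l2 t = pd 1 F t / F t"
  using warp_pair_log_derivative[OF w F(1) warp_smooth] .

lemma harmonic_line_iff:
  fixes f1 :: "'a \<Rightarrow> complex^'n1" and f2 :: "'b \<Rightarrow> complex^'n2"
  assumes f: "eigenmap A1 f1 d1" "eigenmap A2 f2 d2"
    and ne: "(\<Union>c\<in>A1. cran c) \<noteq> {}" "(\<Union>c\<in>A2. cran c) \<noteq> {}"
    and J: "open J" and \<gamma>: "profile_on J \<gamma>"
  shows "harmonic_into_sphere (warped_atlas l1 l2 (line_atlas J) A1 A2) (join_map \<gamma> f1 f2) \<longleftrightarrow>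
    (\<forall>t\<in>J. profile_eq (pd 1 F t / F t) (d1 / (l1 t)\<^sup>2) (d2 / (l2 t)\<^sup>2) \<gamma> t)"
proof -
  have c: "(\<Union>b\<in>line_atlas J. cran b) = J"
    using line_atlas_flat(2)[OF J] by (auto simp: line_atlas_def)
  have s: "smooth_on J \<gamma>" "\<And>t. t \<in> J \<Longrightarrow> norm (\<gamma> t) = 1" using \<gamma> by (auto simp: profile_on_def)
  have G: "join_map \<gamma> f1 f2 (cinv b t, x, y) = (fst (\<gamma> t) *s f1 x, snd (\<gamma> t) *s f2 y)"
    if "b \<in> line_atlas J" "t \<in> cran b" for b t x y
    using line_atlas_flat[OF J that(1)] that(2) by (simp add: join_map_def)
  note args = norm_mult_bilinear_vector_scalar_mult norm_mult_bilinear_vector_scalar_mult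
    line_atlas_flat(1)[OF J] c A f smooth_on_real_derivative[OF warp_smooth(1)]
    smooth_on_real_derivative[OF warp_smooth(2)] warp_pair_pos[OF w] J s G
  show ?thesis
    using harmonic_joinI[OF args] harmonic_joinD[OF args ne] unfolding warp_mu by blast
qed

text \<open>Stated for general scalars: complex ones serve the Hopf tori, real ones the identity
  maps of spheres.\<close>

lemma harmonic_circle:
  fixes f1 :: "'a \<Rightarrow> 'v::euclidean_space" and f2 :: "'b \<Rightarrow> 'w::euclidean_space"
    and B1 :: "'z::euclidean_space \<Rightarrow> 'v \<Rightarrow> 'v" and B2 :: "'z \<Rightarrow> 'w \<Rightarrow> 'w"
  assumes B: "norm_mult_bilinear B1" "norm_mult_bilinear B2"
    and f: "eigenmap A1 f1 d1" "eigenmap A2 f2 d2" and P: "P > 0"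
    and \<gamma>: "smooth_on UNIV \<gamma>" "\<And>t. norm (\<gamma> t) = 1" "periodic P \<gamma>"
    and G: "\<And>t x y. G (t, x, y) = (B1 (fst (\<gamma> t)) (f1 x), B2 (snd (\<gamma> t)) (f2 y))"
  defines "H \<equiv> harmonic_into_sphere (warped_atlas l1 l2 (circle_atlas P) A1 A2) (on_circle G)"
    and "E \<equiv> (\<forall>t. profile_eq (pd 1 F t / F t) (d1 / (l1 t)\<^sup>2) (d2 / (l2 t)\<^sup>2) \<gamma> t)"
  shows "E \<Longrightarrow> H"
    and "(\<Union>c\<in>A1. cran c) \<noteq> {} \<Longrightarrow> (\<Union>c\<in>A2. cran c) \<noteq> {} \<Longrightarrow> H \<Longrightarrow> E"
proof -
  have G': "on_circle G (cinv b t, x, y) = (B1 (fst (\<gamma> t)) (f1 x), B2 (snd (\<gamma> t)) (f2 y))"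
    if "b \<in> circle_atlas P" "t \<in> cran b" for b t x y
  proof -
    have "G (t + P, x, y) = G (t, x, y)" for t x y using \<gamma>(3) by (simp add: G periodic_def)
    from on_circle_eq[of G, OF this] show ?thesis
      unfolding circle_atlas_flat(3)[OF P that] by (simp add: G)
  qed
  note args = B circle_atlas_flat(1)[OF P] circle_atlas_cran[OF P] A f smooth_on_real_derivative[OF warp_smooth(1)]
    smooth_on_real_derivative[OF warp_smooth(2)] warp_pair_pos[OF w] open_UNIV \<gamma>(1) \<gamma>(2) G'
  show "E \<Longrightarrow> H" unfolding H_def E_def using harmonic_joinI[OF args] unfolding warp_mu by simp
  show "(\<Union>c\<in>A1. cran c) \<noteq> {} \<Longrightarrow> (\<Union>c\<in>A2. cran c) \<noteq> {} \<Longrightarrow> H \<Longrightarrow> E"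
    unfolding H_def E_def using harmonic_joinD[OF args] unfolding warp_mu by simp
qed

end

section \<open>Graph geodesics of the conic Finsler metric\<close>

text \<open>
  At a graph satisfying the profile equation the first variation of the length integrand is the
  \<open>s\<close>-derivative of \<open>F (\<gamma>' \<bullet> w) + F (V - |\<gamma>'|\<^sup>2 / 2) \<rho>\<close>, where \<open>(\<rho>, w)\<close> is the variation field.
\<close>

lemma partial_derivatives:
  fixes h :: "real \<times> real \<Rightarrow> 'b::real_normed_vector"
  assumes "h differentiable (at (\<sigma>, s))"
  shows "((\<lambda>\<sigma>. h (\<sigma>, s)) has_vector_derivative pd (1, 0) h (\<sigma>, s)) (at \<sigma>)"
    and "((\<lambda>s. h (\<sigma>, s)) has_vector_derivative pd (0, 1) h (\<sigma>, s)) (at s)"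
  using has_vector_derivative_line[of h "(0, s)" \<sigma> "(1, 0)"] has_vector_derivative_line[of h "(\<sigma>, 0)" s "(0, 1)"]
    assms by simp_all

text \<open>The variation fixes the curve outside \<alpha> to \<beta>, so its field vanishes there
  and, by continuity, at both ends as well. This removes the boundary terms of the first
  variation.\<close>

lemma variation_field_boundary:
  fixes h :: "real \<times> real \<Rightarrow> real \<times> 'b::euclidean_space"
  assumes h: "smooth_on ({-\<epsilon><..<\<epsilon>} \<times> UNIV) h" and \<epsilon>: "\<epsilon> > 0"
    and c: "\<And>\<sigma> s. \<sigma> \<in> {-\<epsilon><..<\<epsilon>} \<Longrightarrow> s \<notin> {\<alpha>..\<beta>} \<Longrightarrow> h (\<sigma>, s) = c s"
    and ab: "\<alpha> \<le> \<beta>"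
  shows "pd (1, 0) h (0, \<alpha>) = 0" "pd (1, 0) h (0, \<beta>) = 0"
proof -
  let ?U = "{-\<epsilon><..<\<epsilon>} \<times> (UNIV :: real set)"
  have U: "open ?U" by (simp add: open_Times)
  have B: "(1, 0) \<in> (Basis :: (real \<times> real) set)" by (simp add: Basis_prod_def)
  have z: "pd (1, 0) h (0, s) = 0" if "s \<notin> {\<alpha>..\<beta>}" for s
  proof -
    have d: "h differentiable (at (0, s))" using smooth_onD(1)[OF h] \<epsilon> by simp
    have 1: "((\<lambda>\<sigma>. h (\<sigma>, s)) has_vector_derivative pd (1, 0) h (0, s)) (at 0)"
      by (rule partial_derivatives(1)[OF d])
    have "((\<lambda>\<sigma>. c s) has_vector_derivative pd (1, 0) h (0, s)) (at 0)"
      by (rule has_vector_derivative_transform_within_open[OF 1, of "{-\<epsilon><..<\<epsilon>}"]) (use \<epsilon> c that in auto)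
    then show ?thesis
      using vector_derivative_unique_at has_vector_derivative_const by blast
  qed
  have "continuous_on ?U (pd (1, 0) h)" by (rule smooth_on_imp_continuous_on[OF smooth_onD(2)[OF h B]])
  then have cont: "continuous_on UNIV (\<lambda>s. pd (1, 0) h (0, s))"
    by (rule continuous_on_compose2) (use \<epsilon> in \<open>auto intro!: continuous_intros\<close>)
  have cl: "closed {s. pd (1, 0) h (0, s) = 0}"
    using continuous_closed_vimage[OF closed_singleton[of 0], of "\<lambda>s. pd (1, 0) h (0, s)"] cont
    by (simp add: continuous_on_eq_continuous_at vimage_def)
  have "{..<\<alpha>} \<subseteq> {s. pd (1, 0) h (0, s) = 0}" "{\<beta><..} \<subseteq> {s. pd (1, 0) h (0, s) = 0}"
    using z ab by auto
  from closure_minimal[OF this(1) cl] closure_minimal[OF this(2) cl]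
  show "pd (1, 0) h (0, \<alpha>) = 0" "pd (1, 0) h (0, \<beta>) = 0" by auto
qed

text \<open>The algebra of the first variation, with numbers for inner products. \<open>aw\<close>,
  \<open>vw\<close>, \<open>lw\<close> are \<gamma>'', \<gamma>' and the force paired with the
  variation \<open>w\<close>; \<open>av\<close>, \<open>v2\<close>, \<open>lv\<close> are the same
  vectors paired with \<gamma>'; \<open>vw'\<close> is \<gamma>' paired with w', and
  \<open>V\<close>, \<open>Vt\<close> are the potential and its time derivative. The hypotheses are
  the profile equation tested against \<open>w\<close> and against \<gamma>'. The second test, an
  energy balance, takes care of variations in the time direction.\<close>

lemma first_variation_identity:
  fixes F F' V Vt \<rho> \<rho>' v2 vw' lw vw aw lv av :: real
  assumes "F * aw + F' * vw = F * lw" "F * av + F' * v2 = F * lv"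
  shows "F' * \<rho> / 2 * (v2 + 2 * V) + F / 2 * (- \<rho>' * v2 + 2 * V * \<rho>' + 2 * vw' + 2 * Vt * \<rho> + 2 * lw)
    = F' * vw + F * (aw + vw') + (F' * (V - v2 / 2) + F * (Vt + lv - av)) * \<rho> + F * (V - v2 / 2) * \<rho>'"
proof -
  have a: "F * aw = F * lw - F' * vw" and b: "F * lv - F * av = F' * v2" using assms by simp_all
  have "F' * vw + F * (aw + vw') + (F' * (V - v2 / 2) + F * (Vt + lv - av)) * \<rho> + F * (V - v2 / 2) * \<rho>'
    = F' * vw + F * aw + F * vw' + (F' * (V - v2 / 2) + F * Vt + (F * lv - F * av)) * \<rho> + F * (V - v2 / 2) * \<rho>'"
    by (simp add: algebra_simps)
  then show ?thesis unfolding a b by (simp add: field_simps)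
qed

text \<open>The boundary term with numbers for inner products: \<open>p\<close> is \<gamma>' paired
  with the variation field, \<open>q\<close> the squared speed, and
  \<open>m1 s * n1 s + m2 s * n2 s\<close> twice the potential.\<close>

lemma first_variation_DERIV:
  fixes F m1 m2 n1 n2 p q \<rho> :: "real \<Rightarrow> real"
  assumes "(F has_real_derivative F') (at s)" "(m1 has_real_derivative m1') (at s)"
    "(m2 has_real_derivative m2') (at s)" "(n1 has_real_derivative n1') (at s)"
    "(n2 has_real_derivative n2') (at s)" "(p has_real_derivative p') (at s)"
    "(q has_real_derivative q') (at s)" "(\<rho> has_real_derivative \<rho>') (at s)"
  shows "((\<lambda>s. F s * p s + F s * ((m1 s * n1 s + m2 s * n2 s) / 2 - q s / 2) * \<rho> s) has_real_derivative
     F' * p s + F s * p' + (F' * ((m1 s * n1 s + m2 s * n2 s) / 2 - q s / 2)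
       + F s * ((m1' * n1 s + m1 s * n1' + m2' * n2 s + m2 s * n2') / 2 - q' / 2)) * \<rho> s
     + F s * ((m1 s * n1 s + m2 s * n2 s) / 2 - q s / 2) * \<rho>') (at s)"
  by (rule DERIV_cong, (rule assms DERIV_add DERIV_diff DERIV_cdivide DERIV_mult)+)
    (simp add: algebra_simps)

text \<open>The parameter is that of the variation. \<open>\<xi> s = 1\<close> because the unvaried
  curve is a graph, which has unit speed in the time direction.\<close>

lemma length_integrand_DERIV:
  fixes F m1 m2 n1 n2 q \<xi> :: "real \<Rightarrow> real"
  assumes "(F has_real_derivative F') (at s)" "(m1 has_real_derivative m1') (at s)"
    "(m2 has_real_derivative m2') (at s)" "(n1 has_real_derivative n1') (at s)"
    "(n2 has_real_derivative n2') (at s)" "(q has_real_derivative q') (at s)"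
    and \<xi>: "(\<xi> has_real_derivative \<xi>') (at s)" "\<xi> s = 1"
  shows "((\<lambda>s. F s / (2 * \<xi> s) * (q s + (m1 s * n1 s + m2 s * n2 s) * (\<xi> s)\<^sup>2)) has_real_derivative
     F' / 2 * (q s + (m1 s * n1 s + m2 s * n2 s))
     + F s / 2 * (- \<xi>' * q s + (m1 s * n1 s + m2 s * n2 s) * \<xi>' + q'
       + (m1' * n1 s + m1 s * n1' + m2' * n2 s + m2 s * n2'))) (at s)"
proof -
  have 1: "((\<lambda>s. F s / (2 * \<xi> s)) has_real_derivative F' / 2 - F s * \<xi>' / 2) (at s)"
    by (rule DERIV_cong[OF DERIV_divide[OF assms(1) DERIV_cmult[OF \<xi>(1), of 2]]])
      (simp_all add: \<xi>(2) diff_divide_distrib)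
  have 2: "((\<lambda>s. (\<xi> s)\<^sup>2) has_real_derivative 2 * \<xi>') (at s)"
    by (rule DERIV_cong[OF DERIV_power[OF \<xi>(1), of 2]]) (simp add: \<xi>(2))
  show ?thesis
    by (rule DERIV_cong, (rule assms 1 2 DERIV_add DERIV_mult)+) (simp add: \<xi>(2) field_simps)
qed

lemma conic_geodesic_graph:
  fixes \<gamma> :: "real \<Rightarrow> complex \<times> complex"
  assumes F: "smooth_on UNIV F" and l: "smooth_on UNIV l1" "smooth_on UNIV l2" "\<And>t. l1 t > 0" "\<And>t. l2 t > 0"
    and Fp: "\<And>t. F t > 0"
    and \<gamma>: "smooth_on UNIV \<gamma>" "\<And>t. norm (\<gamma> t) = 1"
    and E: "\<And>t. profile_eq (pd 1 F t / F t) (d1 / (l1 t)\<^sup>2) (d2 / (l2 t)\<^sup>2) \<gamma> t"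
  shows "conic_geodesic (finsler F (potential d1 d2 l1 l2)) UNIV (graph_curve \<gamma>)"
proof -
  let ?K = "finsler F (potential d1 d2 l1 l2)"
  define m1 where "m1 t = d1 / (l1 t)\<^sup>2" for t
  define m2 where "m2 t = d2 / (l2 t)\<^sup>2" for t
  have l0: "(l1 t)\<^sup>2 \<noteq> 0" "(l2 t)\<^sup>2 \<noteq> 0" for t using l(3,4)[of t] by auto
  have m: "smooth_on UNIV m1" "smooth_on UNIV m2"
    unfolding m1_def[abs_def] m2_def[abs_def]
    by (rule smooth_on_divide[OF open_UNIV smooth_on_const smooth_on_power[OF open_UNIV l(1)] l0(1)],
      rule smooth_on_divide[OF open_UNIV smooth_on_const smooth_on_power[OF open_UNIV l(2)] l0(2)])
  have K: "?K t z \<xi> v = F t / (2 * \<xi>) * (v \<bullet> v + (m1 t * (fst z \<bullet> fst z) + m2 t * (snd z \<bullet> snd z)) * \<xi>\<^sup>2)"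
    for t z \<xi> v
  proof -
    have "2 * potential d1 d2 l1 l2 t z = m1 t * (fst z \<bullet> fst z) + m2 t * (snd z \<bullet> snd z)"
      by (simp add: potential_def m1_def m2_def power2_norm_eq_inner mult_ac)
    then show ?thesis unfolding finsler_def by (simp only: power2_norm_eq_inner)
  qed
  have d\<gamma>: "(\<gamma> has_vector_derivative pd 1 \<gamma> s) (at s)" for s
    using smooth_on_vector_derivative(1,3)[OF open_UNIV \<gamma>(1), of s] by simp
  have s\<gamma>': "smooth_on UNIV (pd 1 \<gamma>)" using smooth_onD(2)[OF \<gamma>(1)] by simp
  have d\<gamma>': "(pd 1 \<gamma> has_vector_derivative pd 1 (pd 1 \<gamma>) s) (at s)" for s
    using smooth_on_vector_derivative(1,3)[OF open_UNIV s\<gamma>', of s] by simp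
  have dc: "(graph_curve \<gamma> has_vector_derivative (1, pd 1 \<gamma> s)) (at s)" for s
    unfolding graph_curve_def[abs_def] by (intro has_vector_derivative_Pair d\<gamma> has_vector_derivative_id)
  have cc: "cone_curve UNIV (graph_curve \<gamma>)"
    unfolding cone_curve_def
  proof (intro conjI ballI)
    show "smooth_on UNIV (graph_curve \<gamma>)"
      unfolding graph_curve_def[abs_def] by (intro smooth_on_Pair smooth_on_ident \<gamma> open_UNIV)
    show "snd (graph_curve \<gamma> s) \<in> S3" for s using \<gamma>(2) by (simp add: graph_curve_def)
    show "0 < fst (vector_derivative (graph_curve \<gamma>) (at s))" for s
      using vector_derivative_at[OF dc, of s] by simp
  qed
  have "((\<lambda>\<sigma>. curve_length ?K (\<lambda>s. h (\<sigma>, s)) \<alpha> \<beta>) has_real_derivative 0) (at 0)"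
    if \<epsilon>: "\<epsilon> > 0" and ab: "\<alpha> \<le> \<beta>" and cv: "cone_variation UNIV (graph_curve \<gamma>) \<epsilon> \<alpha> \<beta> h"
    for \<epsilon> \<alpha> \<beta> h
  proof -
    let ?I = "{-\<epsilon><..<\<epsilon>}" and ?U = "{-\<epsilon><..<\<epsilon>} \<times> (UNIV :: real set)"
    have h: "smooth_on ?U h" and cone: "\<And>\<sigma>. \<sigma> \<in> ?I \<Longrightarrow> cone_curve UNIV (\<lambda>s. h (\<sigma>, s))"
      and h0: "\<And>s. h (0, s) = graph_curve \<gamma> s"
      and out: "\<And>\<sigma> s. \<sigma> \<in> ?I \<Longrightarrow> s \<notin> {\<alpha>..\<beta>} \<Longrightarrow> h (\<sigma>, s) = graph_curve \<gamma> s"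
      using cv by (auto simp: cone_variation_def)
    have U: "open ?U" by (simp add: open_Times)
    have B: "(1, 0) \<in> (Basis :: (real \<times> real) set)" "(0, 1) \<in> (Basis :: (real \<times> real) set)"
      by (simp_all add: Basis_prod_def)
    let ?hs = "pd (0, 1) h" and ?hv = "pd (1, 0) h"
    have hs: "smooth_on ?U ?hs" and hv: "smooth_on ?U ?hv" using smooth_onD(2)[OF h] B by auto
    have vd: "vector_derivative (\<lambda>s. h (\<sigma>, s)) (at s) = ?hs (\<sigma>, s)" if "\<sigma> \<in> ?I" for \<sigma> s
      by (rule vector_derivative_at[OF partial_derivatives(2)[OF smooth_onD(1)[OF h]]]) (use that in simp)
    have pos: "fst (?hs (\<sigma>, s)) > 0" and sph: "norm (snd (h (\<sigma>, s))) = 1" if "\<sigma> \<in> ?I" for \<sigma> s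
    proof -
      have "fst (vector_derivative (\<lambda>s. h (\<sigma>, s)) (at s)) > 0" "snd (h (\<sigma>, s)) \<in> S3"
        using cone[OF that] unfolding cone_curve_def by blast+
      then show "fst (?hs (\<sigma>, s)) > 0" "norm (snd (h (\<sigma>, s))) = 1" by (simp_all add: vd[OF that])
    qed
    have pos': "fst (?hs p) \<noteq> 0" if "p \<in> ?U" for p
      using pos[of "fst p" "snd p"] that by (cases p) auto
    \<comment> \<open>The length integrand as a function of both parameters. The cone condition
      keeps its denominator nonzero, so it is smooth and may be differentiated under the
      integral.\<close>
    define L where "L p = F (fst (h p)) / (2 * fst (?hs p)) * (snd (?hs p) \<bullet> snd (?hs p)
      + (m1 (fst (h p)) * (fst (snd (h p)) \<bullet> fst (snd (h p))) + m2 (fst (h p)) * (snd (snd (h p)) \<bullet> snd (snd (h p))))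
         * (fst (?hs p))\<^sup>2)" for p
    have len: "curve_length ?K (\<lambda>s. h (\<sigma>, s)) \<alpha> \<beta> = integral {\<alpha>..\<beta>} (\<lambda>s. L (\<sigma>, s))" if "\<sigma> \<in> ?I" for \<sigma>
      unfolding curve_length_def using vd[OF that] by (simp add: K L_def)
    note c1 = smooth_on_compose[OF F smooth_on_fst[OF U h] U subset_UNIV]
      smooth_on_compose[OF m(1) smooth_on_fst[OF U h] U subset_UNIV]
      smooth_on_compose[OF m(2) smooth_on_fst[OF U h] U subset_UNIV]
    have L: "smooth_on ?U L"
      unfolding L_def[abs_def]
      by (intro smooth_on_mult smooth_on_divide smooth_on_add smooth_on_inner smooth_on_power c1 U
          smooth_on_fst[OF U hs] smooth_on_snd[OF U hs] smooth_on_fst[OF U smooth_on_snd[OF U h]]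
          smooth_on_snd[OF U smooth_on_snd[OF U h]] smooth_on_const)
        (simp add: pos')
    have Lv: "smooth_on ?U (pd (1, 0) L)" using smooth_onD(2)[OF L B(1)] .
    have "((\<lambda>\<sigma>. integral (cbox \<alpha> \<beta>) (\<lambda>s. L (\<sigma>, s))) has_vector_derivative
        integral (cbox \<alpha> \<beta>) (\<lambda>s. pd (1, 0) L (0, s))) (at 0 within ?I)"
    proof (rule leibniz_rule_vector_derivative[where f="\<lambda>\<sigma> s. L (\<sigma>, s)" and fx="\<lambda>\<sigma> s. pd (1, 0) L (\<sigma>, s)"])
      show "((\<lambda>\<sigma>. L (\<sigma>, s)) has_vector_derivative pd (1, 0) L (\<sigma>, s)) (at \<sigma> within ?I)" if "\<sigma> \<in> ?I" for \<sigma> s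
        by (rule has_vector_derivative_at_within[OF partial_derivatives(1)[OF smooth_onD(1)[OF L]]])
          (use that in simp)
      show "(\<lambda>s. L (\<sigma>, s)) integrable_on cbox \<alpha> \<beta>" if "\<sigma> \<in> ?I" for \<sigma>
        by (intro integrable_continuous continuous_on_compose2[OF smooth_on_imp_continuous_on[OF L]] continuous_intros)
          (use that in auto)
      show "continuous_on (?I \<times> cbox \<alpha> \<beta>) (\<lambda>(\<sigma>, s). pd (1, 0) L (\<sigma>, s))"
        using continuous_on_subset[OF smooth_on_imp_continuous_on[OF Lv], of "?I \<times> cbox \<alpha> \<beta>"]
        by (simp add: Sigma_mono)
    qed (use \<epsilon> in auto)
    then have "((\<lambda>\<sigma>. integral {\<alpha>..\<beta>} (\<lambda>s. L (\<sigma>, s))) has_vector_derivative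
        integral {\<alpha>..\<beta>} (\<lambda>s. pd (1, 0) L (0, s))) (at 0)"
      using \<epsilon> by (simp add: at_within_open[of 0 ?I])
    then have der: "((\<lambda>\<sigma>. curve_length ?K (\<lambda>s. h (\<sigma>, s)) \<alpha> \<beta>) has_vector_derivative
        integral {\<alpha>..\<beta>} (\<lambda>s. pd (1, 0) L (0, s))) (at 0)"
      by (rule has_vector_derivative_transform_within_open[of _ _ _ ?I]) (use \<epsilon> len in auto)
    define \<rho> where "\<rho> s = fst (?hv (0, s))" for s
    define w where "w s = snd (?hv (0, s))" for s
    define A where "A s = F s * (pd 1 \<gamma> s \<bullet> w s)
      + F s * ((m1 s * (fst (\<gamma> s) \<bullet> fst (\<gamma> s)) + m2 s * (snd (\<gamma> s) \<bullet> snd (\<gamma> s))) / 2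
          - pd 1 \<gamma> s \<bullet> pd 1 \<gamma> s / 2) * \<rho> s" for s
    have dA: "(A has_vector_derivative pd (1, 0) L (0, s)) (at s)" for s
    proof -
      have in0: "(0, s) \<in> ?U" using \<epsilon> by simp
      let ?v = "pd 1 \<gamma> s" and ?a = "pd 1 (pd 1 \<gamma>) s"
      have hs0: "?hs (0, s) = (1, ?v)"
      proof -
        have "((\<lambda>s. h (0, s)) has_vector_derivative ?hs (0, s)) (at s)"
          by (rule partial_derivatives(2)[OF smooth_onD(1)[OF h in0]])
        then show ?thesis using dc[of s] unfolding h0 by (rule vector_derivative_unique_at)
      qed
      let ?W = "pd (0, 1) ?hv (0, s)"
      have dW: "((\<lambda>s. ?hv (0, s)) has_vector_derivative ?W) (at s)"
        by (rule partial_derivatives(2)[OF smooth_onD(1)[OF hv in0]])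
      \<comment> \<open>Symmetry of second derivatives: the change of the velocity is the velocity
        of the variation field.\<close>
      have cm: "pd (1, 0) ?hs (0, s) = ?W" by (rule pd_commute[OF U in0 h B])
      have dh: "((\<lambda>\<sigma>. h (\<sigma>, s)) has_vector_derivative ?hv (0, s)) (at 0)"
        by (rule partial_derivatives(1)[OF smooth_onD(1)[OF h in0]])
      have dhs: "((\<lambda>\<sigma>. ?hs (\<sigma>, s)) has_vector_derivative ?W) (at 0)"
        using partial_derivatives(1)[OF smooth_onD(1)[OF hs in0]] unfolding cm .
      note lin = bounded_linear.has_vector_derivative
      note fs = bounded_linear_fst bounded_linear_snd
      have t: "((\<lambda>\<sigma>. fst (h (\<sigma>, s))) has_real_derivative \<rho> s) (at 0)"
        using lin[OF fs(1) dh] by (simp add: \<rho>_def has_real_derivative_iff_has_vector_derivative)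
      have z: "((\<lambda>\<sigma>. snd (h (\<sigma>, s))) has_vector_derivative w s) (at 0)"
        using lin[OF fs(2) dh] by (simp add: w_def)
      have \<xi>: "((\<lambda>\<sigma>. fst (?hs (\<sigma>, s))) has_real_derivative fst ?W) (at 0)"
        using lin[OF fs(1) dhs] by (simp add: has_real_derivative_iff_has_vector_derivative)
      have v: "((\<lambda>\<sigma>. snd (?hs (\<sigma>, s))) has_vector_derivative snd ?W) (at 0)"
        using lin[OF fs(2) dhs] by simp
      have ip: "((\<lambda>r. f r \<bullet> g r) has_real_derivative f r \<bullet> g' + f' \<bullet> g r) (at r)"
        if "(f has_vector_derivative f') (at r)" "(g has_vector_derivative g') (at r)"
        for f g :: "real \<Rightarrow> 'z::real_inner" and f' g' r
        using bounded_bilinear.has_vector_derivative[OF bounded_bilinear_inner that]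
        by (simp add: has_real_derivative_iff_has_vector_derivative)
      have t0: "fst (h (0, s)) = s" and z0: "snd (h (0, s)) = \<gamma> s" by (simp_all add: h0 graph_curve_def)
      have ch: "((\<lambda>\<sigma>. f (fst (h (\<sigma>, s)))) has_real_derivative pd 1 f s * \<rho> s) (at 0)" if "smooth_on UNIV f" for f
        using DERIV_chain2[OF _ t, of f "pd 1 f s"] smooth_on_real_derivative[OF that, of s] t0 by simp
      note D = ch[OF F] ch[OF m(1)] ch[OF m(2)] \<xi> ip[OF v v] ip[OF lin[OF fs(1) z] lin[OF fs(1) z]]
        ip[OF lin[OF fs(2) z] lin[OF fs(2) z]]
      let ?V = "(m1 s * (fst (\<gamma> s) \<bullet> fst (\<gamma> s)) + m2 s * (snd (\<gamma> s) \<bullet> snd (\<gamma> s))) / 2"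
      let ?Vt = "(pd 1 m1 s * (fst (\<gamma> s) \<bullet> fst (\<gamma> s)) + pd 1 m2 s * (snd (\<gamma> s) \<bullet> snd (\<gamma> s))) / 2"
      define lz where "lz = (m1 s *\<^sub>R fst (\<gamma> s), m2 s *\<^sub>R snd (\<gamma> s))"
      have "((\<lambda>\<sigma>. L (\<sigma>, s)) has_real_derivative
        pd 1 F s * \<rho> s / 2 * (?v \<bullet> ?v + 2 * ?V) + F s / 2 * (- fst ?W * (?v \<bullet> ?v) + 2 * ?V * fst ?W
          + 2 * (?v \<bullet> snd ?W) + 2 * ?Vt * \<rho> s + 2 * (lz \<bullet> w s))) (at 0)"
        unfolding L_def
      proof (rule DERIV_cong[OF length_integrand_DERIV[OF D(1-3) D(6,7) D(5) D(4)]])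
        have c: "snd ?W \<bullet> ?v = ?v \<bullet> snd ?W" "fst (w s) \<bullet> fst (\<gamma> s) = fst (\<gamma> s) \<bullet> fst (w s)"
          "snd (w s) \<bullet> snd (\<gamma> s) = snd (\<gamma> s) \<bullet> snd (w s)" by (rule inner_commute)+
        have l: "lz \<bullet> w s = m1 s * (fst (\<gamma> s) \<bullet> fst (w s)) + m2 s * (snd (\<gamma> s) \<bullet> snd (w s))"
          by (simp add: lz_def inner_prod_def)
        show "fst (?hs (0, s)) = 1" by (simp add: hs0)
        show "pd 1 F s * \<rho> s / 2 * (snd (?hs (0, s)) \<bullet> snd (?hs (0, s)) +
              (m1 (fst (h (0, s))) * (fst (snd (h (0, s))) \<bullet> fst (snd (h (0, s))))
               + m2 (fst (h (0, s))) * (snd (snd (h (0, s))) \<bullet> snd (snd (h (0, s))))))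
          + F (fst (h (0, s))) / 2 * (- fst ?W * (snd (?hs (0, s)) \<bullet> snd (?hs (0, s))) +
              (m1 (fst (h (0, s))) * (fst (snd (h (0, s))) \<bullet> fst (snd (h (0, s))))
               + m2 (fst (h (0, s))) * (snd (snd (h (0, s))) \<bullet> snd (snd (h (0, s))))) * fst ?W
            + (snd (?hs (0, s)) \<bullet> snd ?W + snd ?W \<bullet> snd (?hs (0, s)))
            + (pd 1 m1 s * \<rho> s * (fst (snd (h (0, s))) \<bullet> fst (snd (h (0, s))))
              + m1 (fst (h (0, s))) * (fst (snd (h (0, s))) \<bullet> fst (w s) + fst (w s) \<bullet> fst (snd (h (0, s))))
              + pd 1 m2 s * \<rho> s * (snd (snd (h (0, s))) \<bullet> snd (snd (h (0, s))))
              + m2 (fst (h (0, s))) * (snd (snd (h (0, s))) \<bullet> snd (w s) + snd (w s) \<bullet> snd (snd (h (0, s))))))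
          = pd 1 F s * \<rho> s / 2 * (?v \<bullet> ?v + 2 * ?V) + F s / 2 * (- fst ?W * (?v \<bullet> ?v) + 2 * ?V * fst ?W
          + 2 * (?v \<bullet> snd ?W) + 2 * ?Vt * \<rho> s + 2 * (lz \<bullet> w s))"
          unfolding t0 z0 hs0 snd_conv l c by (simp add: field_simps)
      qed
      then have "((\<lambda>\<sigma>. L (\<sigma>, s)) has_vector_derivative
        pd 1 F s * \<rho> s / 2 * (?v \<bullet> ?v + 2 * ?V) + F s / 2 * (- fst ?W * (?v \<bullet> ?v) + 2 * ?V * fst ?W
          + 2 * (?v \<bullet> snd ?W) + 2 * ?Vt * \<rho> s + 2 * (lz \<bullet> w s))) (at 0)"
        unfolding has_real_derivative_iff_has_vector_derivative .
      note Lval = vector_derivative_unique_at[OF partial_derivatives(1)[OF smooth_onD(1)[OF L in0]] this]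
      have d\<rho>: "(\<rho> has_real_derivative fst ?W) (at s)"
        using lin[OF fs(1) dW] by (simp add: \<rho>_def[abs_def] has_real_derivative_iff_has_vector_derivative)
      have dw: "(w has_vector_derivative snd ?W) (at s)"
        using lin[OF fs(2) dW] by (simp add: w_def[abs_def])
      have A': "(A has_real_derivative pd 1 F s * (?v \<bullet> w s) + F s * (?a \<bullet> w s + ?v \<bullet> snd ?W)
        + (pd 1 F s * (?V - ?v \<bullet> ?v / 2) + F s * (?Vt + lz \<bullet> ?v - ?a \<bullet> ?v)) * \<rho> s
        + F s * (?V - ?v \<bullet> ?v / 2) * fst ?W) (at s)"
        unfolding A_def[abs_def]
      proof (rule DERIV_cong[OF first_variation_DERIV[OF smooth_on_real_derivative[OF F]
            smooth_on_real_derivative[OF m(1)] smooth_on_real_derivative[OF m(2)]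
            ip[OF lin[OF fs(1) d\<gamma>] lin[OF fs(1) d\<gamma>]] ip[OF lin[OF fs(2) d\<gamma>] lin[OF fs(2) d\<gamma>]]
            ip[OF d\<gamma>' dw] ip[OF d\<gamma>' d\<gamma>'] d\<rho>]])
        have c: "?v \<bullet> ?a = ?a \<bullet> ?v" "fst ?v \<bullet> fst (\<gamma> s) = fst (\<gamma> s) \<bullet> fst ?v"
          "snd ?v \<bullet> snd (\<gamma> s) = snd (\<gamma> s) \<bullet> snd ?v" by (rule inner_commute)+
        have l: "lz \<bullet> ?v = m1 s * (fst (\<gamma> s) \<bullet> fst ?v) + m2 s * (snd (\<gamma> s) \<bullet> snd ?v)"
          by (simp add: lz_def inner_prod_def)
        show "pd 1 F s * (?v \<bullet> w s) + F s * (?v \<bullet> snd ?W + ?a \<bullet> w s)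
          + (pd 1 F s * (?V - ?v \<bullet> ?v / 2) + F s * ((pd 1 m1 s * (fst (\<gamma> s) \<bullet> fst (\<gamma> s))
            + m1 s * (fst (\<gamma> s) \<bullet> fst ?v + fst ?v \<bullet> fst (\<gamma> s))
            + pd 1 m2 s * (snd (\<gamma> s) \<bullet> snd (\<gamma> s))
            + m2 s * (snd (\<gamma> s) \<bullet> snd ?v + snd ?v \<bullet> snd (\<gamma> s))) / 2 - (?v \<bullet> ?a + ?a \<bullet> ?v) / 2)) * \<rho> s
          + F s * (?V - ?v \<bullet> ?v / 2) * fst ?W
          = pd 1 F s * (?v \<bullet> w s) + F s * (?a \<bullet> w s + ?v \<bullet> snd ?W)
        + (pd 1 F s * (?V - ?v \<bullet> ?v / 2) + F s * (?Vt + lz \<bullet> ?v - ?a \<bullet> ?v)) * \<rho> s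
        + F s * (?V - ?v \<bullet> ?v / 2) * fst ?W"
          unfolding l c by (simp add: field_simps)
      qed
      \<comment> \<open>Tested against a vector orthogonal to \<gamma>, the profile equation loses
        its multiplier. This applies to \<open>w s\<close>, since the varied curves stay on the
        sphere, and to the velocity.\<close>
      have key: "F s * (?a \<bullet> u) + pd 1 F s * (?v \<bullet> u) = F s * (lz \<bullet> u)" if "\<gamma> s \<bullet> u = 0" for u
      proof -
        obtain e where e: "?a + (pd 1 F s / F s) *\<^sub>R ?v = lz + e *\<^sub>R \<gamma> s"
          using E[of s] unfolding profile_eq_def lz_def m1_def m2_def by blast
        have "?a \<bullet> u + (pd 1 F s / F s) * (?v \<bullet> u) = lz \<bullet> u"
          using arg_cong[OF e, of "\<lambda>x. x \<bullet> u"] that by (simp add: inner_add_left)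
        from arg_cong[OF this, of "\<lambda>x. F s * x"] Fp[of s] show ?thesis by (simp add: distrib_left)
      qed
      have wp: "\<gamma> s \<bullet> w s = 0"
      proof -
        have "((\<lambda>\<sigma>. snd (h (\<sigma>, s)) \<bullet> snd (h (\<sigma>, s))) has_real_derivative \<gamma> s \<bullet> w s + w s \<bullet> \<gamma> s) (at 0)"
          using ip[OF z z] by (simp add: z0)
        moreover have "((\<lambda>\<sigma>. snd (h (\<sigma>, s)) \<bullet> snd (h (\<sigma>, s))) has_real_derivative 0) (at 0)"
          by (rule has_field_derivative_transform_within_open[of "\<lambda>\<sigma>. 1" _ _ ?I])
            (use \<epsilon> sph in \<open>auto simp: dot_square_norm\<close>)
        ultimately have "\<gamma> s \<bullet> w s + w s \<bullet> \<gamma> s = 0" by (rule DERIV_unique)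
        then show ?thesis by (simp add: inner_commute)
      qed
      have vp: "\<gamma> s \<bullet> ?v = 0"
        using sphere_curve_derivatives(1)[OF open_UNIV UNIV_I \<gamma>(1), of s] \<gamma>(2) by (simp add: inner_commute)
      have "(A has_real_derivative pd (1, 0) L (0, s)) (at s)"
        using A' unfolding Lval first_variation_identity[OF key[OF wp] key[OF vp]] .
      then show ?thesis by (simp add: has_real_derivative_iff_has_vector_derivative)
    qed
    have "((\<lambda>s. pd (1, 0) L (0, s)) has_integral A \<beta> - A \<alpha>) {\<alpha>..\<beta>}"
      by (rule fundamental_theorem_of_calculus[OF ab has_vector_derivative_at_within[OF dA]])
    moreover have "A \<alpha> = 0" "A \<beta> = 0"
      using variation_field_boundary[OF h \<epsilon> out ab] by (simp_all add: A_def w_def \<rho>_def)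
    ultimately have "integral {\<alpha>..\<beta>} (\<lambda>s. pd (1, 0) L (0, s)) = 0" by (simp add: integral_unique)
    then show ?thesis using der by (simp add: has_real_derivative_iff_has_vector_derivative)
  qed
  note main = this
  show ?thesis unfolding conic_geodesic_def
  proof (intro conjI allI impI cc)
    fix \<epsilon> \<alpha> \<beta> h
    assume "\<epsilon> > 0 \<and> \<alpha> \<le> \<beta> \<and> {\<alpha>..\<beta>} \<subseteq> UNIV \<and> cone_variation UNIV (graph_curve \<gamma>) \<epsilon> \<alpha> \<beta> h"
    then show "((\<lambda>\<sigma>. curve_length ?K (\<lambda>s. h (\<sigma>, s)) \<alpha> \<beta>) has_real_derivative 0) (at 0)"
      by (elim conjE) (rule main)
  qed
qed

lemma closed_geodesic_graph:
  fixes \<gamma> :: "real \<Rightarrow> complex \<times> complex"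
  assumes F: "smooth_on UNIV F" and l: "smooth_on UNIV l1" "smooth_on UNIV l2" "\<And>t. l1 t > 0" "\<And>t. l2 t > 0"
    and Fp: "\<And>t. F t > 0"
    and \<gamma>: "smooth_on UNIV \<gamma>" "\<And>t. norm (\<gamma> t) = 1"
    and E: "\<And>t. profile_eq (pd 1 F t / F t) (d1 / (l1 t)\<^sup>2) (d2 / (l2 t)\<^sup>2) \<gamma> t"
    and P: "P > 0" "periodic P \<gamma>"
  shows "closed_geodesic (finsler F (potential d1 d2 l1 l2)) P (graph_curve \<gamma>) P"
  unfolding closed_geodesic_def
proof (intro conjI allI)
  show "conic_geodesic (finsler F (potential d1 d2 l1 l2)) UNIV (graph_curve \<gamma>)"
    by (rule conic_geodesic_graph) (fact assms)+
  have "\<gamma> (s + P) = \<gamma> s" for s using P(2) unfolding periodic_def by blast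
  then show "to_circle P (graph_curve \<gamma> (s + P)) = to_circle P (graph_curve \<gamma> s)" for s
    by (simp add: to_circle_def graph_curve_def circ_add_period)
qed (rule P(1))

section \<open>The clock \<open>d\<tau> = dt / F\<close>\<close>

text \<open>The clock advances by the same amount on every period, so a solution whose period is
  this amount becomes a P-periodic curve. With the angular speed in place of F the same lemma
  measures the time of one turn of a pendulum.\<close>

lemma clock_exists:
  fixes F :: "real \<Rightarrow> real"
  assumes F: "smooth_on UNIV F" "\<And>t. F t > 0" and P: "P > 0" "periodic P F"
  obtains \<tau> where "\<And>t. (\<tau> has_real_derivative 1 / F t) (at t)" "\<tau> 0 = 0" "smooth_on UNIV \<tau>"
    "\<And>t. \<tau> (t + P) = \<tau> t + integral {0..P} (\<lambda>t. 1 / F t)" "integral {0..P} (\<lambda>t. 1 / F t) > 0"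
proof -
  have F0: "F t \<noteq> 0" for t using F(2)[of t] by simp
  have sF: "smooth_on UNIV (\<lambda>t. 1 / F t)" by (rule smooth_on_divide[OF open_UNIV smooth_on_const F(1) F0])
  have c: "isCont (\<lambda>t. 1 / F t) t" for t
    using smooth_on_imp_continuous_on[OF sF] by (simp add: continuous_on_eq_continuous_at)
  obtain \<tau>0 where \<tau>0: "\<And>t. (\<tau>0 has_vector_derivative 1 / F t) (at t)"
    using einterval_antiderivative[of "-\<infinity>" \<infinity> "\<lambda>t. 1 / F t"] c by auto
  define \<tau> where "\<tau> t = \<tau>0 t - \<tau>0 0" for t
  have dv: "(\<tau> has_vector_derivative 1 / F t) (at t)" for t
    unfolding \<tau>_def[abs_def] using has_vector_derivative_diff_const[of \<tau>0 "\<tau>0 0" "1 / F t" "at t"] \<tau>0[of t] by simp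
  then have d: "(\<tau> has_real_derivative 1 / F t) (at t)" for t
    by (simp add: has_real_derivative_iff_has_vector_derivative)
  have s: "smooth_on UNIV \<tau>" by (rule smooth_on_if_derivative[OF open_UNIV dv sF])
  have "((\<lambda>t. 1 / F t) has_integral \<tau> P - \<tau> 0) {0..P}"
    by (rule fundamental_theorem_of_calculus[OF less_imp_le[OF P(1)] has_vector_derivative_at_within[OF dv]])
  then have I: "integral {0..P} (\<lambda>t. 1 / F t) = \<tau> P" by (simp add: integral_unique \<tau>_def)
  have "((\<lambda>t. \<tau> (t + P) - \<tau> t) has_real_derivative 0) (at t)" for t
  proof -
    have "((\<lambda>t. \<tau> (t + P)) has_real_derivative 1 / F (t + P)) (at t)"
      using d[of "t + P"] by (simp add: DERIV_shift)
    from DERIV_diff[OF this d[of t]] show ?thesis using P(2) by (simp add: periodic_def)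
  qed
  then have "\<tau> (t + P) - \<tau> t = \<tau> (0 + P) - \<tau> 0" for t
    using DERIV_isconst_all[of "\<lambda>t. \<tau> (t + P) - \<tau> t" t 0] by blast
  then have "\<tau> (t + P) - \<tau> t = \<tau> P" for t by (simp add: \<tau>_def)
  then have per: "\<tau> (t + P) = \<tau> t + \<tau> P" for t by (metis diff_eq_eq add.commute)
  have "\<tau> 0 < \<tau> P"
    by (rule DERIV_pos_imp_increasing[OF P(1)]) (use d F(2) in \<open>auto intro!: exI[of _ "1 / F _"]\<close>)
  then have "\<tau> P > 0" by (simp add: \<tau>_def)
  then show thesis by (intro that[of \<tau>]) (simp_all add: d s per I \<tau>_def[of 0])
qed

section \<open>The Hopf torus family\<close>

lemma pd1_eqI: "(f has_vector_derivative D) (at t) \<Longrightarrow> pd 1 f t = D"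
  using pd_eqI[of f "\<lambda>h. h *\<^sub>R D" t 1] by (simp add: has_vector_derivative_def)

definition torus_curve :: "real \<Rightarrow> real \<Rightarrow> real \<Rightarrow> real \<Rightarrow> complex \<times> complex" where
  "torus_curve \<omega>1 \<omega>2 a s = (a *\<^sub>R cis (\<omega>1 * s), sqrt (1 - a\<^sup>2) *\<^sub>R cis (\<omega>2 * s))"

lemma torus_curve_smooth: "smooth_on UNIV (torus_curve \<omega>1 \<omega>2 a)"
  unfolding torus_curve_def[abs_def]
  by (intro smooth_on_Pair smooth_on_scaleR smooth_on_cis smooth_on_mult smooth_on_const smooth_on_ident open_UNIV)

lemma torus_curve_derivs:
  "pd 1 (torus_curve \<omega>1 \<omega>2 a) s = (a *\<^sub>R (\<omega>1 *\<^sub>R (\<i> * cis (\<omega>1 * s))), sqrt (1 - a\<^sup>2) *\<^sub>R (\<omega>2 *\<^sub>R (\<i> * cis (\<omega>2 * s))))"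
  "pd 1 (pd 1 (torus_curve \<omega>1 \<omega>2 a)) s = (- \<omega>1\<^sup>2 *\<^sub>R fst (torus_curve \<omega>1 \<omega>2 a s), - \<omega>2\<^sup>2 *\<^sub>R snd (torus_curve \<omega>1 \<omega>2 a s))"
proof -
  have c: "((\<lambda>s. cis (w * s)) has_vector_derivative w *\<^sub>R (\<i> * cis (w * s))) (at s)" for w s
    unfolding has_vector_derivative_def
    by (rule has_derivative_eq_rhs[OF has_derivative_cis[of "\<lambda>s. w * s" "\<lambda>h. w * h"]])
      (auto intro!: derivative_eq_intros simp: mult.commute)
  have bl: "bounded_linear (\<lambda>z. r *\<^sub>R (z :: complex))" for r by (rule bounded_linear_scaleR_right)
  have bm: "bounded_linear (\<lambda>z. u * (z :: complex))" for u by (rule bounded_linear_mult_right)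
  have 1: "pd 1 (torus_curve \<omega>1 \<omega>2 a) s = (a *\<^sub>R (\<omega>1 *\<^sub>R (\<i> * cis (\<omega>1 * s))), sqrt (1 - a\<^sup>2) *\<^sub>R (\<omega>2 *\<^sub>R (\<i> * cis (\<omega>2 * s))))" for s
    unfolding torus_curve_def[abs_def]
    by (intro pd1_eqI has_vector_derivative_Pair bounded_linear.has_vector_derivative[OF bl] c)
  then show "pd 1 (torus_curve \<omega>1 \<omega>2 a) s = (a *\<^sub>R (\<omega>1 *\<^sub>R (\<i> * cis (\<omega>1 * s))), sqrt (1 - a\<^sup>2) *\<^sub>R (\<omega>2 *\<^sub>R (\<i> * cis (\<omega>2 * s))))" .
  have "pd 1 (pd 1 (torus_curve \<omega>1 \<omega>2 a)) s = pd 1 (\<lambda>s. (a *\<^sub>R (\<omega>1 *\<^sub>R (\<i> * cis (\<omega>1 * s))), sqrt (1 - a\<^sup>2) *\<^sub>R (\<omega>2 *\<^sub>R (\<i> * cis (\<omega>2 * s))))) s"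
    by (simp add: 1[abs_def])
  also have "\<dots> = (a *\<^sub>R (\<omega>1 *\<^sub>R (\<i> * (\<omega>1 *\<^sub>R (\<i> * cis (\<omega>1 * s))))), sqrt (1 - a\<^sup>2) *\<^sub>R (\<omega>2 *\<^sub>R (\<i> * (\<omega>2 *\<^sub>R (\<i> * cis (\<omega>2 * s))))))"
    by (intro pd1_eqI has_vector_derivative_Pair bounded_linear.has_vector_derivative[OF bl]
        bounded_linear.has_vector_derivative[OF bm] c)
  also have "\<dots> = (- \<omega>1\<^sup>2 *\<^sub>R fst (torus_curve \<omega>1 \<omega>2 a s), - \<omega>2\<^sup>2 *\<^sub>R snd (torus_curve \<omega>1 \<omega>2 a s))"
    by (simp add: torus_curve_def power2_eq_square scaleR_conv_of_real mult_ac)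
  finally show "pd 1 (pd 1 (torus_curve \<omega>1 \<omega>2 a)) s = (- \<omega>1\<^sup>2 *\<^sub>R fst (torus_curve \<omega>1 \<omega>2 a s), - \<omega>2\<^sup>2 *\<^sub>R snd (torus_curve \<omega>1 \<omega>2 a s))" .
qed

lemma torus_curve_neumann: "profile_eq 0 0 (\<omega>1\<^sup>2 - \<omega>2\<^sup>2) (torus_curve \<omega>1 \<omega>2 a) s"
  unfolding profile_eq_def torus_curve_derivs
  \<comment> \<open>The first component has coefficient 0 and forces the multiplier - \<omega>1^2;
    the second component then requires \<kappa> = \<omega>1^2 - \<omega>2^2.\<close>
  by (intro exI[of _ "- \<omega>1\<^sup>2"]) (simp add: prod_eq_iff algebra_simps)

lemma torus_curve_norms:
  assumes "0 < a" "a < 1"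
  shows "norm (fst (torus_curve \<omega>1 \<omega>2 a s)) = a" "norm (snd (torus_curve \<omega>1 \<omega>2 a s)) = sqrt (1 - a\<^sup>2)"
    "norm (torus_curve \<omega>1 \<omega>2 a s) = 1"
    "(norm (pd 1 (torus_curve \<omega>1 \<omega>2 a) s))\<^sup>2 = a\<^sup>2 * \<omega>1\<^sup>2 + (1 - a\<^sup>2) * \<omega>2\<^sup>2"
proof -
  have a: "a\<^sup>2 < 1" using assms by (simp add: power_less_one_iff)
  show 1: "norm (fst (torus_curve \<omega>1 \<omega>2 a s)) = a" "norm (snd (torus_curve \<omega>1 \<omega>2 a s)) = sqrt (1 - a\<^sup>2)"
    using assms a by (simp_all add: torus_curve_def)
  show "norm (torus_curve \<omega>1 \<omega>2 a s) = 1" unfolding norm_prod_def 1 using a by simp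
  show "(norm (pd 1 (torus_curve \<omega>1 \<omega>2 a) s))\<^sup>2 = a\<^sup>2 * \<omega>1\<^sup>2 + (1 - a\<^sup>2) * \<omega>2\<^sup>2"
    unfolding torus_curve_derivs using a by (simp add: norm_prod_def norm_mult power_mult_distrib)
qed

text \<open>A single component may have a shorter period. By Bezout an integer combination of
  \<open>r1\<close> and \<open>r2\<close> is 1, so \<open>I\<close> is the minimal period of the
  pair; the congruence argument compares these minimal periods.\<close>

lemma torus_curve_period:
  fixes r1 r2 :: int
  assumes co: "coprime r1 r2" and I: "I > 0" and a: "0 < a" "a < 1"
    and \<omega>: "\<omega>1 = 2 * pi * r1 / I" "\<omega>2 = 2 * pi * r2 / I"
  shows "torus_curve \<omega>1 \<omega>2 a (s + T) = torus_curve \<omega>1 \<omega>2 a s \<longleftrightarrow> T / I \<in> \<int>"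
proof -
  have a2: "sqrt (1 - a\<^sup>2) \<noteq> 0" using a by (simp add: power2_eq_1_iff)
  have "torus_curve \<omega>1 \<omega>2 a (s + T) = torus_curve \<omega>1 \<omega>2 a s \<longleftrightarrow> cis (\<omega>1 * T) = 1 \<and> cis (\<omega>2 * T) = 1"
  proof -
    have "cis (w * (s + T)) = cis (w * s) * cis (w * T)" for w by (simp add: cis_mult distrib_left)
    then show ?thesis using a a2 by (simp add: torus_curve_def)
  qed
  moreover have "cis (2 * pi * r / I * T) = 1 \<longleftrightarrow> r * (T / I) \<in> \<int>" for r :: int
  proof -
    have "cis (2 * pi * r / I * T) = 1 \<longleftrightarrow> (\<exists>n::int. 2 * pi * r / I * T = 2 * pi * n)"
    proof
      assume "cis (2 * pi * r / I * T) = 1"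
      then have "cos (2 * pi * r / I * T) = 1" by (metis cis.simps(1) one_complex.simps(1))
      then show "\<exists>n::int. 2 * pi * r / I * T = 2 * pi * n" by (auto simp: cos_one_2pi_int mult_ac)
    next
      assume "\<exists>n::int. 2 * pi * r / I * T = 2 * pi * n"
      then obtain n :: int where "2 * pi * r / I * T = 2 * pi * n" ..
      then show "cis (2 * pi * r / I * T) = 1" by (simp only: cis_multiple_2pi Ints_of_int)
    qed
    also have "\<dots> \<longleftrightarrow> (\<exists>n::int. r * (T / I) = n)"
    proof -
      have "2 * pi * r / I * T = 2 * pi * n \<longleftrightarrow> r * (T / I) = n" for n :: int
      proof -
        have "2 * pi * r / I * T = 2 * pi * (r * (T / I))" by simp
        then show ?thesis using pi_gt_zero by (simp only: mult_cancel_left) simp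
      qed
      then show ?thesis by simp
    qed
    finally show ?thesis by (auto simp: Ints_def)
  qed
  moreover have "r1 * (T / I) \<in> \<int> \<and> r2 * (T / I) \<in> \<int> \<longleftrightarrow> T / I \<in> \<int>"
  proof
    assume R: "r1 * (T / I) \<in> \<int> \<and> r2 * (T / I) \<in> \<int>"
    obtain u v :: int where "u * r1 + v * r2 = 1" using co bezout_int[of r1 r2] by auto
    then have "real_of_int u * real_of_int r1 + real_of_int v * real_of_int r2 = 1" by (metis of_int_1 of_int_add of_int_mult)
    then have "T / I = (real_of_int u * real_of_int r1 + real_of_int v * real_of_int r2) * (T / I)" by simp
    also have "\<dots> = u * (r1 * (T / I)) + v * (r2 * (T / I))" by (simp only: distrib_right mult.assoc)
    finally show "T / I \<in> \<int>"
      using Ints_add[OF Ints_mult[OF Ints_of_int conjunct1[OF R]] Ints_mult[OF Ints_of_int conjunct2[OF R]]] by metis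
  next
    assume "T / I \<in> \<int>"
    then show "r1 * (T / I) \<in> \<int> \<and> r2 * (T / I) \<in> \<int>" by (intro conjI Ints_mult Ints_of_int)
  qed
  ultimately show ?thesis unfolding \<omega> by simp
qed

section \<open>Congruence of torus curves\<close>

text \<open>An isometry is given by distances alone and no derivative of it is at hand. Speeds are
  therefore compared as limits of quotients of chord length by elapsed time.\<close>

lemma norm_derivative_eq:
  fixes f :: "real \<Rightarrow> 'a::real_normed_vector" and g :: "real \<Rightarrow> 'b::real_normed_vector"
  assumes f: "(f has_vector_derivative f') (at t)" and g: "(g has_vector_derivative g') (at t)"
    and eq: "\<And>s. norm (f s - f t) = norm (g s - g t)"
  shows "norm f' = norm g'"
proof -
  have lim: "((\<lambda>s. norm (h s - h t) / \<bar>s - t\<bar>) \<longlongrightarrow> norm h') (at t)"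
    if "(h has_vector_derivative h') (at t)" for h :: "real \<Rightarrow> 'c::real_normed_vector" and h'
  proof -
    have "((\<lambda>s. norm (h s - h t - (s - t) *\<^sub>R h') / norm (s - t)) \<longlongrightarrow> 0) (at t)"
      using that unfolding has_vector_derivative_def has_derivative_iff_norm by simp
    moreover have "\<forall>\<^sub>F s in at t. norm (norm (h s - h t) / \<bar>s - t\<bar> - norm h')
        \<le> norm (h s - h t - (s - t) *\<^sub>R h') / norm (s - t)"
      unfolding eventually_at
    proof (intro exI[of _ 1] conjI ballI impI)
      fix s assume s: "s \<noteq> t \<and> dist s t < 1"
      have "norm (h s - h t) / \<bar>s - t\<bar> - norm h' = (norm (h s - h t) - norm ((s - t) *\<^sub>R h')) / \<bar>s - t\<bar>"
        using s by (simp add: diff_divide_distrib)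
      then show "norm (norm (h s - h t) / \<bar>s - t\<bar> - norm h') \<le> norm (h s - h t - (s - t) *\<^sub>R h') / norm (s - t)"
        using norm_triangle_ineq3[of "h s - h t" "(s - t) *\<^sub>R h'"]
        by (simp add: divide_right_mono)
    qed simp
    ultimately have "((\<lambda>s. norm (h s - h t) / \<bar>s - t\<bar> - norm h') \<longlongrightarrow> 0) (at t)"
      by (rule Lim_null_comparison[rotated])
    then show ?thesis by (rule LIM_zero_cancel)
  qed
  show ?thesis
    using LIM_unique[OF lim[OF f] lim[OF g, folded eq]] .
qed

text \<open>Cauchy-Schwarz puts the inner products into [-1, 1], where \<open>cos\<close> undoes
  \<open>arccos\<close>.\<close>

lemma S3_isometry_inner:
  assumes "S3_isometry A" "x \<in> S3" "y \<in> S3"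
  shows "A x \<in> S3" "A x \<bullet> A y = x \<bullet> y"
proof -
  have A: "A z \<in> S3" if "z \<in> S3" for z using assms(1) that unfolding S3_isometry_def by blast
  then show "A x \<in> S3" using assms(2) .
  have b: "\<bar>u \<bullet> v\<bar> \<le> 1" if "u \<in> S3" "v \<in> S3" for u v :: "complex \<times> complex"
    using Cauchy_Schwarz_ineq2[of u v] that by simp
  have "arccos (A x \<bullet> A y) = arccos (x \<bullet> y)" using assms unfolding S3_isometry_def by blast
  then have "cos (arccos (A x \<bullet> A y)) = cos (arccos (x \<bullet> y))" by simp
  then show "A x \<bullet> A y = x \<bullet> y" using b[OF A A, OF assms(2,3)] b[OF assms(2,3)] by (simp add: cos_arccos_abs)
qed

lemma S3_isometry_dist:
  assumes "S3_isometry A" "x \<in> S3" "y \<in> S3"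
  shows "norm (A x - A y) = norm (x - y)"
proof -
  have n: "(norm (u - v))\<^sup>2 = 2 - 2 * (u \<bullet> v)" if "u \<in> S3" "v \<in> S3" for u v :: "complex \<times> complex"
  proof -
    have "u \<bullet> u = 1" "v \<bullet> v = 1" using that by (simp_all add: dot_square_norm)
    then show ?thesis by (simp add: power2_norm_eq_inner inner_diff_left inner_diff_right inner_commute)
  qed
  have "(norm (A x - A y))\<^sup>2 = (norm (x - y))\<^sup>2"
    using S3_isometry_inner[OF assms] S3_isometry_inner(1)[OF assms(1,3,2)] assms by (simp add: n)
  then show ?thesis by simp
qed

text \<open>
  A congruence matches speeds, so in the clock \<open>\<tau>\<close> it is affine with slope the quotient of the two
  constant speeds. As it also matches minimal periods, the slope is an integer, and so is its inverse.
\<close>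

lemma torus_curves_not_congruent:
  fixes r1 r2 :: int
  assumes co: "coprime r1 r2" and r: "r1 \<noteq> 0" "r2 \<noteq> 0" "\<bar>r1\<bar> \<noteq> \<bar>r2\<bar>" and I: "I > 0"
    and \<omega>: "\<omega>1 = 2 * pi * r1 / I" "\<omega>2 = 2 * pi * r2 / I"
    and \<tau>: "\<And>t. (\<tau> has_real_derivative 1 / F t) (at t)" "\<And>t. \<tau> (t + P) = \<tau> t + I" and F: "\<And>t. F t > 0"
    and ab: "a \<in> {0<..<1}" "b \<in> {0<..<1}"
    and cong: "congruent_curves (\<lambda>t. torus_curve \<omega>1 \<omega>2 a (\<tau> t)) (\<lambda>t. torus_curve \<omega>1 \<omega>2 b (\<tau> t))"
  shows "a = b"
proof -
  obtain A \<phi> where A: "S3_isometry A" and \<phi>: "bij \<phi>" "smooth_on UNIV \<phi>" "\<And>t. deriv \<phi> t \<noteq> 0"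
    and eq: "\<And>t. torus_curve \<omega>1 \<omega>2 b (\<tau> (\<phi> t)) = A (torus_curve \<omega>1 \<omega>2 a (\<tau> t))"
    using cong unfolding congruent_curves_def by blast
  define v where "v a = sqrt (a\<^sup>2 * \<omega>1\<^sup>2 + (1 - a\<^sup>2) * \<omega>2\<^sup>2)" for a
  have a01: "0 < a" "a < 1" "0 < b" "b < 1" using ab by auto
  have \<omega>0: "\<omega>1 \<noteq> 0" using r I by (simp add: \<omega>)
  have vpos: "v c > 0" if "0 < c" "c < 1" for c
  proof -
    have "c\<^sup>2 * \<omega>1\<^sup>2 > 0" "(1 - c\<^sup>2) * \<omega>2\<^sup>2 \<ge> 0" using that \<omega>0 by (auto simp: power_le_one_iff)
    then show ?thesis by (simp add: v_def)
  qed
  have vn: "norm (pd 1 (torus_curve \<omega>1 \<omega>2 c) s) = v c" if "0 < c" "c < 1" for c s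
    using torus_curve_norms(4)[OF that, of \<omega>1 \<omega>2 s] by (metis norm_ge_zero real_sqrt_abs abs_of_nonneg v_def)
  have S: "torus_curve \<omega>1 \<omega>2 c s \<in> S3" if "0 < c" "c < 1" for c s
    using torus_curve_norms(3)[OF that] by simp
  have d\<phi>: "(\<phi> has_real_derivative deriv \<phi> t) (at t)" for t
    using smooth_on_real_derivative[OF \<phi>(2), of t] DERIV_imp_deriv by metis
  have dtc: "(torus_curve \<omega>1 \<omega>2 c has_vector_derivative pd 1 (torus_curve \<omega>1 \<omega>2 c) s) (at s)" for c s
    using smooth_on_vector_derivative(1,3)[OF open_UNIV torus_curve_smooth, of s] by simp
  have chain: "((\<lambda>t. torus_curve \<omega>1 \<omega>2 c (g t)) has_vector_derivative g' *\<^sub>R pd 1 (torus_curve \<omega>1 \<omega>2 c) (g t)) (at t)"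
    if "(g has_real_derivative g') (at t)" for g g' c t
    using vector_diff_chain_at[of g g' t, OF _ dtc[of c "g t"]] that
    by (simp add: has_real_derivative_iff_has_vector_derivative o_def)
  have d\<tau>\<phi>: "((\<lambda>t. \<tau> (\<phi> t)) has_real_derivative 1 / F (\<phi> t) * deriv \<phi> t) (at t)" for t
    by (rule DERIV_chain2[OF \<tau>(1) d\<phi>])
  have speed: "\<bar>1 / F (\<phi> t) * deriv \<phi> t\<bar> * v b = v a * (1 / F t)" for t
  proof -
    have "norm ((1 / F (\<phi> t) * deriv \<phi> t) *\<^sub>R pd 1 (torus_curve \<omega>1 \<omega>2 b) (\<tau> (\<phi> t)))
      = norm ((1 / F t) *\<^sub>R pd 1 (torus_curve \<omega>1 \<omega>2 a) (\<tau> t))"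
    proof (rule norm_derivative_eq[OF chain[OF d\<tau>\<phi>] chain[OF \<tau>(1)]])
      show "norm (torus_curve \<omega>1 \<omega>2 b (\<tau> (\<phi> s)) - torus_curve \<omega>1 \<omega>2 b (\<tau> (\<phi> t)))
        = norm (torus_curve \<omega>1 \<omega>2 a (\<tau> s) - torus_curve \<omega>1 \<omega>2 a (\<tau> t))" for s
        unfolding eq by (rule S3_isometry_dist[OF A S S]) (use a01 in auto)
    qed
    then show ?thesis using a01 F[of t] by (simp add: vn mult.commute)
  qed
  define c where "c = v a / v b"
  have c: "c > 0" using vpos a01 by (simp add: c_def)
  have cs: "\<bar>1 / F (\<phi> t) * deriv \<phi> t\<bar> = c * (1 / F t)" for t
  proof -
    have "\<bar>1 / F (\<phi> t) * deriv \<phi> t\<bar> = v a * (1 / F t) / v b"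
      using speed[of t] vpos[OF a01(3,4)] by (metis less_numeral_extra(3) nonzero_mult_div_cancel_right)
    then show ?thesis by (simp add: c_def)
  qed
  have "continuous_on UNIV (pd 1 \<phi>)"
    using smooth_on_imp_continuous_on[OF smooth_onD(2)[OF \<phi>(2), of 1]] by simp
  moreover have pd\<phi>: "pd 1 \<phi> t = deriv \<phi> t" for t
    using smooth_on_real_derivative[OF \<phi>(2), of t] DERIV_imp_deriv by metis
  ultimately have cont: "continuous_on UNIV (deriv \<phi>)" by (metis ext)
  have sgn: "(\<forall>t. deriv \<phi> t > 0) \<or> (\<forall>t. deriv \<phi> t < 0)"
  proof (rule ccontr)
    assume "\<not> ?thesis"
    then obtain s t where "deriv \<phi> s \<le> 0" "deriv \<phi> t \<ge> 0" by (auto simp: not_less)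
    moreover have "connected (range (deriv \<phi>))" by (rule connected_continuous_image[OF cont connected_UNIV])
    ultimately have "0 \<in> range (deriv \<phi>)" by (meson connectedD_interval rangeI)
    then show False using \<phi>(3) by (metis rangeE)
  qed
  \<comment> \<open>The sign records whether the reparametrization preserves or reverses the
    direction of time; \<open>congruent_curves\<close> admits both. It is constant because the
    derivative of \<phi> is continuous and has no zero.\<close>
  obtain \<epsilon> :: real where \<epsilon>: "\<epsilon> = 1 \<or> \<epsilon> = -1" "\<And>t. 1 / F (\<phi> t) * deriv \<phi> t = \<epsilon> * c * (1 / F t)"
  proof (cases "\<forall>t. deriv \<phi> t > 0")
    case True
    have "1 / F (\<phi> t) * deriv \<phi> t > 0" for t using True F[of "\<phi> t"] by simp
    then have "1 / F (\<phi> t) * deriv \<phi> t = 1 * c * (1 / F t)" for t using cs[of t] by (metis abs_of_pos mult_1)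
    then show thesis using that[of 1] by blast
  next
    case False
    then have "\<And>t. deriv \<phi> t < 0" using sgn by blast
    then have "1 / F (\<phi> t) * deriv \<phi> t < 0" for t using F[of "\<phi> t"] by (simp add: divide_neg_pos)
    then have "1 / F (\<phi> t) * deriv \<phi> t = - 1 * c * (1 / F t)" for t
      using cs[of t] by (metis abs_of_neg minus_mult_left mult_1 minus_minus)
    then show thesis using that[of "- 1"] by blast
  qed
  have "((\<lambda>t. \<tau> (\<phi> t) - \<epsilon> * c * \<tau> t) has_real_derivative 0) (at t)" for t
    by (rule DERIV_cong[OF DERIV_diff[OF d\<tau>\<phi> DERIV_cmult[OF \<tau>(1)]]]) (simp only: \<epsilon>(2) diff_self)
  then have "\<tau> (\<phi> t) - \<epsilon> * c * \<tau> t = \<tau> (\<phi> 0) - \<epsilon> * c * \<tau> 0" for t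
    using DERIV_isconst_all[of "\<lambda>t. \<tau> (\<phi> t) - \<epsilon> * c * \<tau> t" t 0] by blast
  then obtain C where C: "\<And>t. \<tau> (\<phi> t) = \<epsilon> * c * \<tau> t + C"
    by (metis add.commute diff_add_cancel)
  note per = torus_curve_period[OF co I _ _ \<omega>]
  have "torus_curve \<omega>1 \<omega>2 a (\<tau> 0 + I) = torus_curve \<omega>1 \<omega>2 a (\<tau> 0)"
    using per[of a "\<tau> 0" I] a01 I by simp
  then have "torus_curve \<omega>1 \<omega>2 b (\<tau> (\<phi> (0 + P))) = torus_curve \<omega>1 \<omega>2 b (\<tau> (\<phi> 0))"
    using \<tau>(2)[of 0] by (simp add: eq)
  moreover have "\<tau> (\<phi> (0 + P)) = \<tau> (\<phi> 0) + \<epsilon> * c * I" unfolding C \<tau>(2) by (simp add: algebra_simps)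
  ultimately have "\<epsilon> * c * I / I \<in> \<int>" using per[of b "\<tau> (\<phi> 0)" "\<epsilon> * c * I"] a01 by simp
  then have "\<epsilon> * c \<in> \<int>" using I by simp
  then have c1: "c \<in> \<int>" using \<epsilon>(1) by (auto simp: minus_in_Ints_iff)
  \<comment> \<open>The converse comparison of periods: at \<open>t2\<close> the second curve has
    completed one more period, so the first has returned to its starting point.\<close>
  obtain t2 where t2: "\<phi> t2 = \<phi> 0 + P" using \<phi>(1) by (metis bij_pointE)
  have "torus_curve \<omega>1 \<omega>2 b (\<tau> (\<phi> t2)) = torus_curve \<omega>1 \<omega>2 b (\<tau> (\<phi> 0))"
    unfolding t2 \<tau>(2) using per[of b "\<tau> (\<phi> 0)" I] a01 I by simp
  then have "norm (A (torus_curve \<omega>1 \<omega>2 a (\<tau> t2)) - A (torus_curve \<omega>1 \<omega>2 a (\<tau> 0))) = 0" by (simp add: eq)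
  then have "torus_curve \<omega>1 \<omega>2 a (\<tau> t2) = torus_curve \<omega>1 \<omega>2 a (\<tau> 0)"
    using S3_isometry_dist[OF A S S] a01 by simp
  moreover have "\<tau> t2 = \<tau> 0 + I / (\<epsilon> * c)"
  proof -
    have "\<epsilon> * c * \<tau> t2 + C = \<epsilon> * c * \<tau> 0 + C + I" using \<tau>(2)[of "\<phi> 0"] t2 C by metis
    then show ?thesis using c \<epsilon>(1) by (auto simp: field_simps)
  qed
  ultimately have "I / (\<epsilon> * c) / I \<in> \<int>" using per[of a "\<tau> 0" "I / (\<epsilon> * c)"] a01 by simp
  then have "1 / (\<epsilon> * c) \<in> \<int>" using I by simp
  then have c2: "1 / c \<in> \<int>" using \<epsilon>(1) by (auto simp: minus_in_Ints_iff)
  have ge1: "x \<ge> 1" if "x \<in> \<int>" "x > 0" for x :: real using that by (auto elim!: Ints_cases)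
  have "c \<ge> 1" "1 / c \<ge> 1" using ge1[OF c1 c] ge1[OF c2] c by auto
  then have "c = 1" using c by (simp add: field_simps)
  then have "v a = v b" using vpos a01 by (simp add: c_def)
  then have "a\<^sup>2 * \<omega>1\<^sup>2 + (1 - a\<^sup>2) * \<omega>2\<^sup>2 = b\<^sup>2 * \<omega>1\<^sup>2 + (1 - b\<^sup>2) * \<omega>2\<^sup>2" by (simp add: v_def)
  then have "(a\<^sup>2 - b\<^sup>2) * (\<omega>1\<^sup>2 - \<omega>2\<^sup>2) = 0" by (simp add: algebra_simps)
  \<comment> \<open>With different frequencies the speed is an injective function of the radius;
    this is where |r1| and |r2| have to differ.\<close>
  moreover have "\<omega>1\<^sup>2 \<noteq> \<omega>2\<^sup>2"
  proof
    assume "\<omega>1\<^sup>2 = \<omega>2\<^sup>2"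
    then have "\<bar>\<omega>1\<bar> = \<bar>\<omega>2\<bar>" by (simp add: power2_eq_iff abs_eq_iff)
    then have "\<bar>real_of_int r1\<bar> = \<bar>real_of_int r2\<bar>" using I by (simp add: \<omega> abs_mult)
    then show False using r(3) by linarith
  qed
  ultimately have "a\<^sup>2 = b\<^sup>2" by simp
  then show "a = b" using a01 by (simp add: power2_eq_iff)
qed

lemma curve_length_graph:
  assumes "smooth_on UNIV \<gamma>"
  shows "curve_length (finsler F V) (graph_curve \<gamma>) 0 P
    = integral {0..P} (\<lambda>t. F t / 2 * ((norm (pd 1 \<gamma> t))\<^sup>2 + 2 * V t (\<gamma> t)))"
proof -
  have "(\<gamma> has_vector_derivative pd 1 \<gamma> s) (at s)" for s
    using smooth_on_vector_derivative(1,3)[OF open_UNIV assms, of s] by simp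
  then have "(graph_curve \<gamma> has_vector_derivative (1, pd 1 \<gamma> s)) (at s)" for s
    unfolding graph_curve_def[abs_def] by (intro has_vector_derivative_Pair has_vector_derivative_id)
  from vector_derivative_at[OF this] show ?thesis
    by (simp add: curve_length_def finsler_def graph_curve_def)
qed

lemma hopf_torus_family:
  fixes A1 :: "('a, 'e::euclidean_space) rchart set" and A2 :: "('b, 'f::euclidean_space) rchart set"
    and f1 :: "'a \<Rightarrow> complex^'n1" and f2 :: "'b \<Rightarrow> complex^'n2" and r1 r2 :: int
  assumes F: "smooth_on UNIV F" "\<forall>t. F t > 0" and P: "P > 0" "periodic P F"
    and A: "\<And>c. c \<in> A1 \<Longrightarrow> regular_chart c" "\<And>c. c \<in> A2 \<Longrightarrow> regular_chart c"
    and f: "eigenmap A1 f1 d1" "eigenmap A2 f2 d2"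
    and r: "coprime r1 r2" "r1 \<noteq> 0" "r2 \<noteq> 0" "\<bar>r1\<bar> \<noteq> \<bar>r2\<bar>"
    and I: "I = integral {0..P} (\<lambda>t. 1 / F t)"
    and \<kappa>: "\<kappa> = 4 * pi\<^sup>2 * of_int (r1\<^sup>2 - r2\<^sup>2) / I\<^sup>2"
    and w: "warp_pair F \<kappa> DIM('e) DIM('f) d1 d2 l1 l2"
  shows "\<exists>\<gamma> :: real \<Rightarrow> real \<Rightarrow> complex \<times> complex.
          smooth_on ({0<..<1} \<times> UNIV) (\<lambda>(a, t). \<gamma> a t) \<and>
          (\<forall>a\<in>{0<..<1}.
             profile_on UNIV (\<gamma> a) \<and> periodic P (\<gamma> a) \<and>
             harmonic_into_sphere (warped_atlas l1 l2 (circle_atlas P) A1 A2)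
               (on_circle (join_map (\<gamma> a) f1 f2)) \<and>
             range (\<gamma> a) \<subseteq> hopf_torus a \<and>
             closed_geodesic (finsler F (potential d1 d2 l1 l2)) P (graph_curve (\<gamma> a)) P) \<and>
          (\<forall>a\<in>{0<..<1}. \<forall>b\<in>{0<..<1}. a \<noteq> b \<longrightarrow>
             \<not> congruent_curves (\<gamma> a) (\<gamma> b) \<and>
             circle_graph P (\<gamma> a) \<inter> circle_graph P (\<gamma> b) = {} \<and>
             curve_length (finsler F (potential d1 d2 l1 l2)) (graph_curve (\<gamma> a)) 0 P =
               curve_length (finsler F (potential d1 d2 l1 l2)) (graph_curve (\<gamma> b)) 0 P)"
proof -
  have Fp: "F t > 0" for t using F(2) by blast
  obtain \<tau> where \<tau>: "\<And>t. (\<tau> has_real_derivative 1 / F t) (at t)" "smooth_on UNIV \<tau>"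
    "\<And>t. \<tau> (t + P) = \<tau> t + I" and Ipos: "I > 0"
    using clock_exists[OF F(1) Fp P] unfolding I by metis
  define \<omega>1 where "\<omega>1 = 2 * pi * r1 / I"
  define \<omega>2 where "\<omega>2 = 2 * pi * r2 / I"
  have \<kappa>\<omega>: "\<kappa> = \<omega>1\<^sup>2 - \<omega>2\<^sup>2"
    by (simp add: \<kappa> \<omega>1_def \<omega>2_def power_divide power_mult_distrib diff_divide_distrib[symmetric] algebra_simps)
  define \<gamma> where "\<gamma> a t = torus_curve \<omega>1 \<omega>2 a (\<tau> t)" for a t
  have d: "d1 > 0" "d2 > 0" using f by (auto simp: eigenmap_def)
  note ls = warp_smooth[OF F A d w]
  note lp = warp_pair_pos[OF w]
  have tc: "((\<lambda>t. torus_curve \<omega>1 \<omega>2 a (\<tau> t)) has_vector_derivative (1 / F t) *\<^sub>R pd 1 (torus_curve \<omega>1 \<omega>2 a) (\<tau> t)) (at t)" for a t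
    using vector_diff_chain_at[of \<tau> "1 / F t" t "torus_curve \<omega>1 \<omega>2 a" "pd 1 (torus_curve \<omega>1 \<omega>2 a) (\<tau> t)"] \<tau>(1)[of t]
      smooth_on_vector_derivative(1,3)[OF open_UNIV torus_curve_smooth, of "\<tau> t" \<omega>1 \<omega>2 a]
    by (simp add: has_real_derivative_iff_has_vector_derivative o_def)
  have sm: "smooth_on UNIV (\<gamma> a)" for a
    unfolding \<gamma>_def using smooth_on_compose[OF torus_curve_smooth \<tau>(2) open_UNIV] by simp
  have nrm: "norm (\<gamma> a t) = 1" if "a \<in> {0<..<1}" for a t
    using torus_curve_norms(3)[of a] that by (simp add: \<gamma>_def)
  have per: "periodic P (\<gamma> a)" if "a \<in> {0<..<1}" for a
    using torus_curve_period[OF r(1) Ipos _ _ \<omega>1_def \<omega>2_def, of a _ I] that Ipos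
    by (simp add: periodic_def \<gamma>_def \<tau>(3))
  have ac: "d2 / (l2 t)\<^sup>2 - d1 / (l1 t)\<^sup>2 = \<kappa> / (F t)\<^sup>2" for t using w by (simp add: warp_pair_def)
  have pe: "profile_eq (pd 1 F t / F t) (d1 / (l1 t)\<^sup>2) (d2 / (l2 t)\<^sup>2) (\<gamma> a) t" for a t
    using profile_eq_time_change[OF open_UNIV UNIV_I open_UNIV subset_UNIV \<tau>(1) smooth_on_real_derivative[OF F(1)] Fp
      torus_curve_smooth \<gamma>_def ac] torus_curve_neumann by (simp add: \<kappa>\<omega>)
  have joint: "smooth_on ({0<..<1} \<times> UNIV) (\<lambda>(a, t). \<gamma> a t)"
  proof -
    let ?U = "{0<..<1::real} \<times> (UNIV :: real set)"
    have U: "open ?U" by (simp add: open_Times)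
    have f: "smooth_on ?U fst" and s: "smooth_on ?U (\<lambda>p. \<tau> (snd p))"
      using smooth_on_fst[OF U smooth_on_ident] smooth_on_compose[OF \<tau>(2) smooth_on_snd[OF U smooth_on_ident] U] by simp_all
    have q: "smooth_on ?U (\<lambda>p. sqrt (1 - (fst p)\<^sup>2))"
      by (intro smooth_on_sqrt smooth_on_diff smooth_on_power smooth_on_const f U) (auto simp: power_less_one_iff)
    have "smooth_on ?U (\<lambda>p. (fst p *\<^sub>R cis (\<omega>1 * \<tau> (snd p)), sqrt (1 - (fst p)\<^sup>2) *\<^sub>R cis (\<omega>2 * \<tau> (snd p))))"
      by (intro smooth_on_Pair smooth_on_scaleR smooth_on_cis smooth_on_mult smooth_on_const f s q U)
    then show ?thesis by (simp add: \<gamma>_def torus_curve_def case_prod_unfold)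
  qed
  have harm: "harmonic_into_sphere (warped_atlas l1 l2 (circle_atlas P) A1 A2) (on_circle (join_map (\<gamma> a) f1 f2))"
    if "a \<in> {0<..<1}" for a
    by (rule harmonic_circle(1)[OF F A d w norm_mult_bilinear_vector_scalar_mult norm_mult_bilinear_vector_scalar_mult
          f P(1) sm nrm[OF that] per[OF that]]) (use pe in \<open>auto simp: join_map_def\<close>)
  have geo: "closed_geodesic (finsler F (potential d1 d2 l1 l2)) P (graph_curve (\<gamma> a)) P" if "a \<in> {0<..<1}" for a
    by (rule closed_geodesic_graph[OF F(1) ls lp Fp sm nrm[OF that] pe P(1) per[OF that]])
  have tor: "range (\<gamma> a) \<subseteq> hopf_torus a" if "a \<in> {0<..<1}" for a
    using torus_curve_norms(1,2)[of a] that by (auto simp: \<gamma>_def hopf_torus_def)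
  have nc: "\<not> congruent_curves (\<gamma> a) (\<gamma> b)" if "a \<in> {0<..<1}" "b \<in> {0<..<1}" "a \<noteq> b" for a b
    using torus_curves_not_congruent[OF r Ipos \<omega>1_def \<omega>2_def \<tau>(1,3) Fp that(1,2)] that(3)
    unfolding \<gamma>_def[abs_def] by blast
  have disj: "circle_graph P (\<gamma> a) \<inter> circle_graph P (\<gamma> b) = {}" if "a \<in> {0<..<1}" "b \<in> {0<..<1}" "a \<noteq> b" for a b
  proof -
    have n: "norm (fst (\<gamma> a s)) = a" "norm (fst (\<gamma> b s)) = b" for s
      using torus_curve_norms(1) that by (auto simp: \<gamma>_def)
    have ne: "\<gamma> a s \<noteq> \<gamma> b t" for s t
    proof
      assume "\<gamma> a s = \<gamma> b t"
      then have "norm (fst (\<gamma> a s)) = norm (fst (\<gamma> b t))" by (rule arg_cong)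
      then show False using that(3) unfolding n by (rule notE[rotated])
    qed
    show ?thesis using ne ne[symmetric] by (auto simp: circle_graph_def to_circle_def graph_curve_def)
  qed
  \<comment> \<open>The kinetic part contributes a^2 \<omega>1^2 + (1 - a^2) \<omega>2^2 over F^2,
    and the potential contributes (1 - a^2) (\<omega>1^2 - \<omega>2^2) over F^2 beyond \<lambda>1.
    In the sum the radius cancels.\<close>
  have len: "curve_length (finsler F (potential d1 d2 l1 l2)) (graph_curve (\<gamma> a)) 0 P
    = integral {0..P} (\<lambda>t. F t / 2 * (\<omega>1\<^sup>2 / (F t)\<^sup>2 + d1 / (l1 t)\<^sup>2))" if "a \<in> {0<..<1}" for a
  proof -
    have "(norm (pd 1 (\<gamma> a) t))\<^sup>2 + 2 * potential d1 d2 l1 l2 t (\<gamma> a t) = \<omega>1\<^sup>2 / (F t)\<^sup>2 + d1 / (l1 t)\<^sup>2" for t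
    proof -
      have a: "a\<^sup>2 \<le> 1" "0 < a" "a < 1" using that by (auto simp: power_le_one_iff)
      have "pd 1 (\<gamma> a) t = (1 / F t) *\<^sub>R pd 1 (torus_curve \<omega>1 \<omega>2 a) (\<tau> t)"
        unfolding \<gamma>_def[abs_def] by (rule pd1_eqI[OF tc])
      then have 1: "(norm (pd 1 (\<gamma> a) t))\<^sup>2 = (a\<^sup>2 * \<omega>1\<^sup>2 + (1 - a\<^sup>2) * \<omega>2\<^sup>2) / (F t)\<^sup>2"
        using torus_curve_norms(4)[OF a(2,3)] by (simp add: power_divide power_mult_distrib mult_ac)
      have 2: "2 * potential d1 d2 l1 l2 t (\<gamma> a t) = d1 / (l1 t)\<^sup>2 * a\<^sup>2 + d2 / (l2 t)\<^sup>2 * (1 - a\<^sup>2)"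
        using torus_curve_norms(1,2)[OF a(2,3)] a(1) by (simp add: potential_def \<gamma>_def mult_ac)
      have 3: "d2 / (l2 t)\<^sup>2 = d1 / (l1 t)\<^sup>2 + (\<omega>1\<^sup>2 - \<omega>2\<^sup>2) / (F t)\<^sup>2" using ac[of t] \<kappa>\<omega> by simp
      show ?thesis unfolding 1 2 3 by (simp only: diff_divide_distrib add_divide_distrib times_divide_eq_right) (simp add: algebra_simps diff_divide_distrib)
    qed
    then show ?thesis by (simp add: curve_length_graph[OF sm])
  qed
  have prof: "profile_on UNIV (\<gamma> a)" if "a \<in> {0<..<1}" for a
    using sm nrm[OF that] by (simp add: profile_on_def)
  show ?thesis
  proof (intro exI[of _ \<gamma>] conjI ballI impI)
    fix a b assume "a \<in> {0<..<1}" "b \<in> {0<..<1}" "a \<noteq> (b::real)"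
    then show "curve_length (finsler F (potential d1 d2 l1 l2)) (graph_curve (\<gamma> a)) 0 P =
               curve_length (finsler F (potential d1 d2 l1 l2)) (graph_curve (\<gamma> b)) 0 P" by (simp only: len)
  qed (rule joint prof per harm tor geo nc disj; assumption)+
qed

section \<open>The source manifold and its harmonic profiles\<close>

text \<open>Coordinate changes are the identity on the line and shifts by multiples of
  \<open>P\<close> on the circle; periodic warps are invariant under both.\<close>

lemma warped_geometry:
  fixes A1 :: "('a, 'e::euclidean_space) rchart set" and A2 :: "('b, 'f::euclidean_space) rchart set"
    and f1 :: "'a \<Rightarrow> complex^'n1" and f2 :: "'b \<Rightarrow> complex^'n2"
  assumes F: "smooth_on UNIV F" "\<forall>t. F t > 0" and P: "P > 0" "periodic P F"
    and M: "riemannian_manifold X1 A1" "riemannian_manifold X2 A2"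
    and d: "d1 > 0" "d2 > 0"
    and w: "warp_pair F \<kappa> DIM('e) DIM('f) d1 d2 l1 l2"
  shows "riemannian_manifold (prod_topology euclideanreal (prod_topology X1 X2))
      (warped_atlas l1 l2 (line_atlas UNIV) A1 A2)"
    and "riemannian_manifold (prod_topology (circle_topology P) (prod_topology X1 X2))
      (warped_atlas l1 l2 (circle_atlas P) A1 A2)"
proof -
  note s = warp_pair_unique_smooth(2)[OF DIM_positive DIM_positive d F w]
    and p = warp_pair_unique_smooth(3)[OF DIM_positive DIM_positive d F w P(2)]
  note wp = riemannian_manifold_warped[OF _ M _ conjunct1[OF s] conjunct2[OF s] warp_pair_pos[OF w]]
  show "riemannian_manifold (prod_topology euclideanreal (prod_topology X1 X2))
      (warped_atlas l1 l2 (line_atlas UNIV) A1 A2)"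
  proof (rule wp[OF riemannian_manifold_line line_atlas_flat(1)[OF open_UNIV]])
    fix b b' t assume b: "b \<in> line_atlas UNIV" "b' \<in> line_atlas UNIV"
    have "cmap b' (cinv b t) = t" using line_atlas_flat(3)[OF open_UNIV b(1), of t] b(2) by (simp add: line_atlas_def)
    then show "l1 (cmap b' (cinv b t)) = l1 t \<and> l2 (cmap b' (cinv b t)) = l2 t" by simp
  qed
  show "riemannian_manifold (prod_topology (circle_topology P) (prod_topology X1 X2))
      (warped_atlas l1 l2 (circle_atlas P) A1 A2)"
  proof (rule wp[OF riemannian_manifold_circle[OF P(1)] circle_atlas_flat(1)[OF P(1)]])
    fix b b' t assume b: "b \<in> circle_atlas P" "b' \<in> circle_atlas P" "t \<in> cmap b ` (cdom b \<inter> cdom b')"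
    obtain k :: int where "cmap b' (cinv b t) = t + of_int k * P" using circle_transition(1)[OF P(1) b] by auto
    then show "l1 (cmap b' (cinv b t)) = l1 t \<and> l2 (cmap b' (cinv b t)) = l2 t"
      using periodic_int[OF conjunct1[OF p]] periodic_int[OF conjunct2[OF p]] by simp
  qed
qed

lemma harmonic_profile_iff_neumann:
  fixes A1 :: "('a, 'e::euclidean_space) rchart set" and A2 :: "('b, 'f::euclidean_space) rchart set"
    and f1 :: "'a \<Rightarrow> complex^'n1" and f2 :: "'b \<Rightarrow> complex^'n2"
  assumes F: "smooth_on UNIV F" "\<forall>t. F t > 0" and P: "P > 0"
    and M: "riemannian_manifold X1 A1" "riemannian_manifold X2 A2"
    and f: "eigenmap A1 f1 d1" "eigenmap A2 f2 d2"
    and w: "warp_pair F \<kappa> DIM('e) DIM('f) d1 d2 l1 l2"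
  shows "open J \<Longrightarrow> connected J \<Longrightarrow> (\<And>t. t \<in> J \<Longrightarrow> (\<tau> has_real_derivative 1 / F t) (at t)) \<Longrightarrow> profile_on J \<gamma> \<Longrightarrow>
      harmonic_into_sphere (warped_atlas l1 l2 (line_atlas J) A1 A2) (join_map \<gamma> f1 f2)
        \<longleftrightarrow> (\<exists>\<Gamma>. neumann_trajectory \<kappa> (\<tau> ` J) \<Gamma> \<and> (\<forall>t\<in>J. \<gamma> t = \<Gamma> (\<tau> t)))"
    and "(\<And>t. (\<tau> has_real_derivative 1 / F t) (at t)) \<Longrightarrow> profile_on UNIV \<gamma> \<Longrightarrow> periodic P \<gamma> \<Longrightarrow>
      harmonic_into_sphere (warped_atlas l1 l2 (circle_atlas P) A1 A2) (on_circle (join_map \<gamma> f1 f2))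
        \<longleftrightarrow> (\<exists>\<Gamma>. neumann_trajectory \<kappa> (range \<tau>) \<Gamma> \<and> (\<forall>t. \<gamma> t = \<Gamma> (\<tau> t)))"
proof -
  note A = riemannian_manifold_regular[OF M(1)] riemannian_manifold_regular[OF M(2)]
    and ne = riemannian_manifold_nonempty[OF M(1)] riemannian_manifold_nonempty[OF M(2)]
  have d: "d1 > 0" "d2 > 0" using f by (auto simp: eigenmap_def)
  have ac: "d2 / (l2 t)\<^sup>2 - d1 / (l1 t)\<^sup>2 = \<kappa> / (F t)\<^sup>2" for t using w by (simp add: warp_pair_def)
  show "harmonic_into_sphere (warped_atlas l1 l2 (line_atlas J) A1 A2) (join_map \<gamma> f1 f2)
        \<longleftrightarrow> (\<exists>\<Gamma>. neumann_trajectory \<kappa> (\<tau> ` J) \<Gamma> \<and> (\<forall>t\<in>J. \<gamma> t = \<Gamma> (\<tau> t)))"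
    if J: "open J" "connected J" and t: "\<And>t. t \<in> J \<Longrightarrow> (\<tau> has_real_derivative 1 / F t) (at t)" and g: "profile_on J \<gamma>"
    using harmonic_line_iff[OF F A d w f ne J(1) g] profile_eq_iff_neumann[OF F J t g ac] by simp
  show "harmonic_into_sphere (warped_atlas l1 l2 (circle_atlas P) A1 A2) (on_circle (join_map \<gamma> f1 f2))
        \<longleftrightarrow> (\<exists>\<Gamma>. neumann_trajectory \<kappa> (range \<tau>) \<Gamma> \<and> (\<forall>t. \<gamma> t = \<Gamma> (\<tau> t)))"
    if t: "\<And>t. (\<tau> has_real_derivative 1 / F t) (at t)" and g: "profile_on UNIV \<gamma>" "periodic P \<gamma>"
  proof -
    have s: "smooth_on UNIV \<gamma>" "\<And>t. norm (\<gamma> t) = 1" using g(1) by (auto simp: profile_on_def)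
    have G: "join_map \<gamma> f1 f2 (t, x, y) = (fst (\<gamma> t) *s f1 x, snd (\<gamma> t) *s f2 y)" for t x y by (simp add: join_map_def)
    note c = harmonic_circle[OF F A d w norm_mult_bilinear_vector_scalar_mult norm_mult_bilinear_vector_scalar_mult
        f P s g(2) G]
    have "harmonic_into_sphere (warped_atlas l1 l2 (circle_atlas P) A1 A2) (on_circle (join_map \<gamma> f1 f2))
      \<longleftrightarrow> (\<forall>t\<in>UNIV. profile_eq (pd 1 F t / F t) (d1 / (l1 t)\<^sup>2) (d2 / (l2 t)\<^sup>2) \<gamma> t)"
      using c(1) c(2)[OF _ _ ne] by blast
    also have "\<dots> \<longleftrightarrow> (\<exists>\<Gamma>. neumann_trajectory \<kappa> (range \<tau>) \<Gamma> \<and> (\<forall>t\<in>UNIV. \<gamma> t = \<Gamma> (\<tau> t)))"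
      by (rule profile_eq_iff_neumann[OF F open_UNIV connected_UNIV t g(1) ac])
    finally show ?thesis by simp
  qed
qed

section \<open>Rotating solutions of the pendulum equation\<close>

text \<open>The integral is the time of one turn when the squared angular speed is
  \<open>e + \<kappa> * (sin x)\<^sup>2\<close>. It becomes small for large \<open>e\<close> and
  unbounded as the minimum of the speed tends to 0, where the motion approaches the separatrix;
  continuity supplies all values between.\<close>

lemma pendulum_period_surj:
  fixes \<kappa> J :: real
  assumes J: "J > 0"
  obtains e where "\<And>x. e + \<kappa> * (sin x)\<^sup>2 > 0" "integral {0..2 * pi} (\<lambda>x. 1 / sqrt (e + \<kappa> * (sin x)\<^sup>2)) = J"
proof -
  \<comment> \<open>The shift normalises the minimum over \<open>x\<close> to be \<open>c\<close>,
    so that \<open>c > 0\<close> describes exactly the rotating motions for either sign of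
    \<kappa>.\<close>
  define q where "q c x = c + max 0 (- \<kappa>) + \<kappa> * (sin x)\<^sup>2" for c x
  define T where "T c = integral {0..2 * pi} (\<lambda>x. 1 / sqrt (q c x))" for c
  define K where "K = \<bar>\<kappa>\<bar> + 1"
  \<comment> \<open>The angle at which the speed is least.\<close>
  define x0 where "x0 = (if \<kappa> \<ge> 0 then 0 else pi / 2)"
  have q_alt: "q c x = c + \<bar>\<kappa>\<bar> * (sin (x - x0))\<^sup>2" for c x
  proof (cases "\<kappa> \<ge> 0")
    case False
    then show ?thesis by (simp add: q_def x0_def sin_diff cos_squared_eq algebra_simps)
  qed (simp add: q_def x0_def)
  have ge: "q c x \<ge> c" for c x by (simp add: q_alt)
  have pos: "q c x > 0" if "c > 0" for c x using ge[of c x] that by linarith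
  have cont: "continuous_on ({0<..} \<times> cbox 0 (2 * pi)) (\<lambda>(c, x). 1 / sqrt (q c x))"
    unfolding case_prod_unfold
  proof (intro continuous_on_divide continuous_on_const continuous_on_real_sqrt ballI)
    show "continuous_on ({0<..} \<times> cbox 0 (2 * pi)) (\<lambda>p. q (fst p) (snd p))"
      unfolding q_def by (intro continuous_intros)
    show "sqrt (q (fst p) (snd p)) \<noteq> 0" if "p \<in> {0<..} \<times> cbox 0 (2 * pi)" for p
      using pos[of "fst p" "snd p"] that by (simp add: mem_Times_iff)
  qed
  have Tc: "continuous_on {0<..} T"
    using integral_continuous_on_param[OF cont] by (simp add: T_def[abs_def])
  have cx: "continuous_on S (\<lambda>x. 1 / sqrt (q c x))" if "c > 0" for c S
  proof (intro continuous_on_divide continuous_on_const continuous_on_real_sqrt ballI)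
    show "continuous_on S (q c)" unfolding q_def[abs_def] by (intro continuous_intros)
    show "sqrt (q c x) \<noteq> 0" for x using pos[OF that, of x] by simp
  qed
  have int: "(\<lambda>x. 1 / sqrt (q c x)) integrable_on {a..b}" if "c > 0" for c a b
    by (rule integrable_continuous_real[OF cx[OF that]])
  \<comment> \<open>For this \<open>c\<close> the speed is at least 2 \<pi> / J everywhere, so a
    turn takes at most the time \<open>J\<close>.\<close>
  define c1 where "c1 = (2 * pi / J)\<^sup>2"
  have c1: "c1 > 0" using J by (simp add: c1_def)
  have s1: "sqrt c1 = 2 * pi / J" using J by (simp add: c1_def)
  have "T c1 \<le> integral {0..2 * pi} (\<lambda>x. J / (2 * pi))"
    unfolding T_def
  proof (rule integral_le[OF int[OF c1]])
    fix x
    have "2 * pi / J \<le> sqrt (q c1 x)" using ge[of c1 x] by (metis s1 real_sqrt_le_iff)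
    then have "1 / sqrt (q c1 x) \<le> 1 / (2 * pi / J)" using J by (intro divide_left_mono mult_pos_pos) (auto intro: pos c1)
    then show "1 / sqrt (q c1 x) \<le> J / (2 * pi)" by simp
  qed (rule integrable_const_ivl)
  then have hi: "T c1 \<le> J" by simp
  \<comment> \<open>Chosen so that - ln \<delta> / K = J: the speed grows at most linearly away from
    \<open>x0\<close>, and the integral of the reciprocal linear bound over unit length is at least
    this number.\<close>
  define \<delta> where "\<delta> = exp (- (K * J))"
  have \<delta>: "\<delta> > 0" by (simp add: \<delta>_def)
  have K: "K \<ge> 1" by (simp add: K_def)
  have le: "sqrt (q (\<delta>\<^sup>2) x) \<le> \<delta> + K * (x - x0)" if "x \<ge> x0" for x
  proof (rule real_le_lsqrt)
    show "0 \<le> \<delta> + K * (x - x0)" using \<delta> K that by simp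
    have "\<bar>\<kappa>\<bar> * (sin (x - x0))\<^sup>2 \<le> K\<^sup>2 * (x - x0)\<^sup>2"
    proof (rule mult_mono)
      have "K * 1 \<le> K * K" using K by (intro mult_left_mono) auto
      then show "\<bar>\<kappa>\<bar> \<le> K\<^sup>2" by (simp add: K_def power2_eq_square)
      show "(sin (x - x0))\<^sup>2 \<le> (x - x0)\<^sup>2" using abs_sin_x_le_abs_x[of "x - x0"] by (simp add: abs_le_square_iff)
    qed auto
    moreover have "(\<delta> + K * (x - x0))\<^sup>2 = \<delta>\<^sup>2 + K\<^sup>2 * (x - x0)\<^sup>2 + 2 * \<delta> * (K * (x - x0))"
      by (simp add: power2_sum power_mult_distrib)
    moreover have "2 * \<delta> * (K * (x - x0)) \<ge> 0" using \<delta> K that by simp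
    ultimately show "q (\<delta>\<^sup>2) x \<le> (\<delta> + K * (x - x0))\<^sup>2" unfolding q_alt by linarith
  qed
  have "((\<lambda>x. 1 / (\<delta> + K * (x - x0))) has_integral ln (\<delta> + K * (x0 + 1 - x0)) / K - ln (\<delta> + K * (x0 - x0)) / K) {x0..x0 + 1}"
  proof (rule fundamental_theorem_of_calculus)
    fix x assume "x \<in> {x0..x0 + 1}"
    then have p: "\<delta> + K * (x - x0) > 0" using \<delta> K by (intro add_pos_nonneg mult_nonneg_nonneg) auto
    have "((\<lambda>x. \<delta> + K * (x - x0)) has_real_derivative K) (at x)"
      by (auto intro!: derivative_eq_intros)
    from DERIV_cdivide[OF DERIV_chain2[OF DERIV_ln_divide[OF p] this], of K]
    have "((\<lambda>x. ln (\<delta> + K * (x - x0)) / K) has_real_derivative 1 / (\<delta> + K * (x - x0))) (at x)" using K by simp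
    then show "((\<lambda>x. ln (\<delta> + K * (x - x0)) / K) has_vector_derivative 1 / (\<delta> + K * (x - x0))) (at x within {x0..x0 + 1})"
      by (simp add: has_real_derivative_iff_has_vector_derivative has_vector_derivative_at_within)
  qed simp
  then have hi2: "((\<lambda>x. 1 / (\<delta> + K * (x - x0))) has_integral (ln (\<delta> + K) - ln \<delta>) / K) {x0..x0 + 1}"
    by (simp add: diff_divide_distrib)
  have "ln (\<delta> + K) \<ge> 0" using \<delta> K by simp
  then have "J \<le> (ln (\<delta> + K) - ln \<delta>) / K" using K by (simp add: \<delta>_def field_simps)
  also have "\<dots> \<le> integral {x0..x0 + 1} (\<lambda>x. 1 / sqrt (q (\<delta>\<^sup>2) x))"
  proof (rule has_integral_le[OF hi2 integrable_integral[OF int]])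
    fix x assume "x \<in> {x0..x0 + 1}"
    then show "1 / (\<delta> + K * (x - x0)) \<le> 1 / sqrt (q (\<delta>\<^sup>2) x)"
      using le[of x] pos[of "\<delta>\<^sup>2" x] \<delta> K by (intro divide_left_mono mult_pos_pos add_pos_nonneg) auto
  qed (use \<delta> in simp)
  also have "\<dots> \<le> T (\<delta>\<^sup>2)"
    unfolding T_def
  proof (rule integral_subset_le[OF _ int int])
    show "{x0..x0 + 1} \<subseteq> {0..2 * pi}" using pi_ge_two by (auto simp: x0_def)
  qed (use \<delta> pos in \<open>auto intro: less_imp_le\<close>)
  finally have lo: "J \<le> T (\<delta>\<^sup>2)" .
  have "connected (T ` {0<..})" by (rule connected_continuous_image[OF Tc connected_Ioi])
  then have "J \<in> T ` {0<..}"
    using connectedD_interval[OF _ imageI[of c1] imageI[of "\<delta>\<^sup>2"] hi lo] c1 \<delta> by auto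
  then obtain c where c: "c > 0" "T c = J" by auto
  show thesis
    by (rule that[of "c + max 0 (- \<kappa>)"]) (use pos[OF c(1)] c(2) in \<open>simp_all add: q_def T_def\<close>)
qed

text \<open>The first integral reduces the pendulum to \<theta>' = f(\<theta>), whose solution is
  the inverse of an antiderivative \<open>G\<close> of 1/f. One turn is arranged to take the time
  \<open>I / m\<close>, hence \<open>m\<close> turns fill exactly \<open>I\<close>.\<close>

lemma rotating_pendulum_exists:
  fixes \<kappa> I :: real and m :: nat
  assumes I: "I > 0" and m: "m \<ge> 1"
  obtains \<theta> w where "smooth_on UNIV \<theta>" "\<theta> 0 = 0" "\<And>s. (\<theta> has_real_derivative w s) (at s)" "\<And>s. w s > 0"
    "\<And>s. (w has_real_derivative \<kappa> * (sin (\<theta> s) * cos (\<theta> s))) (at s)" "\<And>s. \<theta> (s + I) = \<theta> s + 2 * pi * m"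
proof -
  have J: "I / m > 0" using I m by simp
  obtain e where e: "\<And>x. e + \<kappa> * (sin x)\<^sup>2 > 0" "integral {0..2 * pi} (\<lambda>x. 1 / sqrt (e + \<kappa> * (sin x)\<^sup>2)) = I / m"
    by (rule pendulum_period_surj[OF J, of \<kappa>]) (rule that)
  define f where "f x = sqrt (e + \<kappa> * (sin x)\<^sup>2)" for x
  have fp: "f x > 0" for x using e(1)[of x] by (simp add: f_def)
  have fs: "smooth_on UNIV f"
    unfolding f_def[abs_def] using e(1)
    by (intro smooth_on_sqrt smooth_on_add smooth_on_mult smooth_on_power smooth_on_sin smooth_on_const smooth_on_ident open_UNIV) simp
  have fper: "periodic (2 * pi) f" by (simp add: periodic_def f_def)
  have df: "(f has_real_derivative \<kappa> * (sin x * cos x) / f x) (at x)" for x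
  proof -
    have "((\<lambda>x. e + \<kappa> * (sin x)\<^sup>2) has_real_derivative \<kappa> * (2 * (sin x * cos x))) (at x)"
      by (auto intro!: derivative_eq_intros)
    from DERIV_chain2[OF DERIV_real_sqrt[OF e(1)[of x]] this]
    have "(f has_real_derivative inverse (f x) / 2 * (\<kappa> * (2 * (sin x * cos x)))) (at x)"
      unfolding f_def[abs_def] .
    then show ?thesis by (rule DERIV_cong) (simp add: field_simps)
  qed
  obtain G where G: "\<And>x. (G has_real_derivative 1 / f x) (at x)" "G 0 = 0" "smooth_on UNIV G"
    "\<And>x. G (x + 2 * pi) = G x + I / m"

  proof (rule clock_exists[OF fs fp _ fper])
    fix G assume g: "\<And>x. (G has_real_derivative 1 / f x) (at x)" "G 0 = 0" "smooth_on UNIV G"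
      "\<And>x. G (x + 2 * pi) = G x + integral {0..2 * pi} (\<lambda>x. 1 / f x)"
    show thesis by (rule that[OF g(1-3)]) (simp add: g(4) e(2)[folded f_def])
  qed simp
  have Gn: "G (x + 2 * pi * real n) = G x + I / m * n" for x n
  proof (induction n)
    case (Suc n)
    have "G (x + 2 * pi * real (Suc n)) = G (x + 2 * pi * real n + 2 * pi)" by (simp add: algebra_simps)
    then show ?case unfolding G(4) Suc by (simp add: algebra_simps add_divide_distrib)
  qed simp
  have cG: "continuous_on UNIV G" by (rule smooth_on_imp_continuous_on[OF G(3)])
  \<comment> \<open>\<open>G\<close> gains the positive amount \<open>I / m\<close> in each turn, so
    it is unbounded in both directions and the solution exists for all times.\<close>
  have surj: "range G = UNIV"
  proof -
    have "y \<in> range G" for y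
    proof -
      obtain n :: nat where n: "\<bar>y\<bar> < n * (I / m)" using reals_Archimedean3[OF J] by blast
      have "connected (range G)" by (rule connected_continuous_image[OF cG connected_UNIV])
      moreover have "G (0 - 2 * pi * n) \<le> y" "y \<le> G (0 + 2 * pi * n)"
        using n Gn[of "0 - 2 * pi * n" n] Gn[of 0 n] G(2) by (simp_all add: mult.commute)
      ultimately show ?thesis by (meson connectedD_interval rangeI)
    qed
    then show ?thesis by blast
  qed
  have p: "1 / f x > 0" for x using fp[of x] by simp
  define \<theta> where "\<theta> = inv_into UNIV G"
  note inv = has_real_derivative_inv_into[OF open_UNIV connected_UNIV G(1) p, unfolded surj]
  have \<theta>G: "\<theta> (G x) = x" for x unfolding \<theta>_def by (rule inv_into_f_f[OF inv(1) UNIV_I])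
  have G\<theta>: "G (\<theta> s) = s" for s unfolding \<theta>_def by (rule f_inv_into_f) (simp add: surj)
  have d\<theta>: "(\<theta> has_real_derivative f (\<theta> s)) (at s)" for s
    using inv(3)[OF UNIV_I, of "\<theta> s"] unfolding G\<theta> \<theta>_def[symmetric] by simp
  have s\<theta>: "smooth_on UNIV \<theta>"
  proof -
    have s: "smooth_on UNIV (\<lambda>x. 1 / f x)"
      by (rule smooth_on_divide[OF open_UNIV smooth_on_const fs]) (use fp in \<open>simp add: less_le\<close>)
    show ?thesis using smooth_on_inv_into[OF open_UNIV connected_UNIV G(1) p s] unfolding surj \<theta>_def .
  qed
  show thesis
  proof (rule that[of \<theta> "\<lambda>s. f (\<theta> s)"])
    show "\<theta> 0 = 0" using \<theta>G[of 0] G(2) by simp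
    show "((\<lambda>s. f (\<theta> s)) has_real_derivative \<kappa> * (sin (\<theta> s) * cos (\<theta> s))) (at s)" for s
      by (rule DERIV_cong[OF DERIV_chain2[OF df d\<theta>]]) (use fp[of "\<theta> s"] in simp)
    show "\<theta> (s + I) = \<theta> s + 2 * pi * m" for s
      using \<theta>G[of "\<theta> s + 2 * pi * m"] m unfolding Gn G\<theta> by simp
  qed (use s\<theta> d\<theta> fp in auto)
qed

text \<open>The pendulum read in the clock; the division of its speed by F produces the friction
  term.\<close>

lemma winding_angle_exists:
  fixes \<kappa> P :: real and m :: nat and F :: "real \<Rightarrow> real"
  assumes F: "smooth_on UNIV F" "\<And>t. F t > 0" and P: "P > 0" "periodic P F" and m: "m \<ge> 1"
  obtains u w where "smooth_on UNIV u" "u 0 = 0" "\<And>t. (u has_real_derivative w t) (at t)" "\<And>t. w t > 0"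
    "\<And>t. (w has_real_derivative \<kappa> / (F t)\<^sup>2 * (sin (u t) * cos (u t)) - pd 1 F t / F t * w t) (at t)"
    "\<And>t. u (t + P) = u t + 2 * pi * m"
proof -
  obtain \<tau> where \<tau>: "\<And>t. (\<tau> has_real_derivative 1 / F t) (at t)" "\<tau> 0 = 0" "smooth_on UNIV \<tau>"
    "\<And>t. \<tau> (t + P) = \<tau> t + integral {0..P} (\<lambda>t. 1 / F t)" and I: "integral {0..P} (\<lambda>t. 1 / F t) > 0"
    by (rule clock_exists[OF F P]) (rule that)
  obtain \<theta> w where \<theta>: "smooth_on UNIV \<theta>" "\<theta> 0 = 0" "\<And>s. (\<theta> has_real_derivative w s) (at s)" "\<And>s. w s > 0"
    "\<And>s. (w has_real_derivative \<kappa> * (sin (\<theta> s) * cos (\<theta> s))) (at s)"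
    "\<And>s. \<theta> (s + integral {0..P} (\<lambda>t. 1 / F t)) = \<theta> s + 2 * pi * m"
    by (rule rotating_pendulum_exists[OF I m, of \<kappa>]) (rule that)
  show thesis
  proof (rule that[of "\<lambda>t. \<theta> (\<tau> t)" "\<lambda>t. w (\<tau> t) / F t"])
    show "smooth_on UNIV (\<lambda>t. \<theta> (\<tau> t))" using smooth_on_compose[OF \<theta>(1) \<tau>(3) open_UNIV] by simp
    show "((\<lambda>t. \<theta> (\<tau> t)) has_real_derivative w (\<tau> t) / F t) (at t)" for t
      using DERIV_chain2[OF \<theta>(3) \<tau>(1)] by simp
    have F0: "F t \<noteq> 0" for t using F(2)[of t] by simp
    show "((\<lambda>t. w (\<tau> t) / F t) has_real_derivative
      \<kappa> / (F t)\<^sup>2 * (sin (\<theta> (\<tau> t)) * cos (\<theta> (\<tau> t))) - pd 1 F t / F t * (w (\<tau> t) / F t)) (at t)" for t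
      by (rule DERIV_cong[OF DERIV_divide[OF DERIV_chain2[OF \<theta>(5) \<tau>(1)] smooth_on_real_derivative[OF F(1)] F0]])
        (use F0[of t] in \<open>simp add: field_simps power2_eq_square\<close>)
  qed (use \<tau>(2,4) \<theta> F(2) in auto)
qed

section \<open>Profiles on a real great circle\<close>

lemma has_vector_derivative_circular:
  fixes v :: "'z::euclidean_space"
  assumes "(u has_real_derivative w) (at t)"
  shows "((\<lambda>t. (cos (u t) *\<^sub>R v, sin (u t) *\<^sub>R v)) has_vector_derivative
    w *\<^sub>R (- sin (u t) *\<^sub>R v, cos (u t) *\<^sub>R v)) (at t)"
proof -
  have "((\<lambda>t. cos (u t)) has_real_derivative - sin (u t) * w) (at t)"
    "((\<lambda>t. sin (u t)) has_real_derivative cos (u t) * w) (at t)"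
    using DERIV_chain2[OF DERIV_cos assms] DERIV_chain2[OF DERIV_sin assms] by auto
  then have "((\<lambda>t. (cos (u t) *\<^sub>R v, sin (u t) *\<^sub>R v)) has_vector_derivative
    ((- sin (u t) * w) *\<^sub>R v, (cos (u t) * w) *\<^sub>R v)) (at t)"
    unfolding has_real_derivative_iff_has_vector_derivative
    by (intro has_vector_derivative_Pair bounded_linear.has_vector_derivative[OF bounded_linear_scaleR_left])
  then show ?thesis by (simp add: mult.commute)
qed

text \<open>Orthogonally to the curve the profile equation is the equation for the angle; along the
  curve it is met by the multiplier. With \<open>v\<close> the real or the complex number 1, the
  same calculation serves the harmonic map and its graph in \<open>S3\<close>.\<close>

lemma profile_eq_circular:
  fixes v :: "'z::euclidean_space"
  assumes u: "\<And>t. (u has_real_derivative w t) (at t)"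
    and w: "(w has_real_derivative (c - a) * (sin (u t) * cos (u t)) - \<mu> * w t) (at t)"
  shows "profile_eq \<mu> a c (\<lambda>t. (cos (u t) *\<^sub>R v, sin (u t) *\<^sub>R v)) t"
proof -
  define w' where "w' = (c - a) * (sin (u t) * cos (u t)) - \<mu> * w t"
  let ?\<gamma> = "\<lambda>t. (cos (u t) *\<^sub>R v, sin (u t) *\<^sub>R v)" and ?\<nu> = "\<lambda>t. (- sin (u t) *\<^sub>R v, cos (u t) *\<^sub>R v)"
  have 1: "pd 1 ?\<gamma> = (\<lambda>t. w t *\<^sub>R ?\<nu> t)"
    by (rule ext, rule pd1_eqI[OF has_vector_derivative_circular[OF u]])
  \<comment> \<open>The unit tangent is the curve itself with the angle advanced by a right angle,
    so the same lemma differentiates it.\<close>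
  have "((\<lambda>t. u t + pi / 2) has_real_derivative w t) (at t)" using DERIV_add[OF u DERIV_const] by simp
  from has_vector_derivative_circular[OF this, of v]
  have "(?\<nu> has_vector_derivative - (w t *\<^sub>R ?\<gamma> t)) (at t)" by (simp add: sin_add cos_add)
  moreover have "(w has_vector_derivative w') (at t)"
    using w by (simp add: w'_def has_real_derivative_iff_has_vector_derivative)
  ultimately have "((\<lambda>t. w t *\<^sub>R ?\<nu> t) has_vector_derivative w t *\<^sub>R (- (w t *\<^sub>R ?\<gamma> t)) + w' *\<^sub>R ?\<nu> t) (at t)"
    by (rule bounded_bilinear.has_vector_derivative[OF bounded_bilinear_scaleR, rotated])
  then have 2: "pd 1 (pd 1 ?\<gamma>) t = w t *\<^sub>R (- (w t *\<^sub>R ?\<gamma> t)) + w' *\<^sub>R ?\<nu> t" unfolding 1 by (rule pd1_eqI)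
  have s: "(sin (u t))\<^sup>2 + (cos (u t))\<^sup>2 - 1 = 0" by simp
  \<comment> \<open>Minus the energy density, the value forced by
    \<open>profile_eq_multiplier\<close>.\<close>
  define e where "e = - ((w t)\<^sup>2 + a * (cos (u t))\<^sup>2 + c * (sin (u t))\<^sup>2)"
  have "- (W * (W * C)) - ((c - a) * (S * C) - \<mu> * W) * S - \<mu> * (W * S) - (a * C + - (W\<^sup>2 + a * C\<^sup>2 + c * S\<^sup>2) * C)
      = a * C * (S\<^sup>2 + C\<^sup>2 - 1)"
    "- (W * (W * S)) + ((c - a) * (S * C) - \<mu> * W) * C + \<mu> * (W * C) - (c * S + - (W\<^sup>2 + a * C\<^sup>2 + c * S\<^sup>2) * S)
      = c * S * (S\<^sup>2 + C\<^sup>2 - 1)" for S C W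
    by (simp_all add: algebra_simps power2_eq_square)
  from this[where S="sin (u t)" and C="cos (u t)" and W="w t"]
have E1: "- (w t * (w t * cos (u t))) - w' * sin (u t) - \<mu> * (w t * sin (u t)) = a * cos (u t) + e * cos (u t)"
    and E2: "- (w t * (w t * sin (u t))) + w' * cos (u t) + \<mu> * (w t * cos (u t)) = c * sin (u t) + e * sin (u t)"
    unfolding s w'_def e_def by simp_all
  have "w t *\<^sub>R (- (w t *\<^sub>R ?\<gamma> t)) + w' *\<^sub>R ?\<nu> t + \<mu> *\<^sub>R (w t *\<^sub>R ?\<nu> t)
    = ((- (w t * (w t * cos (u t))) - w' * sin (u t) - \<mu> * (w t * sin (u t))) *\<^sub>R v,
       (- (w t * (w t * sin (u t))) + w' * cos (u t) + \<mu> * (w t * cos (u t))) *\<^sub>R v)"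
    by (simp add: scaleR_diff_left scaleR_add_left)
  also have "\<dots> = (a *\<^sub>R fst (?\<gamma> t), c *\<^sub>R snd (?\<gamma> t)) + e *\<^sub>R ?\<gamma> t"
    unfolding E1 E2 by (simp add: scaleR_add_left)
  finally show ?thesis unfolding profile_eq_def 2 unfolding 1 by blast
qed

section \<open>Graphs are primitive\<close>

text \<open>Turns the pointwise choices of a multiple of the period into one winding number, because
  a continuous function with discrete values is constant.\<close>

lemma integer_multiple_constant:
  fixes f :: "real \<Rightarrow> real"
  assumes "continuous_on UNIV f" "P > 0" "\<And>s. \<exists>k::int. f s = of_int k * P"
  shows "\<exists>k::int. \<forall>s. f s = of_int k * P"
proof -
  have "f constant_on UNIV"
  proof (rule continuous_discrete_range_constant[OF connected_UNIV assms(1)])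
    fix x :: real
    have "P \<le> norm (f y - f x)" if "f y \<noteq> f x" for y
    proof -
      obtain k l :: int where kl: "f y = of_int k * P" "f x = of_int l * P" using assms(3) by blast
      then have "k \<noteq> l" using that by auto
      then have "\<bar>real_of_int (k - l)\<bar> \<ge> 1" by linarith
      then have "P * 1 \<le> P * \<bar>real_of_int (k - l)\<bar>" using assms(2) by (intro mult_left_mono) auto
      moreover have "norm (f y - f x) = P * \<bar>real_of_int (k - l)\<bar>"
        using assms(2) by (simp add: kl abs_mult flip: left_diff_distrib)
      ultimately show ?thesis by simp
    qed
    then show "\<exists>e>0. \<forall>y. y \<in> UNIV \<and> f y \<noteq> f x \<longrightarrow> e \<le> norm (f y - f x)" using assms(2) by blast
  qed
  then show ?thesis using assms(3) by (metis UNIV_I constant_on_def)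
qed

text \<open>A winding number argument for arbitrary graphs: in one period the time coordinate goes
  round the circle once, whereas an n-fold traversal makes n times the winding number of the shorter
  curve.\<close>

lemma graph_not_iterate:
  assumes P: "P > 0"
  shows "\<not> is_iterate K P (graph_curve \<gamma>) P"
proof
  assume "is_iterate K P (graph_curve \<gamma>) P"
  then obtain n e R \<phi> where n: "n \<ge> (2::nat)" and e: "closed_geodesic K P e R" and \<phi>: "smooth_on UNIV \<phi>"
    "\<And>s. \<phi> (s + P) = \<phi> s + real n * R" and eq: "\<And>s. to_circle P (graph_curve \<gamma> s) = to_circle P (e (\<phi> s))"
    unfolding is_iterate_def by blast
  have "smooth_on UNIV e" using e by (simp add: closed_geodesic_def conic_geodesic_def cone_curve_def)
  then have "continuous_on UNIV e" by (rule smooth_on_imp_continuous_on)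
  then have ce: "continuous_on UNIV (\<lambda>s. fst (e s))" by (rule continuous_on_fst)
  have ceR: "continuous_on UNIV (\<lambda>s. fst (e (s + R)))"
    by (rule continuous_on_compose2[OF ce]) (auto intro!: continuous_intros)
  have ce\<phi>: "continuous_on UNIV (\<lambda>s. fst (e (\<phi> s)))"
    by (rule continuous_on_compose2[OF ce smooth_on_imp_continuous_on[OF \<phi>(1)]]) auto
  have "to_circle P (e (s + R)) = to_circle P (e s)" for s using e by (simp add: closed_geodesic_def)
  then have "\<exists>k::int. fst (e (s + R)) - fst (e s) = of_int k * P" for s
    using circ_eq_iff[of P "fst (e (s + R))" "fst (e s)"] by (auto simp: to_circle_def)
  from integer_multiple_constant[OF continuous_on_diff[OF ceR ce] P this]
  obtain j :: int where j: "\<And>s. fst (e (s + R)) - fst (e s) = of_int j * P" by blast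
  have "\<exists>k::int. s - fst (e (\<phi> s)) = of_int k * P" for s
  proof -
    have "circ P s = circ P (fst (e (\<phi> s)))" using eq[of s] by (simp add: to_circle_def graph_curve_def)
    then obtain k :: int where "s = fst (e (\<phi> s)) + of_int k * P" unfolding circ_eq_iff ..
    then show ?thesis by (intro exI[of _ k]) linarith
  qed
  from integer_multiple_constant[OF continuous_on_diff[OF continuous_on_id ce\<phi>] P this]
  obtain k :: int where k: "\<And>s. s - fst (e (\<phi> s)) = of_int k * P" by blast
  have jn: "fst (e (s + real n * R)) = fst (e s) + real n * (of_int j * P)" for s and n :: nat
  proof (induction n)
    case (Suc n)
    have "fst (e (s + real (Suc n) * R)) = fst (e (s + real n * R + R))" by (simp add: algebra_simps)
    also have "\<dots> = fst (e (s + real n * R)) + of_int j * P" using j[of "s + real n * R"] by simp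
    finally show ?case using Suc by (simp add: algebra_simps)
  qed simp
  \<comment> \<open>One period of the graph advances the lifted time by \<open>P\<close>, the n-fold
    traversal by \<open>n * j * P\<close>; so \<open>n\<close> divides 1.\<close>
  have "P = fst (e (\<phi> (0 + P))) - fst (e (\<phi> 0))" using k[of "0 + P"] k[of 0] by simp
  also have "\<dots> = real n * (of_int j * P)" unfolding \<phi>(2) jn by simp
  finally have "1 * P = of_int (int n * j) * P" by simp
  then have "real_of_int (int n * j) = 1" using P by (simp only: mult_cancel_right) simp
  then have "int n * j = 1" by linarith
  then have "int n = 1" using n by (metis zmult_eq_1_iff of_nat_0_le_iff not_numeral_le_zero abs_of_nonneg abs_of_nat zdvd1_eq dvd_triv_left)
  then show False using n by simp
qed

text \<open>The potential is nonnegative and (F w - 1)^2 \<ge> 0 gives F w^2 / 2 \<ge> w - 1 / (2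
  F). The integral of the right side involves only the total angle and the clock, so the length
  grows with the number of turns.\<close>

lemma curve_length_circular_ge:
  assumes F: "smooth_on UNIV F" "\<And>t. F t > 0" and l: "smooth_on UNIV l1" "smooth_on UNIV l2" "\<And>t. l1 t > 0" "\<And>t. l2 t > 0"
    and d: "d1 > 0" "d2 > 0" and P: "P > 0" and u: "smooth_on UNIV u" "\<And>t. (u has_real_derivative w t) (at t)"
  shows "u P - u 0 - integral {0..P} (\<lambda>t. 1 / F t) / 2
    \<le> curve_length (finsler F (potential d1 d2 l1 l2))
        (graph_curve (\<lambda>t. (complex_of_real (cos (u t)), complex_of_real (sin (u t))))) 0 P"
proof -
  define \<gamma> where "\<gamma> t = (cos (u t) *\<^sub>R (1::complex), sin (u t) *\<^sub>R (1::complex))" for t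
  have F0: "F t \<noteq> 0" "l1 t \<noteq> 0" "l2 t \<noteq> 0" for t using F(2)[of t] l(3,4)[of t] by simp_all
  have \<gamma>: "smooth_on UNIV \<gamma>"
    unfolding \<gamma>_def[abs_def] by (intro smooth_on_Pair smooth_on_scaleR smooth_on_cos smooth_on_sin smooth_on_const u open_UNIV)
  have "pd 1 \<gamma> t = w t *\<^sub>R (- sin (u t) *\<^sub>R 1, cos (u t) *\<^sub>R 1)" for t
    unfolding \<gamma>_def[abs_def] by (rule pd1_eqI[OF has_vector_derivative_circular[OF u(2)]])
  then have n: "(norm (pd 1 \<gamma> t))\<^sup>2 = (w t)\<^sup>2" for t
    by (simp add: norm_prod_def power_mult_distrib flip: distrib_left)
  have w: "w = pd 1 u"
    using smooth_on_real_derivative[OF u(1)] u(2) DERIV_unique by blast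
  have cF: "continuous_on S F" "continuous_on S l1" "continuous_on S l2" "continuous_on S w" "continuous_on S u" for S
    unfolding w using smooth_on_imp_continuous_on[OF smooth_on_subset[OF _ subset_UNIV]] F(1) l(1,2) u(1) smooth_onD(2)[OF u(1), of 1]
    by auto
  let ?L = "\<lambda>t. F t / 2 * ((norm (pd 1 \<gamma> t))\<^sup>2 + 2 * potential d1 d2 l1 l2 t (\<gamma> t))"
  have "(w has_integral u P - u 0) {0..P}"
    by (rule fundamental_theorem_of_calculus)
      (use P u(2) in \<open>auto simp: has_real_derivative_iff_has_vector_derivative intro: has_vector_derivative_at_within\<close>)
  moreover have "((\<lambda>t. 1 / F t) has_integral integral {0..P} (\<lambda>t. 1 / F t)) {0..P}"
    by (intro integrable_integral integrable_continuous_real continuous_intros cF) (simp add: F0)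
  ultimately have lo: "((\<lambda>t. w t - 1 / F t / 2) has_integral u P - u 0 - integral {0..P} (\<lambda>t. 1 / F t) / 2) {0..P}"
    by (intro has_integral_diff has_integral_divide)
  have "?L integrable_on {0..P}"
    unfolding n potential_def \<gamma>_def by (intro integrable_continuous_real continuous_intros cF) (auto simp: F0)
  then have hi: "(?L has_integral integral {0..P} ?L) {0..P}" by (rule integrable_integral)
  have "w t - 1 / F t / 2 \<le> ?L t" for t
  proof -
    have V: "potential d1 d2 l1 l2 t (\<gamma> t) \<ge> 0" using d by (simp add: potential_def)
    have "0 \<le> (F t * w t - 1)\<^sup>2 / (2 * F t)" using F(2)[of t] by simp
    also have "\<dots> = F t / 2 * (w t)\<^sup>2 - (w t - 1 / F t / 2)"
      using F0(1)[of t] by (simp add: power2_eq_square field_simps)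
    finally have "w t - 1 / F t / 2 \<le> F t / 2 * (w t)\<^sup>2" by simp
    also have "\<dots> \<le> ?L t" unfolding n using V F(2)[of t] by (intro mult_left_mono) auto
    finally show ?thesis .
  qed
  from has_integral_le[OF lo hi this] show ?thesis
    using curve_length_graph[OF \<gamma>, of F "potential d1 d2 l1 l2" P] by (simp add: \<gamma>_def[abs_def] of_real_def)
qed

section \<open>Determinants of frames\<close>

text \<open>The passage to matrices makes row exchanges, block triangular forms and products
  available.\<close>

lemma frame_det_eq_det:
  "frame_det B vs = Determinant.det (Matrix.mat (length B) (length B) (\<lambda>(i, j). vs ! i \<bullet> B ! j))"
proof -
  have "(\<Prod>i = 0..<length B. Matrix.mat (length B) (length B) (\<lambda>(i, j). vs ! i \<bullet> B ! j) $$ (i, \<sigma> i))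
    = (\<Prod>i<length B. vs ! i \<bullet> B ! \<sigma> i)" if "\<sigma> permutes {..<length B}" for \<sigma>
    using permutes_in_image[OF that] by (intro prod.cong) (auto simp: atLeast0LessThan)
  then show ?thesis
    unfolding frame_det_def Determinant.det_def by (auto simp: atLeast0LessThan intro!: sum.cong)
qed

lemma frame_det_swap:
  assumes "length us + length vs + length ws = length B"
  shows "frame_det B (us @ vs @ ws) = (- 1) ^ (length us * length vs) * frame_det B (vs @ us @ ws)"
proof -
  let ?n = "length B" and ?k = "length us" and ?m = "length vs"
  let ?A = "Matrix.mat ?n ?n (\<lambda>(i, j). (us @ vs @ ws) ! i \<bullet> B ! j)"
  have "Determinant.det ?A = (- 1) ^ (?k * ?m) * Determinant.det (Matrix.mat ?n ?n
    (\<lambda>(i, j). ?A $$ (if i < ?m then i + ?k else if i < ?k + ?m then i - ?m else i, j)))"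
    by (rule det_swap_initial_rows) (use assms in auto)
  also have "Matrix.mat ?n ?n (\<lambda>(i, j). ?A $$ (if i < ?m then i + ?k else if i < ?k + ?m then i - ?m else i, j))
    = Matrix.mat ?n ?n (\<lambda>(i, j). (vs @ us @ ws) ! i \<bullet> B ! j)"
    using assms by (intro eq_matI) (auto simp: nth_append add.commute)
  finally show ?thesis by (simp add: frame_det_eq_det)
qed

lemma frame_det_scale:
  assumes "\<And>i. i < length B \<Longrightarrow> vs ! i = c i *\<^sub>R ws ! i"
  shows "frame_det B vs = (\<Prod>i<length B. c i) * frame_det B ws"
  unfolding frame_det_def sum_distrib_left
  using assms by (intro sum.cong) (simp_all add: prod.distrib)

lemma frame_det_scale_block:
  assumes "length us + length vs + length ws = length B"
  shows "frame_det B (us @ map ((*\<^sub>R) c) vs @ ws) = c ^ length vs * frame_det B (us @ vs @ ws)"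
proof -
  let ?J = "{length us..<length us + length vs}"
  have "frame_det B (us @ map ((*\<^sub>R) c) vs @ ws)
    = (\<Prod>i<length B. if i \<in> ?J then c else 1) * frame_det B (us @ vs @ ws)"
    by (rule frame_det_scale) (use assms in \<open>auto simp: nth_append\<close>)
  also have "(\<Prod>i<length B. if i \<in> ?J then c else 1) = (\<Prod>i\<in>{..<length B} \<inter> ?J. c)"
    by (rule prod.inter_restrict[symmetric]) simp
  also have "{..<length B} \<inter> ?J = ?J" using assms by auto
  finally show ?thesis by simp
qed

lemma frame_det_linear:
  assumes "length B = Suc n"
  shows "frame_det B ((a *\<^sub>R v + b *\<^sub>R w) # vs) = a * frame_det B (v # vs) + b * frame_det B (w # vs)"
  unfolding frame_det_def assms prod.lessThan_Suc_shift
  by (simp add: inner_add_left distrib_left distrib_right sum.distrib sum_distrib_left mult_ac)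

lemma frame_det_combine:
  assumes n: "length B = Suc (Suc (length vs))"
  shows "frame_det B ((a *\<^sub>R v + b *\<^sub>R w) # (c *\<^sub>R v + d *\<^sub>R w) # vs)
    = (a * d - b * c) * frame_det B (v # w # vs)"
proof -
  have swap: "frame_det B (x # y # vs) = - frame_det B (y # x # vs)" for x y
    using frame_det_swap[of "[x]" "[y]" vs B] n by simp
  have l: "frame_det B (x # (c *\<^sub>R v + d *\<^sub>R w) # vs) = c * frame_det B (x # v # vs) + d * frame_det B (x # w # vs)" for x
    using frame_det_linear[OF n, of c v d w "x # vs"] swap[of x] by simp
  have "frame_det B (x # x # vs) = 0" for x using swap[of x x] by simp
  then show ?thesis
    unfolding frame_det_linear[OF n] l using swap[of w v] by (simp add: algebra_simps)
qed

lemma length_std_frame [simp]: "length (std_frame :: ('a::{finite,linorder}) rvec list) = CARD('a)"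
  by (simp add: std_frame_def)

lemma frame_det_sum_frame:
  fixes us :: "('a::{finite,linorder}) rvec list" and vs :: "('b::{finite,linorder}) rvec list"
  assumes "length us = CARD('a)" "length vs = CARD('b)"
  shows "frame_det sum_frame (map (\<lambda>v. (v, 0)) us @ map (\<lambda>w. (0, w)) vs)
    = frame_det std_frame us * frame_det std_frame vs"
proof -
  let ?n = "CARD('a)" and ?m = "CARD('b)"
  let ?A = "Matrix.mat ?n ?n (\<lambda>(i, j). us ! i \<bullet> std_frame ! j)"
  let ?D = "Matrix.mat ?m ?m (\<lambda>(i, j). vs ! i \<bullet> std_frame ! j)"
  have l: "length (sum_frame :: ('a rvec \<times> 'b rvec) list) = ?n + ?m" by (simp add: sum_frame_def)
  have "Matrix.mat (?n + ?m) (?n + ?m)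
      (\<lambda>(i, j). (map (\<lambda>v. (v, 0)) us @ map (\<lambda>w. (0, w)) vs) ! i \<bullet> sum_frame ! j)
    = four_block_mat ?A (0\<^sub>m ?n ?m) (0\<^sub>m ?m ?n) ?D"
    using assms by (intro eq_matI) (auto simp: nth_append sum_frame_def)
  moreover have "Determinant.det (four_block_mat ?A (0\<^sub>m ?n ?m) (0\<^sub>m ?m ?n) ?D)
    = Determinant.det ?A * Determinant.det ?D"
    by (rule det_four_block_mat_upper_right_zero) auto
  ultimately show ?thesis unfolding frame_det_eq_det l by simp
qed

text \<open>
  Moving the normal of the second sphere past an even number of vectors does not change the sign.
\<close>

lemma frame_det_join:
  fixes x :: "('a::{finite,linorder}) rvec" and y :: "('b::{finite,linorder}) rvec"
  assumes es: "Suc (length es) = CARD('a)" "even (length es)" and hs: "Suc (length hs) = CARD('b)"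
  shows "frame_det sum_frame ((a *\<^sub>R x, b *\<^sub>R y) # (c *\<^sub>R x, d *\<^sub>R y) #
      map (\<lambda>e. (a *\<^sub>R e, 0)) es @ map (\<lambda>h. (0, b *\<^sub>R h)) hs)
    = (a * d - b * c) * a ^ length es * b ^ length hs *
      (frame_det std_frame (x # es) * frame_det std_frame (y # hs))"
proof -
  let ?B = "sum_frame :: ('a rvec \<times> 'b rvec) list"
  let ?X = "(x, 0) :: 'a rvec \<times> 'b rvec" and ?Y = "(0, y) :: 'a rvec \<times> 'b rvec"
  let ?E = "map (\<lambda>e. (e, 0)) es :: ('a rvec \<times> 'b rvec) list" and ?H = "map (\<lambda>h. (0, h)) hs :: ('a rvec \<times> 'b rvec) list"
  have l: "length ?B = Suc (Suc (length es + length hs))" using es hs by (simp add: sum_frame_def)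
  have "((a *\<^sub>R x, b *\<^sub>R y) # (c *\<^sub>R x, d *\<^sub>R y) # map (\<lambda>e. (a *\<^sub>R e, 0)) es @ map (\<lambda>h. (0, b *\<^sub>R h)) hs)
    = (a *\<^sub>R ?X + b *\<^sub>R ?Y) # (c *\<^sub>R ?X + d *\<^sub>R ?Y) # map ((*\<^sub>R) a) ?E @ map ((*\<^sub>R) b) ?H"
    by simp
  also have "frame_det ?B \<dots> = (a * d - b * c) * frame_det ?B (?X # ?Y # map ((*\<^sub>R) a) ?E @ map ((*\<^sub>R) b) ?H)"
    by (rule frame_det_combine) (simp add: l)
  also have "frame_det ?B (?X # ?Y # map ((*\<^sub>R) a) ?E @ map ((*\<^sub>R) b) ?H)
    = a ^ length es * (b ^ length hs * frame_det ?B (?X # ?Y # ?E @ ?H))"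
    using frame_det_scale_block[of "[?X, ?Y]" ?E "map ((*\<^sub>R) b) ?H" ?B a]
      frame_det_scale_block[of "[?X, ?Y] @ ?E" ?H "[]" ?B b] by (simp add: l)
  also have "frame_det ?B (?X # ?Y # ?E @ ?H) = - frame_det ?B (?Y # ?X # ?E @ ?H)"
    using frame_det_swap[of "[?X]" "[?Y]" "?E @ ?H" ?B] by (simp add: l)
  \<comment> \<open>The second normal passes the first one and the vectors of \<open>?E\<close>, an
    odd number in all; this sign compensates the previous exchange.\<close>
  also have "\<dots> = frame_det ?B ((?X # ?E) @ ?Y # ?H)"
    using frame_det_swap[of "[?Y]" "?X # ?E" ?H ?B] es(2) by (simp add: l)
  also have "(?X # ?E) @ ?Y # ?H = map (\<lambda>v. (v, 0)) (x # es) @ map (\<lambda>w. (0, w)) (y # hs)" by simp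
  also have "frame_det ?B \<dots> = frame_det std_frame (x # es) * frame_det std_frame (y # hs)"
    by (rule frame_det_sum_frame) (use es hs in auto)
  finally show ?thesis by simp
qed

section \<open>Existence of positive frames\<close>

lemma sum_std_frame: "(\<Sum>k<CARD('a). f ((std_frame :: ('a::{finite,linorder}) rvec list) ! k)) = (\<Sum>i\<in>UNIV. f (axis i 1))"
proof -
  let ?l = "sorted_list_of_set (UNIV :: 'a set)"
  have "(\<Sum>i\<in>UNIV. f (axis i 1)) = sum_list (map (\<lambda>i. f (axis i 1)) ?l)"
    using sum_list_distinct_conv_sum_set[of ?l "\<lambda>i. f (axis i 1)"] by simp
  also have "\<dots> = (\<Sum>k<CARD('a). f (axis (?l ! k) 1))"
    by (simp add: sum_list_sum_nth atLeast0LessThan)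
  finally show ?thesis by (simp add: std_frame_def)
qed

text \<open>The coordinate matrix times its transpose is the Gram matrix, here the identity, so its
  determinant cannot vanish.\<close>

lemma frame_det_orthonormal:
  fixes vs :: "('a::{finite,linorder}) rvec list"
  assumes l: "length vs = CARD('a)"
    and o: "\<And>i j. i < CARD('a) \<Longrightarrow> j < CARD('a) \<Longrightarrow> vs ! i \<bullet> vs ! j = (if i = j then 1 else 0)"
  shows "frame_det std_frame vs \<noteq> 0"
proof -
  let ?n = "CARD('a)"
  let ?M = "Matrix.mat ?n ?n (\<lambda>(i, j). vs ! i \<bullet> std_frame ! j)"
  have "?M * transpose_mat ?M = 1\<^sub>m ?n"
  proof (rule eq_matI)
    fix i j assume ij: "i < dim_row (1\<^sub>m ?n :: real mat)" "j < dim_col (1\<^sub>m ?n :: real mat)"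
    then have "(?M * transpose_mat ?M) $$ (i, j) = (\<Sum>k<?n. (vs ! i \<bullet> std_frame ! k) * (vs ! j \<bullet> std_frame ! k))"
      by (simp add: scalar_prod_def atLeast0LessThan)
    also have "\<dots> = vs ! i \<bullet> vs ! j"
      unfolding sum_std_frame[of "\<lambda>b. (vs ! i \<bullet> b) * (vs ! j \<bullet> b)"] by (simp add: inner_axis inner_vec_def[of "vs ! i" "vs ! j"])
    finally show "(?M * transpose_mat ?M) $$ (i, j) = 1\<^sub>m ?n $$ (i, j)" using ij o by simp
  qed auto
  then have "Determinant.det ?M * Determinant.det (transpose_mat ?M) = 1"
    using Determinant.det_mult[of ?M ?n "transpose_mat ?M"] by simp
  then show ?thesis by (auto simp: frame_det_eq_det)
qed

text \<open>\<open>orientation_sign\<close> is a definite description over frames, so some frame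
  must exist. An orthonormal completion of \<open>x\<close> has nonzero determinant, and reversing
  one of its tangent vectors corrects the sign; in dimension at least 2 there is such a
  vector.\<close>

lemma positive_frame_exists:
  fixes x :: "('a::{finite,linorder}) rvec"
  assumes x: "norm x = 1" and n: "CARD('a) \<ge> 2"
  obtains es where "positive_frame x es"
proof -
  obtain S where S: "x \<in> S" "pairwise orthogonal S" "\<And>y. y \<in> S \<Longrightarrow> norm y = 1" "independent S"
    "card S = DIM('a rvec)" using vector_in_orthonormal_basis[OF x] by metis
  have fin: "finite S" using S(4) by (rule independent_imp_finite)
  obtain es where es: "set es = S - {x}" "distinct es" using finite_distinct_list[of "S - {x}"] fin by auto
  have "length es = card (S - {x})" using es distinct_card by metis
  then have l: "Suc (length es) = CARD('a)" using S(1,5) fin n by simp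
  have d: "distinct (x # es)" and s: "set (x # es) = S" using es S(1) by auto
  have o: "(x # es) ! i \<bullet> (x # es) ! j = (if i = j then 1 else 0)" if "i < CARD('a)" "j < CARD('a)" for i j
  proof -
    have i: "(x # es) ! i \<in> S" "(x # es) ! j \<in> S" using that l s by (metis length_Cons nth_mem)+
    show ?thesis
    proof (cases "i = j")
      case True
      then show ?thesis using S(3)[OF i(2)] by (simp add: dot_square_norm)
    next
      case False
      then have "(x # es) ! i \<noteq> (x # es) ! j" using d that l nth_eq_iff_index_eq[OF d] by simp
      then have "orthogonal ((x # es) ! i) ((x # es) ! j)" using S(2) i by (simp add: pairwise_def)
      then show ?thesis using False by (simp add: Linear_Algebra.orthogonal_def)
    qed
  qed
  have n0: "frame_det std_frame (x # es) \<noteq> 0" using frame_det_orthonormal[of "x # es"] o l by simp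
  have ox: "e \<bullet> x = 0" if "e \<in> set es" for e
    using S(1,2) that es(1) by (auto simp: pairwise_def Linear_Algebra.orthogonal_def)
  obtain e es' where ee: "es = e # es'" using l n by (cases es) auto
  show thesis
  proof (cases "frame_det std_frame (x # es) > 0")
    case True
    then show ?thesis using that[of es] l ox by (simp add: positive_frame_def)
  next
    case False
    have "frame_det std_frame ([x] @ map ((*\<^sub>R) (- 1)) [e] @ es') = (- 1) ^ 1 * frame_det std_frame ([x] @ [e] @ es')"
      using frame_det_scale_block[of "[x]" "[e]" es' std_frame "- 1"] l ee by simp
    then have "frame_det std_frame (x # - e # es') = - frame_det std_frame (x # es)" by (simp add: ee)
    then show ?thesis using that[of "- e # es'"] l ox False n0 by (auto simp: positive_frame_def ee)
  qed
qed

section \<open>The degree of a rotating join\<close>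

text \<open>A derivative within a product of spheres is not unique as a linear map, but its value on
  the velocity of a curve in the set is. On tangent vectors the arbitrary \<open>D\<close> of
  \<open>orientation_sign\<close> can thus be replaced by the explicit formula.\<close>

lemma has_derivative_eq_on_curves:
  fixes f :: "'a::real_normed_vector \<Rightarrow> 'b::real_normed_vector"
  assumes D: "(f has_derivative D) (at x within S)" "(f has_derivative D') (at x within S)"
    and c: "(c has_vector_derivative v) (at (0::real))" "c 0 = x" "\<And>s. c s \<in> S"
  shows "D v = D' v"
proof -
  have "((\<lambda>s. f (c s)) has_vector_derivative D v) (at 0)" if D: "(f has_derivative D) (at x within S)" for D
  proof -
    have "(f has_derivative D) (at (c 0) within range c)"
      by (rule has_derivative_subset[OF D[folded c(2)]]) (use c(3) in auto)
    from has_derivative_in_compose[OF c(1)[unfolded has_vector_derivative_def] this]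
    have "((\<lambda>s. f (c s)) has_derivative (\<lambda>r. D (r *\<^sub>R v))) (at 0)" .
    then show ?thesis
      using linear_cmul[OF has_derivative_linear[OF D]] by (simp add: has_vector_derivative_def)
  qed
  from vector_derivative_unique_at[OF this[OF D(1)] this[OF D(2)]] show ?thesis .
qed

text \<open>A normalised straight line; the normalising factor is stationary at 0 because
  \<open>e\<close> is tangent.\<close>

lemma sphere_curve_exists:
  fixes x :: "'v::real_inner"
  assumes "norm x = 1" "e \<bullet> x = 0"
  obtains c where "c 0 = x" "\<And>s::real. norm (c s) = 1" "(c has_vector_derivative e) (at 0)"
proof
  let ?n = "\<lambda>s::real. 1 + s\<^sup>2 * (e \<bullet> e)"
  let ?c = "\<lambda>s. inverse (sqrt (?n s)) *\<^sub>R (x + s *\<^sub>R e)"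
  show "?c 0 = x" by simp
  show "norm (?c s) = 1" for s
  proof -
    have p: "?n s > 0" by (simp add: add_pos_nonneg)
    have "(norm (x + s *\<^sub>R e))\<^sup>2 = ?n s"
      using assms unfolding norm_eq_1 power2_norm_eq_inner
      by (simp add: inner_add_left inner_add_right inner_commute[of x e] power2_eq_square)
    then have "norm (x + s *\<^sub>R e) = sqrt (?n s)" by (metis norm_ge_zero real_sqrt_abs abs_of_nonneg)
    then show ?thesis using p by simp
  qed
  have "((\<lambda>s. inverse (sqrt (?n s))) has_real_derivative 0) (at 0)"
    by (rule derivative_eq_intros refl | simp)+
  then have "((\<lambda>s. inverse (sqrt (?n s))) has_vector_derivative 0) (at 0)"
    by (simp add: has_real_derivative_iff_has_vector_derivative)
  moreover have "((\<lambda>s. x + s *\<^sub>R e) has_vector_derivative e) (at 0)"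
    by (rule derivative_eq_intros refl | simp)+
  ultimately have "(?c has_vector_derivative inverse (sqrt (?n 0)) *\<^sub>R e + 0 *\<^sub>R (x + 0 *\<^sub>R e)) (at 0)"
    by (rule bounded_bilinear.has_vector_derivative[OF bounded_bilinear_scaleR])
  then show "(?c has_vector_derivative e) (at 0)" by simp
qed

context
  fixes u w :: "real \<Rightarrow> real" and P :: real and m :: nat
    and \<Phi> :: "real set \<times> ('a::{finite,linorder}) rvec \<times> ('b::{finite,linorder}) rvec \<Rightarrow> 'a rvec \<times> 'b rvec"
  assumes a: "CARD('a) \<ge> 2" "odd CARD('a)" and b: "CARD('b) \<ge> 2" "odd CARD('b)"
    and P: "P > 0" and m: "m \<ge> 1"
    and u: "u 0 = 0" "\<And>t. (u has_real_derivative w t) (at t)" "\<And>t. w t > 0" "\<And>t. u (t + P) = u t + 2 * pi * m"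
    and \<Phi>: "\<And>t x y. \<Phi> (circ P t, x, y) = (cos (u t) *\<^sub>R x, sin (u t) *\<^sub>R y)"
begin

lemma rotating_join_has_derivative:
  "((\<lambda>(t, x, y). \<Phi> (circ P t, x, y)) has_derivative
    (\<lambda>(r, e, h). ((- sin (u t) * w t * r) *\<^sub>R x + cos (u t) *\<^sub>R e, (cos (u t) * w t * r) *\<^sub>R y + sin (u t) *\<^sub>R h)))
    (at (t, x, y) within S)"
proof -
  have uf: "((\<lambda>p :: real \<times> 'a rvec \<times> 'b rvec. u (fst p)) has_derivative (\<lambda>q. w t * fst q)) (at (t, x, y) within S)"
    using has_derivative_compose[OF has_derivative_fst[OF has_derivative_ident] has_derivative_at_withinI] u(2)[of t]
      has_derivative_compose[of fst fst "(t, x, y)" S u "(*) (w t)"]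
    by (simp add: has_field_derivative_def has_derivative_fst)
  show ?thesis
    unfolding \<Phi> case_prod_unfold
    by (rule derivative_eq_intros uf refl | simp)+ (simp add: fun_eq_iff algebra_simps)
qed

lemma rotating_join_derivative_eq:
  assumes D: "((\<lambda>(t, x, y). \<Phi> (circ P t, x, y)) has_derivative D) (at (t, x, y) within UNIV \<times> sphere 0 1 \<times> sphere 0 1)"
    and n: "norm x = 1" "norm y = 1"
  shows "D (1, 0, 0) = ((- sin (u t) * w t) *\<^sub>R x, (cos (u t) * w t) *\<^sub>R y)"
    and "e \<bullet> x = 0 \<Longrightarrow> D (0, e, 0) = (cos (u t) *\<^sub>R e, 0)"
    and "h \<bullet> y = 0 \<Longrightarrow> D (0, 0, h) = (0, sin (u t) *\<^sub>R h)"
proof -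
  note eq = has_derivative_eq_on_curves[OF D rotating_join_has_derivative]
  have "((\<lambda>s. (t + s, x, y)) has_vector_derivative (1, 0, 0)) (at 0)"
    by (intro has_vector_derivative_Pair has_vector_derivative_const) (rule derivative_eq_intros refl | simp)+
  from eq[OF this] show "D (1, 0, 0) = ((- sin (u t) * w t) *\<^sub>R x, (cos (u t) * w t) *\<^sub>R y)" using n by simp
  show "D (0, e, 0) = (cos (u t) *\<^sub>R e, 0)" if o: "e \<bullet> x = 0"
  proof -
    obtain c where c: "c 0 = x" "\<And>s::real. norm (c s) = 1" "(c has_vector_derivative e) (at 0)"
      using sphere_curve_exists[OF n(1) o] by metis
    have "((\<lambda>s. (t, c s, y)) has_vector_derivative (0, e, 0)) (at 0)"
      by (intro has_vector_derivative_Pair has_vector_derivative_const c)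
    from eq[OF this] show ?thesis using n c by simp
  qed
  show "D (0, 0, h) = (0, sin (u t) *\<^sub>R h)" if o: "h \<bullet> y = 0"
  proof -
    obtain c where c: "c 0 = y" "\<And>s::real. norm (c s) = 1" "(c has_vector_derivative h) (at 0)"
      using sphere_curve_exists[OF n(2) o] by metis
    have "((\<lambda>s. (t, x, c s)) has_vector_derivative (0, 0, h)) (at 0)"
      by (intro has_vector_derivative_Pair has_vector_derivative_const c)
    from eq[OF this] show ?thesis using n c by simp
  qed
qed

lemma angle_int_shift: "u (t + of_int k * P) = u t + 2 * pi * m * of_int k"
proof -
  \<comment> \<open>Without its linear growth the angle is periodic.\<close>
  have "periodic P (\<lambda>t. u t - 2 * pi * m * (t / P))" using P by (simp add: periodic_def u(4) field_simps)
  moreover have "2 * pi * m * ((t + of_int k * P) / P) = 2 * pi * m * (t / P) + 2 * pi * m * of_int k"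
    using P by (simp add: field_simps)
  ultimately show ?thesis using periodic_int[of P "\<lambda>t. u t - 2 * pi * m * (t / P)" t k] by linarith
qed

text \<open>In positive frames the Jacobian is u' times powers of \<open>cos (u t)\<close> and
  \<open>sin (u t)\<close>, up to a positive factor. The exponents are the dimensions of the
  spheres, which are even and positive, so the sign is never negative and vanishes only with one of
  these two functions.\<close>

lemma orientation_sign_rotating_join:
  assumes n: "norm x = 1" "norm y = 1"
  shows "orientation_sign P \<Phi> (circ P t, x, y) = of_bool (cos (u t) \<noteq> 0 \<and> sin (u t) \<noteq> 0)"
proof -
  \<comment> \<open>The representative of the circle point, the differential and both frames are
    arbitrary in \<open>orientation_sign\<close>, so every admissible choice must give this one
    value.\<close>
  have sgn: "sgn (frame_det sum_frame (\<Phi> (circ P t, x, y) #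
      map D ((1, 0, 0) # map (\<lambda>e. (0, e, 0)) es @ map (\<lambda>h. (0, 0, h)) hs)))
    = of_bool (cos (u t) \<noteq> 0 \<and> sin (u t) \<noteq> 0)"
    if s: "circ P s = circ P t"
      and D: "((\<lambda>(t, x, y). \<Phi> (circ P t, x, y)) has_derivative D) (at (s, x, y) within UNIV \<times> sphere 0 1 \<times> sphere 0 1)"
      and es: "positive_frame x es" and hs: "positive_frame y hs" for s D es hs
  proof -
    obtain k :: int where k: "s = t + of_int k * P" using s unfolding circ_eq_iff by blast
    have "sin (u s) = sin (u t)" "cos (u s) = cos (u t)"
      unfolding k angle_int_shift
      using sin.plus_of_int[of "u t" "m * k"] cos.plus_of_int[of "u t" "m * k"] by (simp_all add: mult_ac)
    note D' = rotating_join_derivative_eq[OF D n, unfolded this]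
    have l: "Suc (length es) = CARD('a)" "Suc (length hs) = CARD('b)" and pos: "frame_det std_frame (x # es) > 0" "frame_det std_frame (y # hs) > 0"
      using es hs by (auto simp: positive_frame_def)
    have ev: "even (length es)" "even (length hs)" using l a(2) b(2) by (metis even_Suc)+
    have "map (\<lambda>e. D (0, e, 0)) es = map (\<lambda>e. (cos (u t) *\<^sub>R e, 0)) es"
      using es by (auto simp: positive_frame_def intro!: D')
    moreover have "map (\<lambda>h. D (0, 0, h)) hs = map (\<lambda>h. (0, sin (u t) *\<^sub>R h)) hs"
      using hs by (auto simp: positive_frame_def intro!: D')
    ultimately have "\<Phi> (circ P t, x, y) # map D ((1, 0, 0) # map (\<lambda>e. (0, e, 0)) es @ map (\<lambda>h. (0, 0, h)) hs)
      = (cos (u t) *\<^sub>R x, sin (u t) *\<^sub>R y) # ((- sin (u t) * w s) *\<^sub>R x, (cos (u t) * w s) *\<^sub>R y) #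
        map (\<lambda>e. (cos (u t) *\<^sub>R e, 0)) es @ map (\<lambda>h. (0, sin (u t) *\<^sub>R h)) hs"
      using D'(1) by (simp add: \<Phi> o_def)
    also have "frame_det sum_frame \<dots> = (cos (u t) * (cos (u t) * w s) - sin (u t) * (- sin (u t) * w s)) *
        cos (u t) ^ length es * sin (u t) ^ length hs * (frame_det std_frame (x # es) * frame_det std_frame (y # hs))"
      by (rule frame_det_join[OF l(1) ev(1) l(2)])
    also have "cos (u t) * (cos (u t) * w s) - sin (u t) * (- sin (u t) * w s) = w s"
    proof -
      have "c * (c * z) - r * (- r * z) = z * (r\<^sup>2 + c\<^sup>2)" for c r z :: real
        by (simp add: algebra_simps power2_eq_square)
      then show ?thesis by simp
    qed
    finally have det: "frame_det sum_frame (\<Phi> (circ P t, x, y) #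
        map D ((1, 0, 0) # map (\<lambda>e. (0, e, 0)) es @ map (\<lambda>h. (0, 0, h)) hs))
      = w s * cos (u t) ^ length es * sin (u t) ^ length hs * (frame_det std_frame (x # es) * frame_det std_frame (y # hs))" .
    have p: "w s > 0" "frame_det std_frame (x # es) * frame_det std_frame (y # hs) > 0" using pos u(3) by auto
    have sp: "sgn (z ^ j) = of_bool (z \<noteq> 0)" if "even j" "j > 0" for z :: real and j :: nat
      using that by (cases z "0::real" rule: linorder_cases) auto
    have "length es > 0" "length hs > 0" using l a(1) b(1) by auto
    then show ?thesis unfolding det sgn_mult sp[OF ev(1)] using p(1) pos sp[OF ev(2)] sp[OF ev(1)] by simp
  qed
  obtain es where es: "positive_frame x es" using positive_frame_exists[OF n(1) a(1)] by blast
  obtain hs where hs: "positive_frame y hs" using positive_frame_exists[OF n(2) b(1)] by blast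
  show ?thesis
    unfolding orientation_sign_def prod.case
  proof (rule the_equality)
    show "\<exists>s D es hs. circ P s = circ P t \<and>
      ((\<lambda>(t, x, y). \<Phi> (circ P t, x, y)) has_derivative D) (at (s, x, y) within UNIV \<times> sphere 0 1 \<times> sphere 0 1) \<and>
      positive_frame x es \<and> positive_frame y hs \<and>
      of_bool (cos (u t) \<noteq> 0 \<and> sin (u t) \<noteq> 0) = sgn (frame_det sum_frame (\<Phi> (circ P t, x, y) #
        map D ((1, 0, 0) # map (\<lambda>e. (0, e, 0)) es @ map (\<lambda>h. (0, 0, h)) hs)))"
      by (intro exI conjI, rule refl, rule rotating_join_has_derivative, rule es, rule hs,
        rule sgn[symmetric, OF refl rotating_join_has_derivative es hs])
  qed (use sgn in blast)
qed

section \<open>Counting preimages\<close>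

lemma angle_bij: "strict_mono u" "surj u"
proof -
  show "strict_mono u"
  proof (rule strict_monoI)
    fix s t :: real assume "s < t"
    then show "u s < u t" by (rule DERIV_pos_imp_increasing) (use u(2,3) in blast)
  qed
  have cont: "continuous_on UNIV u" using u(2) by (meson DERIV_continuous continuous_at_imp_continuous_on)
  have p: "2 * pi * real m > 0" using m by simp
  have "y \<in> range u" for y
  proof -
    obtain n :: nat where n: "\<bar>y\<bar> < n * (2 * pi * real m)" using reals_Archimedean3[OF p] by blast
    have "connected (range u)" by (rule connected_continuous_image[OF cont connected_UNIV])
    moreover have "u (0 + of_int (- int n) * P) \<le> y" "y \<le> u (0 + of_int (int n) * P)"
      unfolding angle_int_shift u(1) using n by (simp_all add: mult.commute)
    ultimately show ?thesis by (meson connectedD_interval rangeI)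
  qed
  then show "surj u" by blast
qed

text \<open>For 0 < r < 1 each full turn contains four angles with |cos| = r, one in each open
  quadrant.\<close>

lemma card_abs_cos_level:
  assumes r: "0 < r" "r < 1"
  shows "card {\<alpha> \<in> {0..<2 * pi * m}. \<bar>cos \<alpha>\<bar> = r} = 4 * m" "finite {\<alpha> \<in> {0..<2 * pi * m}. \<bar>cos \<alpha>\<bar> = r}"
proof -
  define \<beta> where "\<beta> = arccos r"
  have c: "cos \<beta> = r" using r by (simp add: \<beta>_def)
  have \<beta>: "0 < \<beta>" "\<beta> < pi / 2"
    using r arccos_lt_bounded[of r] arccos_less_mono[of r 0] by (simp_all add: \<beta>_def)
  \<comment> \<open>As \<beta> lies strictly between 0 and \<pi> / 2, the second family is shifted
    by one half turn; then both families have the index set \<open>{..<2 * m}\<close> within the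
    interval.\<close>
  let ?p = "\<lambda>k::nat. \<beta> + pi * k" and ?q = "\<lambda>k::nat. - \<beta> + pi * (real k + 1)"
  \<comment> \<open>The double angle absorbs the absolute value: |cos| is determined by its square,
    hence by cos of twice the angle.\<close>
  have iff: "\<bar>cos \<alpha>\<bar> = r \<longleftrightarrow> (\<exists>k::int. \<alpha> = \<beta> + pi * k \<or> \<alpha> = - \<beta> + pi * k)" for \<alpha>
  proof -
    have "\<bar>cos \<alpha>\<bar> = r \<longleftrightarrow> (cos \<alpha>)\<^sup>2 = (cos \<beta>)\<^sup>2" using r by (auto simp: c abs_eq_iff power2_eq_iff)
    also have "\<dots> \<longleftrightarrow> cos (2 * \<alpha>) = cos (2 * \<beta>)" by (simp add: cos_double_cos)
    also have "\<dots> \<longleftrightarrow> (\<exists>k::int. 2 * \<alpha> = 2 * \<beta> + 2 * k * pi \<or> 2 * \<alpha> = - (2 * \<beta>) + 2 * k * pi)"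
      unfolding cos_eq by (auto elim!: Ints_cases intro: Ints_of_int)
    also have "\<dots> \<longleftrightarrow> (\<exists>k::int. \<alpha> = \<beta> + pi * k \<or> \<alpha> = - \<beta> + pi * k)"
      by (intro ex_cong1) (auto simp: algebra_simps)
    finally show ?thesis .
  qed
  have "{\<alpha> \<in> {0..<2 * pi * m}. \<bar>cos \<alpha>\<bar> = r} = ?p ` {..<2 * m} \<union> ?q ` {..<2 * m}" (is "?L = ?R")
  proof
    show "?L \<subseteq> ?R"
    proof
      fix \<alpha> assume "\<alpha> \<in> ?L"
      then have \<alpha>: "0 \<le> \<alpha>" "\<alpha> < 2 * pi * m" and "\<bar>cos \<alpha>\<bar> = r" by auto
      then obtain k :: int where "\<alpha> = \<beta> + pi * k \<or> \<alpha> = - \<beta> + pi * k" using iff by blast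
      then show "\<alpha> \<in> ?R"
      proof
        assume k: "\<alpha> = \<beta> + pi * k"
        have "pi * (-1) < pi * k" using \<alpha>(1) \<beta> k by linarith
        then have "k \<ge> 0" by (simp only: mult_less_cancel_left_pos[OF pi_gt_zero])
        moreover have "pi * k < pi * (2 * m)"
        proof -
          have "pi * k < 2 * pi * m" using \<alpha>(2) \<beta>(1) k by linarith
          then show ?thesis by (simp only: mult_ac)
        qed
        then have "k < 2 * m" by (simp only: mult_less_cancel_left_pos[OF pi_gt_zero])
        ultimately have "\<alpha> = ?p (nat k)" "nat k \<in> {..<2 * m}" using k by auto
        then show ?thesis by blast
      next
        assume k: "\<alpha> = - \<beta> + pi * k"
        have "pi * 0 < pi * k" using \<alpha>(1) \<beta> k by linarith
        then have "k \<ge> 1" by (simp only: mult_less_cancel_left_pos[OF pi_gt_zero])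
        moreover have "pi * k < pi * (2 * m + 1)"
        proof -
          have "pi * k < 2 * pi * m + pi" using \<alpha>(2) \<beta> k by linarith
          then show ?thesis by (simp add: algebra_simps)
        qed
        then have "k < 2 * m + 1" by (simp only: mult_less_cancel_left_pos[OF pi_gt_zero])
        ultimately have "\<alpha> = ?q (nat (k - 1))" "nat (k - 1) \<in> {..<2 * m}" using k by auto
        then show ?thesis by blast
      qed
    qed
    have up: "pi * (real k + 1) \<le> 2 * pi * m" if "k < 2 * m" for k
    proof -
      have "real k + 1 \<le> 2 * m" using that by linarith
      then have "pi * (real k + 1) \<le> pi * (2 * m)" by (intro mult_left_mono) auto
      then show ?thesis by (simp add: mult_ac)
    qed
    have lo: "pi * real k \<ge> 0" for k by simp
    have "?p k \<in> ?L" if "k < 2 * m" for k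
    proof -
      have "\<bar>cos (?p k)\<bar> = r" unfolding iff by (intro exI[of _ "int k"]) simp
      then show ?thesis using up[OF that] lo[of k] \<beta> by (auto simp: distrib_left)
    qed
    moreover have "?q k \<in> ?L" if "k < 2 * m" for k
    proof -
      have "\<bar>cos (?q k)\<bar> = r" unfolding iff by (intro exI[of _ "int k + 1"]) simp
      moreover have "pi * (real k + 1) = pi * real k + pi" by (simp add: distrib_left)
      then have "0 \<le> ?q k" "?q k < 2 * pi * m" using up[OF that] lo[of k] \<beta> pi_gt_zero by linarith+
      ultimately show ?thesis by simp
    qed
    ultimately show "?R \<subseteq> ?L" by blast
  qed
  moreover have "card (?p ` {..<2 * m}) = 2 * m" "card (?q ` {..<2 * m}) = 2 * m"
    by (subst card_image; simp add: inj_on_def)+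
  moreover have "?p ` {..<2 * m} \<inter> ?q ` {..<2 * m} = {}"
  proof -
    have "?p k \<noteq> ?q l" for k l
    proof
      assume "?p k = ?q l"
      then have e: "2 * \<beta> = pi * (real l + 1 - real k)" by (simp add: algebra_simps)
      have "pi * 0 < pi * (real l + 1 - real k)" "pi * (real l + 1 - real k) < pi * 1" unfolding e[symmetric] using \<beta> by auto
      then have "0 < real l + 1 - real k" "real l + 1 - real k < 1" by (simp_all only: mult_less_cancel_left_pos[OF pi_gt_zero])
      then have "real k < real (l + 1)" "real l < real k" by linarith+
      then show False by simp
    qed
    then show ?thesis by blast
  qed
  ultimately show "card {\<alpha> \<in> {0..<2 * pi * m}. \<bar>cos \<alpha>\<bar> = r} = 4 * m" "finite {\<alpha> \<in> {0..<2 * pi * m}. \<bar>cos \<alpha>\<bar> = r}"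
    by (simp_all add: card_Un_disjoint)
qed

text \<open>The norms of \<open>w1\<close> and \<open>w2\<close> prescribe |cos| and |sin| of the
  angle; once the angle is known, both sphere points are forced by division. The fibre thus
  corresponds to the admissible angles in the \<open>m\<close> turns of one period.\<close>

lemma fibre_rotating_join:
  fixes w1 :: "'a rvec" and w2 :: "'b rvec"
  assumes w: "w1 \<noteq> 0" "w2 \<noteq> 0" "norm (w1, w2) = 1"
  shows "finite (fibre P \<Phi> (w1, w2))" "card (fibre P \<Phi> (w1, w2)) = 4 * m"
proof -
  let ?N = "{\<alpha> \<in> {0..<2 * pi * m}. \<bar>cos \<alpha>\<bar> = norm w1}"
  let ?h = "\<lambda>\<alpha>. (circ P (inv_into UNIV u \<alpha>), (1 / cos \<alpha>) *\<^sub>R w1, (1 / sin \<alpha>) *\<^sub>R w2)"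
  have sq: "(norm w1)\<^sup>2 + (norm w2)\<^sup>2 = 1" using w(3) by (simp add: norm_prod_def)
  have n: "0 < norm w1" "0 < norm w2" using w by auto
  have "(norm w2)\<^sup>2 > 0" using n by simp
  then have "(norm w1)\<^sup>2 < 1\<^sup>2" using sq unfolding one_power2 by linarith
  then have n1: "norm w1 < 1" by (rule power2_less_imp_less) simp
  note N = card_abs_cos_level[OF n(1) n1]
  have u_inv: "u (inv_into UNIV u \<alpha>) = \<alpha>" for \<alpha> by (rule surj_f_inv_f[OF angle_bij(2)])
  have inv_u: "inv_into UNIV u (u t) = t" for t by (rule inv_f_f[OF strict_mono_imp_inj_on[OF angle_bij(1)]])
  have sin: "\<bar>sin \<alpha>\<bar> = norm w2" if "\<bar>cos \<alpha>\<bar> = norm w1" for \<alpha>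
  proof -
    have "(cos \<alpha>)\<^sup>2 = (norm w1)\<^sup>2" using that by (metis power2_abs)
    then have "(sin \<alpha>)\<^sup>2 = (norm w2)\<^sup>2" using sq sin_cos_squared_add[of \<alpha>] by linarith
    then show ?thesis using power2_eq_iff_nonneg[of "\<bar>sin \<alpha>\<bar>" "norm w2"] by simp
  qed
  have fib: "fibre P \<Phi> (w1, w2) = ?h ` ?N"
  proof
    show "?h ` ?N \<subseteq> fibre P \<Phi> (w1, w2)"
    proof
      fix p assume "p \<in> ?h ` ?N"
      then obtain \<alpha> where \<alpha>: "p = ?h \<alpha>" "\<bar>cos \<alpha>\<bar> = norm w1" by blast
      have "cos \<alpha> \<noteq> 0" "sin \<alpha> \<noteq> 0" using \<alpha>(2) sin[OF \<alpha>(2)] n by auto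
      then show "p \<in> fibre P \<Phi> (w1, w2)"
        unfolding \<alpha>(1) fibre_def using \<alpha>(2) sin[OF \<alpha>(2)] n by (simp add: \<Phi> u_inv)
    qed
    show "fibre P \<Phi> (w1, w2) \<subseteq> ?h ` ?N"
    proof
      fix p assume p: "p \<in> fibre P \<Phi> (w1, w2)"
      obtain s x y where s: "p = (circ P s, x, y)" and xy: "norm x = 1" "norm y = 1"
        using p by (auto simp: fibre_def)
      \<comment> \<open>The representative of the circle point in [0, P); its angle lies in the
        interval on which the solutions are counted.\<close>
      define t where "t = s + of_int (- \<lfloor>s / P\<rfloor>) * P"
      have ct: "circ P t = circ P s" unfolding t_def by (rule circ_add_int)
      have t: "0 \<le> t" "t < P"
      proof -
        have "of_int \<lfloor>s / P\<rfloor> * P \<le> s / P * P" using P by (intro mult_right_mono) auto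
        then show "0 \<le> t" using P by (simp add: t_def)
        have "s / P * P < (of_int \<lfloor>s / P\<rfloor> + 1) * P" by (rule mult_strict_right_mono[OF real_of_int_floor_add_one_gt P])
        then show "t < P" using P by (simp add: t_def algebra_simps)
      qed
      have e: "cos (u t) *\<^sub>R x = w1" "sin (u t) *\<^sub>R y = w2" using p unfolding s fibre_def by (auto simp: \<Phi> simp flip: ct)
      have "u 0 \<le> u t" "u t < u (0 + P)" using t strict_mono_less_eq[OF angle_bij(1)] strict_mono_less[OF angle_bij(1)] by auto
      then have "u t \<in> {0..<2 * pi * m}" unfolding u(4) u(1) by simp
      moreover have "\<bar>cos (u t)\<bar> = norm w1" using xy by (simp flip: e)
      moreover have "p = ?h (u t)"
      proof -
        have "cos (u t) \<noteq> 0" "sin (u t) \<noteq> 0" using e w by auto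
        then show ?thesis by (simp add: s inv_u ct flip: e)
      qed
      ultimately show "p \<in> ?h ` ?N" by blast
    qed
  qed
  have "inj_on ?h ?N"
  proof (rule inj_onI)
    fix \<alpha> \<beta> assume ab: "\<alpha> \<in> ?N" "\<beta> \<in> ?N" "?h \<alpha> = ?h \<beta>"
    then obtain k :: int where "inv_into UNIV u \<alpha> = inv_into UNIV u \<beta> + of_int k * P" by (auto simp: circ_eq_iff)
    then have "u (inv_into UNIV u \<alpha>) = u (inv_into UNIV u \<beta>) + 2 * pi * m * of_int k" by (simp only: angle_int_shift)
    then have k: "\<alpha> = \<beta> + 2 * pi * m * of_int k" by (simp only: u_inv)
    have "0 \<le> \<alpha>" "\<alpha> < 2 * pi * m" "0 \<le> \<beta>" "\<beta> < 2 * pi * m" using ab by auto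
    then have b: "2 * pi * m * of_int k < 2 * pi * m * 1" "2 * pi * m * (-1) < 2 * pi * m * of_int k" using k by linarith+
    have p: "2 * pi * real m > 0" using m by simp
    have "real_of_int k < 1" "-1 < real_of_int k" using b by (simp_all only: mult_less_cancel_left_pos[OF p])
    then have "k = 0" by linarith
    then show "\<alpha> = \<beta>" using k by simp
  qed
  then show "finite (fibre P \<Phi> (w1, w2))" "card (fibre P \<Phi> (w1, w2)) = 4 * m"
    unfolding fib using N by (simp_all add: card_image)
qed

text \<open>A value with a vanishing component is never regular: it is attained where
  \<open>cos\<close> or \<open>sin\<close> of the angle is 0, and the Jacobian vanishes there. All
  points of the other fibres have sign 1, so the degree is the number of points.\<close>

lemma has_degree_rotating_join: "has_degree P \<Phi> (4 * int m)"
proof -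
  have sign1: "orientation_sign P \<Phi> p = 1" if "p \<in> fibre P \<Phi> (w1, w2)" "w1 \<noteq> 0" "w2 \<noteq> 0" for p w1 w2
  proof -
    obtain c x y where c: "p = (c, x, y)" by (cases p)
    then have n: "norm x = 1" "norm y = 1" and "c \<in> range (circ P)" using that(1) by (simp_all add: fibre_def)
    then obtain t where p: "p = (circ P t, x, y)" using c by blast
    have "cos (u t) *\<^sub>R x = w1" "sin (u t) *\<^sub>R y = w2" using that(1) by (auto simp: fibre_def p \<Phi>)
    then have "cos (u t) \<noteq> 0" "sin (u t) \<noteq> 0" using that(2,3) by auto
    then show ?thesis unfolding p orientation_sign_rotating_join[OF n] by simp
  qed
  have ex1: "\<exists>x :: 'a rvec. norm x = 1" and ex2: "\<exists>y :: 'b rvec. norm y = 1" using vector_choose_size[of 1] by auto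
  have reg: "w1 \<noteq> 0 \<and> w2 \<noteq> 0" if r: "regular_value P \<Phi> (w1, w2)" for w1 w2
  proof (rule ccontr)
    assume "\<not> ?thesis"
    then consider "w1 = 0" | "w2 = 0" by blast
    then show False
    proof cases
      case 1
      obtain x :: "'a rvec" where x: "norm x = 1" using ex1 by blast
      have n2: "norm w2 = 1" using r 1 by (simp add: regular_value_def norm_prod_def)
      obtain t where t: "u t = pi / 2" using angle_bij(2) by (metis surjE)
      have "(circ P t, x, w2) \<in> fibre P \<Phi> (w1, w2)" using x n2 by (simp add: fibre_def \<Phi> t 1)
      moreover have "orientation_sign P \<Phi> (circ P t, x, w2) = 0"
        unfolding orientation_sign_rotating_join[OF x n2] by (simp add: t)
      ultimately show False using r unfolding regular_value_def by blast
    next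
      case 2
      obtain y :: "'b rvec" where y: "norm y = 1" using ex2 by blast
      have n1: "norm w1 = 1" using r 2 by (simp add: regular_value_def norm_prod_def)
      have "(circ P 0, w1, y) \<in> fibre P \<Phi> (w1, w2)" using y n1 by (simp add: fibre_def \<Phi> u(1) 2)
      moreover have "orientation_sign P \<Phi> (circ P 0, w1, y) = 0"
        unfolding orientation_sign_rotating_join[OF n1 y] by (simp add: u(1))
      ultimately show False using r unfolding regular_value_def by blast
    qed
  qed
  obtain x :: "'a rvec" and y :: "'b rvec" where xy: "norm x = 1" "norm y = 1" using ex1 ex2 by blast
  \<comment> \<open>A unit vector with two nonzero components, which shows that regular values
    exist.\<close>
  let ?w = "((3 / 5) *\<^sub>R x, (4 / 5) *\<^sub>R y)"
  have ne: "x \<noteq> 0" "y \<noteq> 0" using xy by auto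
  have "regular_value P \<Phi> ?w"
    unfolding regular_value_def
  proof (intro conjI ballI)
    have "norm ?w = sqrt ((3 / 5)\<^sup>2 + (4 / 5)\<^sup>2)" using xy by (simp add: norm_prod_def)
    also have "(3 / 5)\<^sup>2 + (4 / 5)\<^sup>2 = (1::real)" by (simp add: power2_eq_square)
    finally show "?w \<in> sphere 0 1" by simp
    show "orientation_sign P \<Phi> p \<noteq> 0" if "p \<in> fibre P \<Phi> ?w" for p using sign1[OF that] ne by simp
  qed
  moreover have "finite (fibre P \<Phi> v)" "(\<Sum>p\<in>fibre P \<Phi> v. orientation_sign P \<Phi> p) = of_int (4 * int m)"
    if r: "regular_value P \<Phi> v" for v
  proof -
    obtain w1 w2 where v: "v = (w1, w2)" by (cases v)
    have w: "w1 \<noteq> 0" "w2 \<noteq> 0" "norm (w1, w2) = 1" using reg[OF r[unfolded v]] r by (auto simp: regular_value_def v)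
    show "finite (fibre P \<Phi> v)" unfolding v by (rule fibre_rotating_join(1)[OF w])
    have "(\<Sum>p\<in>fibre P \<Phi> (w1, w2). orientation_sign P \<Phi> p) = (\<Sum>p\<in>fibre P \<Phi> (w1, w2). 1)"
      by (rule sum.cong[OF refl]) (rule sign1[OF _ w(1,2)])
    then show "(\<Sum>p\<in>fibre P \<Phi> v. orientation_sign P \<Phi> p) = of_int (4 * int m)"
      unfolding v using fibre_rotating_join(2)[OF w] by simp
  qed
  ultimately show ?thesis unfolding has_degree_def by blast
qed

end

text \<open>For each \<open>m\<close> one winding angle supplies all properties at once. The lower
  bound for the length is carried along in the choice of the angles, because unboundedness compares
  different \<open>m\<close>.\<close>

lemma rotating_harmonic_joins:
  fixes F :: "real \<Rightarrow> real" and P \<kappa> :: real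
  assumes F: "smooth_on UNIV F" "\<forall>t. F t > 0" and P: "P > 0" "periodic P F"
    and p: "even CARD('p::finite)" "CARD('p) \<ge> 2" "CARD('a::{finite,linorder}) = CARD('p) + 1"
    and q: "even CARD('q::finite)" "CARD('q) \<ge> 2" "CARD('b::{finite,linorder}) = CARD('q) + 1"
    and w: "warp_pair F \<kappa> CARD('p) CARD('q) (real CARD('p)) (real CARD('q)) l1 l2"
  shows "\<exists>z1 z2 :: nat \<Rightarrow> real \<Rightarrow> real.
          (\<forall>m\<ge>1.
             let \<Phi> = on_circle (real_join_map (z1 m) (z2 m)
                        (\<lambda>x :: 'a rvec. x) (\<lambda>y :: 'b rvec. y));
                 \<gamma> = (\<lambda>t. (complex_of_real (z1 m t), complex_of_real (z2 m t)))
             in smooth_on UNIV (z1 m) \<and> smooth_on UNIV (z2 m) \<and>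
                periodic P (z1 m) \<and> periodic P (z2 m) \<and> (\<forall>t. (z1 m t)\<^sup>2 + (z2 m t)\<^sup>2 = 1) \<and>
                harmonic_into_sphere
                  (warped_atlas l1 l2 (circle_atlas P)
                    (sphere_atlas :: ('a rvec, real^'p) rchart set)
                    (sphere_atlas :: ('b rvec, real^'q) rchart set)) \<Phi> \<and>
                has_degree P \<Phi> (4 * int m) \<and>
                closed_geodesic (finsler F (potential (real CARD('p)) (real CARD('q)) l1 l2)) P (graph_curve \<gamma>) P \<and>
                \<not> is_iterate (finsler F (potential (real CARD('p)) (real CARD('q)) l1 l2)) P (graph_curve \<gamma>) P) \<and>
          (\<forall>B. \<exists>m\<ge>1. curve_length (finsler F (potential (real CARD('p)) (real CARD('q)) l1 l2)) (graph_curve (\<lambda>t.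
                (complex_of_real (z1 m t), complex_of_real (z2 m t)))) 0 P > B)"
    (is "\<exists>z1 z2. (\<forall>m\<ge>1. ?Q m (z1 m) (z2 m)) \<and> (\<forall>B. \<exists>m\<ge>1. ?L (z1 m) (z2 m) > B)")
proof -
  let ?p = "real CARD('p)" and ?q = "real CARD('q)"
  let ?K = "finsler F (potential ?p ?q l1 l2)"
  have Fp: "F t > 0" for t using F(2) by blast
  have d: "?p > 0" "?q > 0" by simp_all
  have w': "warp_pair F \<kappa> DIM(real^'p) DIM(real^'q) ?p ?q l1 l2" using w by simp
  have A: "regular_chart c" if "c \<in> sphere_atlas" for c :: "('a rvec, real^'p) rchart" by (rule sphere_atlas_chart(1)[OF that])
  have A': "regular_chart c" if "c \<in> sphere_atlas" for c :: "('b rvec, real^'q) rchart" by (rule sphere_atlas_chart(1)[OF that])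
  have f: "eigenmap (sphere_atlas :: ('a rvec, real^'p) rchart set) (\<lambda>x. x) ?p"
    "eigenmap (sphere_atlas :: ('b rvec, real^'q) rchart set) (\<lambda>x. x) ?q"
    using eigenmap_sphere_inclusion[where 'v="'a rvec" and 'e="real^'p"] eigenmap_sphere_inclusion[where 'v="'b rvec" and 'e="real^'q"]
      p(3) q(3) by simp_all
  note ls = warp_pair_unique_smooth(2)[OF zero_less_card_finite zero_less_card_finite d F w]
  note lp = warp_pair_pos[OF w]
  have ac: "?q / (l2 t)\<^sup>2 - ?p / (l1 t)\<^sup>2 = \<kappa> / (F t)\<^sup>2" for t using w by (simp add: warp_pair_def)
  define I where "I = integral {0..P} (\<lambda>t. 1 / F t)"
  have ex: "\<exists>u. ?Q m (\<lambda>t. cos (u t)) (\<lambda>t. sin (u t)) \<and> 2 * pi * m - I / 2 \<le> ?L (\<lambda>t. cos (u t)) (\<lambda>t. sin (u t))"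
    if m: "m \<ge> 1" for m
  proof -
    obtain u v where u: "smooth_on UNIV u" "u 0 = 0" "\<And>t. (u has_real_derivative v t) (at t)" "\<And>t. v t > 0"
      "\<And>t. (v has_real_derivative \<kappa> / (F t)\<^sup>2 * (sin (u t) * cos (u t)) - pd 1 F t / F t * v t) (at t)"
      "\<And>t. u (t + P) = u t + 2 * pi * m"
      by (rule winding_angle_exists[OF F(1) Fp P m, of \<kappa>]) (rule that)
    have ode: "(v has_real_derivative (?q / (l2 t)\<^sup>2 - ?p / (l1 t)\<^sup>2) * (sin (u t) * cos (u t)) - pd 1 F t / F t * v t) (at t)" for t
      unfolding ac by (rule u(5))
    have per: "cos (u (t + P)) = cos (u t)" "sin (u (t + P)) = sin (u t)" for t
      using cos.plus_of_nat[of "u t" m] sin.plus_of_nat[of "u t" m] by (simp_all add: u(6) mult_ac)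
    have sm: "smooth_on UNIV (\<lambda>t. cos (u t))" "smooth_on UNIV (\<lambda>t. sin (u t))"
      by (rule smooth_on_cos[OF open_UNIV u(1)], rule smooth_on_sin[OF open_UNIV u(1)])
    have curve: "smooth_on UNIV (\<lambda>t. (cos (u t) *\<^sub>R b, sin (u t) *\<^sub>R b))" for b :: "'z::euclidean_space"
      by (intro smooth_on_Pair smooth_on_scaleR smooth_on_const sm open_UNIV)
    let ?\<Phi> = "on_circle (real_join_map (\<lambda>t. cos (u t)) (\<lambda>t. sin (u t)) (\<lambda>x :: 'a rvec. x) (\<lambda>y :: 'b rvec. y))"
    let ?\<gamma> = "\<lambda>t. (complex_of_real (cos (u t)), complex_of_real (sin (u t)))"
    have harm: "harmonic_into_sphere (warped_atlas l1 l2 (circle_atlas P) (sphere_atlas :: ('a rvec, real^'p) rchart set)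
        (sphere_atlas :: ('b rvec, real^'q) rchart set)) ?\<Phi>"
    proof (rule harmonic_circle(1)[OF F A A' d w' norm_mult_bilinear_scaleR norm_mult_bilinear_scaleR f P(1)])
      show "smooth_on UNIV (\<lambda>t. (cos (u t) *\<^sub>R (1::real), sin (u t) *\<^sub>R (1::real)))" by (rule curve)
      show "\<forall>t. profile_eq (pd 1 F t / F t) (?p / (l1 t)\<^sup>2) (?q / (l2 t)\<^sup>2)
          (\<lambda>t. (cos (u t) *\<^sub>R (1::real), sin (u t) *\<^sub>R (1::real))) t"
        using profile_eq_circular[OF u(3) ode] by blast
    qed (simp_all add: norm_prod_def periodic_def per real_join_map_def)
    have \<gamma>: "?\<gamma> = (\<lambda>t. (cos (u t) *\<^sub>R (1::complex), sin (u t) *\<^sub>R (1::complex)))" by (simp add: of_real_def)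
    have geo: "closed_geodesic ?K P (graph_curve ?\<gamma>) P"
      unfolding \<gamma>
    proof (rule closed_geodesic_graph[OF F(1) conjunct1[OF ls] conjunct2[OF ls] lp Fp curve])
      show "profile_eq (pd 1 F t / F t) (?p / (l1 t)\<^sup>2) (?q / (l2 t)\<^sup>2)
          (\<lambda>t. (cos (u t) *\<^sub>R (1::complex), sin (u t) *\<^sub>R (1::complex))) t" for t
        by (rule profile_eq_circular[OF u(3) ode])
    qed (simp_all add: norm_prod_def periodic_def per P)
    have deg: "has_degree P ?\<Phi> (4 * int m)"
    proof (rule has_degree_rotating_join[OF _ _ _ _ P(1) m u(2,3,4,6)])
      show "?\<Phi> (circ P t, x, y) = (cos (u t) *\<^sub>R x, sin (u t) *\<^sub>R y)" for t x y
        by (subst on_circle_eq) (simp_all add: real_join_map_def per)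
    qed (use p q in auto)
    have len: "u P - u 0 - I / 2 \<le> curve_length ?K (graph_curve ?\<gamma>) 0 P"
      unfolding I_def by (rule curve_length_circular_ge[OF F(1) Fp conjunct1[OF ls] conjunct2[OF ls] lp d P(1) u(1,3)])
    have "u P = 2 * pi * m" using u(6)[of 0] u(2) by simp
    then have "2 * pi * m - I / 2 \<le> curve_length ?K (graph_curve ?\<gamma>) 0 P" using len u(2) by simp
    then show ?thesis
      unfolding Let_def
      by (intro exI[of _ u] conjI sm harm deg geo graph_not_iterate[OF P(1)]) (simp_all add: periodic_def per)
  qed
  define R where "R m u \<longleftrightarrow> ?Q m (\<lambda>t. cos (u t)) (\<lambda>t. sin (u t)) \<and> 2 * pi * m - I / 2 \<le> ?L (\<lambda>t. cos (u t)) (\<lambda>t. sin (u t))"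
    for m and u :: "real \<Rightarrow> real"
  have "\<exists>u. R m u" if "m \<ge> 1" for m unfolding R_def by (rule ex[OF that])
  then obtain u where "\<And>m. m \<ge> 1 \<Longrightarrow> R m (u m)" by metis
  note u = conjunct1[OF this[unfolded R_def]] conjunct2[OF this[unfolded R_def]]
  show ?thesis
  proof (rule exI[of _ "\<lambda>m t. cos (u m t)"], rule exI[of _ "\<lambda>m t. sin (u m t)"], intro conjI allI impI)
    show "?Q m (\<lambda>t. cos (u m t)) (\<lambda>t. sin (u m t))" if "1 \<le> m" for m by (rule u(1)[OF that])
    fix B :: real
    \<comment> \<open>Since 2 \<pi> exceeds 1, more than B + I / 2 turns already make the length
      exceed \<open>B\<close>; the successor ensures at least one turn.\<close>
    obtain m :: nat where m: "m > B + I / 2" using reals_Archimedean2 by blast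
    have "1 * real (Suc m) \<le> 2 * pi * real (Suc m)" using pi_ge_two by (intro mult_right_mono) auto
    moreover have "B + I / 2 < 1 * real (Suc m)" using m by simp
    ultimately have "B < 2 * pi * real (Suc m) - I / 2" unfolding less_diff_eq by (rule less_le_trans[rotated])
    then show "\<exists>m\<ge>1. ?L (\<lambda>t. cos (u m t)) (\<lambda>t. sin (u m t)) > B" using u(2)[of "Suc m"]
      by (intro exI[of _ "Suc m"] conjI) (simp, linarith)
  qed
qed

text \<open>The source metric enters only through \<open>warp_pair\<close>, which has exactly one
  solution, so quantifying over all such pairs speaks about one metric. It is fixed before the tori
  or the numbers of turns are chosen. The profiles of the first claim are treated on arbitrary open
  intervals as well as on the circle, because a time-changed Neumann trajectory need not close
  up.\<close>

theorem theoremD: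
  fixes F :: "real \<Rightarrow> real" and P I\<^sub>F :: real
    and X1 :: "'m1 topology" and A1 :: "('m1, 'e1::euclidean_space) rchart set"
    and X2 :: "'m2 topology" and A2 :: "('m2, 'e2::euclidean_space) rchart set"
    and f1 :: "'m1 \<Rightarrow> complex^'n1" and f2 :: "'m2 \<Rightarrow> complex^'n2"
    and d1 d2 :: real
  assumes "P > 0"
    and "smooth_on UNIV F" and "\<forall>t. F t > 0" and "periodic P F"
    and I_F: "I\<^sub>F = integral {0..P} (\<lambda>t. 1 / F t)"
  shows
    "(riemannian_manifold X1 A1 \<and> eigenmap A1 f1 d1 \<and>
      riemannian_manifold X2 A2 \<and> eigenmap A2 f2 d2 \<longrightarrow>
      (\<forall>\<kappa>.
        (\<exists>!l. warp_pair F \<kappa> DIM('e1) DIM('e2) d1 d2 (fst l) (snd l)) \<and>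
        (\<forall>l1 l2. warp_pair F \<kappa> DIM('e1) DIM('e2) d1 d2 l1 l2 \<longrightarrow>
          smooth_on UNIV l1 \<and> smooth_on UNIV l2 \<and> periodic P l1 \<and> periodic P l2 \<and>
          riemannian_manifold
            (prod_topology euclideanreal (prod_topology X1 X2))
            (warped_atlas l1 l2 (line_atlas UNIV) A1 A2) \<and>
          riemannian_manifold
            (prod_topology (circle_topology P) (prod_topology X1 X2))
            (warped_atlas l1 l2 (circle_atlas P) A1 A2) \<and>
          (\<forall>J \<tau> \<gamma>. open J \<and> connected J \<and> J \<noteq> {} \<and>
             (\<forall>t\<in>J. (\<tau> has_real_derivative 1 / F t) (at t)) \<and> profile_on J \<gamma> \<longrightarrow>
             (harmonic_into_sphere (warped_atlas l1 l2 (line_atlas J) A1 A2) (join_map \<gamma> f1 f2)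
              \<longleftrightarrow> (\<exists>\<Gamma>. neumann_trajectory \<kappa> (\<tau> ` J) \<Gamma> \<and> (\<forall>t\<in>J. \<gamma> t = \<Gamma> (\<tau> t))))) \<and>
          (\<forall>\<tau> \<gamma>. (\<forall>t. (\<tau> has_real_derivative 1 / F t) (at t)) \<and>
             profile_on UNIV \<gamma> \<and> periodic P \<gamma> \<longrightarrow>
             (harmonic_into_sphere (warped_atlas l1 l2 (circle_atlas P) A1 A2)
                (on_circle (join_map \<gamma> f1 f2))
              \<longleftrightarrow> (\<exists>\<Gamma>. neumann_trajectory \<kappa> (range \<tau>) \<Gamma> \<and> (\<forall>t. \<gamma> t = \<Gamma> (\<tau> t))))))) \<and>
      (\<forall>(r1::int) (r2::int) \<kappa> l1 l2.
        coprime r1 r2 \<and> r1 \<noteq> 0 \<and> r2 \<noteq> 0 \<and> \<bar>r1\<bar> \<noteq> \<bar>r2\<bar> \<and>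
        \<kappa> = 4 * pi\<^sup>2 * of_int (r1\<^sup>2 - r2\<^sup>2) / I\<^sub>F\<^sup>2 \<and>
        warp_pair F \<kappa> DIM('e1) DIM('e2) d1 d2 l1 l2 \<longrightarrow>
        (let K = finsler F (potential d1 d2 l1 l2) in
         \<exists>\<gamma> :: real \<Rightarrow> real \<Rightarrow> complex \<times> complex.
          smooth_on ({0<..<1} \<times> UNIV) (\<lambda>(a, t). \<gamma> a t) \<and>
          (\<forall>a\<in>{0<..<1}.
             profile_on UNIV (\<gamma> a) \<and> periodic P (\<gamma> a) \<and>
             harmonic_into_sphere (warped_atlas l1 l2 (circle_atlas P) A1 A2)
               (on_circle (join_map (\<gamma> a) f1 f2)) \<and>
             range (\<gamma> a) \<subseteq> hopf_torus a \<and>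
             closed_geodesic K P (graph_curve (\<gamma> a)) P) \<and>
          (\<forall>a\<in>{0<..<1}. \<forall>b\<in>{0<..<1}. a \<noteq> b \<longrightarrow>
             \<not> congruent_curves (\<gamma> a) (\<gamma> b) \<and>
             circle_graph P (\<gamma> a) \<inter> circle_graph P (\<gamma> b) = {} \<and>
             curve_length K (graph_curve (\<gamma> a)) 0 P =
               curve_length K (graph_curve (\<gamma> b)) 0 P)))) \<and>
     (even CARD('p::finite) \<and> CARD('p) \<ge> 2 \<and> CARD('a::{finite,linorder}) = CARD('p) + 1 \<and>
      even CARD('q::finite) \<and> CARD('q) \<ge> 2 \<and> CARD('b::{finite,linorder}) = CARD('q) + 1 \<longrightarrow>
      eigenmap (sphere_atlas :: ('a rvec, real^'p) rchart set) (\<lambda>x. x) (real CARD('p)) \<and>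
      eigenmap (sphere_atlas :: ('b rvec, real^'q) rchart set) (\<lambda>y. y) (real CARD('q)) \<and>
      (\<forall>\<kappa> l1 l2.
        warp_pair F \<kappa> CARD('p) CARD('q) (real CARD('p)) (real CARD('q)) l1 l2 \<longrightarrow>
        (let K = finsler F (potential (real CARD('p)) (real CARD('q)) l1 l2) in
         \<exists>z1 z2 :: nat \<Rightarrow> real \<Rightarrow> real.
          (\<forall>m\<ge>1.
             let \<Phi> = on_circle (real_join_map (z1 m) (z2 m)
                        (\<lambda>x :: 'a rvec. x) (\<lambda>y :: 'b rvec. y));
                 \<gamma> = (\<lambda>t. (complex_of_real (z1 m t), complex_of_real (z2 m t)))
             in smooth_on UNIV (z1 m) \<and> smooth_on UNIV (z2 m) \<and>
                periodic P (z1 m) \<and> periodic P (z2 m) \<and> (\<forall>t. (z1 m t)\<^sup>2 + (z2 m t)\<^sup>2 = 1) \<and>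
                harmonic_into_sphere
                  (warped_atlas l1 l2 (circle_atlas P)
                    (sphere_atlas :: ('a rvec, real^'p) rchart set)
                    (sphere_atlas :: ('b rvec, real^'q) rchart set)) \<Phi> \<and>
                has_degree P \<Phi> (4 * int m) \<and>
                closed_geodesic K P (graph_curve \<gamma>) P \<and>
                \<not> is_iterate K P (graph_curve \<gamma>) P) \<and>
          (\<forall>B. \<exists>m\<ge>1. curve_length K (graph_curve (\<lambda>t.
                (complex_of_real (z1 m t), complex_of_real (z2 m t)))) 0 P > B))))"
proof -
  note P = \<open>P > 0\<close> \<open>periodic P F\<close> and F = \<open>smooth_on UNIV F\<close> \<open>\<forall>t. F t > 0\<close>
  show ?thesis
  proof (intro conjI impI, goal_cases)
    case 1
    then have M: "riemannian_manifold X1 A1" "riemannian_manifold X2 A2"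
      and f: "eigenmap A1 f1 d1" "eigenmap A2 f2 d2" by auto
    have d: "d1 > 0" "d2 > 0" using f by (auto simp: eigenmap_def)
    note wp = warp_pair_unique_smooth[OF DIM_positive DIM_positive d F]
    show ?case
    proof (intro allI conjI impI, goal_cases)
      case (1 \<kappa>)
      show ?case by (rule wp(1))
    next
      case (2 \<kappa> l1 l2)
      then show ?case using wp(2) by blast
    next
      case (3 \<kappa> l1 l2)
      then show ?case using wp(2) by blast
    next
      case (4 \<kappa> l1 l2)
      then show ?case using wp(3) P(2) by blast
    next
      case (5 \<kappa> l1 l2)
      then show ?case using wp(3) P(2) by blast
    next
      case (6 \<kappa> l1 l2)
      then show ?case by (rule warped_geometry(1)[OF F P M d])
    next
      case (7 \<kappa> l1 l2)
      then show ?case by (rule warped_geometry(2)[OF F P M d])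
    next
      case (8 \<kappa> l1 l2 J \<tau> \<gamma>)
      show ?case by (rule harmonic_profile_iff_neumann(1)[OF F P(1) M f 8(1)]) (use 8(2) in auto)
    next
      case (9 \<kappa> l1 l2 \<tau> \<gamma>)
      show ?case by (rule harmonic_profile_iff_neumann(2)[OF F P(1) M f 9(1)]) (use 9(2) in auto)
    qed
  next
    case 2
    then have M: "riemannian_manifold X1 A1" "riemannian_manifold X2 A2"
      and f: "eigenmap A1 f1 d1" "eigenmap A2 f2 d2" by auto
    note A = riemannian_manifold_regular[OF M(1)] riemannian_manifold_regular[OF M(2)]
    show ?case
    proof (intro allI impI, elim conjE, goal_cases)
      case (1 r1 r2 \<kappa> l1 l2)
      show ?case unfolding Let_def by (rule hopf_torus_family[OF F P A f 1(1-4) I_F 1(5,6)])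
    qed
  next
    case 3
    then show ?case using eigenmap_sphere_inclusion[where 'v="'a rvec" and 'e="real^'p"] by simp
  next
    case 4
    then show ?case using eigenmap_sphere_inclusion[where 'v="'b rvec" and 'e="real^'q"] by simp
  next
    case 5
    then have p: "even CARD('p)" "CARD('p) \<ge> 2" "CARD('a) = CARD('p) + 1"
      and q: "even CARD('q)" "CARD('q) \<ge> 2" "CARD('b) = CARD('q) + 1" by auto
    show ?case
    proof (intro allI impI, goal_cases)
      case (1 \<kappa> l1 l2)
      show ?case unfolding Let_def[of "finsler _ _"] by (rule rotating_harmonic_joins[OF F P p q 1])
    qed
  qed
qed

end
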